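(* Let $0<l<\infty$, $M>0$, and let the potential $v$ of the skew-self-adjoint Dirac system on $[0,l]$ be measurable with $\|v(x)\|\le M$ for $0<x<l$. Let $\varphi$ be a Weyl function of this system on $[0,l]$. Then $v$ can be uniquely recovered (almost everywhere on $[0,l]$) from $\varphi$ in the following way. 1. The matrix function $\Phi_1$ on $[0,l]$ is recovered by $$\Phi_1\Big(\frac{x}{2}\Big)=\frac1\pi \mathrm{e}^{x\eta}\,\mathrm{l.i.m.}_{a\to\infty}\int_{-a}^{a}\mathrm{e}^{-\mathrm{i}x\xi}\frac{\varphi(\xi+\mathrm{i}\eta)}{2\mathrm{i}(\xi+\mathrm{i}\eta)}\,d\xi,\qquad \eta>M,$$ where l.i.m. is the entrywise limit in the norm of $L^2(0,2l)$. 2. The matrix function $\beta$ is recovered by $$\beta(x)=\begin{bmatrix}I_{m_1}&0\end{bmatrix}-\int_0^x\big(S_x^{-1}\Phi_1'\big)(t)^*\begin{bmatrix}\Phi_1(t)&I_{m_2}\end{bmatrix}dt,$$ where $S_x=P_xSP_x^*$ and $$S=I+\int_0^l s(x,t)\,\cdot\,dt,\qquad s(x,t)=\int_0^{\min(x,t)}\Phi_1'(x-\zeta)\Phi_1'(t-\zeta)^*d\zeta .$$ 3. From $\beta$ one recovers an $m_2\times m$ matrix function $\widetilde\gamma$ which is continuous on $[0,l]$, piecewise differentiable (differentiability failing possibly only on a finite set), has bounded left and right derivatives everywhere on $[0,l]$, and satisfies $$\beta\widetilde\gamma^*\equiv0,\qquad \widetilde\gamma\widetilde\gamma^*>0,\qquad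 \widetilde\gamma(0)=\gamma(0)=\begin{bmatrix}0&I_{m_2}\end{bmatrix},$$ and then the $m_2\times m_2$ matrix function $\widetilde\varkappa$ determined by $$\widetilde\varkappa'=-\widetilde\varkappa\,\widetilde\gamma'\,\widetilde\gamma^*(\widetilde\gamma\widetilde\gamma^* )^{-1},\qquad \widetilde\varkappa(0)=I_{m_2}.$$ 4. The matrix function $\gamma$ satisfies $\gamma=\widetilde\varkappa\,\widetilde\gamma$, and $$v(x)=\beta'(x)\gamma(x)^*.$$
   Context: Let $m_1,m_2$ be positive integers, $m=m_1+m_2$. The skew-self-adjoint Dirac system with potential $v$ (an $m_1\times m_2$ matrix function) is $$\frac{d}{dx}y(x,z)=(\mathrm{i}zj+jV(x))y(x,z),\qquad j=\begin{bmatrix} I_{m_1}&0\\ 0&-I_{m_2}\end{bmatrix},\quad V=\begin{bmatrix}0&v\\ v^*&0\end{bmatrix}.$$ Its fundamental solution $u(x,z)$ is normalized by $u(0,z)=I_m$. $\|\cdot\|$ is the operator norm induced by $\ell^2$-norms. $\mathbb{C}_M=\{z:\Im z>M\}$. $\mathbf{P}_{\ge}(j,\mathbb{C}_M)$: $m\times m_1$ matrix functions $\mathcal{P}$, meromorphic in $\mathbb{C}_M$, with $\mathcal{P}(z)^*\mathcal{P}(z)>0$, $\mathcal{P}(z)^*j\mathcal{P}(z)\ge0$ in $\mathbb{C}_M$ (excluding possibly a discrete set). Weyl functions of the system on $[0,l]$ (where $\|v\|\le M$) are the functions, analytic in $\mathbb{C}_M$ (removable singularities removed), $$\varphi(z)=\begin{bmatrix}0&I_{m_2}\end{bmatrix}u(l,z)^{-1}\mathcal{P}(z)\Big(\begin{bmatrix}I_{m_1}&0\end{bmatrix}u(l,z)^{-1}\mathcal{P}(z)\Big)^{-1},\qquad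 \mathcal{P}\in\mathbf{P}_{\ge}(j,\mathbb{C}_M).$$ Set $\beta(x)=\begin{bmatrix}I_{m_1}&0\end{bmatrix}u(x,0)$ and $\gamma(x)=\begin{bmatrix}0&I_{m_2}\end{bmatrix}u(x,0)=\begin{bmatrix}\gamma_1(x)&\gamma_2(x)\end{bmatrix}$, with $\gamma_1$ of size $m_2\times m_1$ and $\gamma_2$ of size $m_2\times m_2$. $L^2_{k}(0,l)$ denotes $\mathbb{C}^k$-valued square-integrable functions. In $L^2_{m_2}(0,l)$ let $(Af)(x)=-\mathrm{i}\int_0^xf(t)dt$ and $(Kf)(x)=-\mathrm{i}\gamma(x)\int_0^x\gamma(t)^*f(t)dt$. $E$ is the bounded operator with bounded inverse on $L^2_{m_2}(0,l)$, of the form $(Ef)(x)=f(x)+\int_0^xE(x,t)f(t)dt$ with bounded kernel, such that $K=EAE^{-1}$ and $E^{-1}\gamma_2\equiv I_{m_2}$ (operators are applied to matrix functions columnwise); it exists, and $E^{\pm1}$ map boundedly differentiable functions (absolutely continuous with bounded derivative) to boundedly differentiable functions. $\Phi_1(x):=(E^{-1}\gamma_1)(x)$, a boundedly differentiable $m_2\times m_1$ matrix function on $[0,l]$. $P_x$ is the restriction operator from $L^2_{m_2}(0,l)$ onto $L^2_{m_2}(0,x)$, $P_x^*$ its adjoint (extension by zero).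
   Formalization: In item 3, γ̃ need only be boundedly differentiable; differentiability off a finite set and bounded one-sided derivatives are required only at points where β has the corresponding derivative, as for merely measurable v no γ̃ with the stated regularity need exist. *)

theory Defs
  imports "HOL-Complex_Analysis.Complex_Analysis"
begin

text \<open>
  The sizes \<open>m\<^sub>1\<close>, \<open>m\<^sub>2\<close> are the finite index types \<^typ>\<open>'m1\<close>, \<^typ>\<open>'m2\<close>, and \<open>m = m\<^sub>1 + m\<^sub>2\<close> is
  the sum type \<^typ>\<open>'m1 + 'm2\<close>.  A \<open>p \<times> q\<close> matrix has type \<^typ>\<open>complex ^ 'q::finite ^ 'p::finite\<close>.
\<close>

section \<open>Matrices\<close>

definition adj :: "complex ^ 'q ^ 'p \<Rightarrow> complex ^ 'p ^ 'q" where
  "adj A = (\<chi> i k. cnj (A $ k $ i))"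

definition hcat :: "complex ^ 'a ^ 'p \<Rightarrow> complex ^ 'b ^ 'p \<Rightarrow> complex ^ ('a::finite + 'b::finite) ^ 'p" where
  "hcat A B = (\<chi> i c. case c of Inl a \<Rightarrow> A $ i $ a | Inr b \<Rightarrow> B $ i $ b)"

definition vcat :: "complex ^ 'q ^ 'a \<Rightarrow> complex ^ 'q ^ 'b \<Rightarrow> complex ^ 'q ^ ('a::finite + 'b::finite)" where
  "vcat A B = (\<chi> r. case r of Inl a \<Rightarrow> A $ a | Inr b \<Rightarrow> B $ b)"

definition left_block :: "complex ^ ('a::finite + 'b::finite) ^ 'p \<Rightarrow> complex ^ 'a ^ 'p" where
  "left_block A = (\<chi> i a. A $ i $ Inl a)"

definition right_block :: "complex ^ ('a::finite + 'b::finite) ^ 'p \<Rightarrow> complex ^ 'b ^ 'p" where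
  "right_block A = (\<chi> i b. A $ i $ Inr b)"

definition I0 :: "complex ^ ('m1::finite + 'm2::finite) ^ 'm1" where
  "I0 = hcat (mat 1) 0"

definition OI :: "complex ^ ('m1::finite + 'm2::finite) ^ 'm2" where
  "OI = hcat 0 (mat 1)"

definition herm_form :: "complex ^ 'p ^ 'p \<Rightarrow> complex ^ 'p \<Rightarrow> complex" where
  "herm_form A h = (\<Sum>i\<in>UNIV. cnj (h $ i) * (A *v h) $ i)"

definition pos_semidef :: "complex ^ 'p ^ 'p \<Rightarrow> bool" where
  "pos_semidef A \<longleftrightarrow> adj A = A \<and> (\<forall>h. 0 \<le> Re (herm_form A h))"

definition pos_def :: "complex ^ 'p ^ 'p \<Rightarrow> bool" where
  "pos_def A \<longleftrightarrow> adj A = A \<and> (\<forall>h. h \<noteq> 0 \<longrightarrow> 0 < Re (herm_form A h))"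

section \<open>Absolutely continuous and boundedly differentiable functions\<close>

definition absolutely_continuous_on :: "real set \<Rightarrow> (real \<Rightarrow> 'a::real_normed_vector) \<Rightarrow> bool" where
  "absolutely_continuous_on S f \<longleftrightarrow>
    (\<forall>\<epsilon>>0. \<exists>\<delta>>0. \<forall>d T. d division_of T \<and> T \<subseteq> S \<and> (\<Sum>k\<in>d. Sup k - Inf k) < \<delta> \<longrightarrow>
      (\<Sum>k\<in>d. norm (f (Sup k) - f (Inf k))) < \<epsilon>)"

definition boundedly_differentiable :: "real \<Rightarrow> (real \<Rightarrow> 'a::euclidean_space) \<Rightarrow> bool" where
  "boundedly_differentiable l f \<longleftrightarrow> absolutely_continuous_on {0..l} f \<and>
    (\<exists>B. AE x in lebesgue_on {0..l}.
      \<exists>D. (f has_vector_derivative D) (at x within {0..l}) \<and> norm D \<le> B)"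

text \<open>Defined almost everywhere only when \<open>f\<close> is boundedly differentiable; it is used under
  integrals and inside \<open>AE\<close>.\<close>

definition derivative_on :: "real \<Rightarrow> (real \<Rightarrow> 'a::real_normed_vector) \<Rightarrow> real \<Rightarrow> 'a" where
  "derivative_on l f x = vector_derivative f (at x within {0..l})"

section \<open>Square-integrable functions and operators on them\<close>

text \<open>Elements of \<open>L\<^sup>2(S)\<close> are represented by functions, and equality in \<open>L\<^sup>2(S)\<close> is equality
  almost everywhere on \<open>S\<close>.  An operator acts on representatives; linearity up to null sets and
  boundedness make it well defined on equivalence classes.\<close>

definition L2_on :: "real set \<Rightarrow> (real \<Rightarrow> 'a::euclidean_space) \<Rightarrow> bool" where
  "L2_on S f \<longleftrightarrow> f \<in> borel_measurable (lebesgue_on S) \<and>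
    integrable (lebesgue_on S) (\<lambda>x. (norm (f x))\<^sup>2)"

definition L2_norm_on :: "real set \<Rightarrow> (real \<Rightarrow> 'a::euclidean_space) \<Rightarrow> real" where
  "L2_norm_on S f = sqrt (LINT x|lebesgue_on S. (norm (f x))\<^sup>2)"

definition lim_in_mean ::
    "real set \<Rightarrow> (real \<Rightarrow> real \<Rightarrow> 'a::euclidean_space) \<Rightarrow> (real \<Rightarrow> 'a) \<Rightarrow> bool" where
  "lim_in_mean S F G \<longleftrightarrow> (\<forall>\<^sub>F a in at_top. L2_on S (F a)) \<and> L2_on S G \<and>
    ((\<lambda>a. L2_norm_on S (\<lambda>x. F a x - G x)) \<longlongrightarrow> 0) at_top"

type_synonym 'p vfun = "real \<Rightarrow> complex ^ 'p"

definition bounded_L2_operator :: "real set \<Rightarrow> ('p::finite vfun \<Rightarrow> 'p vfun) \<Rightarrow> bool" where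
  "bounded_L2_operator S T \<longleftrightarrow>
    (\<forall>f. L2_on S f \<longrightarrow> L2_on S (T f)) \<and>
    (\<forall>f g. L2_on S f \<and> L2_on S g \<longrightarrow>
      (AE x in lebesgue_on S. T (\<lambda>t. f t + g t) x = T f x + T g x)) \<and>
    (\<forall>c f. L2_on S f \<longrightarrow> (AE x in lebesgue_on S. T (\<lambda>t. c *s f t) x = c *s T f x)) \<and>
    (\<exists>C. \<forall>f. L2_on S f \<longrightarrow> L2_norm_on S (T f) \<le> C * L2_norm_on S f)"

definition L2_inverse_operator ::
    "real set \<Rightarrow> ('p::finite vfun \<Rightarrow> 'p vfun) \<Rightarrow> ('p vfun \<Rightarrow> 'p vfun) \<Rightarrow> bool" where
  "L2_inverse_operator S T R \<longleftrightarrow> bounded_L2_operator S T \<and> bounded_L2_operator S R \<and>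
    (\<forall>f. L2_on S f \<longrightarrow>
      (AE x in lebesgue_on S. T (R f) x = f x) \<and> (AE x in lebesgue_on S. R (T f) x = f x))"

definition apply_columnwise ::
    "('p vfun \<Rightarrow> 'p vfun) \<Rightarrow> (real \<Rightarrow> complex ^ 'q ^ 'p) \<Rightarrow> real \<Rightarrow> complex ^ 'q ^ 'p" where
  "apply_columnwise T F x = (\<chi> i k. T (\<lambda>t. column k (F t)) x $ i)"

section \<open>The skew-self-adjoint Dirac system\<close>

definition jmat :: "complex ^ ('m1::finite + 'm2::finite) ^ ('m1 + 'm2)" where
  "jmat = vcat (hcat (mat 1) 0) (hcat 0 (- mat 1))"

definition Vmat :: "complex ^ 'm2 ^ 'm1 \<Rightarrow> complex ^ ('m1::finite + 'm2::finite) ^ ('m1 + 'm2)" where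
  "Vmat w = vcat (hcat 0 w) (hcat (adj w) 0)"

definition admissible_potential ::
    "real \<Rightarrow> real \<Rightarrow> (real \<Rightarrow> complex ^ 'm2::finite ^ 'm1::finite) \<Rightarrow> bool" where
  "admissible_potential l M v \<longleftrightarrow> v \<in> borel_measurable (lebesgue_on {0..l}) \<and>
    (\<forall>x\<in>{0<..<l}. onorm (\<lambda>h. v x *v h) \<le> M)"

definition fundamental_solution ::
    "real \<Rightarrow> (real \<Rightarrow> complex ^ 'm2::finite ^ 'm1::finite) \<Rightarrow>
     (real \<Rightarrow> complex \<Rightarrow> complex ^ ('m1 + 'm2) ^ ('m1 + 'm2)) \<Rightarrow> bool" where
  "fundamental_solution l v u \<longleftrightarrow> (\<forall>z.
    u 0 z = mat 1 \<and> absolutely_continuous_on {0..l} (\<lambda>x. u x z) \<and>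
    (AE x in lebesgue_on {0..l}. ((\<lambda>x. u x z) has_vector_derivative
      (mat (\<i> * z) ** jmat + jmat ** Vmat (v x)) ** u x z) (at x within {0..l})))"

definition half_plane :: "real \<Rightarrow> complex set" where
  "half_plane M = {z. Im z > M}"

text \<open>A property holding outside a discrete subset of \<open>\<complex>\<^sub>M\<close> (one without accumulation points
  in \<open>\<complex>\<^sub>M\<close>) is expressed by the filter \<^const>\<open>cosparse\<close>.  The exceptional set absorbs the poles
  of \<open>P\<close>, where its value carries no information.\<close>

definition P_ge :: "real \<Rightarrow> (complex \<Rightarrow> complex ^ 'm1::finite ^ ('m1 + 'm2::finite)) \<Rightarrow> bool" where
  "P_ge M P \<longleftrightarrow> (\<forall>i k. (\<lambda>z. P z $ i $ k) meromorphic_on half_plane M) \<and>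
    (\<forall>\<^sub>F z in cosparse (half_plane M).
      pos_def (adj (P z) ** P z) \<and> pos_semidef (adj (P z) ** jmat ** P z))"

definition weyl_function ::
    "real \<Rightarrow> real \<Rightarrow> (real \<Rightarrow> complex \<Rightarrow> complex ^ ('m1::finite + 'm2::finite) ^ ('m1 + 'm2)) \<Rightarrow>
     (complex \<Rightarrow> complex ^ 'm1 ^ 'm2) \<Rightarrow> bool" where
  "weyl_function l M u \<phi> \<longleftrightarrow> (\<forall>i k. (\<lambda>z. \<phi> z $ i $ k) analytic_on half_plane M) \<and>
    (\<exists>P. P_ge M P \<and> (\<forall>\<^sub>F z in cosparse (half_plane M).
      \<phi> z = OI ** matrix_inv (u l z) ** P z ** matrix_inv (I0 ** matrix_inv (u l z) ** P z)))"

definition beta ::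
    "(real \<Rightarrow> complex \<Rightarrow> complex ^ ('m1::finite + 'm2::finite) ^ ('m1 + 'm2)) \<Rightarrow>
     real \<Rightarrow> complex ^ ('m1 + 'm2) ^ 'm1" where
  "beta u x = I0 ** u x 0"

definition gamma ::
    "(real \<Rightarrow> complex \<Rightarrow> complex ^ ('m1::finite + 'm2::finite) ^ ('m1 + 'm2)) \<Rightarrow>
     real \<Rightarrow> complex ^ ('m1 + 'm2) ^ 'm2" where
  "gamma u x = OI ** u x 0"

section \<open>The operators of the inverse problem\<close>

definition A_op :: "'p::finite vfun \<Rightarrow> 'p vfun" where
  "A_op f x = (- \<i>) *s (LINT t|lebesgue_on {0..x}. f t)"

definition K_op :: "(real \<Rightarrow> complex ^ 'q::finite ^ 'p::finite) \<Rightarrow> 'p vfun \<Rightarrow> 'p vfun" where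
  "K_op g f x = (- \<i>) *s (g x *v (LINT t|lebesgue_on {0..x}. adj (g t) *v f t))"

text \<open>\<open>similarity_operator l u E Einv\<close>: \<open>E\<close> is the operator described by the three last conjuncts
  and \<open>Einv\<close> is its bounded inverse; both are unique as operators on \<open>L\<^sup>2(0,l)\<close>, since an operator
  that commutes with \<open>A\<close> and fixes the constants fixes all polynomials.\<close>

definition similarity_operator ::
    "real \<Rightarrow> (real \<Rightarrow> complex \<Rightarrow> complex ^ ('m1::finite + 'm2::finite) ^ ('m1 + 'm2)) \<Rightarrow>
     ('m2 vfun \<Rightarrow> 'm2 vfun) \<Rightarrow> ('m2 vfun \<Rightarrow> 'm2 vfun) \<Rightarrow> bool" where
  "similarity_operator l u E Einv \<longleftrightarrow>
    L2_inverse_operator {0..l} E Einv \<and>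
    (\<exists>k :: real \<Rightarrow> real \<Rightarrow> complex ^ 'm2 ^ 'm2.
      (\<lambda>(x, t). k x t) \<in> borel_measurable (lebesgue_on ({0..l} \<times> {0..l})) \<and>
      (\<exists>C. \<forall>x\<in>{0..l}. \<forall>t\<in>{0..l}. norm (k x t) \<le> C) \<and>
      (\<forall>f. L2_on {0..l} f \<longrightarrow>
        (AE x in lebesgue_on {0..l}. E f x = f x + (LINT t|lebesgue_on {0..x}. k x t *v f t)))) \<and>
    (\<forall>f. L2_on {0..l} f \<longrightarrow>
      (AE x in lebesgue_on {0..l}. K_op (gamma u) f x = E (A_op (Einv f)) x)) \<and>
    (AE x in lebesgue_on {0..l}.
      apply_columnwise Einv (\<lambda>t. right_block (gamma u t)) x = mat 1)"

text \<open>\<open>E\<^sup>-\<^sup>1 \<gamma>\<^sub>1\<close> is a class modulo null sets; \<open>\<Phi>\<close> is its boundedly differentiable representative.\<close>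

definition is_Phi1 ::
    "real \<Rightarrow> (real \<Rightarrow> complex \<Rightarrow> complex ^ ('m1::finite + 'm2::finite) ^ ('m1 + 'm2)) \<Rightarrow>
     ('m2 vfun \<Rightarrow> 'm2 vfun) \<Rightarrow> (real \<Rightarrow> complex ^ 'm1 ^ 'm2) \<Rightarrow> bool" where
  "is_Phi1 l u Einv \<Phi> \<longleftrightarrow> boundedly_differentiable l \<Phi> \<and>
    (AE x in lebesgue_on {0..l}.
      \<Phi> x = apply_columnwise Einv (\<lambda>t. left_block (gamma u t)) x)"

definition s_kernel ::
    "real \<Rightarrow> (real \<Rightarrow> complex ^ 'm1::finite ^ 'm2::finite) \<Rightarrow> real \<Rightarrow> real \<Rightarrow> complex ^ 'm2 ^ 'm2" where
  "s_kernel l \<Phi> x t = (LINT \<zeta>|lebesgue_on {0..min x t}.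
     derivative_on l \<Phi> (x - \<zeta>) ** adj (derivative_on l \<Phi> (t - \<zeta>)))"

definition S_op ::
    "real \<Rightarrow> (real \<Rightarrow> complex ^ 'm1::finite ^ 'm2::finite) \<Rightarrow> 'm2 vfun \<Rightarrow> 'm2 vfun" where
  "S_op l \<Phi> f x = f x + (LINT t|lebesgue_on {0..l}. s_kernel l \<Phi> x t *v f t)"

text \<open>Functions are total, so cutting off outside \<open>[0,r]\<close> plays the role both of \<open>P\<^sub>r\<close> (only values
  on \<open>[0,r]\<close> matter in \<open>L\<^sup>2(0,r)\<close>) and of the extension by zero \<open>P\<^sub>r\<^sup>*\<close>.\<close>

definition cutoff :: "real \<Rightarrow> 'p::finite vfun \<Rightarrow> 'p vfun" where
  "cutoff r f x = (if x \<in> {0..r} then f x else 0)"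

definition S_trunc ::
    "real \<Rightarrow> (real \<Rightarrow> complex ^ 'm1::finite ^ 'm2::finite) \<Rightarrow> real \<Rightarrow> 'm2 vfun \<Rightarrow> 'm2 vfun" where
  "S_trunc l \<Phi> r f = cutoff r (S_op l \<Phi> (cutoff r f))"

section \<open>Recovery of \<open>\<gamma>\<close> from \<open>\<beta>\<close>\<close>

text \<open>For a merely measurable potential \<open>b = \<beta>\<close> is differentiable only almost everywhere, and a
  function \<open>g\<close> with \<open>b g\<^sup>* = 0\<close> and \<open>g g\<^sup>* > 0\<close> cannot be more regular than \<open>b\<close>: for \<open>m\<^sub>1 = m\<^sub>2 = 1\<close>
  and real \<open>v\<close>, \<open>g\<close> is a multiple of \<open>(- sin \<theta>, cos \<theta>)\<close> with \<open>\<theta>(x) = \<integral>\<^sub>0\<^sup>x v\<close>.  Hence the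
  requirements of differentiability outside a finite set \<open>N\<close> and of bounded one-sided derivatives
  everywhere are imposed at those points where \<open>b\<close> has the derivative in question.  At the
  remaining points \<open>g\<close> is only required to be boundedly differentiable, like \<open>b\<close>.\<close>

definition gamma_tilde ::
    "real \<Rightarrow> (real \<Rightarrow> complex ^ ('m1::finite + 'm2::finite) ^ 'm1) \<Rightarrow>
     (real \<Rightarrow> complex ^ ('m1 + 'm2) ^ 'm2) \<Rightarrow> bool" where
  "gamma_tilde l b g \<longleftrightarrow>
    continuous_on {0..l} g \<and> boundedly_differentiable l g \<and>
    (\<exists>N. finite N \<and> (\<forall>x\<in>{0..l} - N.
      b differentiable (at x within {0..l}) \<longrightarrow> g differentiable (at x within {0..l}))) \<and>
    (\<exists>B. (\<forall>x\<in>{0..<l}. b differentiable (at_right x) \<longrightarrow>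
            (\<exists>D. (g has_vector_derivative D) (at_right x) \<and> norm D \<le> B)) \<and>
         (\<forall>x\<in>{0<..l}. b differentiable (at_left x) \<longrightarrow>
            (\<exists>D. (g has_vector_derivative D) (at_left x) \<and> norm D \<le> B))) \<and>
    (\<forall>x\<in>{0..l}. b x ** adj (g x) = 0 \<and> pos_def (g x ** adj (g x))) \<and>
    g 0 = OI"

definition kappa_tilde ::
    "real \<Rightarrow> (real \<Rightarrow> complex ^ 'm::finite ^ 'm2::finite) \<Rightarrow> (real \<Rightarrow> complex ^ 'm2 ^ 'm2) \<Rightarrow> bool" where
  "kappa_tilde l g \<kappa> \<longleftrightarrow> \<kappa> 0 = mat 1 \<and> absolutely_continuous_on {0..l} \<kappa> \<and>
    (AE x in lebesgue_on {0..l}. (\<kappa> has_vector_derivative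
      - (\<kappa> x ** derivative_on l g x ** adj (g x) ** matrix_inv (g x ** adj (g x))))
      (at x within {0..l}))"

end

theory Submission
  imports Defs "HOL-Probability.Sinc_Integral"
begin

text \<open>
  At \<open>z = 0\<close> the system reads \<open>\<beta>' = v \<gamma>\<close>, \<open>\<gamma>' = - v\<^sup>* \<beta>\<close>, where \<open>\<beta>\<close> and \<open>\<gamma>\<close> form a unitary matrix.  Let
  \<open>J\<close> be integration from \<open>0\<close>, \<open>L f = \<gamma> J (\<gamma>\<^sup>* f)\<close> and \<open>\<Pi> = [\<Phi>\<^sub>1, I]\<close>.  The similarity \<open>L E = E J\<close> gives
  \<open>E \<Pi> = \<gamma>\<close> and \<open>E \<Phi>\<^sub>1' = - v\<^sup>*\<close>, and the lower half \<open>f\<close> of \<open>exp (- \<i> z x) u(x,z) c\<close> is \<open>f = E q\<close> with the explicit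
  solution \<open>q\<close> of \<open>q = \<Pi> c - 2 \<i> z J q\<close>.

  The solutions defining a Weyl function decay, which gives
  \<open>\<phi>(z) = 2 \<i> z \<integral>\<^sub>0\<^sup>l exp (2 \<i> z t) \<Phi>\<^sub>1(t) dt + O(exp (- 2 l Im z))\<close>.  So \<open>\<phi>\<close> determines \<open>\<Phi>\<^sub>1\<close> by Liouville's theorem,
  and the Fourier formula follows from the Dirichlet integral for the main term and from shifting the
  line of integration upwards for the remainder.

  For \<open>S\<close>, put \<open>f = E q\<close> as above on \<open>[0,r]\<close>.  Then \<open>h = S E\<^sup>* f - q\<close> satisfies \<open>h = g - 2 \<i> z J h\<close> with \<open>g\<close>
  depending only on a terminal value that can be prescribed for every \<open>z\<close>, and \<open>h\<close> is bounded for
  \<open>Im z > 0\<close>; by Liouville's theorem \<open>g = 0\<close>, hence \<open>h = 0\<close>.  Applied to \<open>q = exp (- 2 \<i> z x) b\<close> this shows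
  \<open>S\<^sup>-\<^sup>1 = E\<^sup>* E\<close>, so that \<open>(S\<^sup>-\<^sup>1 \<Phi>\<^sub>1')\<^sup>* \<Pi>\<close> has the same integral as \<open>(E \<Phi>\<^sub>1')\<^sup>* E \<Pi> = - v \<gamma> = - \<beta>'\<close>.
\<close>

section \<open>Lipschitz functions and their derivatives\<close>

text \<open>The potential is only bounded and measurable, so \<open>v\<close>, the derivative of
  \<Phi>1 and the kernel of E are known up to null sets, and identities between kernels cannot be
  checked by differentiating them. They are tested on exponential solutions instead, and Liouville's
  theorem decides. For the inverse of S everything hinges on prescribing data at the right end r:
  for Im z \<ge> 0 the norm of the solution, in the frame of z = 0, increases, so its value at r
  bounds it on [0,r] uniformly in z. Writing the equation backwards from r replaces L by its
  adjoint, E^* turns this into J^* , and J S + S J^* = Pi Pi^* with Pi = [\<Phi>1, I] turns J^* back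
  into - J; the moments cancel and a right-hand side free of z remains. The rate exp (- 2 l Im z)
  for Weyl functions is exactly the threshold on [0,l]: a Laplace transform that small belongs to
  the zero function. It also explains the interval (0, 2 l) of the Fourier formula: the remainder
  carries exp (i (2 l - x) z), which decays upwards precisely for x < 2 l.\<close>

abbreviation leb :: "real \<Rightarrow> real measure" where "leb r \<equiv> lebesgue_on {0..r}"

lemma AE_lebesgue_on_iff_negligible:
  fixes S :: "'a::euclidean_space set"
  assumes "S \<in> sets lebesgue"
  shows "(AE x in lebesgue_on S. P x) \<longleftrightarrow> negligible {x \<in> S. \<not> P x}"
proof -
  have "(AE x in lebesgue_on S. P x) \<longleftrightarrow> (AE x in lebesgue. x \<in> S \<longrightarrow> P x)"
    using assms by (subst AE_restrict_space_iff) auto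
  also have "\<dots> \<longleftrightarrow> {x \<in> space lebesgue. \<not> (x \<in> S \<longrightarrow> P x)} \<in> null_sets lebesgue"
    by (rule completion.AE_iff_null_sets)
  also have "{x \<in> space lebesgue. \<not> (x \<in> S \<longrightarrow> P x)} = {x \<in> S. \<not> P x}"
    by auto
  finally show ?thesis
    by (simp add: negligible_iff_null_sets)
qed

lemma AE_lebesgue_on_subset:
  fixes S T :: "'a::euclidean_space set"
  assumes "AE x in lebesgue_on S. P x" "T \<subseteq> S" "S \<in> sets lebesgue" "T \<in> sets lebesgue"
  shows "AE x in lebesgue_on T. P x"
proof -
  have "negligible {x \<in> S. \<not> P x}"
    using assms by (simp add: AE_lebesgue_on_iff_negligible)
  then have "negligible {x \<in> T. \<not> P x}"
    by (rule negligible_subset) (use assms in auto)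
  then show ?thesis
    using assms by (simp add: AE_lebesgue_on_iff_negligible)
qed

text \<open>The gauge sends the exceptional points into an open set of small measure, where absolute
  continuity controls the increments, and is the gauge of differentiability elsewhere.\<close>

lemma absolutely_continuous_has_integral:
  fixes f :: "real \<Rightarrow> 'a::euclidean_space"
  assumes ac: "absolutely_continuous_on {a..b} f" and ab: "a \<le> b"
    and D: "AE x in lebesgue_on {a..b}. (f has_vector_derivative f' x) (at x within {a..b})"
  shows "(f' has_integral (f b - f a)) {a..b}"
proof -
  define N where "N = {x \<in> {a..b}. \<not> (f has_vector_derivative f' x) (at x within {a..b})}"
  have negN: "negligible N"
    using D unfolding N_def by (subst (asm) AE_lebesgue_on_iff_negligible) auto
  \<comment> \<open>With value 0 on the exceptional set, a tag in \<open>N\<close> contributes only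
    the increment of \<open>f\<close>.\<close>
  define g where "g x = (if x \<in> N then 0 else f' x)" for x
  have "(g has_integral (f b - f a)) {a..b}"
    unfolding has_integral_real
  proof (intro allI impI)
    fix e :: real assume "0 < e"
    obtain \<delta> where "\<delta> > 0" and \<delta>: "\<And>d T. d division_of T \<Longrightarrow> T \<subseteq> {a..b} \<Longrightarrow>
        (\<Sum>k\<in>d. Sup k - Inf k) < \<delta> \<Longrightarrow> (\<Sum>k\<in>d. norm (f (Sup k) - f (Inf k))) < e / 2"
      using ac \<open>0 < e\<close> unfolding absolutely_continuous_on_def
      by (meson half_gt_zero)
    obtain U where U: "open U" "N \<subseteq> U" "(U - N) \<in> lmeasurable" "emeasure lebesgue (U - N) < ennreal \<delta>"
      using sets_lebesgue_outer_open[OF negligible_imp_sets[OF negN] \<open>\<delta> > 0\<close>] by blast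
    have Um: "U \<in> lmeasurable" "measure lebesgue U < \<delta>"
    proof -
      have eq: "U = (U - N) \<union> N" using U by auto
      show "U \<in> lmeasurable"
        by (subst eq) (rule fmeasurable.Un[OF U(3) negligible_imp_measurable[OF negN]])
      have "measure lebesgue U = measure lebesgue (U - N)"
        by (subst eq, rule measure_Un_null_set) (use U negN in \<open>auto simp: negligible_iff_null_sets\<close>)
      also have "\<dots> < \<delta>"
        using U(4)[unfolded emeasure_eq_measure2[OF U(3)]] \<open>\<delta> > 0\<close> by (simp add: ennreal_less_iff)
      finally show "measure lebesgue U < \<delta>" .
    qed
    \<comment> \<open>The half of \<open>e\<close> left for the regular tags, spread over the
      length; the summand 1 covers \<open>a = b\<close>.\<close>
    define e' where "e' = e / 2 / (b - a + 1)"
    have "e' > 0" using \<open>0 < e\<close> ab by (simp add: e'_def)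
    have "\<exists>\<eta>>0. \<forall>y\<in>{a..b}. \<bar>y - x\<bar> < \<eta> \<longrightarrow> norm (f y - f x - (y - x) *\<^sub>R f' x) \<le> e' * \<bar>y - x\<bar>"
      if "x \<in> {a..b} - N" for x
    proof -
      have "(f has_vector_derivative f' x) (at x within {a..b})"
        using that by (auto simp: N_def)
      then show ?thesis
        unfolding has_vector_derivative_def has_derivative_within_alt using \<open>e' > 0\<close>
        by (auto simp: real_norm_def)
    qed
    then obtain \<eta> where \<eta>: "\<And>x. x \<in> {a..b} - N \<Longrightarrow> \<eta> x > 0"
      "\<And>x y. x \<in> {a..b} - N \<Longrightarrow> y\<in>{a..b} \<Longrightarrow> \<bar>y - x\<bar> < \<eta> x \<Longrightarrow>
         norm (f y - f x - (y - x) *\<^sub>R f' x) \<le> e' * \<bar>y - x\<bar>"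
      by metis
    define \<gamma> where "\<gamma> x = (if x \<in> N then U else if x \<in> {a..b} then ball x (\<eta> x) else ball x 1)" for x
    have "gauge \<gamma>"
      using U \<eta>(1) by (auto simp: gauge_def \<gamma>_def)
    moreover have "norm ((\<Sum>(x,k)\<in>p. measure lborel k *\<^sub>R g x) - (f b - f a)) < e"
      if p: "p tagged_division_of {a..b}" and fine: "\<gamma> fine p" for p
    proof -
      define pN where "pN = {t \<in> p. fst t \<in> N}"
      have finp: "finite p" using p by blast
      then have finpN: "finite pN" by (simp add: pN_def)
      have pk: "k = {Inf k..Sup k}" "k \<subseteq> {a..b}" "Inf k \<le> x" "x \<le> Sup k" "k \<noteq> {}"
        "Inf k \<in> {a..b}" "Sup k \<in> {a..b}" "Inf k \<in> k" "Sup k \<in> k"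
        "measure lborel k = Sup k - Inf k" if "(x,k) \<in> p" for x k
      proof -
        have 1: "x \<in> k" "k \<subseteq> {a..b}" "\<exists>u v. k = cbox u v"
          using tagged_division_ofD(2-4)[OF p that] by auto
        then obtain u v where k: "k = {u..v}" by (auto simp: box_real)
        with 1 have "u \<le> x" "x \<le> v" by auto
        then have "Inf k = u" "Sup k = v" "u \<le> v" using k by auto
        then show "k = {Inf k..Sup k}" "k \<subseteq> {a..b}" "Inf k \<le> x" "x \<le> Sup k" "k \<noteq> {}"
          "Inf k \<in> {a..b}" "Sup k \<in> {a..b}" "Inf k \<in> k" "Sup k \<in> k"
          "measure lborel k = Sup k - Inf k"
          using 1(2) k \<open>u \<le> x\<close> \<open>x \<le> v\<close> by (auto simp: measure_lborel_Icc)
      qed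
      have pN: "x \<in> N" "(x,k) \<in> p" if "(x,k) \<in> pN" for x k
        using that by (auto simp: pN_def)
      have "(\<Sum>(x,k)\<in>p. measure lborel k *\<^sub>R g x) - (f b - f a)
          = (\<Sum>(x,k)\<in>p. measure lborel k *\<^sub>R g x - (f (Sup k) - f (Inf k)))"
        using additive_tagged_division_1[OF ab p, of f]
        by (simp add: case_prod_unfold sum_subtractf)
      also have "norm \<dots> \<le> (\<Sum>(x,k)\<in>p. norm (measure lborel k *\<^sub>R g x - (f (Sup k) - f (Inf k))))"
        by (rule order.trans[OF norm_sum]) (simp add: case_prod_unfold)
      also have "\<dots> = (\<Sum>(x,k)\<in>pN. norm (measure lborel k *\<^sub>R g x - (f (Sup k) - f (Inf k))))
          + (\<Sum>(x,k)\<in>p - pN. norm (measure lborel k *\<^sub>R g x - (f (Sup k) - f (Inf k))))"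
        using sum.subset_diff[of pN p "\<lambda>(x,k). norm (measure lborel k *\<^sub>R g x - (f (Sup k) - f (Inf k)))"] finp
        by (simp add: pN_def add.commute)
      also have "\<dots> < e / 2 + e / 2"
      proof (rule add_less_le_mono)
        have tp: "pN tagged_partial_division_of {a..b}"
          by (rule tagged_partial_division_subset[of p]) (use p in \<open>auto simp: pN_def tagged_division_of_def\<close>)
        have div: "snd ` pN division_of \<Union>(snd ` pN)"
          by (rule partial_division_of_tagged_division[OF tp])
        have sub: "\<Union>(snd ` pN) \<subseteq> {a..b}"

        proof -
          have "\<forall>t\<in>pN. snd t \<subseteq> {a..b}" using pk(2)[OF pN(2)] by (simp add: split_paired_all Ball_def)
          then show ?thesis by blast
        qed
        have subU: "\<Union>(snd ` pN) \<subseteq> U"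
        proof -
          have "k \<subseteq> U" if "(x,k) \<in> pN" for x k
          proof -
            have "(x,k) \<in> p" "x \<in> N" using that by (auto simp: pN_def)
            then have "k \<subseteq> \<gamma> x" using fine by (auto simp: fine_def)
            then show ?thesis using \<open>x \<in> N\<close> by (simp add: \<gamma>_def)
          qed
          then have "\<forall>t\<in>pN. snd t \<subseteq> U" by (simp add: split_paired_all Ball_def)
          then show ?thesis by blast
        qed
        have "(\<Sum>k\<in>snd ` pN. Sup k - Inf k) = (\<Sum>k\<in>snd ` pN. measure lborel k)"
          by (rule sum.cong) (auto simp: pk(10)[OF pN(2)])
        also have "\<dots> = measure lebesgue (\<Union>(snd ` pN))"
          by (subst content_division[OF div, symmetric], rule sum.cong)
             (use div in \<open>auto dest!: division_ofD(4)\<close>)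
        also have "\<dots> \<le> measure lebesgue U"
          by (rule measure_mono_fmeasurable[OF subU])
             (use Um lmeasurable_division[OF div] in \<open>auto intro: fmeasurableD\<close>)
        also have "\<dots> < \<delta>" by fact
        finally have small: "(\<Sum>k\<in>snd ` pN. norm (f (Sup k) - f (Inf k))) < e / 2"
          by (intro \<delta>[OF div sub]) auto
        \<comment> \<open>Passing from tagged intervals to the set of intervals needs a summand that
          vanishes on every interval with empty interior; on \<open>{}\<close> the values of
          \<open>Sup\<close> and \<open>Inf\<close> are unspecified.\<close>
        define h where "h k = (if k = {} then 0 else norm (f (Sup k) - f (Inf k)))" for k
        have tpU: "pN tagged_division_of \<Union>(snd ` pN)"
          by (rule tagged_partial_division_of_Union_self[OF tp])
        have "(\<Sum>(x,k)\<in>pN. norm (measure lborel k *\<^sub>R g x - (f (Sup k) - f (Inf k)))) = (\<Sum>(x,k)\<in>pN. h k)"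
          by (rule sum.cong) (auto simp: pN(1) pk(5)[OF pN(2)] g_def h_def norm_minus_commute)
        also have "\<dots> = (\<Sum>k\<in>snd ` pN. h k)"
          by (rule sum.over_tagged_division_lemma[OF tpU]) (auto simp: h_def box_real)
        also have "\<dots> = (\<Sum>k\<in>snd ` pN. norm (f (Sup k) - f (Inf k)))"
          by (rule sum.cong) (auto simp: pk(5)[OF pN(2)] h_def)
        finally show "(\<Sum>(x,k)\<in>pN. norm (measure lborel k *\<^sub>R g x - (f (Sup k) - f (Inf k)))) < e / 2"
          using small by simp
      next
        have one: "norm (measure lborel k *\<^sub>R g x - (f (Sup k) - f (Inf k))) \<le> e' * measure lborel k"
          if "(x,k) \<in> p - pN" for x k
        proof -
          define u v where "u = Inf k" and "v = Sup k"
          note k = pk[of x k, folded u_def v_def]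
          have k: "u \<le> x" "x \<le> v" "u \<in> {a..b}" "v \<in> {a..b}" "u \<in> k" "v \<in> k"
            "measure lborel k = v - u" "x \<in> {a..b}"
            using k that by auto
          have xN: "x \<in> {a..b} - N" using that k by (auto simp: pN_def)
          have "k \<subseteq> \<gamma> x" using fine that by (auto simp: fine_def)
          then have "k \<subseteq> ball x (\<eta> x)" using xN by (simp add: \<gamma>_def)
          then have "\<bar>u - x\<bar> < \<eta> x" "\<bar>v - x\<bar> < \<eta> x" using k(5,6) by (auto simp: subset_iff dist_real_def abs_minus_commute)
          then have le: "norm (f u - f x - (u - x) *\<^sub>R f' x) \<le> e' * \<bar>u - x\<bar>"
             "norm (f v - f x - (v - x) *\<^sub>R f' x) \<le> e' * \<bar>v - x\<bar>"
            using \<eta>(2)[OF xN k(3)] \<eta>(2)[OF xN k(4)] by auto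
          have eq: "measure lborel k *\<^sub>R g x - (f (Sup k) - f (Inf k)) =
             (f u - f x - (u - x) *\<^sub>R f' x) - (f v - f x - (v - x) *\<^sub>R f' x)"
            using xN unfolding k(7) u_def[symmetric] v_def[symmetric] by (simp add: g_def algebra_simps)
          have "norm (measure lborel k *\<^sub>R g x - (f (Sup k) - f (Inf k))) \<le> e' * \<bar>u - x\<bar> + e' * \<bar>v - x\<bar>"
            unfolding eq by (rule order_trans[OF norm_triangle_ineq4 add_mono[OF le]])
          also have "\<dots> = e' * (v - u)" using k(1,2) by (simp add: algebra_simps)
          also have "\<dots> = e' * measure lborel k" using k(7) by simp
          finally show ?thesis .
        qed
        have "(\<Sum>(x,k)\<in>p - pN. norm (measure lborel k *\<^sub>R g x - (f (Sup k) - f (Inf k))))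
            \<le> (\<Sum>(x,k)\<in>p - pN. e' * measure lborel k)"
          by (rule sum_mono) (use one in auto)
        also have "\<dots> \<le> (\<Sum>(x,k)\<in>p. e' * measure lborel k)"
          by (rule sum_mono2) (use finp \<open>e' > 0\<close> in auto)
        also have "\<dots> = e' * (b - a)"
          using additive_content_tagged_division[of p a b] p ab
          by (simp add: sum_distrib_left[symmetric] case_prod_unfold)
        also have "\<dots> \<le> e / 2"
          using ab \<open>0 < e\<close> by (simp add: e'_def field_simps)
        finally show "(\<Sum>(x,k)\<in>p - pN. norm (measure lborel k *\<^sub>R g x - (f (Sup k) - f (Inf k)))) \<le> e / 2" .
      qed
      finally show ?thesis by simp
    qed
    ultimately show "\<exists>\<gamma>. gauge \<gamma> \<and> (\<forall>\<D>. \<D> tagged_division_of {a..b} \<and> \<gamma> fine \<D> \<longrightarrow>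
        norm ((\<Sum>(x, k)\<in>\<D>. measure lborel k *\<^sub>R g x) - (f b - f a)) < e)"
      by (intro exI[of _ \<gamma>]) simp
  qed
  from has_integral_spike[OF negN _ this] show ?thesis
    by (auto simp: g_def)
qed

lemma lipschitz_on_imp_absolutely_continuous_on:
  fixes f :: "real \<Rightarrow> 'a::real_normed_vector"
  assumes "L-lipschitz_on {a..b} f"
  shows "absolutely_continuous_on {a..b} f"
  unfolding absolutely_continuous_on_def
proof (intro allI impI)
  fix e :: real assume "e > 0"
  have "L \<ge> 0" using assms by (rule lipschitz_on_nonneg)
  show "\<exists>\<delta>>0. \<forall>d T. d division_of T \<and> T \<subseteq> {a..b} \<and> (\<Sum>k\<in>d. Sup k - Inf k) < \<delta> \<longrightarrow>
    (\<Sum>k\<in>d. norm (f (Sup k) - f (Inf k))) < e"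
  proof (intro exI[of _ "e / (L + 1)"] conjI allI impI; (elim conjE)?)
    show "e / (L + 1) > 0" using \<open>e > 0\<close> \<open>L \<ge> 0\<close> by simp
    fix d T assume d: "d division_of T" "T \<subseteq> {a..b}" "(\<Sum>k\<in>d. Sup k - Inf k) < e / (L + 1)"
    have k: "Sup k \<in> {a..b}" "Inf k \<in> {a..b}" "Inf k \<le> Sup k" if kd: "k \<in> d" for k
    proof -
      obtain u v where k: "k = {u..v}" using division_ofD(4)[OF d(1) kd] by (auto simp: box_real)
      have "k \<noteq> {}" "k \<subseteq> T" using division_ofD(2,3)[OF d(1) kd] by auto
      then have "u \<le> v" "k \<subseteq> {a..b}" using k d(2) by (auto simp del: atLeastatMost_subset_iff)
      then show "Sup k \<in> {a..b}" "Inf k \<in> {a..b}" "Inf k \<le> Sup k" using k by auto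
    qed
    have "(\<Sum>k\<in>d. norm (f (Sup k) - f (Inf k))) \<le> (\<Sum>k\<in>d. L * (Sup k - Inf k))"
    proof (rule sum_mono)
      fix i assume i: "i \<in> d"
      show "norm (f (Sup i) - f (Inf i)) \<le> L * (Sup i - Inf i)"
        using lipschitz_on_normD[OF assms k(1,2)[OF i]] k(3)[OF i] by (simp add: real_norm_def)
    qed
    also have "\<dots> = L * (\<Sum>k\<in>d. Sup k - Inf k)" by (simp add: sum_distrib_left)
    also have "\<dots> \<le> L * (e / (L + 1))" using d(3) \<open>L \<ge> 0\<close> by (intro mult_left_mono) auto
    also have "\<dots> < e" using \<open>e > 0\<close> \<open>L \<ge> 0\<close> by (simp add: field_simps)
    finally show "(\<Sum>k\<in>d. norm (f (Sup k) - f (Inf k))) < e" .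
  qed
qed

lemma absolutely_continuous_on_subset:
  "absolutely_continuous_on S f \<Longrightarrow> T \<subseteq> S \<Longrightarrow> absolutely_continuous_on T f"
  unfolding absolutely_continuous_on_def by (meson order_trans)

lemma has_integral_AE_bound:
  fixes f :: "real \<Rightarrow> 'a::euclidean_space"
  assumes "(f has_integral i) {a..b}" "AE x in lebesgue_on {a..b}. norm (f x) \<le> B" "0 \<le> B" "a \<le> b"
  shows "norm i \<le> B * (b - a)"
proof -
  define N where "N = {x \<in> {a..b}. \<not> norm (f x) \<le> B}"
  have "negligible N"
    using assms(2) unfolding N_def by (subst (asm) AE_lebesgue_on_iff_negligible) auto
  from has_integral_spike[OF this _ assms(1), of "\<lambda>x. if x \<in> N then 0 else f x"]
  have "((\<lambda>x. if x \<in> N then 0 else f x) has_integral i) {a..b}" by auto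
  from has_integral_bound[OF \<open>0 \<le> B\<close> this[folded box_real(2)]]
  show ?thesis using assms by (auto simp: N_def)
qed

lemma has_integral_AE_nonneg:
  fixes f :: "real \<Rightarrow> real"
  assumes "(f has_integral i) {a..b}" "AE x in lebesgue_on {a..b}. 0 \<le> f x"
  shows "0 \<le> i"
proof -
  define N where "N = {x \<in> {a..b}. \<not> 0 \<le> f x}"
  have "negligible N"
    using assms(2) unfolding N_def by (subst (asm) AE_lebesgue_on_iff_negligible) auto
  from has_integral_spike[OF this _ assms(1), of "\<lambda>x. if x \<in> N then 0 else f x"]
  have "((\<lambda>x. if x \<in> N then 0 else f x) has_integral i) {a..b}" by auto
  then show ?thesis
    by (rule has_integral_nonneg) (auto simp: N_def)
qed

lemma has_vector_derivative_norm_le_lipschitz: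
  fixes f :: "real \<Rightarrow> 'a::real_normed_vector"
  assumes L: "L-lipschitz_on {a..b} f" and D: "(f has_vector_derivative D) (at x within {a..b})"
    and "a < b" "x \<in> {a..b}"
  shows "norm D \<le> L"
proof (rule field_le_epsilon)
  fix e :: real assume "e > 0"
  obtain d where "d > 0" and d: "\<And>y. y \<in> {a..b} \<Longrightarrow> \<bar>y - x\<bar> < d \<Longrightarrow>
      norm (f y - f x - (y - x) *\<^sub>R D) \<le> e * \<bar>y - x\<bar>"
    using D \<open>e > 0\<close> unfolding has_vector_derivative_def has_derivative_within_alt
    by (auto simp: real_norm_def)
  \<comment> \<open>A point on the side where the interval continues, so that a difference quotient
    exists at the end points too.\<close>
  define y where "y = (if x < b then min b (x + d/2) else max a (x - d/2))"
  have y: "y \<in> {a..b}" "\<bar>y - x\<bar> < d" "y \<noteq> x"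
    using \<open>a < b\<close> \<open>d > 0\<close> \<open>x \<in> {a..b}\<close> by (auto simp: y_def min_def max_def)
  have "norm ((y - x) *\<^sub>R D) \<le> norm (f y - f x) + norm (f y - f x - (y - x) *\<^sub>R D)"
    by (metis norm_triangle_sub norm_minus_commute)
  also have "\<dots> \<le> L * \<bar>y - x\<bar> + e * \<bar>y - x\<bar>"
    using d[OF y(1,2)] lipschitz_on_normD[OF L y(1) \<open>x \<in> {a..b}\<close>] by (simp add: real_norm_def)
  finally have "\<bar>y - x\<bar> * norm D \<le> \<bar>y - x\<bar> * (L + e)" by (simp add: distrib_right mult.commute)
  then show "norm D \<le> L + e" using y(3) by simp
qed

text \<open>The working class for all differential equations below. The derivative is an argument of
  its own because it is determined only up to null sets; with it, product rules and the fundamental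
  theorem become formulas. For \<open>0 < l\<close> these are the boundedly differentiable
  functions.\<close>

definition lip_ad :: "real \<Rightarrow> (real \<Rightarrow> 'a::euclidean_space) \<Rightarrow> (real \<Rightarrow> 'a) \<Rightarrow> bool" where
  "lip_ad l f f' \<longleftrightarrow> (\<exists>L. L-lipschitz_on {0..l} f) \<and>
     (AE x in leb l. (f has_vector_derivative f' x) (at x within {0..l}))"

lemma lip_adD_lipschitz: "lip_ad l f f' \<Longrightarrow> \<exists>L. L-lipschitz_on {0..l} f"
  and lip_adD_AE: "lip_ad l f f' \<Longrightarrow> AE x in leb l. (f has_vector_derivative f' x) (at x within {0..l})"
  by (auto simp: lip_ad_def)

lemma lip_ad_continuous_on: "lip_ad l f f' \<Longrightarrow> continuous_on {0..l} f"
  using lipschitz_on_continuous_on by (auto simp: lip_ad_def)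

lemma lip_ad_absolutely_continuous_on: "lip_ad l f f' \<Longrightarrow> absolutely_continuous_on {0..l} f"
  using lipschitz_on_imp_absolutely_continuous_on by (auto simp: lip_ad_def)

lemma lip_ad_restrict:
  assumes "lip_ad l f f'" "r \<le> l"
  shows "lip_ad r f f'"
proof -
  have sub: "{0..r} \<subseteq> {0..l}" using assms by auto
  have "AE x in leb r. (f has_vector_derivative f' x) (at x within {0..l})"
    by (rule AE_lebesgue_on_subset[OF lip_adD_AE[OF assms(1)] sub]) auto
  then have "AE x in leb r. (f has_vector_derivative f' x) (at x within {0..r})"
    by eventually_elim (rule has_vector_derivative_within_subset[OF _ sub])
  then show ?thesis
    using assms(1) lipschitz_on_subset[OF _ sub] unfolding lip_ad_def by blast
qed

lemma lip_ad_cong: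
  assumes "lip_ad l f f'" "\<And>x. x \<in> {0..l} \<Longrightarrow> f x = g x" "AE x in leb l. f' x = g' x"
  shows "lip_ad l g g'"
proof -
  have "AE x in leb l. x \<in> {0..l}" by (rule AE_I2) auto
  then have "AE x in leb l. (g has_vector_derivative g' x) (at x within {0..l})"
    using assms(3) lip_adD_AE[OF assms(1)]
  proof eventually_elim
    case (elim x)
    then show ?case
      using has_vector_derivative_transform[of x "{0..l}" g f "g' x"] assms(2) by simp
  qed
  then show ?thesis
    using assms(1) lipschitz_on_transform[of _ "{0..l}" f g] assms(2) unfolding lip_ad_def by metis
qed

lemma lip_ad_has_integral:
  assumes "lip_ad l f f'" "0 \<le> a" "a \<le> b" "b \<le> l"
  shows "(f' has_integral (f b - f a)) {a..b}"
proof (rule absolutely_continuous_has_integral)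
  have sub: "{a..b} \<subseteq> {0..l}" using assms by auto
  show "absolutely_continuous_on {a..b} f"
    by (rule absolutely_continuous_on_subset[OF lip_ad_absolutely_continuous_on[OF assms(1)] sub])
  have "AE x in lebesgue_on {a..b}. (f has_vector_derivative f' x) (at x within {0..l})"
    by (rule AE_lebesgue_on_subset[OF lip_adD_AE[OF assms(1)] sub]) auto
  then show "AE x in lebesgue_on {a..b}. (f has_vector_derivative f' x) (at x within {a..b})"
    by eventually_elim (rule has_vector_derivative_within_subset[OF _ sub])
qed fact

lemma AE_lebesgue_on_singleton: "AE x in lebesgue_on {a::real..a}. P x"
  by (subst AE_lebesgue_on_iff_negligible) (auto intro: negligible_subset[of "{a}"])

lemma lip_ad_AE_bound:
  assumes "lip_ad l f f'"
  shows "\<exists>B\<ge>0. AE x in leb l. norm (f' x) \<le> B"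
proof (cases "0 < l")
  case True
  obtain L where L: "L-lipschitz_on {0..l} f" using lip_adD_lipschitz[OF assms] by blast
  have "AE x in leb l. x \<in> {0..l}" by (rule AE_I2) auto
  then have "AE x in leb l. norm (f' x) \<le> L"
    using lip_adD_AE[OF assms]
    by eventually_elim (rule has_vector_derivative_norm_le_lipschitz[OF L _ True])
  then show ?thesis using lipschitz_on_nonneg[OF L] by blast
next
  case False
  then have "{0..l} \<subseteq> {0..0}" by auto
  then have "AE x in leb l. norm (f' x) \<le> 0"
    by (rule AE_lebesgue_on_subset[OF AE_lebesgue_on_singleton]) auto
  then show ?thesis by blast
qed

lemma integrable_lebesgue_on_AE_bound:
  fixes f :: "real \<Rightarrow> 'a::euclidean_space"
  assumes "f \<in> borel_measurable (lebesgue_on {a..b})" "AE x in lebesgue_on {a..b}. norm (f x) \<le> B"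
  shows "integrable (lebesgue_on {a..b}) f"
proof -
  have "finite_measure (lebesgue_on {a..b})"
    by (rule finite_measureI) (simp add: emeasure_restrict_space emeasure_lborel_Icc_eq)
  then interpret finite_measure "lebesgue_on {a..b}" .
  show ?thesis by (rule integrable_const_bound[OF assms(2,1)])
qed

lemma lip_ad_integrable:
  assumes "lip_ad l f f'"
  shows "integrable (leb l) f'"
proof (cases "0 \<le> l")
  case True
  have "f' integrable_on {0..l}" using lip_ad_has_integral[OF assms, of 0 l] True by blast
  then have "f' \<in> borel_measurable (leb l)" by (rule integrable_imp_measurable)
  with lip_ad_AE_bound[OF assms] show ?thesis
    using integrable_lebesgue_on_AE_bound by blast
next
  case False
  then have *: "{0..l} = {}" by auto
  show ?thesis unfolding * by (rule integrableI_bounded) (auto simp: space_restrict_space nn_integral_empty measurable_def)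
qed

lemma lip_ad_lebesgue_integral:
  assumes "lip_ad l f f'" "0 \<le> x" "x \<le> l"
  shows "(LINT t|leb x. f' t) = f x - f 0"
proof -
  have "integrable (leb x) f'"
    by (rule lip_ad_integrable[OF lip_ad_restrict[OF assms(1,3)]])
  then have "(LINT t|leb x. f' t) = integral {0..x} f'"
    by (rule lebesgue_integral_eq_integral) simp
  also have "\<dots> = f x - f 0"
    using lip_ad_has_integral[OF assms(1) _ assms(2,3)] by (simp add: integral_unique)
  finally show ?thesis .
qed

text \<open>By the fundamental theorem an almost everywhere bound of the derivative is a Lipschitz
  constant. The maximum with 0 is there because \<open>B\<close> may be negative on a null
  interval.\<close>

lemma lip_adI_absolutely_continuous:
  fixes f :: "real \<Rightarrow> 'a::euclidean_space"
  assumes ac: "absolutely_continuous_on {0..l} f"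
    and D: "AE x in leb l. (f has_vector_derivative f' x) (at x within {0..l})"
    and B: "AE x in leb l. norm (f' x) \<le> B"
  shows "lip_ad l f f'"
proof -
  have "(max B 0)-lipschitz_on {0..l} f"
  proof (rule lipschitz_on_leI)
    fix x y assume xy: "x \<in> {0..l}" "y \<in> {0..l}" "x \<le> y"
    then have sub: "{x..y} \<subseteq> {0..l}" by auto
    have "AE t in lebesgue_on {x..y}. (f has_vector_derivative f' t) (at t within {0..l})"
      by (rule AE_lebesgue_on_subset[OF D sub]) auto
    then have "AE t in lebesgue_on {x..y}. (f has_vector_derivative f' t) (at t within {x..y})"
      by eventually_elim (rule has_vector_derivative_within_subset[OF _ sub])
    with absolutely_continuous_on_subset[OF ac sub] xy(3) have I: "(f' has_integral f y - f x) {x..y}"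
      by (rule absolutely_continuous_has_integral)
    have "AE t in lebesgue_on {x..y}. norm (f' t) \<le> B"
      by (rule AE_lebesgue_on_subset[OF B sub]) auto
    then have "AE t in lebesgue_on {x..y}. norm (f' t) \<le> max B 0"
      by eventually_elim auto
    with I have "norm (f y - f x) \<le> max B 0 * (y - x)"
      by (rule has_integral_AE_bound) (use xy in auto)
    then show "dist (f x) (f y) \<le> max B 0 * dist x y"
      using xy by (simp add: dist_norm norm_minus_commute)
  qed simp
  then show ?thesis using D by (auto simp: lip_ad_def)
qed

lemma lip_ad_const_deriv_0:
  assumes "lip_ad l f f'" "AE x in leb l. f' x = 0" "x \<in> {0..l}"
  shows "f x = f 0"
proof -
  have sub: "{0..x} \<subseteq> {0..l}" using assms by auto
  have "AE t in leb x. f' t = 0"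
    by (rule AE_lebesgue_on_subset[OF assms(2) sub]) auto
  then have "AE t in leb x. norm (f' t) \<le> 0" by eventually_elim auto
  moreover have "(f' has_integral (f x - f 0)) {0..x}"
    using assms(3) by (intro lip_ad_has_integral[OF assms(1)]) auto
  ultimately have "norm (f x - f 0) \<le> 0 * (x - 0)"
    using assms(3) by (intro has_integral_AE_bound[of f']) auto
  then show ?thesis by simp
qed

lemma lip_ad_mono:
  fixes f :: "real \<Rightarrow> real"
  assumes "lip_ad l f f'" "AE x in leb l. 0 \<le> f' x" "0 \<le> x" "x \<le> y" "y \<le> l"
  shows "f x \<le> f y"
proof -
  have sub: "{x..y} \<subseteq> {0..l}" using assms by auto
  have "AE t in lebesgue_on {x..y}. 0 \<le> f' t"
    by (rule AE_lebesgue_on_subset[OF assms(2) sub]) auto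
  with lip_ad_has_integral[OF assms(1,3,4,5)] have "0 \<le> f y - f x"
    by (rule has_integral_AE_nonneg)
  then show ?thesis by simp
qed

lemma lip_ad_antimono:
  fixes f :: "real \<Rightarrow> real"
  assumes "lip_ad l f f'" "AE x in leb l. f' x \<le> 0" "0 \<le> x" "x \<le> y" "y \<le> l"
  shows "f y \<le> f x"
proof -
  have sub: "{x..y} \<subseteq> {0..l}" using assms by auto
  have "AE t in lebesgue_on {x..y}. f' t \<le> 0"
    by (rule AE_lebesgue_on_subset[OF assms(2) sub]) auto
  then have "AE t in lebesgue_on {x..y}. 0 \<le> - f' t" by eventually_elim auto
  with has_integral_neg[OF lip_ad_has_integral[OF assms(1,3,4,5)]] have "0 \<le> - (f y - f x)"
    by (rule has_integral_AE_nonneg)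
  then show ?thesis by simp
qed

lemma lip_ad_linear:
  fixes h :: "'a::euclidean_space \<Rightarrow> 'b::euclidean_space"
  assumes "bounded_linear h" "lip_ad l f f'"
  shows "lip_ad l (\<lambda>x. h (f x)) (\<lambda>x. h (f' x))"
proof -
  interpret bounded_linear h by fact
  obtain L where L: "L-lipschitz_on {0..l} f" using assms(2) unfolding lip_ad_def by blast
  obtain K where K: "K-lipschitz_on (f ` {0..l}) h" by (rule lipschitz_boundE)
  have "(K * L)-lipschitz_on {0..l} (\<lambda>x. h (f x))"
    using lipschitz_on_compose[OF L K] by (simp add: o_def)
  moreover have "AE x in leb l. ((\<lambda>x. h (f x)) has_vector_derivative h (f' x)) (at x within {0..l})"
    using lip_adD_AE[OF assms(2)] by eventually_elim (rule has_vector_derivative)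
  ultimately show ?thesis by (auto simp: lip_ad_def)
qed

text \<open>The one product rule behind all conserved and monotone quantities below: it is applied
  to matrix products, scalar multiples and inner products.\<close>

lemma lip_ad_bilinear:
  fixes h :: "'a::euclidean_space \<Rightarrow> 'b::euclidean_space \<Rightarrow> 'c::euclidean_space"
  assumes "bounded_bilinear h" "lip_ad l f f'" "lip_ad l g g'"
  shows "lip_ad l (\<lambda>x. h (f x) (g x)) (\<lambda>x. h (f x) (g' x) + h (f' x) (g x))"
proof -
  interpret bounded_bilinear h by fact
  obtain K where K: "K > 0" "\<And>a b. norm (h a b) \<le> norm a * norm b * K" using pos_bounded by blast
  obtain L1 where L1: "L1-lipschitz_on {0..l} f" using assms by (auto simp: lip_ad_def)
  obtain L2 where L2: "L2-lipschitz_on {0..l} g" using assms by (auto simp: lip_ad_def)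
  have "bounded (f ` {0..l})" "bounded (g ` {0..l})"
    using lip_ad_continuous_on assms(2,3) by (meson compact_Icc compact_continuous_image compact_imp_bounded)+
  then obtain B1 B2 where B: "B1 > 0" "B2 > 0" "\<And>x. x \<in> {0..l} \<Longrightarrow> norm (f x) \<le> B1" "\<And>x. x \<in> {0..l} \<Longrightarrow> norm (g x) \<le> B2"
    unfolding bounded_pos by (metis imageI)
  have "(B1 * L2 * K + L1 * B2 * K)-lipschitz_on {0..l} (\<lambda>x. h (f x) (g x))"
  proof (rule lipschitz_onI)
    fix x y assume xy: "x \<in> {0..l}" "y \<in> {0..l}"
    have "h (f x) (g x) - h (f y) (g y) = h (f x) (g x - g y) + h (f x - f y) (g y)"
      by (simp add: diff_left diff_right)
    then have "dist (h (f x) (g x)) (h (f y) (g y)) \<le> norm (h (f x) (g x - g y)) + norm (h (f x - f y) (g y))"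
      by (simp add: dist_norm norm_triangle_ineq)
    also have "\<dots> \<le> norm (f x) * norm (g x - g y) * K + norm (f x - f y) * norm (g y) * K"
      by (intro add_mono K)
    also have "\<dots> \<le> B1 * (L2 * dist x y) * K + (L1 * dist x y) * B2 * K"
      using lipschitz_on_normD[OF L1 xy] lipschitz_on_normD[OF L2 xy] B K(1)
        lipschitz_on_nonneg[OF L1] lipschitz_on_nonneg[OF L2] xy
      by (intro add_mono mult_mono) (auto simp: dist_norm)
    finally show "dist (h (f x) (g x)) (h (f y) (g y)) \<le> (B1 * L2 * K + L1 * B2 * K) * dist x y"
      by (simp add: algebra_simps)
  next
    show "0 \<le> B1 * L2 * K + L1 * B2 * K"
      using B K lipschitz_on_nonneg[OF L1] lipschitz_on_nonneg[OF L2] by simp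
  qed
  moreover have "AE x in leb l. ((\<lambda>x. h (f x) (g x)) has_vector_derivative (h (f x) (g' x) + h (f' x) (g x))) (at x within {0..l})"
    using lip_adD_AE[OF assms(2)] lip_adD_AE[OF assms(3)]
    by eventually_elim (rule has_vector_derivative)
  ultimately show ?thesis by (auto simp: lip_ad_def)
qed

lemma lip_ad_add:
  assumes "lip_ad l f f'" "lip_ad l g g'"
  shows "lip_ad l (\<lambda>x. f x + g x) (\<lambda>x. f' x + g' x)"
proof -
  have "AE x in leb l. ((\<lambda>x. f x + g x) has_vector_derivative f' x + g' x) (at x within {0..l})"
    using lip_adD_AE[OF assms(1)] lip_adD_AE[OF assms(2)]
    by eventually_elim (rule has_vector_derivative_add)
  then show ?thesis
    using lipschitz_on_add assms unfolding lip_ad_def by blast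
qed

lemma lip_ad_C1:
  fixes f :: "real \<Rightarrow> 'a::euclidean_space"
  assumes "\<And>x. x \<in> {0..l} \<Longrightarrow> (f has_vector_derivative f' x) (at x within {0..l})" "continuous_on {0..l} f'"
  shows "lip_ad l f f'"
proof -
  have "bounded (f' ` {0..l})"
    using assms(2) by (meson compact_Icc compact_continuous_image compact_imp_bounded)
  then obtain B where B: "B > 0" "\<And>x. x \<in> {0..l} \<Longrightarrow> norm (f' x) \<le> B" unfolding bounded_pos by (metis imageI)
  have "B-lipschitz_on {0..l} f"
  proof (rule lipschitz_onI)
    fix x y assume "x \<in> {0..l}" "y \<in> {0..l}"
    moreover have "onorm (\<lambda>h. h *\<^sub>R f' x) \<le> B" if "x \<in> {0..l}" for x
      using B(1) mult_left_mono[OF B(2)[OF that], of "\<bar>h\<bar>" for h] by (intro onorm_bound) (auto simp: mult.commute)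
    ultimately have "norm (f x - f y) \<le> B * norm (x - y)"
      using assms(1) unfolding has_vector_derivative_def
      by (intro differentiable_bound[of "{0..l}" f "\<lambda>x h. h *\<^sub>R f' x"]) auto
    then show "dist (f x) (f y) \<le> B * dist x y" by (simp add: dist_norm)
  qed (use B in auto)
  moreover have "AE x in leb l. (f has_vector_derivative f' x) (at x within {0..l})"
    by (rule AE_I2) (use assms in auto)
  ultimately show ?thesis by (auto simp: lip_ad_def)
qed

lemma lip_ad_const: "lip_ad l (\<lambda>x. c) (\<lambda>x. 0)"
  by (rule lip_ad_C1) (auto intro: has_vector_derivative_const)

section \<open>Complex vectors and block matrices\<close>

text \<open>Conjugate-linear in the first argument, like \<open>herm_form\<close>. The real inner
  product of the type is only its real part and is not compatible with complex scalars.\<close>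

definition cip :: "complex ^ 'p::finite \<Rightarrow> complex ^ 'p \<Rightarrow> complex" where
  "cip a b = (\<Sum>i\<in>UNIV. cnj (a $ i) * b $ i)"

lemma cip_cnj: "cnj (cip a b) = cip b a"
  by (simp add: cip_def mult.commute)

lemma cip_add_right: "cip a (b + c) = cip a b + cip a c"
  and cip_add_left: "cip (b + c) a = cip b a + cip c a"
  and cip_diff_right: "cip a (b - c) = cip a b - cip a c"
  and cip_diff_left: "cip (b - c) a = cip b a - cip c a"
  and cip_scale_right: "cip a (k *s b) = k * cip a b"
  and cip_scale_left: "cip (k *s a) b = cnj k * cip a b"
  and cip_zero [simp]: "cip a 0 = 0" "cip 0 a = 0"
  and cip_minus_right: "cip a (- b) = - cip a b"
  and cip_minus_left: "cip (- a) b = - cip a b"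
  by (simp_all add: cip_def algebra_simps sum.distrib sum_subtractf sum_distrib_left sum_negf)

lemma cip_scaleR_right: "cip a (k *\<^sub>R b) = k *\<^sub>R cip a b"
  and cip_scaleR_left: "cip (k *\<^sub>R a) b = k *\<^sub>R cip a b"
  by (simp_all add: cip_def scaleR_sum_right)

lemma cip_self: "cip a a = of_real ((norm a)\<^sup>2)"
proof -
  have "complex_of_real ((norm a)\<^sup>2) = (\<Sum>i\<in>UNIV. complex_of_real ((norm (a $ i))\<^sup>2))"
    by (simp add: norm_vec_def L2_set_def sum_nonneg)
  then show ?thesis by (simp only: complex_norm_square cip_def mult.commute)
qed

lemma Re_cip: "Re (cip a b) = a \<bullet> b"
  by (simp add: cip_def inner_vec_def inner_complex_def)

lemma cip_unit: "cip (axis i 1) b = b $ i"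
  by (simp add: cip_def axis_def if_distrib[of cnj] if_distrib[of "\<lambda>x. x * _"] cong: if_cong)

text \<open>A unimodular factor turns \<open>cip a b\<close> into its modulus, which reduces the
  claim to Cauchy-Schwarz for the real inner product.\<close>

lemma norm_cip_le: "norm (cip a b) \<le> norm a * norm b"
proof (cases "cip a b = 0")
  case False
  define k where "k = cnj (cip a b) / of_real (norm (cip a b))"
  have k: "norm k = 1" using False by (simp add: k_def norm_divide)
  have "cip a (k *s b) = of_real (norm (cip a b))"
    using False by (simp add: cip_scale_right k_def complex_norm_square[symmetric] power2_eq_square mult.commute)
  then have "norm (cip a b) = Re (cip a (k *s b))" by simp
  also have "\<dots> \<le> norm a * norm (k *s b)" unfolding Re_cip by (rule norm_cauchy_schwarz)
  also have "norm (k *s b) = norm b"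
    using k by (simp add: norm_vec_def vector_scalar_mult_def norm_mult L2_set_def)
  finally show ?thesis .
qed simp

lemma norm_smult: "norm (k *s (b::complex^'n::finite)) = norm k * norm b"
  by (simp add: norm_vec_def vector_scalar_mult_def norm_mult L2_set_right_distrib)

lemma bounded_bilinear_cip: "bounded_bilinear cip"
  by (rule bounded_bilinear.intro)
     (auto simp: cip_add_left cip_add_right cip_scaleR_left cip_scaleR_right intro!: exI[of _ 1] norm_cip_le)

lemma bounded_bilinear_smult: "bounded_bilinear ((*s) :: complex \<Rightarrow> complex^'n::finite \<Rightarrow> complex^'n)"
  by (rule bounded_bilinear.intro)
     (auto simp: vec_eq_iff algebra_simps norm_smult intro!: exI[of _ 1])

lemma bounded_bilinear_matrix_vector_mult:
  "bounded_bilinear ((*v) :: complex^'q::finite^'p::finite \<Rightarrow> complex^'q \<Rightarrow> complex^'p)"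
  unfolding bilinear_conv_bounded_bilinear[symmetric] bilinear_def
  by (auto intro!: linearI simp: vec_eq_iff matrix_vector_mult_def algebra_simps sum.distrib sum_distrib_left scaleR_sum_right)

lemma bounded_bilinear_matrix_matrix_mult:
  "bounded_bilinear ((**) :: complex^'q::finite^'p::finite \<Rightarrow> complex^'r::finite^'q \<Rightarrow> complex^'r^'p)"
  unfolding bilinear_conv_bounded_bilinear[symmetric] bilinear_def
  by (auto intro!: linearI simp: vec_eq_iff matrix_matrix_mult_def algebra_simps sum.distrib sum_distrib_left scaleR_sum_right)

lemma bounded_linear_adj: "bounded_linear (adj :: complex^'q::finite^'p::finite \<Rightarrow> complex^'p^'q)"
  unfolding linear_conv_bounded_linear[symmetric]
  by (auto intro!: linearI simp: vec_eq_iff adj_def)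

lemma norm_adj: "norm (adj A) = norm (A :: complex^'q::finite^'p::finite)"
  by (simp add: norm_vec_def L2_set_def adj_def sum_nonneg sum.swap[of _ "UNIV::'q set"])

lemma bounded_linear_matrix_vector_left: "bounded_linear (\<lambda>A::complex^'q::finite^'p::finite. A *v x)"
  by (rule bounded_bilinear.bounded_linear_left[OF bounded_bilinear_matrix_vector_mult])

lemma bounded_linear_matrix_vector_right: "bounded_linear (\<lambda>x. (A::complex^'q::finite^'p::finite) *v x)"
  by (rule bounded_bilinear.bounded_linear_right[OF bounded_bilinear_matrix_vector_mult])

lemma adj_adj [simp]: "adj (adj A) = A"
  by (simp add: adj_def vec_eq_iff)

lemma adj_add: "adj (A + B) = adj A + adj B"
  and adj_diff: "adj (A - B) = adj A - adj B"
  and adj_minus: "adj (- A) = - adj A"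
  and adj_zero [simp]: "adj 0 = 0"
  by (simp_all add: adj_def vec_eq_iff)

lemma adj_mult: "adj (A ** B) = adj B ** adj (A :: complex^'q::finite^'p::finite)"
  by (simp add: adj_def vec_eq_iff matrix_matrix_mult_def mult.commute)

lemma adj_mat: "adj (mat c) = (mat (cnj c) :: complex^'q::finite^'q)"
  by (auto simp: adj_def vec_eq_iff mat_def)

lemma cip_adj: "cip a (A *v b) = cip (adj A *v a) (b::complex^'q::finite)"
proof -
  have "cip a (A *v b) = (\<Sum>i\<in>UNIV. \<Sum>j\<in>UNIV. cnj (a $ i) * (A $ i $ j * b $ j))"
    by (simp add: cip_def matrix_vector_mult_def sum_distrib_left)
  also have "\<dots> = (\<Sum>j\<in>UNIV. \<Sum>i\<in>UNIV. cnj (a $ i) * (A $ i $ j * b $ j))"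
    by (rule sum.swap)
  also have "\<dots> = cip (adj A *v a) b"
    by (simp add: cip_def matrix_vector_mult_def adj_def sum_distrib_right sum_distrib_left mult_ac)
  finally show ?thesis .
qed

lemma cip_adj': "cip (A *v a) b = cip a (adj A *v (b::complex^'q::finite))"
  using cip_adj[of "a" "adj A" b] by simp

lemma herm_form_cip: "herm_form A h = cip h (A *v h)"
  by (simp add: herm_form_def cip_def)

lemma matrix_mult_minus_left: "(- A) ** B = - (A ** (B::complex^'r::finite^'q::finite))"
  and matrix_mult_minus_right: "A ** (- B) = - (A ** B)"
  by (simp_all add: matrix_matrix_mult_def vec_eq_iff sum_negf)

lemma matrix_vector_mult_minus_left: "(- A) *v x = - (A *v (x::complex^'q::finite))"
  by (simp add: matrix_vector_mult_def vec_eq_iff sum_negf)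

lemma matrix_vector_mult_smult: "A *v (k *s x) = k *s (A *v (x::complex^'q::finite))"
  by (simp add: matrix_vector_mult_def vec_eq_iff sum_distrib_left algebra_simps)

lemma mat_vector_mult: "mat k *v x = k *s (x::complex^'q::finite)"
  by (simp add: matrix_vector_mult_def vec_eq_iff mat_def if_distrib[of "\<lambda>x. x * _"] cong: if_cong)

lemma smult_smult: "a *s (b *s x) = (a * b) *s (x::complex^'q::finite)"
  by (simp add: vec_eq_iff)

lemma matrix_vector_mult_eqI:
  fixes A B :: "complex^'q::finite^'p::finite"
  assumes "\<And>x. A *v x = B *v x"
  shows "A = B"
proof -
  have "(C *v axis j 1) $ i = C $ i $ j" for C :: "complex^'q^'p" and i j
    by (simp add: matrix_vector_mult_def axis_def if_distrib[of "\<lambda>x. _ * x"] cong: if_cong)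
  then show ?thesis using assms by (metis vec_eq_iff)
qed

section \<open>Block vectors and block matrices\<close>

definition vtop :: "complex ^ ('a::finite + 'b::finite) \<Rightarrow> complex ^ 'a" where
  "vtop x = (\<chi> i. x $ Inl i)"

definition vbot :: "complex ^ ('a::finite + 'b::finite) \<Rightarrow> complex ^ 'b" where
  "vbot x = (\<chi> i. x $ Inr i)"

definition vjoin :: "complex ^ 'a \<Rightarrow> complex ^ 'b \<Rightarrow> complex ^ ('a::finite + 'b::finite)" where
  "vjoin a b = (\<chi> i. case i of Inl k \<Rightarrow> a $ k | Inr k \<Rightarrow> b $ k)"

lemma sum_UNIV_Plus: "(\<Sum>i\<in>UNIV. f i) = (\<Sum>i\<in>UNIV. f (Inl i)) + (\<Sum>i\<in>UNIV. f (Inr i))"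
  for f :: "'a::finite + 'b::finite \<Rightarrow> 'c::comm_monoid_add"
  by (subst UNIV_Plus_UNIV[symmetric], subst sum.Plus) simp_all

lemma vtop_vjoin [simp]: "vtop (vjoin a b) = a" and vbot_vjoin [simp]: "vbot (vjoin a b) = b"
  by (simp_all add: vtop_def vbot_def vjoin_def vec_eq_iff)

lemma vjoin_eq: "vjoin (vtop x) (vbot x) = x"
  by (auto simp: vtop_def vbot_def vjoin_def vec_eq_iff split: sum.split)

lemma block_vec_eqI: "vtop x = vtop y \<Longrightarrow> vbot x = vbot y \<Longrightarrow> x = y"
  by (metis vjoin_eq)

lemma cip_blocks: "cip x y = cip (vtop x) (vtop y) + cip (vbot x) (vbot y)"
  by (simp add: cip_def sum_UNIV_Plus vtop_def vbot_def)

lemma norm_blocks: "(norm x)\<^sup>2 = (norm (vtop x))\<^sup>2 + (norm (vbot x))\<^sup>2"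
proof -
  have "complex_of_real ((norm x)\<^sup>2) = of_real ((norm (vtop x))\<^sup>2 + (norm (vbot x))\<^sup>2)"
    unfolding of_real_add cip_self[symmetric] by (rule cip_blocks)
  then show ?thesis using of_real_eq_iff by blast
qed

lemma bounded_linear_vtop: "bounded_linear vtop" and bounded_linear_vbot: "bounded_linear vbot"
  unfolding linear_conv_bounded_linear[symmetric]
  by (auto intro!: linearI simp: vec_eq_iff vtop_def vbot_def)

lemma vtop_smult: "vtop (k *s x) = k *s vtop x" and vbot_smult: "vbot (k *s x) = k *s vbot x"
  and vtop_add: "vtop (x + y) = vtop x + vtop y" and vbot_add: "vbot (x + y) = vbot x + vbot y"
  and vtop_diff: "vtop (x - y) = vtop x - vtop y" and vbot_diff: "vbot (x - y) = vbot x - vbot y"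
  by (simp_all add: vtop_def vbot_def vec_eq_iff)

lemma I0_mult_vec: "I0 *v x = vtop x"
  by (simp add: I0_def hcat_def matrix_vector_mult_def sum_UNIV_Plus vtop_def vec_eq_iff mat_def
      if_distrib[of "\<lambda>x. x * _"] cong: if_cong)

lemma OI_mult_vec: "OI *v x = vbot x"
  by (simp add: OI_def hcat_def matrix_vector_mult_def sum_UNIV_Plus vbot_def vec_eq_iff mat_def
      if_distrib[of "\<lambda>x. x * _"] cong: if_cong)

lemma hcat_mult_vec: "hcat A B *v x = A *v vtop x + B *v vbot x"
  by (simp add: hcat_def matrix_vector_mult_def sum_UNIV_Plus vtop_def vbot_def vec_eq_iff)

lemma vtop_vcat: "vtop (vcat A B *v x) = A *v x" and vbot_vcat: "vbot (vcat A B *v x) = B *v x"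
  by (simp_all add: vtop_def vbot_def vcat_def matrix_vector_mult_def vec_eq_iff)

lemma vtop_jmat: "vtop (jmat *v x) = vtop x" and vbot_jmat: "vbot (jmat *v x) = - vbot x"
  by (simp_all add: jmat_def vtop_vcat vbot_vcat hcat_mult_vec matrix_vector_mult_minus_left)

lemma vtop_Vmat: "vtop (Vmat w *v x) = w *v vbot x" and vbot_Vmat: "vbot (Vmat w *v x) = adj w *v vtop x"
  by (simp_all add: Vmat_def vtop_vcat vbot_vcat hcat_mult_vec)

lemma left_block_mult: "left_block A *v x = A *v vjoin x 0"
  and right_block_mult: "right_block A *v y = A *v vjoin 0 y"
  by (simp_all add: left_block_def right_block_def vjoin_def matrix_vector_mult_def vec_eq_iff sum_UNIV_Plus)

lemma adj_jmat: "adj jmat = jmat"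
  by (auto simp: adj_def jmat_def vcat_def hcat_def vec_eq_iff mat_def split: sum.split)

lemma adj_Vmat: "adj (Vmat w) = Vmat w"
  by (auto simp: adj_def Vmat_def vcat_def hcat_def vec_eq_iff split: sum.split)

lemma vtop_minus: "vtop (- x) = - vtop x" and vbot_minus: "vbot (- x) = - vbot x"
  by (simp_all add: vtop_def vbot_def vec_eq_iff)

lemma matrix_vector_mult_minus_right: "A *v (- x) = - (A *v (x::complex^'q::finite))"
  by (simp add: matrix_vector_mult_def vec_eq_iff sum_negf)

text \<open>This anticommutation turns the adjoint of the coefficient matrix at \<open>cnj z\<close>
  into minus the coefficient matrix at \<open>z\<close>, see \<open>adj_dirac\<close>.\<close>

lemma Vmat_jmat: "Vmat w ** jmat = - (jmat ** Vmat w)"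
  by (rule matrix_vector_mult_eqI, rule block_vec_eqI)
     (simp_all add: matrix_vector_mul_assoc[symmetric] matrix_vector_mult_minus_left vtop_jmat vbot_jmat
        vtop_Vmat vbot_Vmat vtop_minus vbot_minus matrix_vector_mult_minus_right)

section \<open>Gronwall's inequality and uniqueness for Laplace transforms\<close>

lemma integrable_lebesgue_on_subset:
  fixes f :: "real \<Rightarrow> 'a::euclidean_space"
  assumes "integrable (lebesgue_on S) f" "T \<subseteq> S" "S \<in> sets lebesgue" "T \<in> sets lebesgue"
  shows "integrable (lebesgue_on T) f"
proof -
  have "set_integrable lebesgue S f"
    using assms by (simp add: integrable_restrict_space set_integrable_def)
  then have "set_integrable lebesgue T f"
    using assms set_integrable_subset by blast
  then show ?thesis
    using assms by (simp add: integrable_restrict_space set_integrable_def)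
qed

lemma AE_space_lebesgue_on: "AE x in lebesgue_on S. x \<in> S"
  by (rule AE_I2) auto

lemma lebesgue_integral_Icc_extend:
  fixes f :: "real \<Rightarrow> 'a::euclidean_space"
  assumes "a \<le> b" "b \<le> c"
  shows "(LINT t|lebesgue_on {a..b}. f t) = (LINT t|lebesgue_on {a..c}. (if t \<le> b then f t else 0))"
proof -
  have "(LINT t|lebesgue_on {a..b}. f t) = (LINT t|lebesgue. indicat_real {a..b} t *\<^sub>R f t)"
    by (subst integral_restrict_space) auto
  also have "\<dots> = (LINT t|lebesgue. indicat_real {a..c} t *\<^sub>R (if t \<le> b then f t else 0))"
    by (rule Bochner_Integration.integral_cong) (use assms in \<open>auto simp: indicator_def\<close>)
  also have "\<dots> = (LINT t|lebesgue_on {a..c}. (if t \<le> b then f t else 0))"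
    by (subst integral_restrict_space) auto
  finally show ?thesis .
qed

lemma continuous_on_indefinite_lebesgue_integral:
  fixes f :: "real \<Rightarrow> 'a::euclidean_space"
  assumes "integrable (leb r) f"
  shows "continuous_on {0..r} (\<lambda>x. LINT t|leb x. f t)"
proof -
  have "f integrable_on {0..r}"
    using integrable_on_lebesgue_on[OF assms] by simp
  from indefinite_integral_continuous_1[OF this]
  have "continuous_on {0..r} (\<lambda>x. integral {0..x} f)" .
  then show ?thesis
  proof (rule continuous_on_eq)
    fix x assume "x \<in> {0..r}"
    then have "integrable (leb x) f"
      by (intro integrable_lebesgue_on_subset[OF assms]) auto
    then show "integral {0..x} f = (LINT t|leb x. f t)"
      by (simp add: lebesgue_integral_eq_integral)
  qed
qed

text \<open>\<open>q\<close> is only integrable and the inequality holds almost everywhere, so the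
  classical argument is run on the primitive \<open>H\<close> of the continuous majorant
  \<open>\<psi>\<close>.\<close>

lemma gronwall_AE:
  fixes q :: "real \<Rightarrow> real"
  assumes q: "integrable (leb r) q"
    and le: "AE x in leb r. q x \<le> a + C * (LINT t|leb x. q t)"
    and "0 < C"
  shows "AE x in leb r. q x \<le> a * exp (C * x)"
proof -
  define J where "J x = (LINT t|leb x. q t)" for x
  define \<psi> where "\<psi> x = a + C * J x" for x
  define H where "H x = integral {0..x} \<psi>" for x
  have cJ: "continuous_on {0..r} J"
    unfolding J_def by (rule continuous_on_indefinite_lebesgue_integral[OF q])
  then have c\<psi>: "continuous_on {0..r} \<psi>"
    unfolding \<psi>_def by (intro continuous_intros)
  have dH: "(H has_real_derivative \<psi> x) (at x within {0..r})" if "x \<in> {0..r}" for x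
    using integral_has_vector_derivative[OF c\<psi> that]
    by (simp add: has_real_derivative_iff_has_vector_derivative H_def[abs_def])
  have JH: "J x \<le> H x" if x: "x \<in> {0..r}" for x
  proof -
    have sub: "{0..x} \<subseteq> {0..r}" using x by auto
    have i\<psi>: "integrable (leb x) \<psi>"
      by (rule continuous_imp_integrable_real) (use continuous_on_subset[OF c\<psi> sub] in auto)
    have "J x \<le> (LINT t|leb x. \<psi> t)"
      unfolding J_def
    proof (rule integral_mono_AE)
      show "integrable (leb x) q"
        by (rule integrable_lebesgue_on_subset[OF q sub]) auto
      have "AE t in leb r. q t \<le> \<psi> t"
        using le by (simp add: \<psi>_def J_def)
      then show "AE t in leb x. q t \<le> \<psi> t"
        by (rule AE_lebesgue_on_subset[OF _ sub]) auto
    qed fact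
    also have "\<dots> = H x"
      unfolding H_def by (rule lebesgue_integral_eq_integral[OF i\<psi>]) auto
    finally show ?thesis .
  qed
  \<comment> \<open>The derivative is \<open>C * (J x - H x) * exp (- C * x)\<close>, which is
    nonpositive because integrating \<open>q \<le> \<psi>\<close> gives
    \<open>J x \<le> H x\<close>.\<close>
  define G where "G x = (H x + a / C) * exp (- C * x)" for x
  have dG: "(G has_real_derivative (\<psi> x - C * H x - a) * exp (- C * x)) (at x within {0..r})" if "x \<in> {0..r}" for x
    unfolding G_def using \<open>0 < C\<close>
    by (auto intro!: derivative_eq_intros dH[OF that] simp: field_simps)
  have bound: "q x \<le> a * exp (C * x)" if x: "x \<in> {0..r}" and qx: "q x \<le> a + C * J x" for x
  proof -
    have "G x \<le> G 0"
    proof (rule DERIV_nonpos_imp_decreasing_open[of 0 x G])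
      fix y assume y: "0 < y" "y < x"
      have "(G has_real_derivative (\<psi> y - C * H y - a) * exp (- C * y)) (at y)"
        using dG[of y] x y at_within_Icc_at[of 0 y r] by auto
      moreover have "(\<psi> y - C * H y - a) * exp (- C * y) \<le> 0"
        using JH[of y] x y \<open>0 < C\<close> by (intro mult_nonpos_nonneg) (auto simp: \<psi>_def)
      ultimately show "\<exists>y'. (G has_real_derivative y') (at y) \<and> y' \<le> 0" by blast
    next
      show "continuous_on {0..x} G"
        by (intro DERIV_continuous_on[of _ G "\<lambda>x. (\<psi> x - C * H x - a) * exp (- C * x)"])
          (rule DERIV_subset[OF dG]; use x in auto)
    qed (use x in auto)
    then have "(H x + a / C) * exp (- C * x) \<le> a / C" by (simp add: G_def H_def)
    then have "(H x + a / C) * exp (- C * x) * exp (C * x) \<le> a / C * exp (C * x)"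
      by (intro mult_right_mono) auto
    then have "H x + a / C \<le> a / C * exp (C * x)"
      by (simp add: mult.assoc flip: exp_add)
    then have "C * (H x + a / C) \<le> C * (a / C * exp (C * x))"
      using \<open>0 < C\<close> by (intro mult_left_mono) auto
    then have "C * H x + a \<le> a * exp (C * x)"
      using \<open>0 < C\<close> by (simp add: distrib_left)
    then show ?thesis
      using qx JH[OF x] mult_left_mono[OF JH[OF x], of C] \<open>0 < C\<close> by linarith
  qed
  show ?thesis
    using le AE_space_lebesgue_on by eventually_elim (use bound J_def in auto)
qed

text \<open>The sets over which the integral vanishes form a Dynkin system containing all
  half-lines, hence all Borel sets, in particular the sets where the function is positive and where
  it is negative.\<close>

lemma AE_zero_if_indefinite_integral_zero_real:
  fixes f :: "real \<Rightarrow> real"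
  assumes f: "integrable (leb r) f"
    and zero: "\<And>x. x \<in> {0..r} \<Longrightarrow> (LINT t|leb x. f t) = 0"
  shows "AE x in leb r. f x = 0"
proof (cases "0 \<le> r")
  case True
  define g where "g x = indicat_real {0..r} x *\<^sub>R f x" for x
  have ig: "integrable lebesgue g"
    using f by (simp add: g_def[abs_def] integrable_restrict_space)
  \<comment> \<open>Half-lines generate only the Borel sets, so the function is first replaced by a
    Borel one.\<close>
  then obtain h where h: "h \<in> borel_measurable lborel" "AE x in lborel. g x = h x"
    using completion_ex_borel_measurable_real[of g lborel] by auto
  have AEg: "AE x in lebesgue. g x = h x" using h(2) by (rule AE_completion)
  have hm: "h \<in> borel_measurable lebesgue" using h(1) by (rule measurable_completion)
  have gm: "g \<in> borel_measurable lebesgue" using ig by auto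
  have hb[measurable]: "h \<in> borel_measurable borel" using h(1) by simp
  have ih: "integrable lborel h"
  proof -
    have "integrable lebesgue h"
      using ig AEg hm gm by (subst integrable_cong_AE[symmetric, of g]) auto
    then show ?thesis using h(1) by (simp add: integrable_completion)
  qed
  have base: "(LINT x:{..a}|lborel. h x) = 0" for a
  proof -
    have "(LINT x:{..a}|lborel. h x) = (LINT x|lebesgue. indicat_real {..a} x *\<^sub>R h x)"
      unfolding set_lebesgue_integral_def using h(1) by (subst integral_completion) auto
    also have "\<dots> = (LINT x|lebesgue. indicat_real {..a} x *\<^sub>R g x)"
      using AEg by (intro integral_cong_AE borel_measurable_scaleR borel_measurable_indicator hm gm) auto
    also have "\<dots> = 0"
    proof (cases "a < 0")
      case True
      then have "(\<lambda>x. indicat_real {..a} x *\<^sub>R g x) = (\<lambda>x. 0)"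
        by (auto simp: g_def indicator_def fun_eq_iff)
      then show ?thesis by simp
    next
      case False
      define b where "b = min a r"
      have b: "b \<in> {0..r}" using False True by (auto simp: b_def)
      have "(LINT x|lebesgue. indicat_real {..a} x *\<^sub>R g x) = (LINT x|lebesgue. indicat_real {0..b} x *\<^sub>R f x)"
        by (rule Bochner_Integration.integral_cong) (auto simp: g_def b_def indicator_def)
      also have "\<dots> = (LINT t|leb b. f t)"
        by (subst integral_restrict_space) auto
      finally show ?thesis using zero[OF b] by simp
    qed
    finally show ?thesis .
  qed
  have univ: "(LINT x|lborel. h x) = 0"
  proof -
    have "(LINT x|lborel. h x) = (LINT x|lebesgue. h x)" using h(1) by (simp add: integral_completion)
    also have "\<dots> = (LINT x|lebesgue. g x)" using AEg hm gm by (intro integral_cong_AE) auto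
    also have "\<dots> = (LINT t|leb r. f t)"
      unfolding g_def by (subst integral_restrict_space) auto
    finally show ?thesis using zero[of r] True by simp
  qed
  have all: "(LINT x:A|lborel. h x) = 0" if "A \<in> sets borel" for A
  proof -
    have A: "A \<in> sigma_sets UNIV (range (\<lambda>a::real. {..a}))"
      using that by (simp add: borel_eq_atMost)
    have int: "set_integrable lborel B h" if "B \<in> sets borel" for B
      unfolding set_integrable_def using ih that by (intro integrable_mult_indicator) auto
    have sb: "B \<in> sets borel" if "B \<in> sigma_sets UNIV (range (\<lambda>a::real. {..a}))" for B
      using that by (simp add: borel_eq_atMost)
    have sub: "range (\<lambda>a::real. {..a}) \<subseteq> Pow UNIV" by simp
    have stable: "Int_stable (range (\<lambda>a::real. {..a}))"
      by (auto simp: Int_stable_def)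
    show ?thesis
    proof (induction rule: sigma_sets_induct_disjoint[OF stable sub A, case_names basic empty compl union])
      case (basic B)
      then show ?case by (auto simp: base)
    next
      case (compl B)
      have "(LINT x:UNIV|lborel. h x) = (LINT x:B \<union> (UNIV - B)|lborel. h x)" by (simp add: Un_absorb1)
      also have "\<dots> = (LINT x:B|lborel. h x) + (LINT x:UNIV - B|lborel. h x)"
        using sb[OF compl(1)] by (intro set_integral_Un int) auto
      finally show ?case using compl univ by (simp add: set_lebesgue_integral_def)
    next
      case (union B)
      have B: "B i \<in> sets borel" for i using union(2) sb by blast
      have "(LINT x:(\<Union>i. B i)|lborel. h x) = (\<Sum>i. (LINT x:(B i)|lborel. h x))"
        using union(1) B by (intro lebesgue_integral_countable_add int sets.countable_UN) (auto simp: disjoint_family_on_def)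
      then show ?case using union by simp
    qed (auto simp: set_lebesgue_integral_def)
  qed
  have "AE x in lborel. indicat_real {x. h x > 0} x *\<^sub>R h x = 0"
  proof (subst integral_nonneg_eq_0_iff_AE[symmetric])
    show "integrable lborel (\<lambda>x. indicat_real {x. 0 < h x} x *\<^sub>R h x)"
      by (intro integrable_mult_indicator ih) measurable
    show "(LINT x|lborel. indicat_real {x. 0 < h x} x *\<^sub>R h x) = 0"
      using all[of "{x. h x > 0}"] h(1) by (simp add: set_lebesgue_integral_def)
  qed (auto simp: indicator_def)
  moreover have "AE x in lborel. indicat_real {x. h x < 0} x *\<^sub>R (- h x) = 0"
  proof (subst integral_nonneg_eq_0_iff_AE[symmetric])
    show "integrable lborel (\<lambda>x. indicat_real {x. h x < 0} x *\<^sub>R - h x)"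
      using ih by (intro integrable_mult_indicator integrable_minus) measurable
    show "(LINT x|lborel. indicat_real {x. h x < 0} x *\<^sub>R - h x) = 0"
      using all[of "{x. h x < 0}"] h(1) by (simp add: set_lebesgue_integral_def)
  qed (auto simp: indicator_def)
  ultimately have "AE x in lborel. h x = 0"
  proof eventually_elim
    case (elim x)
    then show ?case by (cases "h x > 0"; cases "h x < 0") auto
  qed
  then have "AE x in lebesgue. h x = 0" by (rule AE_completion)
  with AEg have "AE x in lebesgue. g x = 0" by eventually_elim simp
  then have "AE x in lebesgue. x \<in> {0..r} \<longrightarrow> f x = 0"
    by eventually_elim (auto simp: g_def indicator_def)
  then show ?thesis by (subst AE_restrict_space_iff) auto
next
  case False
  then have "{0..r} = {}" by auto
  then show ?thesis by (simp add: AE_lebesgue_on_iff_negligible)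
qed

lemma AE_zero_if_indefinite_integral_zero:
  fixes f :: "real \<Rightarrow> 'a::euclidean_space"
  assumes f: "integrable (leb r) f"
    and zero: "\<And>x. x \<in> {0..r} \<Longrightarrow> (LINT t|leb x. f t) = 0"
  shows "AE x in leb r. f x = 0"
proof -
  have "AE x in leb r. f x \<bullet> b = 0" for b
  proof (rule AE_zero_if_indefinite_integral_zero_real)
    show "integrable (leb r) (\<lambda>x. f x \<bullet> b)" using f by auto
    fix x assume x: "x \<in> {0..r}"
    have "integrable (leb x) f"
      using x by (intro integrable_lebesgue_on_subset[OF f]) auto
    then show "(LINT t|leb x. f t \<bullet> b) = 0"
      using zero[OF x] by simp
  qed
  then have "AE x in leb r. \<forall>b\<in>Basis. f x \<bullet> b = 0"
    by (simp add: AE_finite_all)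
  then show ?thesis
    by eventually_elim (use euclidean_all_zero_iff in blast)
qed

section \<open>Moments and Laplace transforms on a bounded interval\<close>

lemma integrable_continuous_on_mult:
  fixes h \<delta> :: "real \<Rightarrow> complex"
  assumes h: "continuous_on {a..b} h" and \<delta>: "integrable (lebesgue_on {a..b}) \<delta>"
  shows "integrable (lebesgue_on {a..b}) (\<lambda>t. h t * \<delta> t)"
proof -
  have [measurable]: "\<delta> \<in> borel_measurable (lebesgue_on {a..b})" using \<delta> by auto
  have [measurable]: "h \<in> borel_measurable (lebesgue_on {a..b})"
    using h by (rule continuous_imp_measurable_on_sets_lebesgue) auto
  have "bounded (h ` {a..b})"
    using h by (meson compact_Icc compact_continuous_image compact_imp_bounded)
  then obtain B where "\<forall>y\<in>h ` {a..b}. norm y \<le> B" unfolding bounded_iff by blast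
  then have B: "norm (h t) \<le> B" if "t \<in> {a..b}" for t using that by auto
  show ?thesis
  proof (rule Bochner_Integration.integrable_bound)
    show "integrable (lebesgue_on {a..b}) (\<lambda>t. B * norm (\<delta> t))" using \<delta> by auto
    show "AE t in lebesgue_on {a..b}. norm (h t * \<delta> t) \<le> norm (B * norm (\<delta> t))"
      using AE_space_lebesgue_on[of "{a..b}"]
    proof eventually_elim
      case (elim t)
      have "norm (h t) * cmod (\<delta> t) \<le> \<bar>B\<bar> * cmod (\<delta> t)"
        using B[OF elim] by (intro mult_right_mono) auto
      then show ?case by (simp add: norm_mult abs_mult)
    qed
  qed measurable
qed

text \<open>By Weierstrass the moments control the integrals against all continuous functions, and
  steep ramps approximate the indicator of [0,x]. Powers of \<open>r - t\<close> are the ones that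
  occur when the Laplace transform is normalised at the right end.\<close>

lemma AE_zero_if_moments_zero:
  fixes \<delta> :: "real \<Rightarrow> complex"
  assumes \<delta>: "integrable (leb r) \<delta>"
    and mom: "\<And>n. (LINT t|leb r. of_real ((r - t) ^ n) * \<delta> t) = 0"
  shows "AE t in leb r. \<delta> t = 0"
proof (rule AE_zero_if_indefinite_integral_zero[OF \<delta>])
  fix x assume x: "x \<in> {0..r}"
  have [measurable]: "\<delta> \<in> borel_measurable (leb r)" using \<delta> by auto
  have int: "integrable (leb r) (\<lambda>t. of_real (h t) * \<delta> t)" if "continuous_on UNIV h" for h :: "real \<Rightarrow> real"
    using that by (intro integrable_continuous_on_mult[OF _ \<delta>] continuous_intros) (auto intro: continuous_on_subset)
  have poly: "(LINT t|leb r. of_real (p (r - t)) * \<delta> t) = 0" if "real_polynomial_function p" for p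
  proof -
    from that[unfolded real_polynomial_function_iff_sum]
    obtain a n where p: "p = (\<lambda>x. \<Sum>i\<le>n. a i * x ^ i)" by (elim exE)
    have "(LINT t|leb r. of_real (p (r - t)) * \<delta> t) =
        (LINT t|leb r. (\<Sum>i\<le>n. of_real (a i) * (of_real ((r - t) ^ i) * \<delta> t)))"
      by (simp add: p sum_distrib_right mult.assoc)
    also have "\<dots> = (\<Sum>i\<le>n. (LINT t|leb r. of_real (a i) * (of_real ((r - t) ^ i) * \<delta> t)))"
      by (intro Bochner_Integration.integral_sum integrable_mult_right int continuous_intros)
    also have "\<dots> = 0" by (simp only: integral_mult_right_zero mom) simp
    finally show ?thesis .
  qed
  have cont: "(LINT t|leb r. of_real (h t) * \<delta> t) = 0" if h: "continuous_on UNIV h" for h :: "real \<Rightarrow> real"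
  proof -
    define D where "D = (LINT t|leb r. norm (\<delta> t))"
    have D0: "D \<ge> 0" by (simp add: D_def)
    have "norm (LINT t|leb r. of_real (h t) * \<delta> t) \<le> e" if "e > 0" for e
    proof -
      define e' where "e' = e / (D + 1)"
      have "e' > 0" using that D0 by (simp add: e'_def)
      have "continuous_on {0..r} (\<lambda>s. h (r - s))"
        by (intro continuous_on_compose2[OF h] continuous_intros) auto
      then obtain p where p: "real_polynomial_function p" "\<And>s. s \<in> {0..r} \<Longrightarrow> \<bar>h (r - s) - p s\<bar> < e'"
        using Stone_Weierstrass_real_polynomial_function[of "{0..r}" "\<lambda>s. h (r - s)" e'] \<open>e' > 0\<close> by auto
      have "continuous_on UNIV p"
        using continuous_real_polymonial_function[OF p(1)] by (simp add: continuous_on_eq_continuous_at)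
      then have cp: "continuous_on UNIV (\<lambda>t. p (r - t))"
        by (rule continuous_on_compose2) (intro continuous_intros, simp)
      have "(LINT t|leb r. of_real (h t) * \<delta> t) =
          (LINT t|leb r. of_real (h t) * \<delta> t) - (LINT t|leb r. of_real (p (r - t)) * \<delta> t)"
        using poly[OF p(1)] by simp
      also have "\<dots> = (LINT t|leb r. of_real (h t) * \<delta> t - of_real (p (r - t)) * \<delta> t)"
        by (rule Bochner_Integration.integral_diff[symmetric]) (intro int h cp)+
      also have "norm \<dots> \<le> (LINT t|leb r. e' * norm (\<delta> t))"
      proof (rule Bochner_Integration.integral_norm_bound_integral)
        show "integrable (leb r) (\<lambda>t. of_real (h t) * \<delta> t - of_real (p (r - t)) * \<delta> t)"
          by (intro Bochner_Integration.integrable_diff int h cp)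
        show "integrable (leb r) (\<lambda>t. e' * norm (\<delta> t))" using \<delta> by auto
        fix t assume "t \<in> space (leb r)"
        then have t: "r - t \<in> {0..r}" by auto
        have "norm (of_real (h t) * \<delta> t - of_real (p (r - t)) * \<delta> t) = \<bar>h t - p (r - t)\<bar> * norm (\<delta> t)"
          by (metis left_diff_distrib norm_mult norm_of_real of_real_diff)
        also have "\<dots> \<le> e' * norm (\<delta> t)"
          using p(2)[OF t] by (intro mult_right_mono) auto
        finally show "norm (of_real (h t) * \<delta> t - of_real (p (r - t)) * \<delta> t) \<le> e' * norm (\<delta> t)" .
      qed
      also have "\<dots> = e' * D" by (simp add: D_def)
      also have "\<dots> \<le> e" using that D0 by (simp add: e'_def field_simps)
      finally show ?thesis .
    qed
    then have "norm (LINT t|leb r. of_real (h t) * \<delta> t) \<le> 0"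
      by (rule field_le_epsilon[of _ 0, simplified])
    then show ?thesis by simp
  qed
  define h where "h n t = max 0 (min 1 (1 - real n * (t - x)))" for n :: nat and t :: real
  have ch: "continuous_on UNIV (h n)" for n unfolding h_def by (intro continuous_intros)
  have "(\<lambda>n. LINT t|leb r. of_real (h n t) * \<delta> t) \<longlonglongrightarrow>
     (LINT t|leb r. (if t \<le> x then \<delta> t else 0))"
  proof (rule integral_dominated_convergence[where w = "\<lambda>t. norm (\<delta> t)"])
    show "(\<lambda>t. if t \<le> x then \<delta> t else 0) \<in> borel_measurable (leb r)"
    proof -
      have "indicat_real {..x} \<in> borel_measurable lebesgue" by (intro borel_measurable_indicator) auto
      then have "indicat_real {..x} \<in> borel_measurable (leb r)" by (rule measurable_restrict_space1)
      then have meas: "(\<lambda>t. indicat_real {..x} t *\<^sub>R \<delta> t) \<in> borel_measurable (leb r)"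
        by (rule borel_measurable_scaleR) fact
      have eq: "(if t \<le> x then \<delta> t else 0) = indicat_real {..x} t *\<^sub>R \<delta> t" for t
        by (simp add: indicator_def)
      show ?thesis unfolding eq by (rule meas)
    qed
    show "integrable (leb r) (\<lambda>t. norm (\<delta> t))" using \<delta> by auto
    show "(\<lambda>t. of_real (h n t) * \<delta> t) \<in> borel_measurable (leb r)" for n
      using int[OF ch] by auto
    show "AE t in leb r. norm (of_real (h n t) * \<delta> t) \<le> norm (\<delta> t)" for n
    proof (rule AE_I2)
      fix t
      have "\<bar>h n t\<bar> \<le> 1" by (auto simp: h_def)
      then have "\<bar>h n t\<bar> * norm (\<delta> t) \<le> 1 * norm (\<delta> t)" by (intro mult_right_mono) auto
      then show "norm (of_real (h n t) * \<delta> t) \<le> norm (\<delta> t)" by (simp add: norm_mult)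
    qed
    show "AE t in leb r. (\<lambda>n. of_real (h n t) * \<delta> t) \<longlonglongrightarrow> (if t \<le> x then \<delta> t else 0)"
    proof (rule AE_I2)
      fix t
      have "(\<lambda>n. h n t) \<longlonglongrightarrow> (if t \<le> x then 1 else 0)"
      proof (cases "t \<le> x")
        case True
        then have "h n t = 1" for n
          using mult_nonneg_nonneg[of "real n" "x - t"] by (simp add: h_def algebra_simps)
        with True show ?thesis by simp
      next
        case False
        obtain N where N: "real N > 1 / (t - x)" using reals_Archimedean2 by blast
        have "\<forall>\<^sub>F n in sequentially. h n t = 0"
        proof (rule eventually_sequentiallyI[of N])
          fix n assume "N \<le> n"
          then have "real n > 1 / (t - x)" using N by linarith
          then have "real n * (t - x) > 1" using False by (simp add: field_simps)
          then show "h n t = 0" by (simp add: h_def)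
        qed
        then show ?thesis using False by (simp add: tendsto_eventually)
      qed
      then have "(\<lambda>n. of_real (h n t) * \<delta> t) \<longlonglongrightarrow> of_real (if t \<le> x then 1 else 0) * \<delta> t"
        by (intro tendsto_intros)
      then show "(\<lambda>n. of_real (h n t) * \<delta> t) \<longlonglongrightarrow> (if t \<le> x then \<delta> t else 0)"
        by (auto split: if_splits)
    qed
  qed
  then have "(LINT t|leb r. (if t \<le> x then \<delta> t else 0)) = 0"
    using cont[OF ch] by (simp add: LIMSEQ_const_iff)
  then show "(LINT t|leb x. \<delta> t) = 0"
    using lebesgue_integral_Icc_extend[of 0 x r \<delta>] x by simp
qed

text \<open>Termwise integration of the exponential series, dominated through the bound
  \<open>R\<close> of the exponent on [0,r]. The series is in \<open>r - t\<close> because the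
  factor exp (- 2 i z r) has been absorbed into the integrand.\<close>

lemma Laplace_sums:
  fixes \<delta> :: "real \<Rightarrow> complex"
  assumes \<delta>: "integrable (leb r) \<delta>"
  defines "a \<equiv> \<lambda>n. (- 2 * \<i>) ^ n / fact n * (LINT t|leb r. of_real ((r - t) ^ n) * \<delta> t)"
  shows "(\<lambda>n. a n * z ^ n) sums (LINT t|leb r. exp (- 2 * \<i> * z * of_real (r - t)) * \<delta> t)"
proof -
  have [measurable]: "\<delta> \<in> borel_measurable (leb r)" using \<delta> by auto
  define w where "w t = - 2 * \<i> * z * of_real (r - t)" for t
  have cw: "continuous_on {0..r} (\<lambda>t. w t ^ n / fact n)" for n
    unfolding w_def by (intro continuous_intros) auto
  have wm[measurable]: "(\<lambda>t. w t ^ n / fact n) \<in> borel_measurable (leb r)" for n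
    using cw by (rule continuous_imp_measurable_on_sets_lebesgue) auto
  define R where "R = 2 * norm z * \<bar>r\<bar>"
  have wR: "norm (w t) \<le> R" if "t \<in> {0..r}" for t
    using that by (auto simp: w_def R_def norm_mult simp flip: of_real_diff intro!: mult_left_mono)
  have bd: "norm (w t ^ n / fact n * \<delta> t) \<le> R ^ n / fact n * norm (\<delta> t)" if "t \<in> {0..r}" for t n
    using power_mono[OF wR[OF that], of n]
    by (auto simp: norm_mult norm_divide norm_power intro!: mult_right_mono divide_right_mono)
  have int: "integrable (leb r) (\<lambda>t. w t ^ n / fact n * \<delta> t)" for n
  proof (rule Bochner_Integration.integrable_bound)
    show "integrable (leb r) (\<lambda>t. R ^ n / fact n * norm (\<delta> t))" using \<delta> by auto
    show "AE t in leb r. norm (w t ^ n / fact n * \<delta> t) \<le> norm (R ^ n / fact n * norm (\<delta> t))"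
      using AE_space_lebesgue_on[of "{0..r}"]
    proof eventually_elim
      case (elim t)
      show ?case using bd[OF elim, of n] by (rule order_trans) (simp only: real_norm_def abs_ge_self)
    qed
  qed measurable
  have "(\<lambda>n. LINT t|leb r. w t ^ n / fact n * \<delta> t) sums
      (LINT t|leb r. (\<Sum>n. w t ^ n / fact n * \<delta> t))"
  proof (rule sums_integral[OF int])
    show "AE t in leb r. summable (\<lambda>n. norm (w t ^ n / fact n * \<delta> t))"
    proof (rule AE_I2)
      fix t
      have "summable (\<lambda>n. norm (w t) ^ n / fact n)"
        using summable_exp[of "norm (w t)"] by (simp add: divide_inverse mult.commute)
      then show "summable (\<lambda>n. norm (w t ^ n / fact n * \<delta> t))"
        unfolding norm_mult norm_divide norm_power norm_fact by (rule summable_mult2)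
    qed
    show "summable (\<lambda>n. LINT t|leb r. norm (w t ^ n / fact n * \<delta> t))"
    proof (rule summable_comparison_test'[of "\<lambda>n. R ^ n / fact n * (LINT t|leb r. norm (\<delta> t))" 0])
      show "summable (\<lambda>n. R ^ n / fact n * (LINT t|leb r. norm (\<delta> t)))"
        using summable_exp[of R] by (intro summable_mult2) (simp add: divide_inverse mult.commute)
      fix n
      have "(LINT t|leb r. norm (w t ^ n / fact n * \<delta> t)) \<le> (LINT t|leb r. R ^ n / fact n * norm (\<delta> t))"
        by (rule integral_mono) (use int[of n] \<delta> bd in auto)
      then show "norm (LINT t|leb r. norm (w t ^ n / fact n * \<delta> t)) \<le> R ^ n / fact n * (LINT t|leb r. norm (\<delta> t))"
        by simp
    qed
  qed
  moreover have "(\<Sum>n. w t ^ n / fact n * \<delta> t) = exp (w t) * \<delta> t" for t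
  proof -
    have "(\<lambda>n. w t ^ n / fact n * \<delta> t) sums (exp (w t) * \<delta> t)"
      using exp_converges[of "w t"] by (intro sums_mult2) (simp add: scaleR_conv_of_real divide_inverse mult.commute)
    then show ?thesis by (simp add: sums_iff)
  qed
  moreover have "(LINT t|leb r. w t ^ n / fact n * \<delta> t) = a n * z ^ n" for n
  proof -
    have "(LINT t|leb r. w t ^ n / fact n * \<delta> t) =
       (LINT t|leb r. ((- 2 * \<i>) ^ n / fact n * z ^ n) * (of_real ((r - t) ^ n) * \<delta> t))"
    proof (rule Bochner_Integration.integral_cong)
      fix t
      have "w t = (- 2 * \<i>) * (z * of_real (r - t))" by (simp add: w_def)
      then have "w t ^ n = (- 2 * \<i>) ^ n * (z ^ n * of_real ((r - t) ^ n))"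
        by (simp only: power_mult_distrib of_real_power)
      then show "w t ^ n / fact n * \<delta> t = ((- 2 * \<i>) ^ n / fact n * z ^ n) * (of_real ((r - t) ^ n) * \<delta> t)"
        by (simp only: divide_inverse mult_ac)
    qed simp
    also have "\<dots> = a n * z ^ n"
      by (subst integral_mult_right_zero) (simp add: a_def)
    finally show ?thesis .
  qed
  ultimately show ?thesis by (simp add: w_def)
qed

text \<open>Multiplied by \<open>exp (- 2 \<i> z r)\<close> the integral is an entire function that is bounded in both
  half-planes \<open>Im z > M\<close> and \<open>Im z \<le> M\<close>, hence constant, and its Taylor coefficients are moments of \<open>\<delta>\<close>.\<close>

lemma AE_zero_if_Laplace_bound:
  fixes \<delta> :: "real \<Rightarrow> complex"
  assumes \<delta>: "integrable (leb r) \<delta>" and "0 \<le> M"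
    and bd: "\<And>z. Im z > M \<Longrightarrow> norm (LINT t|leb r. exp (2 * \<i> * z * of_real t) * \<delta> t) \<le> C * exp (- 2 * r * Im z)"
  shows "AE t in leb r. \<delta> t = 0"

proof -
  define F where "F z = (LINT t|leb r. exp (- 2 * \<i> * z * of_real (r - t)) * \<delta> t)" for z
  have int: "integrable (leb r) (\<lambda>t. exp (- 2 * \<i> * z * of_real (r - t)) * \<delta> t)" for z
    by (intro integrable_continuous_on_mult[OF _ \<delta>] continuous_intros)
  define a where "a n = (- 2 * \<i>) ^ n / fact n * (LINT t|leb r. of_real ((r - t) ^ n) * \<delta> t)" for n
  have sums: "(\<lambda>n. a n * z ^ n) sums F z" for z
    unfolding a_def F_def by (rule Laplace_sums[OF \<delta>])
  have "F holomorphic_on ball 0 R" for R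
    using power_series_holomorphic[of 0 R a F] sums by simp
  then have "F field_differentiable at z" for z
    by (rule holomorphic_on_imp_differentiable_at[of _ "ball 0 (norm z + 1)"]) auto
  then have "F holomorphic_on UNIV" by (simp add: holomorphic_on_def)
  moreover have "bounded (range F)"
  proof -
    define D where "D = (LINT t|leb r. norm (\<delta> t))"
    have "norm (F z) \<le> max C (exp (2 * M * r) * D)" for z
    proof (cases "Im z > M")
      case True
      have "F z = (LINT t|leb r. exp (- 2 * \<i> * z * of_real r) * (exp (2 * \<i> * z * of_real t) * \<delta> t))"
        unfolding F_def
      proof (rule Bochner_Integration.integral_cong)
        fix t
        have "- 2 * \<i> * z * of_real (r - t) = - 2 * \<i> * z * of_real r + 2 * \<i> * z * of_real t"
          by (simp add: right_diff_distrib)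
        then show "exp (- 2 * \<i> * z * of_real (r - t)) * \<delta> t = exp (- 2 * \<i> * z * of_real r) * (exp (2 * \<i> * z * of_real t) * \<delta> t)"
          by (simp only: exp_add mult.assoc)
      qed simp
      also have "norm \<dots> = exp (2 * r * Im z) * norm (LINT t|leb r. exp (2 * \<i> * z * of_real t) * \<delta> t)"
        by (simp add: norm_mult)
      also have "\<dots> \<le> exp (2 * r * Im z) * (C * exp (- 2 * r * Im z))"
        by (intro mult_left_mono bd True) auto
      also have "\<dots> = C" by (simp add: exp_minus)
      finally show ?thesis by simp
    next
      case False
      have "norm (F z) \<le> (LINT t|leb r. exp (2 * M * r) * norm (\<delta> t))"
        unfolding F_def
      proof (rule Bochner_Integration.integral_norm_bound_integral[OF int])
        show "integrable (leb r) (\<lambda>t. exp (2 * M * r) * norm (\<delta> t))" using \<delta> by auto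
        fix t assume "t \<in> space (leb r)"
        then have t: "0 \<le> t" "t \<le> r" by auto
        have "Im z * (r - t) \<le> M * (r - t)" using False t by (intro mult_right_mono) auto
        also have "\<dots> \<le> M * r" using t \<open>0 \<le> M\<close> by (intro mult_left_mono) auto
        finally have "exp (2 * (Im z * (r - t))) \<le> exp (2 * M * r)" by simp
        moreover have "norm (exp (- 2 * \<i> * z * of_real (r - t))) = exp (2 * (Im z * (r - t)))"
          by (simp add: norm_exp_eq_Re)
        ultimately show "norm (exp (- 2 * \<i> * z * of_real (r - t)) * \<delta> t) \<le> exp (2 * M * r) * norm (\<delta> t)"
          unfolding norm_mult by (intro mult_right_mono) auto
      qed
      then show ?thesis by (simp add: D_def)
    qed
    then show ?thesis by (auto simp: bounded_iff)
  qed
  ultimately obtain k where k: "\<And>z. F z = k"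
    using Liouville_theorem[of F] by (auto simp: constant_on_def)
  \<comment> \<open>The constant is read off on the negative imaginary axis, where the exponential
    tends to 0 for every \<open>t < r\<close>.\<close>
  have "(\<lambda>n. F (- \<i> * of_nat n)) \<longlonglongrightarrow> (LINT t|leb r. 0)"
    unfolding F_def
  proof (rule integral_dominated_convergence[where w = "\<lambda>t. norm (\<delta> t)"])
    show "(\<lambda>t. exp (- 2 * \<i> * (- \<i> * of_nat n) * of_real (r - t)) * \<delta> t) \<in> borel_measurable (leb r)" for n
      by (rule borel_measurable_integrable[OF int])
    show "integrable (leb r) (\<lambda>t. norm (\<delta> t))" using \<delta> by auto
    have eq: "norm (exp (- 2 * \<i> * (- \<i> * of_nat n) * of_real (r - t))) = exp (- 2 * (r - t)) ^ n" for n t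
    proof -
      have "Re (- 2 * \<i> * (- \<i> * of_nat n) * of_real (r - t)) = real n * (- 2 * (r - t))" by (simp add: algebra_simps)
      then show ?thesis by (simp only: norm_exp_eq_Re exp_of_nat_mult)
    qed
    have "AE t in leb r. t \<noteq> r"
      by (subst AE_lebesgue_on_iff_negligible) (auto intro: negligible_subset[of "{r}"])
    then show "AE t in leb r. (\<lambda>n. exp (- 2 * \<i> * (- \<i> * of_nat n) * of_real (r - t)) * \<delta> t) \<longlonglongrightarrow> 0"
      using AE_space_lebesgue_on[of "{0..r}"]
    proof eventually_elim
      case (elim t)
      then have "exp (- 2 * (r - t)) < 1" by simp
      then have "(\<lambda>n. exp (- 2 * (r - t)) ^ n) \<longlonglongrightarrow> 0" by (intro LIMSEQ_power_zero) auto
      then have "(\<lambda>n. exp (- 2 * \<i> * (- \<i> * of_nat n) * of_real (r - t))) \<longlonglongrightarrow> 0"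
        by (subst tendsto_norm_zero_iff[symmetric]) (simp only: eq)
      then show ?case by (rule tendsto_mult_left_zero)
    qed
    show "AE t in leb r. norm (exp (- 2 * \<i> * (- \<i> * of_nat n) * of_real (r - t)) * \<delta> t) \<le> norm (\<delta> t)" for n
      using AE_space_lebesgue_on[of "{0..r}"]
    proof eventually_elim
      case (elim t)
      then have "exp (- 2 * (r - t)) ^ n \<le> 1" by (intro power_le_one) auto
      then have "exp (- 2 * (r - t)) ^ n * norm (\<delta> t) \<le> 1 * norm (\<delta> t)" by (intro mult_right_mono) auto
      then show ?case by (simp only: norm_mult eq mult_1)
    qed
  qed simp
  then have F0: "F z = 0" for z
    using k by (simp add: LIMSEQ_const_iff)
  \<comment> \<open>A nonzero coefficient of positive order would make 0 an isolated zero of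
    \<open>F\<close>; the coefficient of order 0 is \<open>F 0\<close>.\<close>
  have a0: "a n = 0" for n
  proof (cases "n = 0")
    case True
    then show ?thesis using sums_unique2[OF powser_sums_zero[of a] sums[of 0]] F0 by simp
  next
    case False
    show ?thesis
    proof (rule ccontr)
      assume "a n \<noteq> 0"
      moreover have "(\<lambda>n. a n * (x - 0) ^ n) sums F x" for x using sums[of x] by simp
      ultimately obtain s where s: "0 < s" "\<And>z. z \<in> cball 0 s - {0} \<Longrightarrow> F z \<noteq> 0"
        using powser_0_nonzero[of 1 0 a F n] F0 False by (metis neq0_conv zero_less_one)
      then have "F (of_real s) \<noteq> 0" by (intro s(2)) auto
      then show False using F0 by simp
    qed
  qed
  show ?thesis
  proof (rule AE_zero_if_moments_zero[OF \<delta>])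
    show "(LINT t|leb r. of_real ((r - t) ^ n) * \<delta> t) = 0" for n
      using a0[of n] by (simp add: a_def)
  qed
qed

section \<open>Adjoint operators and integral operators on an interval\<close>

lemma borel_measurable_bilinear:
  fixes h :: "'a::euclidean_space \<Rightarrow> 'b::euclidean_space \<Rightarrow> 'c::euclidean_space"
  assumes "bounded_bilinear h" "f \<in> borel_measurable M" "g \<in> borel_measurable M"
  shows "(\<lambda>x. h (f x) (g x)) \<in> borel_measurable M"
  using assms(2,3)
  by (rule borel_measurable_continuous_Pair)
     (intro bounded_bilinear.continuous_on[OF assms(1)] continuous_intros)

lemma borel_measurable_linear:
  fixes h :: "'a::euclidean_space \<Rightarrow> 'b::euclidean_space"
  assumes "bounded_linear h" "f \<in> borel_measurable M"
  shows "(\<lambda>x. h (f x)) \<in> borel_measurable M"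
  using assms borel_measurable_continuous_on[of h f M] by (simp add: linear_continuous_on)

lemmas borel_measurable_cip = borel_measurable_bilinear[OF bounded_bilinear_cip]
lemmas borel_measurable_mv = borel_measurable_bilinear[OF bounded_bilinear_matrix_vector_mult]
lemmas borel_measurable_mm = borel_measurable_bilinear[OF bounded_bilinear_matrix_matrix_mult]
lemmas borel_measurable_adj = borel_measurable_linear[OF bounded_linear_adj]

lemma finite_measure_lebesgue_on_Icc: "finite_measure (lebesgue_on {a..b::real})"
  by (rule finite_measureI) (simp add: emeasure_restrict_space emeasure_lborel_Icc_eq)

lemma L2_on_measurable: "L2_on S f \<Longrightarrow> f \<in> borel_measurable (lebesgue_on S)"
  and L2_on_square_integrable: "L2_on S f \<Longrightarrow> integrable (lebesgue_on S) (\<lambda>x. (norm (f x))\<^sup>2)"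
  by (simp_all add: L2_on_def)

lemma L2_onI_bound:
  fixes f :: "real \<Rightarrow> 'a::euclidean_space"
  assumes f: "f \<in> borel_measurable (lebesgue_on S)"
    and g: "integrable (lebesgue_on S) g" "AE x in lebesgue_on S. (norm (f x))\<^sup>2 \<le> g x"
  shows "L2_on S f"
  unfolding L2_on_def
proof
  show "integrable (lebesgue_on S) (\<lambda>x. (norm (f x))\<^sup>2)"
  proof (rule Bochner_Integration.integrable_bound[OF g(1)])
    show "AE x in lebesgue_on S. norm ((norm (f x))\<^sup>2) \<le> norm (g x)"
      using g(2) by eventually_elim simp
  qed (use f in measurable)
qed (fact f)

lemma L2_on_bounded:
  fixes f :: "real \<Rightarrow> 'a::euclidean_space"
  assumes f: "f \<in> borel_measurable (lebesgue_on {a..b})" "AE x in lebesgue_on {a..b}. norm (f x) \<le> B"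
  shows "L2_on {a..b} f"
proof (rule L2_onI_bound[OF f(1)])
  interpret finite_measure "lebesgue_on {a..b}" by (rule finite_measure_lebesgue_on_Icc)
  show "integrable (lebesgue_on {a..b}) (\<lambda>x. B\<^sup>2)" by simp
  show "AE x in lebesgue_on {a..b}. (norm (f x))\<^sup>2 \<le> B\<^sup>2"
    using f(2) by eventually_elim (simp add: power_mono)
qed

lemma L2_on_continuous:
  fixes f :: "real \<Rightarrow> 'a::euclidean_space"
  assumes "continuous_on {a..b} f"
  shows "L2_on {a..b} f"
proof -
  have "bounded (f ` {a..b})"
    using assms by (meson compact_Icc compact_continuous_image compact_imp_bounded)
  then obtain B where "\<forall>y\<in>f ` {a..b}. norm y \<le> B" unfolding bounded_iff by blast
  then show ?thesis
    by (intro L2_on_bounded[of _ _ _ B] continuous_imp_measurable_on_sets_lebesgue assms AE_I2) auto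
qed

lemma square_norm_add_le: "(norm (a + b))\<^sup>2 \<le> 2 * (norm a)\<^sup>2 + 2 * (norm (b::'a::real_normed_vector))\<^sup>2"
proof -
  have "(norm (a + b))\<^sup>2 \<le> (norm a + norm b)\<^sup>2" by (intro power_mono norm_triangle_ineq) simp
  also have "\<dots> \<le> 2 * (norm a)\<^sup>2 + 2 * (norm b)\<^sup>2"
    using sum_squares_bound[of "norm a" "norm b"] by (simp add: power2_sum)
  finally show ?thesis .
qed

lemma L2_on_add:
  assumes "L2_on S f" "L2_on S g"
  shows "L2_on S (\<lambda>x. f x + g x)"
proof (rule L2_onI_bound)
  show "integrable (lebesgue_on S) (\<lambda>x. 2 * (norm (f x))\<^sup>2 + 2 * (norm (g x))\<^sup>2)"
    using assms by (intro Bochner_Integration.integrable_add integrable_mult_right L2_on_square_integrable)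
  show "AE x in lebesgue_on S. (norm (f x + g x))\<^sup>2 \<le> 2 * (norm (f x))\<^sup>2 + 2 * (norm (g x))\<^sup>2"
    by (rule AE_I2) (rule square_norm_add_le)
  show "(\<lambda>x. f x + g x) \<in> borel_measurable (lebesgue_on S)"
    using assms by (intro borel_measurable_add L2_on_measurable)
qed

lemma L2_on_bounded_linear:
  assumes "bounded_linear h" "L2_on S f"
  shows "L2_on S (\<lambda>x. h (f x))"
proof -
  obtain K where K: "\<And>x. norm (h x) \<le> norm x * K" using bounded_linear.bounded[OF assms(1)] by blast
  show ?thesis
  proof (rule L2_onI_bound)
    show "integrable (lebesgue_on S) (\<lambda>x. K\<^sup>2 * (norm (f x))\<^sup>2)"
      using assms by (intro integrable_mult_right L2_on_square_integrable)
    show "AE x in lebesgue_on S. (norm (h (f x)))\<^sup>2 \<le> K\<^sup>2 * (norm (f x))\<^sup>2"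
    proof (rule AE_I2)
      fix x show "(norm (h (f x)))\<^sup>2 \<le> K\<^sup>2 * (norm (f x))\<^sup>2"
        using power_mono[OF K[of "f x"], of 2] by (simp add: power_mult_distrib mult.commute)
    qed
    show "(\<lambda>x. h (f x)) \<in> borel_measurable (lebesgue_on S)"
      by (intro borel_measurable_linear[OF assms(1)] L2_on_measurable assms)
  qed
qed

lemma L2_on_smult: fixes c :: complex shows "L2_on S f \<Longrightarrow> L2_on S (\<lambda>x. c *s f x)"
  by (rule L2_on_bounded_linear[OF bounded_bilinear.bounded_linear_right[OF bounded_bilinear_smult, of c]])

lemma L2_on_minus: "L2_on S f \<Longrightarrow> L2_on S (\<lambda>x. - f x)"
  by (rule L2_on_bounded_linear[OF bounded_linear_minus[OF bounded_linear_ident]])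

lemma L2_on_diff: "L2_on S f \<Longrightarrow> L2_on S g \<Longrightarrow> L2_on S (\<lambda>x. f x - g x)"
  using L2_on_add[OF _ L2_on_minus, of S f g] by simp

lemma L2_on_integrable:
  assumes "L2_on {a..b} f"
  shows "integrable (lebesgue_on {a..b}) f"
proof (rule Bochner_Integration.integrable_bound)
  interpret finite_measure "lebesgue_on {a..b}" by (rule finite_measure_lebesgue_on_Icc)
  show "integrable (lebesgue_on {a..b}) (\<lambda>x. 1 + (norm (f x))\<^sup>2)"
    by (intro Bochner_Integration.integrable_add L2_on_square_integrable[OF assms]) simp
  show "f \<in> borel_measurable (lebesgue_on {a..b})" by (rule L2_on_measurable[OF assms])
  show "AE x in lebesgue_on {a..b}. norm (f x) \<le> norm (1 + (norm (f x))\<^sup>2)"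
  proof (rule AE_I2)
    fix x
    have "norm (f x) \<le> 1 + (norm (f x))\<^sup>2"
    proof -
      have "0 \<le> (norm (f x) - 1)\<^sup>2" by simp
      then have "2 * norm (f x) \<le> 1 + (norm (f x))\<^sup>2" by (simp add: power2_diff)
      then show ?thesis using norm_ge_zero[of "f x"] by linarith
    qed
    then show "norm (f x) \<le> norm (1 + (norm (f x))\<^sup>2)" by simp
  qed
qed

lemma L2_on_subset:
  fixes f :: "real \<Rightarrow> 'a::euclidean_space"
  assumes "L2_on {a..b} f" "c \<ge> a" "d \<le> b"
  shows "L2_on {c..d} f"
proof -
  have sub: "{c..d} \<subseteq> {a..b}" using assms by auto
  show ?thesis
    unfolding L2_on_def
  proof
    show "f \<in> borel_measurable (lebesgue_on {c..d})"
      using integrable_lebesgue_on_subset[OF L2_on_integrable[OF assms(1)] sub] by auto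
    show "integrable (lebesgue_on {c..d}) (\<lambda>x. (norm (f x))\<^sup>2)"
      by (rule integrable_lebesgue_on_subset[OF L2_on_square_integrable[OF assms(1)] sub]) auto
  qed
qed

lemma L2_integrable_cip:
  assumes "L2_on S f" "L2_on S g"
  shows "integrable (lebesgue_on S) (\<lambda>x. cip (f x) (g x))"
proof (rule Bochner_Integration.integrable_bound)
  show "integrable (lebesgue_on S) (\<lambda>x. (norm (f x))\<^sup>2 + (norm (g x))\<^sup>2)"
    using assms by (intro Bochner_Integration.integrable_add L2_on_square_integrable)
  show "(\<lambda>x. cip (f x) (g x)) \<in> borel_measurable (lebesgue_on S)"
    using assms by (intro borel_measurable_cip L2_on_measurable)
  show "AE x in lebesgue_on S. norm (cip (f x) (g x)) \<le> norm ((norm (f x))\<^sup>2 + (norm (g x))\<^sup>2)"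
  proof (rule AE_I2)
    fix x
    have "norm (cip (f x) (g x)) \<le> norm (f x) * norm (g x)" by (rule norm_cip_le)
    also have "\<dots> \<le> (norm (f x))\<^sup>2 + (norm (g x))\<^sup>2"
    proof -
      have "2 * (norm (f x) * norm (g x)) \<le> (norm (f x))\<^sup>2 + (norm (g x))\<^sup>2"
        using sum_squares_bound[of "norm (f x)" "norm (g x)"] by (simp add: mult.assoc)
      moreover have "0 \<le> norm (f x) * norm (g x)" by simp
      ultimately show ?thesis by linarith
    qed
    finally show "norm (cip (f x) (g x)) \<le> norm ((norm (f x))\<^sup>2 + (norm (g x))\<^sup>2)" by simp
  qed
qed

section \<open>Inner product and adjoint pairs on L^2(0,r)\<close>

definition ipL :: "real \<Rightarrow> 'p::finite vfun \<Rightarrow> 'p vfun \<Rightarrow> complex" where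
  "ipL r f g = (LINT x|leb r. cip (f x) (g x))"

lemma ipL_cnj: "cnj (ipL r f g) = ipL r g f"
  unfolding ipL_def by (subst Bochner_Integration.integral_cnj[symmetric]) (simp add: cip_cnj)

lemma ipL_add_left: "L2_on {0..r} f \<Longrightarrow> L2_on {0..r} g \<Longrightarrow> L2_on {0..r} h \<Longrightarrow>
    ipL r (\<lambda>x. f x + g x) h = ipL r f h + ipL r g h"
  unfolding ipL_def cip_add_left by (intro Bochner_Integration.integral_add L2_integrable_cip)

lemma ipL_add_right: "L2_on {0..r} f \<Longrightarrow> L2_on {0..r} g \<Longrightarrow> L2_on {0..r} h \<Longrightarrow>
    ipL r h (\<lambda>x. f x + g x) = ipL r h f + ipL r h g"
  unfolding ipL_def cip_add_right by (intro Bochner_Integration.integral_add L2_integrable_cip)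

lemma ipL_diff_left: "L2_on {0..r} f \<Longrightarrow> L2_on {0..r} g \<Longrightarrow> L2_on {0..r} h \<Longrightarrow>
    ipL r (\<lambda>x. f x - g x) h = ipL r f h - ipL r g h"
  unfolding ipL_def cip_diff_left by (intro Bochner_Integration.integral_diff L2_integrable_cip)

lemma ipL_scale_left: "ipL r (\<lambda>x. c *s f x) h = cnj c * ipL r f h"
  and ipL_scale_right: "ipL r h (\<lambda>x. c *s f x) = c * ipL r h f"
  unfolding ipL_def cip_scale_left cip_scale_right by simp_all

lemma ipL_cong_left:
  assumes "L2_on {0..r} f" "L2_on {0..r} f'" "L2_on {0..r} g" "AE x in leb r. f x = f' x"
  shows "ipL r f g = ipL r f' g"
  unfolding ipL_def
  using assms by (intro integral_cong_AE borel_measurable_cip L2_on_measurable) auto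

lemma ipL_self_zero:
  assumes "L2_on {0..r} h" "ipL r h h = 0"
  shows "AE x in leb r. h x = 0"
proof -
  have "ipL r h h = of_real (LINT x|leb r. (norm (h x))\<^sup>2)"
    unfolding ipL_def cip_self by (simp del: of_real_power)
  then have "(LINT x|leb r. (norm (h x))\<^sup>2) = 0" using assms by simp
  then have "AE x in leb r. (norm (h x))\<^sup>2 = 0"
    using integral_nonneg_eq_0_iff_AE[OF L2_on_square_integrable[OF assms(1)]] by simp
  then show ?thesis by eventually_elim simp
qed

text \<open>\<open>T\<close> and \<open>T'\<close> are adjoint to each other on \<open>L\<^sup>2(0,r)\<close>; this alone forces both of them to be
  linear and to respect almost everywhere equality, up to null sets.\<close>

definition adjp :: "real \<Rightarrow> ('p::finite vfun \<Rightarrow> 'q::finite vfun) \<Rightarrow> ('q vfun \<Rightarrow> 'p vfun) \<Rightarrow> bool" where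
  "adjp r T T' \<longleftrightarrow> (\<forall>f. L2_on {0..r} f \<longrightarrow> L2_on {0..r} (T f)) \<and> (\<forall>g. L2_on {0..r} g \<longrightarrow> L2_on {0..r} (T' g)) \<and>
     (\<forall>f g. L2_on {0..r} f \<longrightarrow> L2_on {0..r} g \<longrightarrow> ipL r (T f) g = ipL r f (T' g))"

lemma adjpD:
  assumes "adjp r T T'"
  shows "L2_on {0..r} f \<Longrightarrow> L2_on {0..r} (T f)" "L2_on {0..r} g \<Longrightarrow> L2_on {0..r} (T' g)"
    "L2_on {0..r} f \<Longrightarrow> L2_on {0..r} g \<Longrightarrow> ipL r (T f) g = ipL r f (T' g)"
  using assms by (auto simp: adjp_def)

lemma adjp_sym:
  fixes T :: "'p::finite vfun \<Rightarrow> 'q::finite vfun"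
  shows "adjp r T T' \<Longrightarrow> adjp r T' T"
  unfolding adjp_def
proof (intro conjI allI impI; (elim conjE)?)
  fix f :: "'q vfun" and g :: "'p vfun" assume fg: "L2_on {0..r} f" "L2_on {0..r} g"
    and "\<forall>f g. L2_on {0..r} f \<longrightarrow> L2_on {0..r} g \<longrightarrow> ipL r (T f) g = ipL r f (T' g)"
  then have "ipL r (T g) f = ipL r g (T' f)" by blast
  then have "cnj (ipL r (T g) f) = cnj (ipL r g (T' f))" by simp
  then show "ipL r (T' f) g = ipL r f (T g)" by (simp add: ipL_cnj)
qed auto

lemma adjp_id: "adjp r (\<lambda>f. f) (\<lambda>f. f)"
  by (auto simp: adjp_def)

lemma adjp_compose:
  assumes "adjp r T T'" "adjp r U U'"
  shows "adjp r (\<lambda>f. T (U f)) (\<lambda>g. U' (T' g))"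
  using assms by (auto simp: adjp_def)

lemma adjp_add:
  assumes "adjp r T T'" "adjp r U U'"
  shows "adjp r (\<lambda>f x. T f x + U f x) (\<lambda>g x. T' g x + U' g x)"
  unfolding adjp_def
  using adjpD[OF assms(1)] adjpD[OF assms(2)] by (auto simp: ipL_add_left ipL_add_right intro: L2_on_add)

lemma AE_eq_if_ipL_eq:
  assumes "L2_on {0..r} f" "L2_on {0..r} g"
    and "\<And>h. L2_on {0..r} h \<Longrightarrow> ipL r f h = ipL r g h"
  shows "AE x in leb r. f x = g x"
proof -
  have d: "L2_on {0..r} (\<lambda>x. f x - g x)" using assms by (intro L2_on_diff)
  have "ipL r (\<lambda>x. f x - g x) (\<lambda>x. f x - g x) = 0"
    using assms d by (simp add: ipL_diff_left)
  from ipL_self_zero[OF d this] show ?thesis by eventually_elim simp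
qed

lemma adjp_AE_cong:
  fixes T :: "'p::finite vfun \<Rightarrow> 'q::finite vfun"
  assumes "adjp r T T'" "L2_on {0..r} f" "L2_on {0..r} g" "AE x in leb r. f x = g x"
  shows "AE x in leb r. T f x = T g x"
proof (rule AE_eq_if_ipL_eq)
  fix h :: "'q vfun" assume "L2_on {0..r} h"
  then show "ipL r (T f) h = ipL r (T g) h"
    using adjpD[OF assms(1)] assms by (simp add: ipL_cong_left[of r f g])
qed (use adjpD[OF assms(1)] assms in auto)

lemma adjp_AE_add:
  fixes T :: "'p::finite vfun \<Rightarrow> 'q::finite vfun"
  assumes "adjp r T T'" "L2_on {0..r} f" "L2_on {0..r} g"
  shows "AE x in leb r. T (\<lambda>x. f x + g x) x = T f x + T g x"
proof (rule AE_eq_if_ipL_eq)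
  fix h :: "'q vfun" assume h: "L2_on {0..r} h"
  show "ipL r (T (\<lambda>x. f x + g x)) h = ipL r (\<lambda>x. T f x + T g x) h"
    using adjpD[OF assms(1)] assms h by (simp add: ipL_add_left L2_on_add)
qed (use adjpD[OF assms(1)] assms in \<open>auto intro: L2_on_add\<close>)

lemma adjp_AE_diff:
  fixes T :: "'p::finite vfun \<Rightarrow> 'q::finite vfun"
  assumes "adjp r T T'" "L2_on {0..r} f" "L2_on {0..r} g"
  shows "AE x in leb r. T (\<lambda>x. f x - g x) x = T f x - T g x"
proof (rule AE_eq_if_ipL_eq)
  fix h :: "'q vfun" assume h: "L2_on {0..r} h"
  show "ipL r (T (\<lambda>x. f x - g x)) h = ipL r (\<lambda>x. T f x - T g x) h"
    using adjpD[OF assms(1)] assms h by (simp add: ipL_diff_left L2_on_diff)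
qed (use adjpD[OF assms(1)] assms in \<open>auto intro: L2_on_diff\<close>)

lemma adjp_AE_smult:
  fixes T :: "'p::finite vfun \<Rightarrow> 'q::finite vfun"
  assumes "adjp r T T'" "L2_on {0..r} f"
  shows "AE x in leb r. T (\<lambda>x. c *s f x) x = c *s T f x"
proof (rule AE_eq_if_ipL_eq)
  fix h :: "'q vfun" assume h: "L2_on {0..r} h"
  show "ipL r (T (\<lambda>x. c *s f x)) h = ipL r (\<lambda>x. c *s T f x) h"
    using adjpD[OF assms(1)] assms h by (simp add: ipL_scale_left L2_on_smult)
qed (use adjpD[OF assms(1)] assms in \<open>auto intro: L2_on_smult\<close>)

text \<open>Transfers an operator identity to the adjoints, for instance the commutation of
  \<open>W\<close> with \<open>Jop\<close> to that of \<open>Wadj\<close> with \<open>Jadj\<close>,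
  without a second computation with kernels.\<close>

lemma adjp_unique:
  fixes T :: "'p::finite vfun \<Rightarrow> 'q::finite vfun"
  assumes "adjp r T T'" "adjp r U U'"
    and eq: "\<And>f. L2_on {0..r} f \<Longrightarrow> AE x in leb r. T f x = U f x"
    and g: "L2_on {0..r} g"
  shows "AE x in leb r. T' g x = U' g x"
proof (rule AE_eq_if_ipL_eq)
  fix h :: "'p vfun" assume h: "L2_on {0..r} h"
  have "ipL r h (T' g) = ipL r h (U' g)"
    using adjpD[OF assms(1)] adjpD[OF assms(2)] h g ipL_cong_left[OF _ _ g eq[OF h]]
    by (simp flip: adjpD(3)[OF assms(1)] adjpD(3)[OF assms(2)])
  then have "cnj (ipL r h (T' g)) = cnj (ipL r h (U' g))" by simp
  then show "ipL r (T' g) h = ipL r (U' g) h" by (simp add: ipL_cnj)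
qed (use adjpD[OF assms(1)] adjpD[OF assms(2)] g in auto)

text \<open>A majorant in product form makes \<open>H\<close> integrable on the square by Tonelli.
  Measurability refers to the product of the two Lebesgue sigma-algebras, which is smaller than the
  Lebesgue sigma-algebra of the square; this is why kernels are made Borel before use.\<close>

lemma Fubini_lebesgue_on_bounded:
  fixes H :: "real \<Rightarrow> real \<Rightarrow> 'a::euclidean_space"
  assumes m: "(\<lambda>(x, t). H x t) \<in> borel_measurable (lebesgue_on {a..b} \<Otimes>\<^sub>M lebesgue_on {a..b})"
    and f: "integrable (lebesgue_on {a..b}) f" and g: "integrable (lebesgue_on {a..b}) g"
    and le: "\<And>x t. x \<in> {a..b} \<Longrightarrow> t \<in> {a..b} \<Longrightarrow> norm (H x t) \<le> f x * g t"
    and nn: "\<And>x. 0 \<le> f x" "\<And>x. 0 \<le> g x"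
  shows "(LINT t|lebesgue_on {a..b}. LINT x|lebesgue_on {a..b}. H x t) = (LINT x|lebesgue_on {a..b}. LINT t|lebesgue_on {a..b}. H x t)"
proof -
  define \<mu> where "\<mu> = lebesgue_on {a..b}"
  interpret finite_measure \<mu> unfolding \<mu>_def by (rule finite_measure_lebesgue_on_Icc)
  interpret P: pair_sigma_finite \<mu> \<mu> by unfold_locales
  have sp: "x \<in> {a..b}" if "x \<in> space \<mu>" for x using that by (simp add: \<mu>_def)
  have m': "(\<lambda>(x, t). H x t) \<in> borel_measurable (\<mu> \<Otimes>\<^sub>M \<mu>)" using m by (simp add: \<mu>_def)
  have f': "integrable \<mu> f" and g': "integrable \<mu> g" using f g by (simp_all add: \<mu>_def)
  have sec: "(\<lambda>t. H x t) \<in> borel_measurable \<mu>" if "x \<in> space \<mu>" for x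
    using measurable_Pair2[OF m' that] by simp
  have isec: "integrable \<mu> (\<lambda>t. H x t)" if x: "x \<in> space \<mu>" for x
  proof (rule Bochner_Integration.integrable_bound)
    show "integrable \<mu> (\<lambda>t. f x * g t)" using g' by simp
    show "AE t in \<mu>. norm (H x t) \<le> norm (f x * g t)"
    proof (rule AE_I2)
      fix t assume "t \<in> space \<mu>"
      from le[OF sp[OF x] sp[OF this]] show "norm (H x t) \<le> norm (f x * g t)"
        unfolding real_norm_def by (rule order_trans) (rule abs_ge_self)
    qed
  qed (rule sec[OF x])
  have "integrable (\<mu> \<Otimes>\<^sub>M \<mu>) (\<lambda>(x, t). H x t)"
  proof (rule P.Fubini_integrable[OF m'])
    show "integrable \<mu> (\<lambda>x. LINT t|\<mu>. norm (case (x, t) of (x, t) \<Rightarrow> H x t))"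
    proof (rule Bochner_Integration.integrable_bound)
      show "integrable \<mu> (\<lambda>x. f x * (LINT t|\<mu>. g t))" using f' by simp
      show "(\<lambda>x. LINT t|\<mu>. norm (case (x, t) of (x, t) \<Rightarrow> H x t)) \<in> borel_measurable \<mu>"
        using m' by measurable
      show "AE x in \<mu>. norm (LINT t|\<mu>. norm (case (x, t) of (x, t) \<Rightarrow> H x t)) \<le> norm (f x * (LINT t|\<mu>. g t))"
      proof (rule AE_I2)
        fix x assume x: "x \<in> space \<mu>"
        have "(LINT t|\<mu>. norm (H x t)) \<le> (LINT t|\<mu>. f x * g t)"
          by (rule integral_mono) (use isec[OF x] g' le sp[OF x] sp in auto)
        moreover have "0 \<le> (LINT t|\<mu>. norm (H x t))" by simp
        ultimately show "norm (LINT t|\<mu>. norm (case (x, t) of (x, t) \<Rightarrow> H x t)) \<le> norm (f x * (LINT t|\<mu>. g t))"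
          by simp
      qed
    qed
    show "AE x in \<mu>. integrable \<mu> (\<lambda>t. case (x, t) of (x, t) \<Rightarrow> H x t)"
      by (rule AE_I2) (use isec in simp)
  qed
  from P.Fubini_integral[OF this] show ?thesis by (simp add: \<mu>_def)
qed

text \<open>The bound holds everywhere on the square and measurability is that of the product
  sigma-algebra, so every section of such a kernel is measurable and bounded, without exceptional
  points.\<close>

definition bker :: "real \<Rightarrow> (real \<Rightarrow> real \<Rightarrow> complex ^ 'q::finite ^ 'p::finite) \<Rightarrow> bool" where
  "bker r \<kappa> \<longleftrightarrow> (\<lambda>(x, t). \<kappa> x t) \<in> borel_measurable (leb r \<Otimes>\<^sub>M leb r) \<and>
     (\<exists>C. \<forall>x\<in>{0..r}. \<forall>t\<in>{0..r}. norm (\<kappa> x t) \<le> C)"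

definition vop :: "real \<Rightarrow> (real \<Rightarrow> real \<Rightarrow> complex ^ 'q::finite ^ 'p::finite) \<Rightarrow> 'q vfun \<Rightarrow> 'p vfun" where
  "vop r \<kappa> f x = (LINT t|leb r. \<kappa> x t *v f t)"

definition adjk :: "(real \<Rightarrow> real \<Rightarrow> complex ^ 'q::finite ^ 'p::finite) \<Rightarrow> real \<Rightarrow> real \<Rightarrow> complex ^ 'p ^ 'q" where
  "adjk \<kappa> x t = adj (\<kappa> t x)"

text \<open>Extends a Volterra kernel by zero above the diagonal, so that integrals up to
  \<open>x\<close> become instances of \<open>vop\<close> and their adjoints are again of that
  form.\<close>

definition lowk :: "(real \<Rightarrow> real \<Rightarrow> complex ^ 'q::finite ^ 'p::finite) \<Rightarrow> real \<Rightarrow> real \<Rightarrow> complex ^ 'q ^ 'p" where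
  "lowk \<kappa> x t = (if t \<le> x then \<kappa> x t else 0)"

lemma bkerD_bound:
  assumes "bker r \<kappa>"
  obtains C where "C \<ge> 0" "\<And>x t. x \<in> {0..r} \<Longrightarrow> t \<in> {0..r} \<Longrightarrow> norm (\<kappa> x t) \<le> C"
proof -
  obtain C where C: "\<forall>x\<in>{0..r}. \<forall>t\<in>{0..r}. norm (\<kappa> x t) \<le> C" using assms by (auto simp: bker_def)
  show ?thesis
    by (rule that[of "max C 0"]) (use C in \<open>auto simp: le_max_iff_disj\<close>)
qed

lemma bker_adjk: "bker r \<kappa> \<Longrightarrow> bker r (adjk \<kappa>)"
  unfolding bker_def
proof (elim conjE, intro conjI)
  assume m: "(\<lambda>(x, t). \<kappa> x t) \<in> borel_measurable (leb r \<Otimes>\<^sub>M leb r)"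
  have "(\<lambda>(x, t). \<kappa> t x) \<in> borel_measurable (leb r \<Otimes>\<^sub>M leb r)"
    using measurable_pair_swap[OF m] by simp
  then show "(\<lambda>(x, t). adjk \<kappa> x t) \<in> borel_measurable (leb r \<Otimes>\<^sub>M leb r)"
    unfolding adjk_def case_prod_beta' by (rule borel_measurable_adj)
qed (auto simp: adjk_def norm_adj)

lemma measurable_id_lebesgue_on: "(\<lambda>x. x) \<in> borel_measurable (lebesgue_on {a..b::real})"
  by (rule continuous_imp_measurable_on_sets_lebesgue) auto

lemma bker_lowk:
  assumes "bker r \<kappa>"
  shows "bker r (lowk \<kappa>)"
  unfolding bker_def
proof
  obtain C where C: "C \<ge> 0" "\<And>x t. x \<in> {0..r} \<Longrightarrow> t \<in> {0..r} \<Longrightarrow> norm (\<kappa> x t) \<le> C"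
    using bkerD_bound[OF assms] by blast
  then show "\<exists>C. \<forall>x\<in>{0..r}. \<forall>t\<in>{0..r}. norm (lowk \<kappa> x t) \<le> C"
    by (intro exI[of _ C]) (auto simp: lowk_def)
  note [measurable] = measurable_id_lebesgue_on[of 0 r]
  have [measurable]: "(\<lambda>p. \<kappa> (fst p) (snd p)) \<in> borel_measurable (leb r \<Otimes>\<^sub>M leb r)"
    using assms by (simp add: bker_def case_prod_beta')
  have "(\<lambda>p. if snd p \<le> fst p then \<kappa> (fst p) (snd p) else 0) \<in> borel_measurable (leb r \<Otimes>\<^sub>M leb r)"
  proof (rule measurable_If)
    have f: "(\<lambda>p. fst p) \<in> borel_measurable (leb r \<Otimes>\<^sub>M leb r)"
      using measurable_compose[OF measurable_fst measurable_id_lebesgue_on[of 0 r]] by simp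
    have s: "(\<lambda>p. snd p) \<in> borel_measurable (leb r \<Otimes>\<^sub>M leb r)"
      using measurable_compose[OF measurable_snd measurable_id_lebesgue_on[of 0 r]] by simp
    show "{p \<in> space (leb r \<Otimes>\<^sub>M leb r). snd p \<le> fst p} \<in> sets (leb r \<Otimes>\<^sub>M leb r)"
      by (rule borel_measurable_le[OF s f])
  qed measurable
  then show "(\<lambda>(x, t). lowk \<kappa> x t) \<in> borel_measurable (leb r \<Otimes>\<^sub>M leb r)"
    by (simp add: lowk_def case_prod_beta')
qed

lemma bker_product:
  assumes "a \<in> borel_measurable (leb r)" "b \<in> borel_measurable (leb r)"
    and "\<And>x. x \<in> {0..r} \<Longrightarrow> norm (a x) \<le> A" "\<And>x. x \<in> {0..r} \<Longrightarrow> norm (b x) \<le> B"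
  shows "bker r (\<lambda>x t. (a x :: complex^'k::finite^'p::finite) ** (b t :: complex^'q::finite^'k))"
  unfolding bker_def
proof
  have a: "(\<lambda>p. a (fst p)) \<in> borel_measurable (leb r \<Otimes>\<^sub>M leb r)"
    by (rule measurable_compose[OF measurable_fst assms(1)])
  have b: "(\<lambda>p. b (snd p)) \<in> borel_measurable (leb r \<Otimes>\<^sub>M leb r)"
    by (rule measurable_compose[OF measurable_snd assms(2)])
  show "(\<lambda>(x, t). a x ** b t) \<in> borel_measurable (leb r \<Otimes>\<^sub>M leb r)"
    unfolding case_prod_beta' by (rule borel_measurable_mm[OF a b])
  obtain K where K: "K > 0" "\<And>a b. norm ((a::complex^'k^'p) ** (b::complex^'q^'k)) \<le> norm a * norm b * K"
    using bounded_bilinear.pos_bounded[OF bounded_bilinear_matrix_matrix_mult] by blast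
  have "norm (a x ** b t) \<le> \<bar>A\<bar> * \<bar>B\<bar> * K" if "x \<in> {0..r}" "t \<in> {0..r}" for x t
    by (rule order_trans[OF K(2)], intro mult_mono)
       (use assms(3)[OF that(1)] assms(4)[OF that(2)] K(1) in auto)
  then show "\<exists>C. \<forall>x\<in>{0..r}. \<forall>t\<in>{0..r}. norm (a x ** b t) \<le> C" by blast
qed

lemma bker_const: "bker r (\<lambda>x t. c)"
  by (auto simp: bker_def case_prod_beta')

lemma vop_lowk:
  assumes "x \<in> {0..r}"
  shows "vop r (lowk \<kappa>) f x = (LINT t|leb x. \<kappa> x t *v f t)"
proof -
  have "(if t \<le> x then \<kappa> x t else 0) *v f t = (if t \<le> x then \<kappa> x t *v f t else 0)" for t
    by simp
  then show ?thesis
    using lebesgue_integral_Icc_extend[of 0 x r "\<lambda>t. \<kappa> x t *v f t"] assms by (simp add: vop_def lowk_def)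
qed

lemma bounded_matrix_vector:
  obtains K where "K > 0" "\<And>A x. norm ((A::complex^'q::finite^'p::finite) *v x) \<le> norm A * norm x * K"
  using bounded_bilinear.pos_bounded[OF bounded_bilinear_matrix_vector_mult] by blast

lemma bker_section_integrable:
  fixes f :: "'q::finite vfun" and \<kappa> :: "real \<Rightarrow> real \<Rightarrow> complex ^ 'q ^ 'p::finite"
  assumes "bker r \<kappa>" "integrable (leb r) f" "x \<in> {0..r}"
  shows "integrable (leb r) (\<lambda>t. \<kappa> x t *v f t)"
proof -
  obtain K where K: "K > 0" "\<And>A x. norm ((A::complex^'q^'p) *v x) \<le> norm A * norm x * K"
    by (rule bounded_matrix_vector) blast
  obtain C where C: "C \<ge> 0" "\<And>x t. x \<in> {0..r} \<Longrightarrow> t \<in> {0..r} \<Longrightarrow> norm (\<kappa> x t) \<le> C"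
    using bkerD_bound[OF assms(1)] by blast
  have x: "x \<in> space (leb r)" using assms(3) by simp
  have i: "integrable (leb r) (\<lambda>t. C * norm (f t) * K)" using assms by auto
  have "(\<lambda>t. \<kappa> x t) \<in> borel_measurable (leb r)"
    using measurable_Pair2[OF assms(1)[unfolded bker_def, THEN conjunct1] x] by simp
  then have m: "(\<lambda>t. \<kappa> x t *v f t) \<in> borel_measurable (leb r)"
    using assms(2) by (intro borel_measurable_mv) auto
  have "AE t in leb r. norm (\<kappa> x t *v f t) \<le> norm (C * norm (f t) * K)"
    using AE_space_lebesgue_on[of "{0..r}"]
  proof eventually_elim
    case (elim t)
    have "norm (\<kappa> x t *v f t) \<le> norm (\<kappa> x t) * norm (f t) * K" by (rule K)
    also have "\<dots> \<le> C * norm (f t) * K"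
      using C(2)[OF assms(3) elim] K(1) by (intro mult_right_mono) auto
    also have "\<dots> \<le> norm (C * norm (f t) * K)" unfolding real_norm_def by (rule abs_ge_self)
    finally show ?case .
  qed
  with i m show ?thesis by (rule Bochner_Integration.integrable_bound)
qed

lemma vop_bound:
  fixes \<kappa> :: "real \<Rightarrow> real \<Rightarrow> complex ^ 'q::finite ^ 'p::finite"
  assumes "bker r \<kappa>"
  obtains C where "C \<ge> 0" "\<And>f x. integrable (leb r) f \<Longrightarrow> x \<in> {0..r} \<Longrightarrow>
     norm (vop r \<kappa> f x) \<le> C * (LINT t|leb r. norm (f t))"
proof -
  obtain K where K: "K > 0" "\<And>A x. norm ((A::complex^'q^'p) *v x) \<le> norm A * norm x * K"
    by (rule bounded_matrix_vector) blast
  obtain C where C: "C \<ge> 0" "\<And>x t. x \<in> {0..r} \<Longrightarrow> t \<in> {0..r} \<Longrightarrow> norm (\<kappa> x t) \<le> C"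
    using bkerD_bound[OF assms(1)] by blast
  show ?thesis
  proof (rule that[of "C * K"])
    show "C * K \<ge> 0" using C K by simp
    fix f :: "'q vfun" and x assume f: "integrable (leb r) f" and x: "x \<in> {0..r}"
    have "norm (vop r \<kappa> f x) \<le> (LINT t|leb r. C * K * norm (f t))"
      unfolding vop_def
    proof (rule Bochner_Integration.integral_norm_bound_integral[OF bker_section_integrable[OF assms f x]])
      show "integrable (leb r) (\<lambda>t. C * K * norm (f t))" using f by auto
      fix t assume "t \<in> space (leb r)"
      then have t: "t \<in> {0..r}" by simp
      have "norm (\<kappa> x t *v f t) \<le> norm (\<kappa> x t) * norm (f t) * K" by (rule K)
      also have "\<dots> \<le> C * norm (f t) * K"
        using C(2)[OF x t] K(1) by (intro mult_right_mono) auto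
      finally show "norm (\<kappa> x t *v f t) \<le> C * K * norm (f t)" by (simp add: mult_ac)
    qed
    then show "norm (vop r \<kappa> f x) \<le> C * K * (LINT t|leb r. norm (f t))" by simp
  qed
qed

lemma vop_measurable:
  assumes "bker r \<kappa>" "f \<in> borel_measurable (leb r)"
  shows "vop r \<kappa> f \<in> borel_measurable (leb r)"
proof -
  interpret finite_measure "leb r" by (rule finite_measure_lebesgue_on_Icc)
  have a: "(\<lambda>p. f (snd p)) \<in> borel_measurable (leb r \<Otimes>\<^sub>M leb r)"
    by (rule measurable_compose[OF measurable_snd assms(2)])
  have "(\<lambda>p. \<kappa> (fst p) (snd p) *v f (snd p)) \<in> borel_measurable (leb r \<Otimes>\<^sub>M leb r)"
    using assms(1) by (intro borel_measurable_mv a) (simp add: bker_def case_prod_beta')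
  then show ?thesis
    unfolding vop_def[abs_def] by (intro borel_measurable_lebesgue_integral) (simp add: case_prod_beta')
qed

lemma vop_L2:
  assumes "bker r \<kappa>" "L2_on {0..r} f"
  shows "L2_on {0..r} (vop r \<kappa> f)"
proof -
  obtain C where C: "C \<ge> 0" "\<And>f x. integrable (leb r) f \<Longrightarrow> x \<in> {0..r} \<Longrightarrow>
     norm (vop r \<kappa> f x) \<le> C * (LINT t|leb r. norm (f t))"
    using vop_bound[OF assms(1)] by blast
  show ?thesis
  proof (rule L2_on_bounded)
    show "vop r \<kappa> f \<in> borel_measurable (leb r)"
      by (rule vop_measurable[OF assms(1) L2_on_measurable[OF assms(2)]])
    show "AE x in leb r. norm (vop r \<kappa> f x) \<le> C * (LINT t|leb r. norm (f t))"
      by (rule AE_I2) (use C(2)[OF L2_on_integrable[OF assms(2)]] in simp)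
  qed
qed

lemma adjp_vop:
  fixes \<kappa> :: "real \<Rightarrow> real \<Rightarrow> complex ^ 'q::finite ^ 'p::finite"
  assumes \<kappa>: "bker r \<kappa>"
  shows "adjp r (vop r \<kappa>) (vop r (adjk \<kappa>))"
  unfolding adjp_def
proof (intro conjI allI impI)
  fix f :: "'q vfun" assume "L2_on {0..r} f" then show "L2_on {0..r} (vop r \<kappa> f)" by (rule vop_L2[OF \<kappa>])
next
  fix g :: "'p vfun" assume "L2_on {0..r} g"
  then show "L2_on {0..r} (vop r (adjk \<kappa>) g)" by (rule vop_L2[OF bker_adjk[OF \<kappa>]])
next
  fix f :: "'q vfun" and g :: "'p vfun" assume f: "L2_on {0..r} f" and g: "L2_on {0..r} g"
  obtain K where K: "K > 0" "\<And>A x. norm ((A::complex^'q^'p) *v x) \<le> norm A * norm x * K"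
    by (rule bounded_matrix_vector) blast
  obtain C where C: "C \<ge> 0" "\<And>x t. x \<in> {0..r} \<Longrightarrow> t \<in> {0..r} \<Longrightarrow> norm (\<kappa> x t) \<le> C"
    using bkerD_bound[OF \<kappa>] by blast
  note fi = L2_on_integrable[OF f] and gi = L2_on_integrable[OF g]
  define H where "H x t = cip (\<kappa> x t *v f t) (g x)" for x t
  have "ipL r (vop r \<kappa> f) g = (LINT x|leb r. LINT t|leb r. H x t)"
    unfolding ipL_def
  proof (rule Bochner_Integration.integral_cong)
    fix x assume "x \<in> space (leb r)"
    then have x: "x \<in> {0..r}" by simp
    show "cip (vop r \<kappa> f x) (g x) = (LINT t|leb r. H x t)"
      unfolding vop_def H_def
      using integral_bounded_linear[OF bounded_bilinear.bounded_linear_left[OF bounded_bilinear_cip] bker_section_integrable[OF \<kappa> fi x]]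
      by simp
  qed simp
  also have "\<dots> = (LINT t|leb r. LINT x|leb r. H x t)"
  proof (rule Fubini_lebesgue_on_bounded[symmetric, where f = "\<lambda>x. norm (g x)" and g = "\<lambda>t. C * K * norm (f t)"])
    have a: "(\<lambda>p. f (snd p)) \<in> borel_measurable (leb r \<Otimes>\<^sub>M leb r)"
      by (rule measurable_compose[OF measurable_snd L2_on_measurable[OF f]])
    have b: "(\<lambda>p. g (fst p)) \<in> borel_measurable (leb r \<Otimes>\<^sub>M leb r)"
      by (rule measurable_compose[OF measurable_fst L2_on_measurable[OF g]])
    show "(\<lambda>(x, t). H x t) \<in> borel_measurable (leb r \<Otimes>\<^sub>M leb r)"
      unfolding H_def case_prod_beta' using \<kappa>
      by (intro borel_measurable_cip borel_measurable_mv a b) (simp add: bker_def case_prod_beta')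
    fix x t assume xt: "x \<in> {0..r}" "t \<in> {0..r}"
    have "norm (H x t) \<le> norm (\<kappa> x t *v f t) * norm (g x)" unfolding H_def by (rule norm_cip_le)
    also have "\<dots> \<le> (norm (\<kappa> x t) * norm (f t) * K) * norm (g x)" by (intro mult_right_mono K) auto
    also have "\<dots> \<le> (C * norm (f t) * K) * norm (g x)"
      using C(2)[OF xt] K(1) by (intro mult_right_mono) auto
    finally show "norm (H x t) \<le> norm (g x) * (C * K * norm (f t))" by (simp add: mult_ac)
  qed (use C(1) K(1) fi gi in auto)
  also have "\<dots> = ipL r f (vop r (adjk \<kappa>) g)"
    unfolding ipL_def
  proof (rule Bochner_Integration.integral_cong)
    fix t assume "t \<in> space (leb r)"
    then have t: "t \<in> {0..r}" by simp
    have "cip (f t) (vop r (adjk \<kappa>) g t) = (LINT x|leb r. cip (f t) (adjk \<kappa> t x *v g x))"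
      unfolding vop_def
      using integral_bounded_linear[OF bounded_bilinear.bounded_linear_right[OF bounded_bilinear_cip] bker_section_integrable[OF bker_adjk[OF \<kappa>] gi t]]
      by simp
    then show "(LINT x|leb r. H x t) = cip (f t) (vop r (adjk \<kappa>) g t)"
      by (simp add: H_def adjk_def cip_adj')
  qed simp
  finally show "ipL r (vop r \<kappa> f) g = ipL r f (vop r (adjk \<kappa>) g)" .
qed

section \<open>The Dirac system\<close>

lemma absolutely_continuous_on_imp_continuous_on:
  fixes f :: "real \<Rightarrow> 'a::real_normed_vector"
  assumes "absolutely_continuous_on {a..b} f"
  shows "continuous_on {a..b} f"
  unfolding continuous_on_iff
proof (intro ballI allI impI)
  fix x e :: real assume x: "x \<in> {a..b}" and "e > 0"
  obtain \<delta> where "\<delta> > 0" and \<delta>: "\<And>d T. d division_of T \<Longrightarrow> T \<subseteq> {a..b} \<Longrightarrow>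
      (\<Sum>k\<in>d. Sup k - Inf k) < \<delta> \<Longrightarrow> (\<Sum>k\<in>d. norm (f (Sup k) - f (Inf k))) < e"
    using assms \<open>0 < e\<close> unfolding absolutely_continuous_on_def by meson
  have *: "norm (f q - f p) < e" if "p \<in> {a..b}" "q \<in> {a..b}" "p \<le> q" "q - p < \<delta>" for p q
    using \<delta>[of "{{p..q}}" "{p..q}"] that division_of_self[of p q] by (auto simp: box_real)
  show "\<exists>d>0. \<forall>x'\<in>{a..b}. dist x' x < d \<longrightarrow> dist (f x') (f x) < e"
  proof (intro exI[of _ \<delta>] conjI ballI impI)
    fix y assume "y \<in> {a..b}" "dist y x < \<delta>"
    then show "dist (f y) (f x) < e"
      using *[of x y] *[of y x] x by (cases "x \<le> y") (auto simp: dist_norm norm_minus_commute)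
  qed fact
qed

lemma norm_matrix_le_entries:
  fixes A :: "complex^'q::finite^'p::finite"
  assumes "\<And>i j. norm (A $ i $ j) \<le> B"
  shows "norm A \<le> real CARD('p) * (real CARD('q) * B)"
proof -
  have "norm A \<le> (\<Sum>i\<in>UNIV. norm (A $ i))"
    unfolding norm_vec_def[of A] by (rule L2_set_le_sum) auto
  also have "\<dots> \<le> (\<Sum>i\<in>(UNIV::'p set). \<Sum>j\<in>(UNIV::'q set). B)"
  proof (rule sum_mono)
    fix i
    have "norm (A $ i) \<le> (\<Sum>j\<in>UNIV. norm (A $ i $ j))"
      unfolding norm_vec_def[of "A $ i"] by (rule L2_set_le_sum) auto
    also have "\<dots> \<le> (\<Sum>j\<in>(UNIV::'q set). B)" by (rule sum_mono) (rule assms)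
    finally show "norm (A $ i) \<le> (\<Sum>j\<in>(UNIV::'q set). B)" .
  qed
  finally show ?thesis by simp
qed

lemma matrix_vector_axis:
  fixes A :: "complex^'q::finite^'p"
  shows "(A *v axis j 1) $ i = A $ i $ j"
  by (simp add: matrix_vector_mult_def axis_def if_distrib[of "\<lambda>x. _ * x"] cong: if_cong)

lemma adj_I0_mult: "adj I0 *v a = vjoin a 0" and adj_OI_mult: "adj OI *v b = vjoin 0 b"
  by (auto simp: adj_def I0_def OI_def hcat_def vjoin_def matrix_vector_mult_def vec_eq_iff mat_def
      if_distrib[of cnj] if_distrib[of "\<lambda>x. x * _"] split: sum.split cong: if_cong)

lemma I0_adj_I0: "I0 ** adj I0 = mat 1" and OI_adj_OI: "OI ** adj OI = mat 1"
  and I0_adj_OI: "I0 ** adj OI = 0" and OI_adj_I0: "OI ** adj I0 = 0"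
  by (rule matrix_vector_mult_eqI; simp add: matrix_vector_mul_assoc[symmetric] adj_I0_mult adj_OI_mult I0_mult_vec OI_mult_vec)+

lemma adj_blocks_sum: "adj I0 ** I0 + adj OI ** OI = mat 1"
proof (rule matrix_vector_mult_eqI)
  fix x :: "complex ^ ('a + 'b)"
  show "(adj I0 ** I0 + adj OI ** OI) *v x = mat 1 *v x"
    by (rule block_vec_eqI)
       (simp_all add: matrix_vector_mult_add_rdistrib matrix_vector_mul_assoc[symmetric] adj_I0_mult adj_OI_mult
          I0_mult_vec OI_mult_vec vtop_add vbot_add)
qed

definition dirac_matrix :: "complex ^ 'm2::finite ^ 'm1::finite \<Rightarrow> complex \<Rightarrow> complex ^ ('m1 + 'm2) ^ ('m1 + 'm2)" where
  "dirac_matrix w z = mat (\<i> * z) ** jmat + jmat ** Vmat w"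

lemma vtop_dirac: "vtop (dirac_matrix w z *v x) = (\<i> * z) *s vtop x + w *v vbot x"
  and vbot_dirac: "vbot (dirac_matrix w z *v x) = (- \<i> * z) *s vbot x - adj w *v vtop x"
  by (simp_all add: dirac_matrix_def matrix_vector_mult_add_rdistrib matrix_vector_mul_assoc[symmetric] vtop_add vbot_add
      mat_vector_mult vtop_smult vbot_smult vtop_jmat vbot_jmat vtop_Vmat vbot_Vmat)

lemma adj_dirac: "adj (dirac_matrix w (cnj z)) = - dirac_matrix w z"
proof -
  have "adj (dirac_matrix w (cnj z)) = jmat ** mat (- \<i> * z) + Vmat w ** jmat"
    by (simp add: dirac_matrix_def adj_add adj_mult adj_jmat adj_Vmat adj_mat)
  also have "jmat ** mat (- \<i> * z) = - (mat (\<i> * z) ** jmat)"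
    by (rule matrix_vector_mult_eqI)
       (simp add: matrix_vector_mul_assoc[symmetric] mat_vector_mult matrix_vector_mult_smult matrix_vector_mult_minus_left matrix_vector_mult_minus_right)
  finally show ?thesis by (simp add: Vmat_jmat dirac_matrix_def)
qed

text \<open>Pairing \<open>adj A *v k\<close> with itself gives the square of its norm; moving
  \<open>A\<close> to the other side bounds this by \<open>M\<close> times the product of the two
  norms.\<close>

lemma norm_adj_mult_vec_le:
  assumes "\<And>h. norm (A *v h) \<le> M * norm h" and "0 \<le> M"
  shows "norm (adj A *v (k::complex^'p::finite)) \<le> M * norm k"
proof (cases "adj A *v k = 0")
  case False
  define w where "w = adj A *v k"
  have "(norm w)\<^sup>2 = norm (cip w w)" by (simp add: cip_self del: of_real_power)
  also have "cip w w = cip (A *v w) k" unfolding w_def by (simp add: cip_adj')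
  also have "norm \<dots> \<le> norm (A *v w) * norm k" by (rule norm_cip_le)
  also have "\<dots> \<le> M * norm w * norm k" by (intro mult_right_mono assms) auto
  finally have "norm w * norm w \<le> norm w * (M * norm k)" by (simp add: power2_eq_square mult_ac)
  then show ?thesis using False by (simp add: w_def)
qed (use assms in simp)

section \<open>The system, its fundamental solution, \<beta> and \<gamma>\<close>

locale dirac_system =
  fixes l M :: real
    and v :: "real \<Rightarrow> complex ^ 'm2::finite ^ 'm1::finite"
    and u :: "real \<Rightarrow> complex \<Rightarrow> complex ^ ('m1 + 'm2) ^ ('m1 + 'm2)"
  assumes l_pos: "0 < l" and M_pos: "0 < M"
    and adm: "admissible_potential l M v"
    and fund: "fundamental_solution l v u"
begin

lemma v_measurable: "v \<in> borel_measurable (leb l)"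
  using adm by (simp add: admissible_potential_def)

lemma AE_interior: "AE x in leb l. x \<in> {0<..<l}"
  by (subst AE_lebesgue_on_iff_negligible) (auto intro: negligible_subset[of "{0, l}"])

lemma norm_v_mult: "x \<in> {0<..<l} \<Longrightarrow> norm (v x *v h) \<le> M * norm h"
proof -
  assume x: "x \<in> {0<..<l}"
  have "norm (v x *v h) \<le> onorm (\<lambda>h. v x *v h) * norm h"
    by (rule onorm[OF bounded_linear_matrix_vector_right])
  also have "\<dots> \<le> M * norm h"
    using adm x by (intro mult_right_mono) (auto simp: admissible_potential_def)
  finally show ?thesis .
qed

lemma norm_adj_v_mult: "x \<in> {0<..<l} \<Longrightarrow> norm (adj (v x) *v h) \<le> M * norm h"
  using norm_v_mult M_pos by (intro norm_adj_mult_vec_le) auto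

text \<open>Only Lipschitz estimates use this matrix norm, so the dimensional constant does no harm;
  the decay estimates work with the operator bound \<open>M\<close> itself.\<close>

lemma norm_v_bound: "\<exists>B. \<forall>x\<in>{0<..<l}. norm (v x) \<le> B"
proof (intro exI ballI)
  fix x assume x: "x \<in> {0<..<l}"
  show "norm (v x) \<le> real CARD('m1) * (real CARD('m2) * M)"
  proof (rule norm_matrix_le_entries)
    fix i j
    have "norm (v x $ i $ j) = norm ((v x *v axis j 1) $ i)" by (simp add: matrix_vector_axis)
    also have "\<dots> \<le> norm (v x *v axis j 1)" by (rule Finite_Cartesian_Product.norm_nth_le)
    also have "\<dots> \<le> M" using norm_v_mult[OF x, of "axis j 1"] by simp
    finally show "norm (v x $ i $ j) \<le> M" .
  qed
qed

lemma u_0: "u 0 z = mat 1"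
  using fund by (simp add: fundamental_solution_def)

lemma bounded_linear_Vmat: "bounded_linear (Vmat :: complex^'m2^'m1 \<Rightarrow> _)"
  unfolding linear_conv_bounded_linear[symmetric]
  by (auto intro!: linearI simp: vec_eq_iff Vmat_def vcat_def hcat_def adj_def split: sum.split)

text \<open>Absolute continuity gives continuity, so \<open>u\<close> is bounded on [0,l]; as
  \<open>v\<close> is bounded too, the equation bounds the derivative.\<close>

lemma lip_ad_u: "lip_ad l (\<lambda>x. u x z) (\<lambda>x. dirac_matrix (v x) z ** u x z)"
proof -
  have ac: "absolutely_continuous_on {0..l} (\<lambda>x. u x z)"
    and D: "AE x in leb l. ((\<lambda>x. u x z) has_vector_derivative dirac_matrix (v x) z ** u x z) (at x within {0..l})"
    using fund by (simp_all add: fundamental_solution_def dirac_matrix_def)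
  have "compact ((\<lambda>x. u x z) ` {0..l})"
    by (rule compact_continuous_image[OF absolutely_continuous_on_imp_continuous_on[OF ac]]) simp
  then obtain U where U: "\<And>x. x \<in> {0..l} \<Longrightarrow> norm (u x z) \<le> U"
    by (meson bounded_iff compact_imp_bounded imageI)
  obtain B where B: "\<And>x. x \<in> {0<..<l} \<Longrightarrow> norm (v x) \<le> B" using norm_v_bound by blast
  obtain K where K: "\<And>w. norm (Vmat w :: complex^('m1+'m2)^('m1+'m2)) \<le> norm w * K" "K > 0"
    using bounded_linear.pos_bounded[OF bounded_linear_Vmat] by blast
  obtain K2 where K2: "\<And>X Y. norm ((X::complex^('m1+'m2)^('m1+'m2)) ** (Y::complex^('m1+'m2)^('m1+'m2))) \<le> norm X * norm Y * K2" "K2 > 0"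
    using bounded_bilinear.pos_bounded[OF bounded_bilinear_matrix_matrix_mult] by blast
  define J :: "complex^('m1+'m2)^('m1+'m2)" where "J = jmat"
  define T :: "complex^('m1+'m2)^('m1+'m2)" where "T = mat (\<i> * z) ** jmat"
  have bnd: "norm (dirac_matrix (v x) z ** u x z) \<le> (norm T + norm J * (\<bar>B\<bar> * K) * K2) * \<bar>U\<bar> * K2" if x: "x \<in> {0<..<l}" for x
  proof -
    have "norm (dirac_matrix (v x) z) \<le> norm T + norm (J ** Vmat (v x))"
      unfolding dirac_matrix_def T_def J_def by (rule norm_triangle_ineq)
    also have "norm (J ** Vmat (v x)) \<le> norm J * norm (Vmat (v x) :: complex^('m1+'m2)^('m1+'m2)) * K2" by (rule K2)
    also have "norm (Vmat (v x) :: complex^('m1+'m2)^('m1+'m2)) \<le> \<bar>B\<bar> * K"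
      using K(1)[of "v x"] mult_right_mono[OF B[OF x], of K] mult_right_mono[OF abs_ge_self[of B], of K] K(2) by linarith
    finally have 1: "norm (dirac_matrix (v x) z) \<le> norm T + norm J * (\<bar>B\<bar> * K) * K2"
      using K2(2) by (simp add: mult_left_mono mult_right_mono)
    have "norm (u x z) \<le> \<bar>U\<bar>" using U[of x] x by auto
    with 1 show ?thesis
      by (intro order_trans[OF K2(1)] mult_right_mono mult_mono) (use K(2) K2(2) in auto)
  qed
  have "AE x in leb l. norm (dirac_matrix (v x) z ** u x z) \<le> (norm T + norm J * (\<bar>B\<bar> * K) * K2) * \<bar>U\<bar> * K2"
    using AE_interior by eventually_elim (rule bnd)
  with ac D show ?thesis by (rule lip_adI_absolutely_continuous)
qed

text \<open>By \<open>adj_dirac\<close> the two terms of the derivative cancel. This supplies the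
  inverse of \<open>u\<close> explicitly and, at \<open>z = 0\<close>, unitarity, from which all
  relations between \<open>\<beta>\<close> and \<open>\<gamma>\<close> follow.\<close>

lemma adj_u_mult_u:
  assumes "x \<in> {0..l}"
  shows "adj (u x (cnj z)) ** u x z = mat 1" "u x z ** adj (u x (cnj z)) = mat 1"
proof -
  have 1: "lip_ad l (\<lambda>x. adj (u x (cnj z)) ** u x z) (\<lambda>x. adj (u x (cnj z)) ** (dirac_matrix (v x) z ** u x z)
      + adj (dirac_matrix (v x) (cnj z) ** u x (cnj z)) ** u x z)"
    by (rule lip_ad_bilinear[OF bounded_bilinear_matrix_matrix_mult lip_ad_linear[OF bounded_linear_adj lip_ad_u] lip_ad_u])
  have 2: "adj (u x (cnj z)) ** (dirac_matrix (v x) z ** u x z) + adj (dirac_matrix (v x) (cnj z) ** u x (cnj z)) ** u x z = 0" for x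
    by (simp add: adj_mult adj_dirac matrix_mult_minus_left matrix_mult_minus_right matrix_mul_assoc)
  have "adj (u x (cnj z)) ** u x z = adj (u 0 (cnj z)) ** u 0 z"
    by (rule lip_ad_const_deriv_0[OF 1 _ assms]) (simp add: 2)
  also have "\<dots> = mat 1" by (simp add: u_0 adj_mat)
  finally show "adj (u x (cnj z)) ** u x z = mat 1" .
  then show "u x z ** adj (u x (cnj z)) = mat 1" by (simp add: matrix_left_right_inverse)
qed

lemma adj_u0_mult_u0:
  assumes "x \<in> {0..l}"
  shows "adj (u x 0) ** u x 0 = mat 1" "u x 0 ** adj (u x 0) = mat 1"
  using adj_u_mult_u[OF assms, of 0] by simp_all

abbreviation "\<beta> \<equiv> beta u"
abbreviation "\<gamma> \<equiv> gamma u"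

lemma gamma_0: "\<gamma> 0 = OI" and beta_0: "\<beta> 0 = I0"
  by (simp_all add: gamma_def beta_def u_0)

lemma gamma_adj_gamma: "x \<in> {0..l} \<Longrightarrow> \<gamma> x ** adj (\<gamma> x) = mat 1"
  and beta_adj_beta: "x \<in> {0..l} \<Longrightarrow> \<beta> x ** adj (\<beta> x) = mat 1"
  and beta_adj_gamma: "x \<in> {0..l} \<Longrightarrow> \<beta> x ** adj (\<gamma> x) = 0"
  and gamma_adj_beta: "x \<in> {0..l} \<Longrightarrow> \<gamma> x ** adj (\<beta> x) = 0"
  and gamma_adj_u: "x \<in> {0..l} \<Longrightarrow> \<gamma> x ** adj (u x 0) = OI"
proof -
  assume x: "x \<in> {0..l}"
  have *: "(A ** u x 0) ** (adj (u x 0) ** B) = A ** B" for A :: "complex^('m1+'m2)^'a" and B :: "complex^'b^('m1+'m2)"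
    by (metis adj_u0_mult_u0(2)[OF x] matrix_mul_assoc matrix_mul_rid)
  show "\<gamma> x ** adj (\<gamma> x) = mat 1" "\<beta> x ** adj (\<beta> x) = mat 1" "\<beta> x ** adj (\<gamma> x) = 0" "\<gamma> x ** adj (\<beta> x) = 0"
    by (simp_all add: gamma_def beta_def adj_mult * I0_adj_I0 OI_adj_OI I0_adj_OI OI_adj_I0)
  show "\<gamma> x ** adj (u x 0) = OI"
    by (metis adj_u0_mult_u0(2)[OF x] gamma_def matrix_mul_assoc matrix_mul_rid)
qed

lemma adj_beta_beta: "x \<in> {0..l} \<Longrightarrow> adj (\<beta> x) ** \<beta> x + adj (\<gamma> x) ** \<gamma> x = mat 1"
proof -
  assume x: "x \<in> {0..l}"
  have "adj (\<beta> x) ** \<beta> x + adj (\<gamma> x) ** \<gamma> x = adj (u x 0) ** (adj I0 ** I0 + adj OI ** OI) ** u x 0"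
    by (simp add: gamma_def beta_def adj_mult bounded_bilinear.add_right[OF bounded_bilinear_matrix_matrix_mult] bounded_bilinear.add_left[OF bounded_bilinear_matrix_matrix_mult] matrix_mul_assoc)
  then show ?thesis by (simp only: adj_blocks_sum matrix_mul_rid adj_u0_mult_u0[OF x])
qed

lemma lip_ad_beta: "lip_ad l \<beta> (\<lambda>x. v x ** \<gamma> x)"
proof -
  have "I0 ** (dirac_matrix (v x) 0 ** u x 0) = v x ** \<gamma> x" for x
    by (rule matrix_vector_mult_eqI)
       (simp add: gamma_def matrix_vector_mul_assoc[symmetric] I0_mult_vec OI_mult_vec vtop_dirac)
  then show ?thesis
    using lip_ad_linear[OF bounded_bilinear.bounded_linear_right[OF bounded_bilinear_matrix_matrix_mult, of I0] lip_ad_u[of 0]]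
    by (simp add: beta_def[abs_def])
qed

lemma lip_ad_gamma: "lip_ad l \<gamma> (\<lambda>x. - (adj (v x) ** \<beta> x))"
proof -
  have "OI ** (dirac_matrix (v x) 0 ** u x 0) = - (adj (v x) ** \<beta> x)" for x
    by (rule matrix_vector_mult_eqI)
       (simp add: beta_def matrix_vector_mul_assoc[symmetric] I0_mult_vec OI_mult_vec vbot_dirac matrix_vector_mult_minus_left)
  then show ?thesis
    using lip_ad_linear[OF bounded_bilinear.bounded_linear_right[OF bounded_bilinear_matrix_matrix_mult, of OI] lip_ad_u[of 0]]
    by (simp add: gamma_def[abs_def])
qed

lemma AE_in_interval: "AE x in leb l. x \<in> {0..l}"
  by (rule AE_space_lebesgue_on)

text \<open>Multiply \<open>\<beta>' = v \<gamma>\<close> from the right by the adjoint of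
  \<open>\<gamma>\<close> and use \<open>gamma_adj_gamma\<close>.\<close>

lemma potential_from_beta_gamma:
  "AE x in leb l. \<exists>D. (\<beta> has_vector_derivative D) (at x within {0..l}) \<and> v x = D ** adj (\<gamma> x)"
  using lip_adD_AE[OF lip_ad_beta] AE_in_interval
proof eventually_elim
  case (elim x)
  then show ?case
    by (intro exI[of _ "v x ** \<gamma> x"]) (simp add: matrix_mul_assoc[symmetric] gamma_adj_gamma)
qed

end

lemma lip_ad_exp: "lip_ad l (\<lambda>x. exp (a * of_real x)) (\<lambda>x. a * exp (a * of_real x) :: complex)"
proof (rule lip_ad_C1)
  fix x
  show "((\<lambda>x. exp (a * of_real x)) has_vector_derivative a * exp (a * of_real x)) (at x within {0..l})"
    by (rule has_vector_derivative_real_field) (auto intro!: derivative_eq_intros)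
qed (intro continuous_intros)

lemma inner_self_norm: "(x::'a::real_inner) \<bullet> x = (norm x)\<^sup>2"
  by (simp add: power2_norm_eq_inner)

lemma lip_ad_norm_square:
  fixes f :: "real \<Rightarrow> complex ^ 'p::finite"
  assumes "lip_ad l f f'"
  shows "lip_ad l (\<lambda>x. (norm (f x))\<^sup>2) (\<lambda>x. 2 * Re (cip (f x) (f' x)))"
  using lip_ad_bilinear[OF bounded_bilinear_inner assms assms]
  by (simp add: inner_self_norm Re_cip inner_commute)

lemma smult_matrix_combination:
  fixes A :: "complex ^ 'q::finite ^ 'p::finite"
  shows "e *s (A *v w + - (A *v w')) + (a * e) *s (A *v y) = e *s (A *v (w - w' + a *s y))"
  by (simp add: matrix_vector_mult_diff_distrib matrix_vector_right_distrib matrix_vector_mult_smult)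

lemma Re_cip_smult_self: "Re (cip x (k *s x + w)) = Re k * (norm x)\<^sup>2 + Re (cip x w)"
proof -
  have "cip x (k *s x + w) = k * of_real ((norm x)\<^sup>2) + cip x w"
    by (simp only: cip_add_right cip_scale_right cip_self)
  then show ?thesis by (simp del: of_real_power)
qed

section \<open>Solutions in the frame of the system at z = 0\<close>

context dirac_system begin

lemma lip_ad_u_vec: "lip_ad l (\<lambda>x. u x z *v c) (\<lambda>x. dirac_matrix (v x) z *v (u x z *v c))"
  using lip_ad_linear[OF bounded_linear_matrix_vector_left[of c] lip_ad_u[of z]]
  by (simp only: matrix_vector_mul_assoc)

definition fsol :: "complex \<Rightarrow> complex ^ ('m1 + 'm2) \<Rightarrow> real \<Rightarrow> complex ^ 'm2" where
  "fsol z c x = exp (- \<i> * z * of_real x) *s vbot (u x z *v c)"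

text \<open>Variation of constants: the solution in the frame of \<open>u x 0\<close>. The
  exponential shifts the eigenvalues of \<open>\<i> z j\<close> to 0 and \<open>- 2 \<i> z\<close>,
  so that \<open>y' = - 2 \<i> z adj \<gamma> \<gamma> y\<close> and the potential enters through
  \<open>\<gamma>\<close> alone.\<close>

definition ysol :: "complex \<Rightarrow> complex ^ ('m1 + 'm2) \<Rightarrow> real \<Rightarrow> complex ^ ('m1 + 'm2)" where
  "ysol z c x = exp (- \<i> * z * of_real x) *s (adj (u x 0) *v (u x z *v c))"

lemma fsol_eq: "x \<in> {0..l} \<Longrightarrow> fsol z c x = \<gamma> x *v ysol z c x"
  by (simp add: fsol_def ysol_def matrix_vector_mult_smult matrix_vector_mul_assoc[of "\<gamma> x"] gamma_adj_u OI_mult_vec)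

lemma ysol_0: "ysol z c 0 = c"
  by (simp add: ysol_def u_0 adj_mat mat_vector_mult)

lemma adj_gamma_mult: "adj (\<gamma> x) *v b = adj (u x 0) *v vjoin 0 b"
  by (simp add: gamma_def adj_mult matrix_vector_mul_assoc[symmetric] adj_OI_mult)

lemma lip_ad_ysol: "lip_ad l (ysol z c) (\<lambda>x. (- 2 * \<i> * z) *s (adj (\<gamma> x) *v fsol z c x))"
proof -
  define a where "a = - \<i> * z"
  define Y where "Y x = u x z *v c" for x
  have 1: "lip_ad l (\<lambda>x. adj (u x 0)) (\<lambda>x. adj (dirac_matrix (v x) 0 ** u x 0))"
    by (rule lip_ad_linear[OF bounded_linear_adj lip_ad_u])
  have 2: "lip_ad l (\<lambda>x. adj (u x 0) *v Y x)
     (\<lambda>x. adj (u x 0) *v (dirac_matrix (v x) z *v Y x) + adj (dirac_matrix (v x) 0 ** u x 0) *v Y x)"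
    unfolding Y_def by (rule lip_ad_bilinear[OF bounded_bilinear_matrix_vector_mult 1 lip_ad_u_vec])
  have 3: "lip_ad l (\<lambda>x. exp (a * of_real x) *s (adj (u x 0) *v Y x))
     (\<lambda>x. exp (a * of_real x) *s (adj (u x 0) *v (dirac_matrix (v x) z *v Y x) + adj (dirac_matrix (v x) 0 ** u x 0) *v Y x)
       + (a * exp (a * of_real x)) *s (adj (u x 0) *v Y x))"
    by (rule lip_ad_bilinear[OF bounded_bilinear_smult lip_ad_exp 2])
  have E: "exp (a * of_real x) *s (adj (u x 0) *v (dirac_matrix (v x) z *v Y x) + adj (dirac_matrix (v x) 0 ** u x 0) *v Y x)
       + (a * exp (a * of_real x)) *s (adj (u x 0) *v Y x) = (- 2 * \<i> * z) *s (adj (\<gamma> x) *v fsol z c x)" for x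
  proof -
    have "adj (dirac_matrix (v x) 0 ** u x 0) = - (adj (u x 0) ** dirac_matrix (v x) 0)"
      using adj_dirac[of "v x" 0] by (simp add: adj_mult matrix_mult_minus_right)
    then have "adj (dirac_matrix (v x) 0 ** u x 0) *v Y x = - (adj (u x 0) *v (dirac_matrix (v x) 0 *v Y x))"
      by (simp add: matrix_vector_mult_minus_left matrix_vector_mul_assoc[symmetric])
    then have "exp (a * of_real x) *s (adj (u x 0) *v (dirac_matrix (v x) z *v Y x) + adj (dirac_matrix (v x) 0 ** u x 0) *v Y x)
       + (a * exp (a * of_real x)) *s (adj (u x 0) *v Y x)
       = exp (a * of_real x) *s (adj (u x 0) *v (dirac_matrix (v x) z *v Y x - dirac_matrix (v x) 0 *v Y x + a *s Y x))"
      by (simp only: smult_matrix_combination)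
    also have "dirac_matrix (v x) z *v Y x - dirac_matrix (v x) 0 *v Y x + a *s Y x = vjoin 0 ((2 * a) *s vbot (Y x))"
      by (rule block_vec_eqI)
         (simp_all add: vtop_add vtop_diff vbot_add vbot_diff vtop_smult vbot_smult vtop_dirac vbot_dirac a_def vec_eq_iff)
    also have "exp (a * of_real x) *s (adj (u x 0) *v vjoin 0 ((2 * a) *s vbot (Y x)))
       = (2 * a) *s (adj (\<gamma> x) *v (exp (a * of_real x) *s vbot (Y x)))"
      by (simp only: adj_gamma_mult[symmetric] matrix_vector_mult_smult smult_smult mult.commute)
    also have "2 * a = - 2 * \<i> * z" by (simp add: a_def)
    finally show ?thesis by (simp only: fsol_def a_def Y_def)
  qed
  have eq: "ysol z c = (\<lambda>x. exp (a * of_real x) *s (adj (u x 0) *v Y x))"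
    by (simp add: fun_eq_iff ysol_def a_def Y_def)
  show ?thesis unfolding eq using 3 unfolding E .
qed

lemma continuous_on_fsol: "continuous_on {0..l} (fsol z c)"
proof -
  have "continuous_on {0..l} (\<lambda>x. exp (- \<i> * z * of_real x))" by (intro continuous_intros)
  then show ?thesis
    unfolding fsol_def[abs_def]
    by (rule bounded_bilinear.continuous_on[OF bounded_bilinear_smult _
          bounded_linear.continuous_on[OF bounded_linear_vbot lip_ad_continuous_on[OF lip_ad_u_vec]]])
qed

lemma ysol_integral:
  assumes "x \<in> {0..l}"
  shows "ysol z c x = c + (- 2 * \<i> * z) *s (LINT t|leb x. adj (\<gamma> t) *v fsol z c t)"
    "integrable (leb x) (\<lambda>t. adj (\<gamma> t) *v fsol z c t)"
proof -
  have "continuous_on {0..l} (\<lambda>t. adj (\<gamma> t) *v fsol z c t)"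
    by (rule bounded_bilinear.continuous_on[OF bounded_bilinear_matrix_vector_mult
          bounded_linear.continuous_on[OF bounded_linear_adj lip_ad_continuous_on[OF lip_ad_gamma]] continuous_on_fsol])
  then have "continuous_on {0..x} (\<lambda>t. adj (\<gamma> t) *v fsol z c t)"
    by (rule continuous_on_subset) (use assms in auto)
  then show int: "integrable (leb x) (\<lambda>t. adj (\<gamma> t) *v fsol z c t)"
    by (intro L2_on_integrable L2_on_continuous)
  have 1: "(LINT t|leb x. (- 2 * \<i> * z) *s (adj (\<gamma> t) *v fsol z c t)) = ysol z c x - ysol z c 0"
    by (rule lip_ad_lebesgue_integral[OF lip_ad_ysol[of z c]]) (use assms in auto)
  have 2: "(LINT t|leb x. (- 2 * \<i> * z) *s (adj (\<gamma> t) *v fsol z c t))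
      = (- 2 * \<i> * z) *s (LINT t|leb x. adj (\<gamma> t) *v fsol z c t)"
    by (rule integral_bounded_linear[OF bounded_bilinear.bounded_linear_right[OF bounded_bilinear_smult] int])
  have "ysol z c x = c + (ysol z c x - ysol z c 0)" by (simp add: ysol_0)
  also have "ysol z c x - ysol z c 0 = (- 2 * \<i> * z) *s (LINT t|leb x. adj (\<gamma> t) *v fsol z c t)"
    by (rule trans[OF 1[symmetric] 2])
  finally show "ysol z c x = c + (- 2 * \<i> * z) *s (LINT t|leb x. adj (\<gamma> t) *v fsol z c t)" .
qed

lemma norm_gamma_mult_le: "x \<in> {0..l} \<Longrightarrow> norm (\<gamma> x *v y) \<le> norm y"
proof -
  assume x: "x \<in> {0..l}"
  have "cip (u x 0 *v y) (u x 0 *v y) = cip y (adj (u x 0) *v (u x 0 *v y))" by (rule cip_adj')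
  also have "\<dots> = cip y y" by (simp only: matrix_vector_mul_assoc adj_u0_mult_u0(1)[OF x] matrix_vector_mul_lid)
  finally have "(norm (u x 0 *v y))\<^sup>2 = (norm y)\<^sup>2" by (simp only: cip_self of_real_eq_iff)
  then have 1: "norm (u x 0 *v y) = norm y"
    using norm_ge_zero[of y] norm_ge_zero[of "u x 0 *v y"] by (simp only: power2_eq_iff_nonneg)
  have 2: "\<gamma> x *v y = vbot (u x 0 *v y)"
    by (simp only: gamma_def matrix_vector_mul_assoc[symmetric] OI_mult_vec)
  have "(norm (vbot (u x 0 *v y)))\<^sup>2 \<le> (norm (u x 0 *v y))\<^sup>2"
    using norm_blocks[of "u x 0 *v y"] by simp
  then have "norm (vbot (u x 0 *v y)) \<le> norm (u x 0 *v y)"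
    by (rule power2_le_imp_le) simp
  then show ?thesis by (simp only: 1 2)
qed

text \<open>The derivative of the squared norm is \<open>4 * Im z\<close> times the squared norm of
  \<open>fsol\<close>. For \<open>Im z \<ge> 0\<close> the value at the right end therefore bounds
  the whole solution, with a bound that does not involve z.\<close>

lemma ysol_norm_mono:
  assumes "0 \<le> Im z" "0 \<le> x" "x \<le> y" "y \<le> l"
  shows "norm (ysol z c x) \<le> norm (ysol z c y)"
proof -
  have "(norm (ysol z c x))\<^sup>2 \<le> (norm (ysol z c y))\<^sup>2"
  proof (rule lip_ad_mono[OF lip_ad_norm_square[OF lip_ad_ysol[of z c]] _ assms(2,3,4)])
    show "AE t in leb l. 0 \<le> 2 * Re (cip (ysol z c t) ((- 2 * \<i> * z) *s (adj (\<gamma> t) *v fsol z c t)))"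
      using AE_in_interval
    proof eventually_elim
      case (elim t)
      have "cip (ysol z c t) (adj (\<gamma> t) *v fsol z c t) = cip (\<gamma> t *v ysol z c t) (fsol z c t)"
        by (simp only: cip_adj[of "ysol z c t" "adj (\<gamma> t)"] adj_adj)
      then have "cip (ysol z c t) ((- 2 * \<i> * z) *s (adj (\<gamma> t) *v fsol z c t)) = (- 2 * \<i> * z) * cip (fsol z c t) (fsol z c t)"
        by (simp only: cip_scale_right fsol_eq[OF elim, symmetric])
      also have "Re \<dots> = 2 * Im z * (norm (fsol z c t))\<^sup>2" by (simp add: cip_self del: of_real_power)
      finally show ?case using assms(1) by simp
    qed
  qed
  then show ?thesis by (rule power2_le_imp_le) simp
qed

lemma fsol_norm_le:
  assumes "0 \<le> Im z" "0 \<le> x" "x \<le> y" "y \<le> l"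
  shows "norm (fsol z c x) \<le> norm (ysol z c y)"
  using order_trans[OF norm_gamma_mult_le[of x "ysol z c x"] ysol_norm_mono[OF assms, of c]] fsol_eq[of x z c] assms by auto

lemma ysol_terminal:
  assumes "r \<in> {0..l}"
  shows "\<exists>c. ysol z c r = a"
proof (intro exI)
  have "u r z *v (adj (u r (cnj z)) *v w) = w" for w
    by (simp add: matrix_vector_mul_assoc adj_u_mult_u[OF assms])
  moreover have "adj (u r 0) *v (u r 0 *v w) = w" for w
    by (simp add: matrix_vector_mul_assoc adj_u0_mult_u0[OF assms])
  ultimately show "ysol z (exp (\<i> * z * of_real r) *s (adj (u r (cnj z)) *v (u r 0 *v a))) r = a"
    by (simp add: ysol_def matrix_vector_mult_smult smult_smult flip: exp_add)
qed

text \<open>For \<open>Im z > M\<close>, \<open>\<bar>y\<^sub>1\<bar>\<^sup>2 - \<bar>y\<^sub>2\<bar>\<^sup>2\<close> decreases along solutions; if it is nonnegative at \<open>l\<close>, then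
  \<open>\<bar>y\<^sub>2\<bar> \<le> \<bar>y\<^sub>1\<bar>\<close> throughout and \<open>\<bar>y\<^sub>1\<bar>\<close> decays.\<close>

lemma j_form_antimono:
  assumes "Im z \<ge> M" "0 \<le> x" "x \<le> y" "y \<le> l"
  shows "(norm (vtop (u y z *v c)))\<^sup>2 - (norm (vbot (u y z *v c)))\<^sup>2 \<le> (norm (vtop (u x z *v c)))\<^sup>2 - (norm (vbot (u x z *v c)))\<^sup>2"
proof -
  define p where "p x = vtop (u x z *v c)" for x
  define q where "q x = vbot (u x z *v c)" for x
  have p: "lip_ad l p (\<lambda>x. (\<i> * z) *s p x + v x *v q x)"
    using lip_ad_linear[OF bounded_linear_vtop lip_ad_u_vec[of z c]] by (simp add: p_def[abs_def] q_def vtop_dirac)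
  have q: "lip_ad l q (\<lambda>x. (- \<i> * z) *s q x - adj (v x) *v p x)"
    using lip_ad_linear[OF bounded_linear_vbot lip_ad_u_vec[of z c]] by (simp add: p_def q_def[abs_def] vbot_dirac)
  have "lip_ad l (\<lambda>x. (norm (p x))\<^sup>2 + - (norm (q x))\<^sup>2)
    (\<lambda>x. 2 * Re (cip (p x) ((\<i> * z) *s p x + v x *v q x)) + - (2 * Re (cip (q x) ((- \<i> * z) *s q x - adj (v x) *v p x))))"
    by (intro lip_ad_add lip_ad_norm_square p lip_ad_linear[OF bounded_linear_minus[OF bounded_linear_ident]] q)
  moreover have "AE x in leb l. 2 * Re (cip (p x) ((\<i> * z) *s p x + v x *v q x)) + - (2 * Re (cip (q x) ((- \<i> * z) *s q x - adj (v x) *v p x))) \<le> 0"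
    using AE_interior
  proof eventually_elim
    case (elim x)
    have "Re (cip (q x) (adj (v x) *v p x)) = Re (cip (p x) (v x *v q x))"
    proof -
      have "cip (q x) (adj (v x) *v p x) = cip (v x *v q x) (p x)" by (simp only: cip_adj[of "q x" "adj (v x)"] adj_adj)
      also have "\<dots> = cnj (cip (p x) (v x *v q x))" by (rule cip_cnj[symmetric])
      finally show ?thesis by simp
    qed
    moreover have "Re (cip (q x) ((- \<i> * z) *s q x + - (adj (v x) *v p x))) = Im z * (norm (q x))\<^sup>2 - Re (cip (q x) (adj (v x) *v p x))"
      by (simp only: Re_cip_smult_self cip_minus_right) simp
    moreover have "Re (cip (p x) ((\<i> * z) *s p x + v x *v q x)) = - (Im z * (norm (p x))\<^sup>2) + Re (cip (p x) (v x *v q x))"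
      by (simp only: Re_cip_smult_self) simp
    ultimately have "2 * Re (cip (p x) ((\<i> * z) *s p x + v x *v q x)) + - (2 * Re (cip (q x) ((- \<i> * z) *s q x - adj (v x) *v p x)))
      = - (2 * (Im z * ((norm (p x))\<^sup>2 + (norm (q x))\<^sup>2))) + 4 * Re (cip (p x) (v x *v q x))"
      by (simp only: diff_conv_add_uminus[of "(- \<i> * z) *s q x"] distrib_left[of "Im z"], simp add: algebra_simps)
    moreover have "Re (cip (p x) (v x *v q x)) \<le> norm (p x) * norm (v x *v q x)"
      by (rule order_trans[OF complex_Re_le_cmod norm_cip_le])
    moreover have "\<dots> \<le> norm (p x) * (M * norm (q x))"
      by (intro mult_left_mono norm_v_mult elim) auto
    moreover have "2 * (norm (p x) * (M * norm (q x))) \<le> M * ((norm (p x))\<^sup>2 + (norm (q x))\<^sup>2)"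
      using mult_left_mono[OF sum_squares_bound[of "norm (p x)" "norm (q x)"], of M] M_pos by (simp add: algebra_simps)
    moreover have "M * ((norm (p x))\<^sup>2 + (norm (q x))\<^sup>2) \<le> Im z * ((norm (p x))\<^sup>2 + (norm (q x))\<^sup>2)"
      using assms(1) by (intro mult_right_mono) auto
    ultimately show ?case by linarith
  qed
  ultimately have "(norm (p y))\<^sup>2 + - (norm (q y))\<^sup>2 \<le> (norm (p x))\<^sup>2 + - (norm (q x))\<^sup>2"
    by (rule lip_ad_antimono) (use assms in auto)
  then show ?thesis by (simp add: p_def q_def)
qed

text \<open>The upper half decays like exp (- (Im z - M) x), because the potential costs at most the
  rate \<open>M\<close>. The factor of modulus exp (Im z x) in \<open>fsol\<close> then leaves exp
  (M x): a bound uniform in z, on which the asymptotics of Weyl functions rest.\<close>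

lemma weyl_solution_decay:
  assumes z: "Im z > M" and wl: "norm (vbot (u l z *v c)) \<le> norm (vtop (u l z *v c))" and x: "x \<in> {0..l}"
  shows "norm (fsol z c x) \<le> exp (M * x) * norm (vtop c)"
proof -
  define p where "p x = vtop (u x z *v c)" for x
  define q where "q x = vbot (u x z *v c)" for x
  have qp: "norm (q x) \<le> norm (p x)" if "x \<in> {0..l}" for x
  proof -
    have "0 \<le> (norm (p l))\<^sup>2 - (norm (q l))\<^sup>2" using wl by (simp add: p_def q_def power_mono)
    also have "\<dots> \<le> (norm (p x))\<^sup>2 - (norm (q x))\<^sup>2"
      unfolding p_def q_def by (rule j_form_antimono) (use that z in auto)
    finally have "(norm (q x))\<^sup>2 \<le> (norm (p x))\<^sup>2" by simp
    then show ?thesis by (rule power2_le_imp_le) simp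
  qed
  have p: "lip_ad l p (\<lambda>x. (\<i> * z) *s p x + v x *v q x)"
    using lip_ad_linear[OF bounded_linear_vtop lip_ad_u_vec[of z c]] by (simp add: p_def[abs_def] q_def vtop_dirac)
  \<comment> \<open>The squared norm of \<open>p\<close> has derivative at most \<open>- k\<close>
    times itself, since \<open>q\<close> is dominated by \<open>p\<close>.\<close>
  define k where "k = 2 * (Im z - M)"
  have ek: "lip_ad l (\<lambda>x. exp (k * x)) (\<lambda>x. k * exp (k * x))"
  proof (rule lip_ad_C1)
    show "((\<lambda>x. exp (k * x)) has_vector_derivative k * exp (k * x)) (at x within {0..l})" for x
      by (rule has_real_derivative_iff_has_vector_derivative[THEN iffD1]) (auto intro!: derivative_eq_intros)
  qed (intro continuous_intros)
  have "(norm (p x))\<^sup>2 * exp (k * x) \<le> (norm (p 0))\<^sup>2 * exp (k * 0)"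
  proof (rule lip_ad_antimono[OF lip_ad_bilinear[OF bounded_bilinear_mult lip_ad_norm_square[OF p] ek]])
    show "AE x in leb l. (norm (p x))\<^sup>2 * (k * exp (k * x)) + 2 * Re (cip (p x) ((\<i> * z) *s p x + v x *v q x)) * exp (k * x) \<le> 0"
      using AE_interior
    proof eventually_elim
      case (elim x)
      have "Re (cip (p x) ((\<i> * z) *s p x + v x *v q x)) = - (Im z * (norm (p x))\<^sup>2) + Re (cip (p x) (v x *v q x))"
        by (simp only: Re_cip_smult_self) simp
      moreover have "Re (cip (p x) (v x *v q x)) \<le> norm (p x) * norm (v x *v q x)"
        by (rule order_trans[OF complex_Re_le_cmod norm_cip_le])
      moreover have "norm (p x) * norm (v x *v q x) \<le> norm (p x) * (M * norm (p x))"
      proof (rule mult_left_mono)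
        have "norm (v x *v q x) \<le> M * norm (q x)" by (rule norm_v_mult[OF elim])
        also have "\<dots> \<le> M * norm (p x)" using qp[of x] elim M_pos by (intro mult_left_mono) auto
        finally show "norm (v x *v q x) \<le> M * norm (p x)" .
      qed simp
      moreover have "norm (p x) * (M * norm (p x)) = M * (norm (p x))\<^sup>2"
        by (simp add: power2_eq_square)
      moreover have "k * (norm (p x))\<^sup>2 = 2 * (Im z * (norm (p x))\<^sup>2) - 2 * (M * (norm (p x))\<^sup>2)"
        by (simp add: k_def left_diff_distrib)
      ultimately have "k * (norm (p x))\<^sup>2 + 2 * Re (cip (p x) ((\<i> * z) *s p x + v x *v q x)) \<le> 0"
        by linarith
      then have "(k * (norm (p x))\<^sup>2 + 2 * Re (cip (p x) ((\<i> * z) *s p x + v x *v q x))) * exp (k * x) \<le> 0"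
        by (intro mult_nonpos_nonneg) auto
      moreover have "a * (k * e) + b * e = (k * a + b) * e" for a b e :: real
        by (simp add: algebra_simps)
      ultimately show ?case by (simp only:)
    qed
  qed (use x in auto)
  moreover have ek2: "exp (k * x) = (exp ((Im z - M) * x))\<^sup>2"
  proof -
    have "k * x = 2 * ((Im z - M) * x)" by (simp add: k_def)
    then show ?thesis by (simp only: exp_double)
  qed
  moreover have "p 0 = vtop c" by (simp add: p_def u_0)
  ultimately have "(norm (p x) * exp ((Im z - M) * x))\<^sup>2 \<le> (norm (vtop c))\<^sup>2"
    by (simp only: power_mult_distrib mult_zero_right exp_zero mult_1_right)
  then have "norm (p x) * exp ((Im z - M) * x) \<le> norm (vtop c)"
    by (rule power2_le_imp_le) simp
  moreover have "norm (q x) * exp ((Im z - M) * x) \<le> norm (p x) * exp ((Im z - M) * x)"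
    by (rule mult_right_mono[OF qp[OF x]]) simp
  ultimately have le: "norm (q x) * exp ((Im z - M) * x) \<le> norm (vtop c)" by linarith
  have eM: "exp ((Im z - M) * x) * exp (M * x) = exp (Im z * x)"
    unfolding exp_add[symmetric] by (simp add: left_diff_distrib)
  have "norm (fsol z c x) = norm (q x) * exp (Im z * x)"
  proof -
    have "norm (exp (- \<i> * z * of_real x)) = exp (Im z * x)" by (simp add: norm_exp_eq_Re)
    then show ?thesis by (simp only: fsol_def q_def norm_smult mult.commute)
  qed
  also have "\<dots> = norm (q x) * exp ((Im z - M) * x) * exp (M * x)"
    by (simp only: eM mult.assoc)
  also have "\<dots> \<le> norm (vtop c) * exp (M * x)"
    by (rule mult_right_mono[OF le]) simp
  finally show ?thesis by (simp only: mult.commute)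
qed

end

section \<open>The similarity operator\<close>

lemma borel_representative:
  fixes f :: "'a::euclidean_space \<Rightarrow> 'b::euclidean_space"
  assumes f: "f \<in> borel_measurable (lebesgue_on S)" and S: "S \<in> sets lebesgue"
  obtains g where "g \<in> borel_measurable borel" "AE x in lebesgue. x \<in> S \<longrightarrow> f x = g x"
proof -
  define h where "h x = (if x \<in> S then f x else 0)" for x
  have hm: "h \<in> borel_measurable lebesgue"
    unfolding h_def[abs_def] by (rule borel_measurable_if_I[OF f S])
  have "\<exists>g\<in>borel_measurable lborel. AE x in lborel. h x \<bullet> b = g x" for b
  proof (rule completion_ex_borel_measurable_real)
    show "(\<lambda>x. h x \<bullet> b) \<in> borel_measurable (completion lborel)"
      by (intro borel_measurable_linear[OF bounded_linear_inner_left] hm)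
  qed
  then obtain g where g: "\<And>b. g b \<in> borel_measurable lborel" "\<And>b. AE x in lborel. h x \<bullet> b = g b x"
    by metis
  show thesis
  proof
    show "(\<lambda>x. \<Sum>b\<in>Basis. g b x *\<^sub>R b) \<in> borel_measurable borel"
      using g(1) by (intro borel_measurable_sum borel_measurable_scaleR) auto
    have "AE x in lborel. \<forall>b\<in>Basis. h x \<bullet> b = g b x"
      using g(2) by (simp add: AE_finite_all)
    then have "AE x in lebesgue. \<forall>b\<in>Basis. h x \<bullet> b = g b x" by (rule AE_completion)
    then show "AE x in lebesgue. x \<in> S \<longrightarrow> f x = (\<Sum>b\<in>Basis. g b x *\<^sub>R b)"
    proof eventually_elim
      case (elim x)
      have "(\<Sum>b\<in>Basis. g b x *\<^sub>R b) = (\<Sum>b\<in>Basis. (h x \<bullet> b) *\<^sub>R b)"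
        by (rule sum.cong) (use elim in auto)
      then show ?case by (simp add: euclidean_representation h_def)
    qed
  qed
qed

text \<open>A Borel kernel is measurable for the product of the two Lebesgue sigma-algebras, which a
  Lebesgue measurable function on the square need not be.\<close>

lemma bker_borel:
  assumes "(\<lambda>(x, t). \<kappa> x t) \<in> borel_measurable borel" and "\<And>x t. x \<in> {0..r} \<Longrightarrow> t \<in> {0..r} \<Longrightarrow> norm (\<kappa> x t) \<le> C"
  shows "bker r \<kappa>"
  unfolding bker_def
proof
  have "(\<lambda>p. (fst p, snd p)) \<in> (leb r \<Otimes>\<^sub>M leb r) \<rightarrow>\<^sub>M (borel \<Otimes>\<^sub>M borel)"
    by (intro measurable_Pair measurable_compose[OF measurable_fst measurable_id_lebesgue_on]
        measurable_compose[OF measurable_snd measurable_id_lebesgue_on])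
  then have "(\<lambda>p. p) \<in> (leb r \<Otimes>\<^sub>M leb r) \<rightarrow>\<^sub>M borel"
    by (simp add: borel_prod)
  from measurable_compose[OF this assms(1)]
  show "(\<lambda>(x, t). \<kappa> x t) \<in> borel_measurable (leb r \<Otimes>\<^sub>M leb r)" by simp
qed (use assms(2) in blast)

text \<open>Gronwall's inequality bounds the inverse of identity plus Volterra operator in the
  supremum norm. With \<open>a = 0\<close> this is uniqueness for Volterra equations; with the
  kernel of \<open>E\<close> it carries bounds from \<open>E q\<close> over to
  \<open>q\<close>.\<close>

lemma volterra_bound:
  fixes \<kappa> :: "real \<Rightarrow> real \<Rightarrow> complex ^ 'p::finite ^ 'p"
  assumes \<kappa>: "bker r \<kappa>"
  obtains C where "C > 0"
    "\<And>q a. L2_on {0..r} q \<Longrightarrow> 0 \<le> a \<Longrightarrow> (AE x in leb r. norm (q x + vop r (lowk \<kappa>) q x) \<le> a) \<Longrightarrow>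
       AE x in leb r. norm (q x) \<le> a * exp (C * x)"
proof -
  obtain K where K: "K > 0" "\<And>A x. norm ((A::complex^'p^'p) *v x) \<le> norm A * norm x * K"
    by (rule bounded_matrix_vector) blast
  obtain C where C: "C \<ge> 0" "\<And>x t. x \<in> {0..r} \<Longrightarrow> t \<in> {0..r} \<Longrightarrow> norm (\<kappa> x t) \<le> C"
    using bkerD_bound[OF \<kappa>] by blast
  \<comment> \<open>The summand 1 makes the constant positive, as \<open>gronwall_AE\<close>
    demands.\<close>
  define D where "D = C * K + 1"
  have "D > 0" using C(1) K(1) by (simp add: D_def add_nonneg_pos)
  show thesis
  proof (rule that[OF \<open>D > 0\<close>])
    fix q :: "'p vfun" and a :: real
    assume q: "L2_on {0..r} q" and a: "0 \<le> a" and le: "AE x in leb r. norm (q x + vop r (lowk \<kappa>) q x) \<le> a"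
    have iq: "integrable (leb r) (\<lambda>x. norm (q x))" using L2_on_integrable[OF q] by auto
    show "AE x in leb r. norm (q x) \<le> a * exp (D * x)"
    proof (rule gronwall_AE[OF iq _ \<open>D > 0\<close>])
      show "AE x in leb r. norm (q x) \<le> a + D * (LINT t|leb x. norm (q t))"
        using le AE_space_lebesgue_on[of "{0..r}"]
      proof eventually_elim
        case (elim x)
        then have x: "x \<in> {0..r}" by simp
        have sub: "{0..x} \<subseteq> {0..r}" using x by auto
        have iqx: "integrable (leb x) (\<lambda>t. norm (q t))"
          by (rule integrable_lebesgue_on_subset[OF iq sub]) auto
        have int: "integrable (leb x) (\<lambda>t. \<kappa> x t *v q t)"
          by (rule integrable_lebesgue_on_subset[OF bker_section_integrable[OF \<kappa> L2_on_integrable[OF q] x] sub]) auto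
        have "norm (vop r (lowk \<kappa>) q x) \<le> (LINT t|leb x. D * norm (q t))"
          unfolding vop_lowk[OF x]
        proof (rule Bochner_Integration.integral_norm_bound_integral[OF int])
          show "integrable (leb x) (\<lambda>t. D * norm (q t))" using iqx by auto
          fix t assume "t \<in> space (leb x)"
          then have t: "t \<in> {0..r}" using x by auto
          have "norm (\<kappa> x t *v q t) \<le> norm (\<kappa> x t) * norm (q t) * K" by (rule K)
          also have "\<dots> \<le> C * norm (q t) * K"
            using C(2)[OF x t] K(1) by (intro mult_right_mono) auto
          also have "\<dots> \<le> D * norm (q t)" by (simp add: D_def distrib_right)
          finally show "norm (\<kappa> x t *v q t) \<le> D * norm (q t)" .
        qed
        then have "norm (vop r (lowk \<kappa>) q x) \<le> D * (LINT t|leb x. norm (q t))" by simp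
        moreover have "norm (q x) \<le> norm (q x + vop r (lowk \<kappa>) q x) + norm (vop r (lowk \<kappa>) q x)"
          using norm_triangle_ineq4[of "q x + vop r (lowk \<kappa>) q x" "vop r (lowk \<kappa>) q x"] by simp
        ultimately show ?case using elim by linarith
      qed
    qed
  qed
qed

lemma L2_on_cutoff:
  assumes "L2_on {0..r} f" "r \<le> l"
  shows "L2_on {0..l} (cutoff r f)"
proof -
  have eq: "cutoff r f = (\<lambda>x. if x \<in> {0..r} then f x else 0)" by (simp add: cutoff_def fun_eq_iff)
  have f: "f \<in> borel_measurable (leb r)" "integrable (leb r) (\<lambda>x. (norm (f x))\<^sup>2)"
    using assms by (simp_all add: L2_on_def)
  have m: "cutoff r f \<in> borel_measurable lebesgue"
    unfolding eq by (rule borel_measurable_if_I[OF f(1)]) simp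
  have "integrable lebesgue (\<lambda>x. indicat_real {0..r} x *\<^sub>R (norm (f x))\<^sup>2)"
    using f(2) by (simp add: integrable_restrict_space)
  also have "(\<lambda>x. indicat_real {0..r} x *\<^sub>R (norm (f x))\<^sup>2) = (\<lambda>x. indicat_real {0..l} x *\<^sub>R (norm (cutoff r f x))\<^sup>2)"
    using assms(2) by (auto simp: cutoff_def fun_eq_iff indicator_def)
  finally have "integrable (leb l) (\<lambda>x. (norm (cutoff r f x))\<^sup>2)"
    by (simp add: integrable_restrict_space)
  then show ?thesis
    using measurable_restrict_space1[OF m] by (simp add: L2_on_def)
qed

lemma lebesgue_integral_cong_AE_subset:
  fixes f :: "real \<Rightarrow> 'a::euclidean_space"
  assumes "AE x in lebesgue_on S. f x = g x" "T \<subseteq> S" "S \<in> sets lebesgue" "T \<in> sets lebesgue"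
    "f \<in> borel_measurable (lebesgue_on T)" "g \<in> borel_measurable (lebesgue_on T)"
  shows "(LINT x|lebesgue_on T. f x) = (LINT x|lebesgue_on T. g x)"
  by (rule integral_cong_AE[OF assms(5,6) AE_lebesgue_on_subset[OF assms(1-4)]])

text \<open>\<open>Jop\<close> and \<open>Lop\<close> with \<open>g = \<gamma>\<close> are \<open>\<i> A\<close> and \<open>\<i> K\<close>.\<close>

definition Jop :: "real \<Rightarrow> 'p::finite vfun \<Rightarrow> 'p vfun" where
  "Jop r = vop r (lowk (\<lambda>x t. mat 1))"

definition Lop :: "real \<Rightarrow> (real \<Rightarrow> complex ^ 'q::finite ^ 'p::finite) \<Rightarrow> 'p vfun \<Rightarrow> 'p vfun" where
  "Lop r g = vop r (lowk (\<lambda>x t. g x ** adj (g t)))"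

lemma Jop_eq: "x \<in> {0..r} \<Longrightarrow> Jop r f x = (LINT t|leb x. f t)"
  by (simp add: Jop_def vop_lowk)

lemma bker_J: "bker r (lowk (\<lambda>x t. mat 1))"
  by (rule bker_lowk[OF bker_const])

lemma Jop_L2: "L2_on {0..r} f \<Longrightarrow> L2_on {0..r} (Jop r f)"
  unfolding Jop_def by (rule vop_L2[OF bker_J])

lemma borel_measurable_lebesgue_on_AE_cong:
  fixes f g :: "'a::euclidean_space \<Rightarrow> 'b::euclidean_space"
  assumes f: "f \<in> borel_measurable (lebesgue_on S)" and eq: "AE x in lebesgue_on S. g x = f x" and S: "S \<in> sets lebesgue"
  shows "g \<in> borel_measurable (lebesgue_on S)"
proof (rule borel_measurable_if_D)
  have "AE x in lebesgue. x \<in> S \<longrightarrow> g x = f x"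
    using eq S by (subst (asm) AE_restrict_space_iff) auto
  then have ae: "AE x in lebesgue. (if x \<in> S then f x else 0) = (if x \<in> S then g x else 0)"
    by eventually_elim auto
  show "(\<lambda>x. if x \<in> S then g x else 0) \<in> borel_measurable lebesgue"
    by (rule borel_measurable_AE[OF borel_measurable_if_I[OF f S] ae])
qed

lemma L2_on_cong:
  assumes "\<And>x. x \<in> S \<Longrightarrow> f x = g x" "L2_on S f"
  shows "L2_on S g"
proof -
  have "f \<in> borel_measurable (lebesgue_on S) \<longleftrightarrow> g \<in> borel_measurable (lebesgue_on S)"
    by (rule measurable_cong) (use assms(1) in auto)
  moreover have "integrable (lebesgue_on S) (\<lambda>x. (norm (f x))\<^sup>2) \<longleftrightarrow> integrable (lebesgue_on S) (\<lambda>x. (norm (g x))\<^sup>2)"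
    by (rule Bochner_Integration.integrable_cong) (use assms(1) in auto)
  ultimately show ?thesis using assms(2) by (simp add: L2_on_def)
qed

text \<open>Operators act on representatives, so this needs an argument: the image of
  \<open>f - g\<close> has norm 0 by boundedness, and additivity is applied to
  \<open>g + (f - g)\<close>.\<close>

lemma bounded_L2_operator_AE_cong:
  assumes T: "bounded_L2_operator S T" and f: "L2_on S f" and g: "L2_on S g"
    and eq: "AE x in lebesgue_on S. f x = g x"
  shows "AE x in lebesgue_on S. T f x = T g x"
proof -
  have d: "L2_on S (\<lambda>x. f x - g x)" by (rule L2_on_diff[OF f g])
  have "(LINT x|lebesgue_on S. (norm (f x - g x))\<^sup>2) = (LINT x|lebesgue_on S. 0)"
  proof (rule integral_cong_AE)
    show "(\<lambda>x. (norm (f x - g x))\<^sup>2) \<in> borel_measurable (lebesgue_on S)"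
      using L2_on_measurable[OF d] by measurable
    show "AE x in lebesgue_on S. (norm (f x - g x))\<^sup>2 = 0" using eq by eventually_elim simp
  qed simp
  then have "L2_norm_on S (\<lambda>x. f x - g x) = 0" by (simp add: L2_norm_on_def)
  moreover obtain C where "L2_norm_on S (T (\<lambda>x. f x - g x)) \<le> C * L2_norm_on S (\<lambda>x. f x - g x)"
    using T d unfolding bounded_L2_operator_def by blast
  ultimately have le: "L2_norm_on S (T (\<lambda>x. f x - g x)) \<le> 0" by simp
  have Td: "L2_on S (T (\<lambda>x. f x - g x))" using T d by (simp add: bounded_L2_operator_def)
  have "0 \<le> (LINT x|lebesgue_on S. (norm (T (\<lambda>x. f x - g x) x))\<^sup>2)" by simp
  with le have "(LINT x|lebesgue_on S. (norm (T (\<lambda>x. f x - g x) x))\<^sup>2) = 0"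
    by (simp add: L2_norm_on_def)
  then have "AE x in lebesgue_on S. (norm (T (\<lambda>x. f x - g x) x))\<^sup>2 = 0"
    using integral_nonneg_eq_0_iff_AE[OF L2_on_square_integrable[OF Td]] by simp
  then have z: "AE x in lebesgue_on S. T (\<lambda>x. f x - g x) x = 0" by eventually_elim simp
  have "AE x in lebesgue_on S. T (\<lambda>t. g t + (f t - g t)) x = T g x + T (\<lambda>x. f x - g x) x"
    using T g d unfolding bounded_L2_operator_def by blast
  then show ?thesis using z by eventually_elim simp
qed

section \<open>A Borel kernel for E and its restrictions to [0,r]\<close>

locale dirac_similarity = dirac_system l M v u
  for l M :: real
    and v :: "real \<Rightarrow> complex ^ 'm2::finite ^ 'm1::finite"
    and u :: "real \<Rightarrow> complex \<Rightarrow> complex ^ ('m1 + 'm2) ^ ('m1 + 'm2)" +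
  fixes E Einv :: "'m2 vfun \<Rightarrow> 'm2 vfun"
  assumes sim: "similarity_operator l u E Einv"
begin

lemma Einv_bounded: "bounded_L2_operator {0..l} Einv"
  and E_Einv: "L2_on {0..l} f \<Longrightarrow> AE x in leb l. E (Einv f) x = f x"
  and Einv_E: "L2_on {0..l} f \<Longrightarrow> AE x in leb l. Einv (E f) x = f x"
  and E_bounded: "bounded_L2_operator {0..l} E"
  using sim by (auto simp: similarity_operator_def L2_inverse_operator_def)

lemma Einv_L2: "L2_on {0..l} f \<Longrightarrow> L2_on {0..l} (Einv f)"
  and E_L2: "L2_on {0..l} f \<Longrightarrow> L2_on {0..l} (E f)"
  using Einv_bounded E_bounded by (auto simp: bounded_L2_operator_def)

definition ker :: "real \<Rightarrow> real \<Rightarrow> complex ^ 'm2 ^ 'm2" where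
  "ker = (SOME k. (\<lambda>(x, t). k x t) \<in> borel_measurable borel \<and>
     (\<exists>C. \<forall>x\<in>{0..l}. \<forall>t\<in>{0..l}. norm (k x t) \<le> C) \<and>
     (\<forall>f. L2_on {0..l} f \<longrightarrow> (AE x in leb l. E f x = f x + (LINT t|leb x. k x t *v f t))))"

text \<open>The kernel in \<open>similarity_operator\<close> is only Lebesgue measurable on the
  square. It is replaced by a Borel representative; by Fubini, for almost every \<open>x\<close> the
  sections agree almost everywhere, which is enough for the integrals.\<close>

lemma ker_exists:
  "\<exists>k. (\<lambda>(x, t). k x t) \<in> borel_measurable borel \<and>
     (\<exists>C. \<forall>x\<in>{0..l}. \<forall>t\<in>{0..l}. norm (k x t) \<le> C) \<and>
     (\<forall>f. L2_on {0..l} f \<longrightarrow> (AE x in leb l. E f x = f x + (LINT t|leb x. k x t *v f t)))"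
proof -
  have "\<exists>k :: real \<Rightarrow> real \<Rightarrow> complex ^ 'm2 ^ 'm2. (\<lambda>(x, t). k x t) \<in> borel_measurable (lebesgue_on ({0..l} \<times> {0..l})) \<and>
      (\<exists>C. \<forall>x\<in>{0..l}. \<forall>t\<in>{0..l}. norm (k x t) \<le> C) \<and>
      (\<forall>f. L2_on {0..l} f \<longrightarrow>
        (AE x in leb l. E f x = f x + (LINT t|leb x. k x t *v f t)))"
    using sim[unfolded similarity_operator_def] by (elim conjE)
  then obtain k where k123: "(\<lambda>(x, t). k x t) \<in> borel_measurable (lebesgue_on ({0..l} \<times> {0..l})) \<and>
      (\<exists>C. \<forall>x\<in>{0..l}. \<forall>t\<in>{0..l}. norm (k x t) \<le> C) \<and>
      (\<forall>f. L2_on {0..l} f \<longrightarrow>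
        (AE x in leb l. E f x = f x + (LINT t|leb x. k x t *v f t)))" ..
  note k1 = k123[THEN conjunct1] and k2 = k123[THEN conjunct2, THEN conjunct1] and k3 = k123[THEN conjunct2, THEN conjunct2]
  from k2 obtain C where C: "\<forall>x\<in>{0..l}. \<forall>t\<in>{0..l}. norm (k x t) \<le> C" by (elim exE)
  note k = k1 C k3
  have "{0..l} \<times> {0..l} \<in> sets lebesgue"
    using closed_Times[of "{0..l}" "{0..l}"] by (intro sets_completionI_sets) (simp add: borel_closed)
  from borel_representative[OF k(1) this]
  obtain g where g: "g \<in> borel_measurable borel" "AE p in lebesgue. p \<in> {0..l} \<times> {0..l} \<longrightarrow> (case p of (x, t) \<Rightarrow> k x t) = g p"
    by blast
  \<comment> \<open>The representative may exceed the bound on a null set, hence the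
    truncation.\<close>
  define k' where "k' x t = (if norm (g (x, t)) \<le> C then g (x, t) else 0)" for x t
  have "AE p in lborel. p \<in> {0..l} \<times> {0..l} \<longrightarrow> (case p of (x, t) \<Rightarrow> k x t) = g p"
    using g(2) by (subst (asm) AE_completion_iff)
  then have "AE p in lborel \<Otimes>\<^sub>M lborel. p \<in> {0..l} \<times> {0..l} \<longrightarrow> (case p of (x, t) \<Rightarrow> k x t) = g p"
    unfolding lborel_prod .
  from lborel_pair.AE_pair[OF this]
  have "AE x in lborel. AE t in lborel. x \<in> {0..l} \<and> t \<in> {0..l} \<longrightarrow> k x t = g (x, t)" by simp
  then have "AE x in lebesgue. AE t in lborel. x \<in> {0..l} \<and> t \<in> {0..l} \<longrightarrow> k x t = g (x, t)" by (rule AE_completion)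
  then have AE: "AE x in leb l. AE t in lborel. x \<in> {0..l} \<and> t \<in> {0..l} \<longrightarrow> k x t = g (x, t)"
    by (intro AE_restrict_space_iff[THEN iffD2]) (simp, erule eventually_mono, rule impI, assumption)
  have gm: "(\<lambda>(x, t). k' x t) \<in> borel_measurable borel"
  proof -
    have "(\<lambda>p. if norm (g p) \<le> C then g p else 0) \<in> borel_measurable borel"
      using g(1) by measurable
    moreover have "(\<lambda>(x, t). k' x t) = (\<lambda>p. if norm (g p) \<le> C then g p else 0)"
      by (simp add: fun_eq_iff k'_def)
    ultimately show ?thesis by (simp only:)
  qed
  have "norm (k 0 0) \<le> C" using k(2) l_pos by simp
  then have C0: "C \<ge> 0" by (rule order_trans[OF norm_ge_zero])
  have kb: "norm (k' x t) \<le> C" for x t using C0 by (simp add: k'_def)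
  have bk': "bker l k'" by (rule bker_borel[OF gm kb])
  have "AE x in leb l. E f x = f x + (LINT t|leb x. k' x t *v f t)" if f: "L2_on {0..l} f" for f
  proof -
    have "AE x in leb l. E f x = f x + (LINT t|leb x. k x t *v f t)" using k(3) f by blast
    then show ?thesis using AE AE_in_interval
    proof eventually_elim
      case (elim x)
      have "AE t in lebesgue. x \<in> {0..l} \<and> t \<in> {0..l} \<longrightarrow> k x t = g (x, t)"
        using elim(2) by (rule AE_completion)
      then have AEx: "AE t in leb x. k x t *v f t = k' x t *v f t"
      proof (intro AE_restrict_space_iff[THEN iffD2], goal_cases)
        case 2
        then show ?case
        proof eventually_elim
          case (elim t)
          show ?case
          proof
            assume "t \<in> {0..x}"
            then have "t \<in> {0..l}" using \<open>x \<in> {0..l}\<close> by auto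
            moreover from this have "k x t = g (x, t)" using elim \<open>x \<in> {0..l}\<close> by blast
            moreover have "norm (k x t) \<le> C" using k(2) \<open>x \<in> {0..l}\<close> \<open>t \<in> {0..l}\<close> by blast
            ultimately show "k x t *v f t = k' x t *v f t" by (simp add: k'_def)
          qed
        qed
      qed simp
      have m': "(\<lambda>t. k' x t *v f t) \<in> borel_measurable (leb x)"
      proof -
        have "integrable (leb x) (\<lambda>t. k' x t *v f t)"
          using elim(3) by (intro integrable_lebesgue_on_subset[OF bker_section_integrable[OF bk' L2_on_integrable[OF f] elim(3)]]) auto
        then show ?thesis by auto
      qed
      have "(LINT t|leb x. k x t *v f t) = (LINT t|leb x. k' x t *v f t)"
      proof -
        have "(\<lambda>t. k x t *v f t) \<in> borel_measurable (leb x)"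
          by (rule borel_measurable_lebesgue_on_AE_cong[OF m' AEx]) simp
        then show ?thesis by (rule integral_cong_AE[OF _ m' AEx])
      qed
      with elim(1) show ?case by simp
    qed
  qed
  with gm kb show ?thesis by blast
qed

lemma ker_borel: "(\<lambda>(x, t). ker x t) \<in> borel_measurable borel"
  and ker_bounded: "\<exists>C. \<forall>x\<in>{0..l}. \<forall>t\<in>{0..l}. norm (ker x t) \<le> C"
  and E_ker: "L2_on {0..l} f \<Longrightarrow> AE x in leb l. E f x = f x + (LINT t|leb x. ker x t *v f t)"
  using someI_ex[OF ker_exists, folded ker_def] by blast+

lemma bker_ker: "r \<le> l \<Longrightarrow> bker r ker"
proof -
  assume r: "r \<le> l"
  obtain C where C: "\<forall>x\<in>{0..l}. \<forall>t\<in>{0..l}. norm (ker x t) \<le> C" using ker_bounded by blast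
  show ?thesis by (rule bker_borel[OF ker_borel, of r C]) (use C r in auto)
qed

text \<open>The action of \<open>E\<close> on [0,r], meaningful because \<open>E\<close> at x sees
  only [0,x]. Unlike \<open>E\<close> it has a definite value at every point, so on L^2 functions it
  is linear at every point of [0,r] and can be restricted pointwise.\<close>

definition Er :: "real \<Rightarrow> 'm2 vfun \<Rightarrow> 'm2 vfun" where
  "Er r f x = f x + vop r (lowk ker) f x"

lemma Er_eq: "x \<in> {0..r} \<Longrightarrow> Er r f x = f x + (LINT t|leb x. ker x t *v f t)"
  by (simp add: Er_def vop_lowk)

lemma Er_L2: "r \<le> l \<Longrightarrow> L2_on {0..r} f \<Longrightarrow> L2_on {0..r} (Er r f)"
  unfolding Er_def[abs_def] by (intro L2_on_add vop_L2 bker_lowk bker_ker)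

lemma E_Er: "L2_on {0..l} f \<Longrightarrow> AE x in leb l. E f x = Er l f x"
proof -
  assume "L2_on {0..l} f"
  from E_ker[OF this] AE_in_interval show ?thesis by eventually_elim (simp add: Er_eq)
qed

lemma Er_cong: "(\<And>t. t \<in> {0..r} \<Longrightarrow> f t = g t) \<Longrightarrow> x \<in> {0..r} \<Longrightarrow> Er r f x = Er r g x"
  unfolding Er_def vop_def by (auto intro!: Bochner_Integration.integral_cong arg_cong2[where f = "(+)"])

lemma Er_AE_cong:
  assumes r: "r \<le> l" and f: "L2_on {0..r} f" and g: "L2_on {0..r} g" and eq: "AE x in leb r. f x = g x"
  shows "AE x in leb r. Er r f x = Er r g x"
proof -
  have "AE x in leb r. vop r (lowk ker) f x = vop r (lowk ker) g x"
    by (rule adjp_AE_cong[OF adjp_vop[OF bker_lowk[OF bker_ker[OF r]]] f g eq])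
  with eq show ?thesis by eventually_elim (simp add: Er_def)
qed

lemma Er_restrict: "x \<in> {0..r} \<Longrightarrow> r \<le> l \<Longrightarrow> Er r f x = Er l f x"
  using Er_eq[of x r f] Er_eq[of x l f] by auto

lemma norm_gamma_bound: "\<exists>B. \<forall>x\<in>{0..l}. norm (\<gamma> x) \<le> B"
proof -
  have "compact (\<gamma> ` {0..l})" by (rule compact_continuous_image[OF lip_ad_continuous_on[OF lip_ad_gamma]]) simp
  then show ?thesis using compact_imp_bounded bounded_iff by (metis imageI)
qed

lemma gamma_measurable: "r \<le> l \<Longrightarrow> \<gamma> \<in> borel_measurable (leb r)"
  by (rule continuous_imp_measurable_on_sets_lebesgue[OF lip_ad_continuous_on[OF lip_ad_restrict[OF lip_ad_gamma]]]) auto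

lemma bker_gamma: "r \<le> l \<Longrightarrow> bker r (\<lambda>x t. \<gamma> x ** adj (\<gamma> t))"
proof -
  assume r: "r \<le> l"
  obtain B where B: "\<forall>x\<in>{0..l}. norm (\<gamma> x) \<le> B" using norm_gamma_bound by blast
  show ?thesis
    by (rule bker_product[of _ _ _ B B]) (use B r in \<open>auto simp: norm_adj intro: gamma_measurable borel_measurable_adj\<close>)
qed

lemma adj_gamma_mult_integrable:
  assumes "L2_on {0..r} f" "r \<le> l" "x \<in> {0..r}"
  shows "integrable (leb x) (\<lambda>t. adj (\<gamma> t) *v f t)"
proof -
  obtain B where B: "\<forall>x\<in>{0..l}. norm (\<gamma> x) \<le> B" using norm_gamma_bound by blast
  have "bker r (\<lambda>x t. mat 1 ** adj (\<gamma> t))"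
    by (rule bker_product[of _ _ _ "norm (mat 1 :: complex^('m1+'m2)^('m1+'m2))" B])
       (use B assms(2) in \<open>auto simp: norm_adj intro: gamma_measurable borel_measurable_adj\<close>)
  from bker_section_integrable[OF this L2_on_integrable[OF assms(1)] assms(3)]
  have "integrable (leb r) (\<lambda>t. adj (\<gamma> t) *v f t)" by simp
  then show ?thesis
    by (rule integrable_lebesgue_on_subset) (use assms(3) in auto)
qed

lemma Lop_gamma:
  assumes "L2_on {0..r} f" "r \<le> l" "x \<in> {0..r}"
  shows "Lop r \<gamma> f x = \<gamma> x *v (LINT t|leb x. adj (\<gamma> t) *v f t)"
proof -
  have "Lop r \<gamma> f x = (LINT t|leb x. \<gamma> x *v (adj (\<gamma> t) *v f t))"
    unfolding Lop_def vop_lowk[OF assms(3)] by (simp only: matrix_vector_mul_assoc)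
  also have "\<dots> = \<gamma> x *v (LINT t|leb x. adj (\<gamma> t) *v f t)"
    by (rule integral_bounded_linear[OF bounded_linear_matrix_vector_right adj_gamma_mult_integrable[OF assms]])
  finally show ?thesis .
qed

lemma Er_smult:
  assumes "r \<le> l" "L2_on {0..r} f" "x \<in> {0..r}"
  shows "Er r (\<lambda>t. c *s f t) x = c *s Er r f x"
proof -
  have "vop r (lowk ker) (\<lambda>t. c *s f t) x = (LINT t|leb r. c *s (lowk ker x t *v f t))"
    by (simp add: vop_def matrix_vector_mult_smult)
  also have "\<dots> = c *s vop r (lowk ker) f x"
    unfolding vop_def
    by (rule integral_bounded_linear[OF bounded_bilinear.bounded_linear_right[OF bounded_bilinear_smult]
          bker_section_integrable[OF bker_lowk[OF bker_ker[OF assms(1)]] L2_on_integrable[OF assms(2)] assms(3)]])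
  finally show ?thesis by (simp add: Er_def vec.scale_right_distrib)
qed

text \<open>By causality the similarity \<open>K E = E A\<close> restricts to \<open>[0,r]\<close>.\<close>

lemma intertwining:
  assumes r: "0 \<le> r" "r \<le> l" and f: "L2_on {0..r} f"
  shows "AE x in leb r. Lop r \<gamma> (Er r f) x = Er r (Jop r f) x"
proof -
  \<comment> \<open>Extension by zero to [0,l], the interval on which the similarity is given; at
    points of [0,r] both sides see only \<open>f\<close>.\<close>
  define f0 where "f0 = cutoff r f"
  have f0: "L2_on {0..l} f0" unfolding f0_def by (rule L2_on_cutoff[OF f r(2)])
  have f0r: "f0 t = f t" if "t \<in> {0..r}" for t using that by (simp add: f0_def cutoff_def)
  have A_L2: "L2_on {0..l} (A_op g)" if "L2_on {0..l} g" for g :: "'m2 vfun"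
  proof -
    have "L2_on {0..l} (\<lambda>x. (- \<i>) *s Jop l g x)" by (rule L2_on_smult[OF Jop_L2[OF that]])
    then show ?thesis
      by (rule L2_on_cong[rotated]) (simp add: A_op_def Jop_eq)
  qed
  have "AE x in leb l. K_op \<gamma> (E f0) x = E (A_op (Einv (E f0))) x"
    using sim E_L2[OF f0] by (simp add: similarity_operator_def)
  moreover have "AE x in leb l. E (A_op (Einv (E f0))) x = E (A_op f0) x"
  proof (rule bounded_L2_operator_AE_cong[OF E_bounded])
    show "L2_on {0..l} (A_op (Einv (E f0)))" "L2_on {0..l} (A_op f0)"
      by (intro A_L2 Einv_L2 E_L2 f0)+
    show "AE x in leb l. A_op (Einv (E f0)) x = A_op f0 x"
      using AE_in_interval
    proof eventually_elim
      case (elim x)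
      then have sub: "{0..x} \<subseteq> {0..l}" by auto
      have "(LINT t|leb x. Einv (E f0) t) = (LINT t|leb x. f0 t)"
        by (rule lebesgue_integral_cong_AE_subset[OF Einv_E[OF f0] sub])
           (use sub integrable_lebesgue_on_subset[OF L2_on_integrable[OF f0] sub]
             integrable_lebesgue_on_subset[OF L2_on_integrable[OF Einv_L2[OF E_L2[OF f0]]] sub] in auto)
      then show ?case by (simp add: A_op_def)
    qed
  qed
  moreover have "AE x in leb l. E (A_op f0) x = Er l (A_op f0) x"
    by (rule E_Er[OF A_L2[OF f0]])
  ultimately have "AE x in leb l. K_op \<gamma> (E f0) x = Er l (A_op f0) x"
    by eventually_elim simp
  then have "AE x in leb r. K_op \<gamma> (E f0) x = Er l (A_op f0) x"
    by (rule AE_lebesgue_on_subset) (use r in auto)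
  then show ?thesis
    using AE_space_lebesgue_on[of "{0..r}"]
  proof eventually_elim
    case (elim x)
    then have x: "x \<in> {0..r}" by simp
    have sub: "{0..x} \<subseteq> {0..l}" using x r by auto
    have EL: "L2_on {0..r} (Er r f)" by (rule Er_L2[OF r(2) f])
    have "AE t in leb l. adj (\<gamma> t) *v E f0 t = adj (\<gamma> t) *v Er l f0 t"
      using E_Er[OF f0] by eventually_elim simp
    then have "(LINT t|leb x. adj (\<gamma> t) *v E f0 t) = (LINT t|leb x. adj (\<gamma> t) *v Er l f0 t)"
    proof (rule lebesgue_integral_cong_AE_subset[OF _ sub])
      have xl: "x \<in> {0..l}" using x r by auto
      show "(\<lambda>t. adj (\<gamma> t) *v E f0 t) \<in> borel_measurable (leb x)"
        using adj_gamma_mult_integrable[OF E_L2[OF f0] order_refl xl] by auto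
      show "(\<lambda>t. adj (\<gamma> t) *v Er l f0 t) \<in> borel_measurable (leb x)"
        using adj_gamma_mult_integrable[OF Er_L2[OF order_refl f0] order_refl xl] by auto
    qed auto
    also have "\<dots> = (LINT t|leb x. adj (\<gamma> t) *v Er r f t)"
    proof (rule Bochner_Integration.integral_cong)
      fix t assume "t \<in> space (leb x)"
      then have t: "t \<in> {0..r}" using x by auto
      have "Er l f0 t = Er r f0 t" using Er_restrict[OF t r(2)] by simp
      also have "\<dots> = Er r f t" by (rule Er_cong[OF f0r t])
      finally show "adj (\<gamma> t) *v Er l f0 t = adj (\<gamma> t) *v Er r f t" by simp
    qed simp
    finally have K: "K_op \<gamma> (E f0) x = (- \<i>) *s Lop r \<gamma> (Er r f) x"
      by (simp only: K_op_def Lop_gamma[OF EL r(2) x])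
    have Aj: "A_op f0 t = (- \<i>) *s Jop r f t" if t: "t \<in> {0..r}" for t
    proof -
      have "(LINT s|leb t. f0 s) = (LINT s|leb t. f s)"
        by (rule Bochner_Integration.integral_cong) (use t f0r in auto)
      then show ?thesis by (simp only: A_op_def Jop_eq[OF t])
    qed
    have "Er l (A_op f0) x = Er r (A_op f0) x" using Er_restrict[OF x r(2)] by simp
    also have "\<dots> = Er r (\<lambda>t. (- \<i>) *s Jop r f t) x" by (rule Er_cong[OF Aj x])
    also have "\<dots> = (- \<i>) *s Er r (Jop r f) x"
      by (rule Er_smult[OF r(2) Jop_L2[OF f] x])
    finally have "(- \<i>) *s Lop r \<gamma> (Er r f) x = (- \<i>) *s Er r (Jop r f) x"
      using elim(1) K by simp
    then show ?case by (simp add: vec_eq_iff)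
  qed
qed

end

lemma matrix_vector_mult_axis_sum:
  fixes D :: "complex ^ 'q::finite ^ 'p::finite"
  shows "D *v c = (\<Sum>j\<in>UNIV. (c $ j) *s (D *v axis j 1))"
  by (simp add: vec_eq_iff matrix_vector_axis) (simp add: matrix_vector_mult_def mult.commute)

lemma bker_scale:
  assumes "bker r \<kappa>"
  shows "bker r (\<lambda>x t. mat c ** \<kappa> x t)"
  unfolding bker_def
proof
  have "(\<lambda>p. \<kappa> (fst p) (snd p)) \<in> borel_measurable (leb r \<Otimes>\<^sub>M leb r)"
    using assms by (simp add: bker_def case_prod_beta')
  then show "(\<lambda>(x, t). mat c ** \<kappa> x t) \<in> borel_measurable (leb r \<Otimes>\<^sub>M leb r)"
    unfolding case_prod_beta' by (intro borel_measurable_mm) simp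
  obtain C where C: "C \<ge> 0" "\<And>x t. x \<in> {0..r} \<Longrightarrow> t \<in> {0..r} \<Longrightarrow> norm (\<kappa> x t) \<le> C"
    using bkerD_bound[OF assms] by blast
  obtain K where K: "\<And>A. norm ((mat c :: complex^'b^'b) ** (A::complex^'a^'b)) \<le> norm A * K" "K > 0"
    using bounded_linear.pos_bounded[OF bounded_bilinear.bounded_linear_right[OF bounded_bilinear_matrix_matrix_mult, of "mat c :: complex^'b^'b"]] by blast
  show "\<exists>C. \<forall>x\<in>{0..r}. \<forall>t\<in>{0..r}. norm (mat c ** \<kappa> x t) \<le> C"
  proof (intro exI ballI)
    fix x t assume "x \<in> {0..r}" "t \<in> {0..r}"
    then show "norm (mat c ** \<kappa> x t) \<le> C * K"
      using order_trans[OF K(1) mult_right_mono[OF C(2)]] K(2) by auto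
  qed
qed

lemma lowk_scale: "lowk (\<lambda>x t. mat c ** \<kappa> x t) = (\<lambda>x t. mat c ** lowk \<kappa> x t)"
  by (simp add: lowk_def fun_eq_iff)

lemma vop_scale:
  assumes "bker r \<kappa>" "integrable (leb r) f" "x \<in> {0..r}"
  shows "vop r (\<lambda>x t. mat c ** \<kappa> x t) f x = c *s vop r \<kappa> f x"
proof -
  have "vop r (\<lambda>x t. mat c ** \<kappa> x t) f x = (LINT t|leb r. c *s (\<kappa> x t *v f t))"
    by (simp add: vop_def matrix_vector_mul_assoc[symmetric] mat_vector_mult)
  also have "\<dots> = c *s vop r \<kappa> f x"
    unfolding vop_def
    by (rule integral_bounded_linear[OF bounded_bilinear.bounded_linear_right[OF bounded_bilinear_smult] bker_section_integrable[OF assms]])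
  finally show ?thesis .
qed

lemma continuous_AE_eq:
  fixes f g :: "real \<Rightarrow> 'a::euclidean_space"
  assumes f: "continuous_on {0..l} f" and g: "continuous_on {0..l} g" and "0 < l"
    and eq: "AE x in leb l. f x = g x" and x: "x \<in> {0..l}"
  shows "f x = g x"
proof (rule ccontr)
  assume ne: "f x \<noteq> g x"
  have "continuous_on {0..l} (\<lambda>x. norm (f x - g x))" using f g by (intro continuous_intros)
  moreover have "0 < norm (f x - g x) / 2" using ne by simp
  ultimately obtain d where d: "d > 0" "\<And>y. y \<in> {0..l} \<Longrightarrow> \<bar>y - x\<bar> < d \<Longrightarrow> \<bar>norm (f y - g y) - norm (f x - g x)\<bar> < norm (f x - g x) / 2"
    using x unfolding continuous_on_iff by (metis dist_real_def)
  define a b where "a = max 0 (x - d/2)" and "b = min l (x + d/2)"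
  have "a < b" using x d(1) \<open>0 < l\<close> by (auto simp: a_def b_def)
  have sub: "{a..b} \<subseteq> {y \<in> {0..l}. f y \<noteq> g y}"
  proof
    fix y assume "y \<in> {a..b}"
    then have y: "y \<in> {0..l}" "\<bar>y - x\<bar> < d" using d(1) by (auto simp: a_def b_def)
    show "y \<in> {y \<in> {0..l}. f y \<noteq> g y}" using d(2)[OF y] y(1) ne by auto
  qed
  have "negligible {y \<in> {0..l}. f y \<noteq> g y}" using eq by (subst (asm) AE_lebesgue_on_iff_negligible) auto
  then have "negligible {a..b}" by (rule negligible_subset[OF _ sub])
  then show False using \<open>a < b\<close> negligible_interval(1)[of a b] by (simp add: box_real)
qed

section \<open>\<Phi>1 and its derivative as preimages under E\<close>

context dirac_similarity begin

lemma Er_sum: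
  assumes "finite I" "\<And>j. j \<in> I \<Longrightarrow> L2_on {0..r} (f j)" "r \<le> l" "x \<in> {0..r}"
  shows "Er r (\<lambda>t. \<Sum>j\<in>I. f j t) x = (\<Sum>j\<in>I. Er r (f j) x)"
proof -
  have "vop r (lowk ker) (\<lambda>t. \<Sum>j\<in>I. f j t) x = (LINT t|leb r. (\<Sum>j\<in>I. lowk ker x t *v f j t))"
    by (simp only: vop_def linear_sum[OF bounded_linear.linear[OF bounded_linear_matrix_vector_right]])
  also have "\<dots> = (\<Sum>j\<in>I. vop r (lowk ker) (f j) x)"
    unfolding vop_def
    by (intro Bochner_Integration.integral_sum bker_section_integrable[OF bker_lowk[OF bker_ker]] L2_on_integrable assms)
  finally show ?thesis by (simp add: Er_def sum.distrib)
qed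

lemma Er_add:
  assumes "L2_on {0..r} f" "L2_on {0..r} g" "r \<le> l" "x \<in> {0..r}"
  shows "Er r (\<lambda>t. f t + g t) x = Er r f x + Er r g x"
proof -
  have "vop r (lowk ker) (\<lambda>t. f t + g t) x = vop r (lowk ker) f x + vop r (lowk ker) g x"
    unfolding vop_def matrix_vector_right_distrib
    by (intro Bochner_Integration.integral_add bker_section_integrable[OF bker_lowk[OF bker_ker]] L2_on_integrable assms)
  then show ?thesis by (simp add: Er_def)
qed

lemma Er_columns:
  fixes D W :: "real \<Rightarrow> complex ^ 'q::finite ^ 'm2"
  assumes L2: "\<And>j. L2_on {0..l} (\<lambda>t. D t *v axis j 1)"
    and eq: "\<And>j. AE x in leb l. Er l (\<lambda>t. D t *v axis j 1) x = W x *v axis j 1"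
  shows "AE x in leb l. Er l (\<lambda>t. D t *v c) x = W x *v c"
proof -
  have "AE x in leb l. \<forall>j\<in>UNIV. Er l (\<lambda>t. D t *v axis j 1) x = W x *v axis j 1"
    by (rule AE_finite_allI) (simp_all add: eq)
  then show ?thesis using AE_in_interval
  proof eventually_elim
    case (elim x)
    have "Er l (\<lambda>t. D t *v c) x = Er l (\<lambda>t. \<Sum>j\<in>UNIV. (c $ j) *s (D t *v axis j 1)) x"
      by (subst matrix_vector_mult_axis_sum) simp
    also have "\<dots> = (\<Sum>j\<in>UNIV. Er l (\<lambda>t. (c $ j) *s (D t *v axis j 1)) x)"
      by (rule Er_sum) (use elim in \<open>auto intro: L2_on_smult L2\<close>)
    also have "\<dots> = (\<Sum>j\<in>UNIV. (c $ j) *s (W x *v axis j 1))"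
      by (rule sum.cong) (use elim Er_smult[OF order_refl L2] in auto)
    also have "\<dots> = W x *v c" by (rule matrix_vector_mult_axis_sum[symmetric])
    finally show ?case .
  qed
qed

lemma gamma_vec_L2: "L2_on {0..l} (\<lambda>t. \<gamma> t *v c)"
  by (rule L2_on_continuous)
     (rule bounded_linear.continuous_on[OF bounded_linear_matrix_vector_left lip_ad_continuous_on[OF lip_ad_gamma]])

lemma L2_on_const: "L2_on {a..b::real} (\<lambda>_. c)"
  by (rule L2_on_continuous) simp

text \<open>The normalisation of \<open>Einv\<close> on the columns of
  \<open>\<gamma>\<^sub>2\<close>, read backwards.\<close>

lemma Er_const: "AE x in leb l. Er l (\<lambda>_. c) x = \<gamma> x *v vjoin 0 c"
proof -
  have "AE x in leb l. Er l (\<lambda>t. mat 1 *v c) x = right_block (\<gamma> x) *v c"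
  proof (rule Er_columns)
    show "L2_on {0..l} (\<lambda>t. mat 1 *v axis j 1)" for j by (rule L2_on_const)
    fix j :: 'm2
    define h where "h t = column j (right_block (\<gamma> t))" for t
    have h: "h t = \<gamma> t *v vjoin 0 (axis j 1)" for t
      by (simp add: h_def right_block_mult[symmetric] vec_eq_iff matrix_vector_axis column_def)
    have hL2: "L2_on {0..l} h" unfolding h[abs_def] by (rule gamma_vec_L2)
    have "AE x in leb l. apply_columnwise Einv (\<lambda>t. right_block (\<gamma> t)) x = mat 1"
      using sim by (simp add: similarity_operator_def)
    then have "AE x in leb l. Einv h x = axis j 1"
    proof eventually_elim
      case (elim x)
      have "Einv h x $ i = axis j 1 $ i" for i
      proof -
        have "apply_columnwise Einv (\<lambda>t. right_block (\<gamma> t)) x $ i $ j = mat 1 $ i $ j" using elim by simp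
        then show ?thesis by (simp add: apply_columnwise_def h_def[abs_def] mat_def axis_def)
      qed
      then show ?case by (simp add: vec_eq_iff)
    qed
    then have "AE x in leb l. E (Einv h) x = E (\<lambda>_. axis j 1) x"
      by (rule bounded_L2_operator_AE_cong[OF E_bounded Einv_L2[OF hL2] L2_on_const])
    with E_Einv[OF hL2] E_Er[OF L2_on_const[of 0 l "axis j 1"]]
    have "AE x in leb l. Er l (\<lambda>_. axis j 1) x = h x" by eventually_elim simp
    then show "AE x in leb l. Er l (\<lambda>t. mat 1 *v axis j 1) x = right_block (\<gamma> x) *v axis j 1"
      by (simp add: h right_block_mult)
  qed
  then show ?thesis by (simp add: right_block_mult)
qed

definition gcol :: "'m1 \<Rightarrow> 'm2 vfun" where
  "gcol j = Einv (\<lambda>x. - adj (v x) *v axis j 1)"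

lemma adj_v_vec_L2: "L2_on {0..l} (\<lambda>x. - adj (v x) *v c)"
proof (rule L2_on_bounded)
  show "(\<lambda>x. - adj (v x) *v c) \<in> borel_measurable (leb l)"
    by (intro borel_measurable_linear[OF bounded_linear_matrix_vector_left] borel_measurable_uminus borel_measurable_adj v_measurable)
  show "AE x in leb l. norm (- adj (v x) *v c) \<le> M * norm c"
    using AE_interior by eventually_elim (simp add: matrix_vector_mult_minus_left norm_adj_v_mult)
qed

lemma gcol_L2: "L2_on {0..l} (gcol j)"
  unfolding gcol_def by (rule Einv_L2[OF adj_v_vec_L2])

lemma Er_gcol: "AE x in leb l. Er l (gcol j) x = - adj (v x) *v axis j 1"
  using E_Einv[OF adj_v_vec_L2[of "axis j 1"]] E_Er[OF gcol_L2[of j]]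
  by eventually_elim (simp add: gcol_def)

text \<open>The potential is bounded by \<open>M\<close>, and \<open>volterra_bound\<close> carries
  this over to the preimages under \<open>E\<close>.\<close>

lemma gcol_bounded: "\<exists>B. \<forall>j. AE x in leb l. norm (gcol j x) \<le> B"
proof -
  obtain C where C: "C > 0"
    "\<And>q a. L2_on {0..l} q \<Longrightarrow> 0 \<le> a \<Longrightarrow> (AE x in leb l. norm (q x + vop l (lowk ker) q x) \<le> a) \<Longrightarrow>
       AE x in leb l. norm (q x) \<le> a * exp (C * x)"
    using volterra_bound[OF bker_ker[OF order_refl]] by blast
  have "AE x in leb l. norm (gcol j x) \<le> M * exp (C * l)" for j
  proof -
    have "AE x in leb l. norm (gcol j x + vop l (lowk ker) (gcol j) x) \<le> M"
      using Er_gcol[of j] AE_interior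
    proof eventually_elim
      case (elim x)
      then show ?case using norm_adj_v_mult[of x "axis j 1"] by (simp add: Er_def matrix_vector_mult_minus_left)
    qed
    from C(2)[OF gcol_L2 less_imp_le[OF M_pos] this]
    have "AE x in leb l. norm (gcol j x) \<le> M * exp (C * x)" .
    then show ?thesis using AE_in_interval
    proof eventually_elim
      case (elim x)
      have "M * exp (C * x) \<le> M * exp (C * l)" using elim M_pos C(1) by (intro mult_left_mono) auto
      with elim show ?case by linarith
    qed
  qed
  then show ?thesis by blast
qed

text \<open>A bounded Borel representative of \<open>- E\<^sup>-\<^sup>1 v\<^sup>*\<close>, which will be \<open>\<Phi>\<^sub>1'\<close>.\<close>

definition dfun :: "real \<Rightarrow> complex ^ 'm1 ^ 'm2" where
  "dfun = (SOME d. d \<in> borel_measurable borel \<and> (\<exists>B. \<forall>x. norm (d x) \<le> B) \<and>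
     (\<forall>j. AE x in leb l. d x *v axis j 1 = gcol j x))"

lemma dfun_exists:
  "\<exists>d :: real \<Rightarrow> complex ^ 'm1 ^ 'm2. d \<in> borel_measurable borel \<and> (\<exists>B. \<forall>x. norm (d x) \<le> B) \<and>
     (\<forall>j. AE x in leb l. d x *v axis j 1 = gcol j x)"
proof -
  define D :: "real \<Rightarrow> complex ^ 'm1 ^ 'm2" where "D x = (\<chi> i j. gcol j x $ i)" for x
  have Dc: "D x *v axis j 1 = gcol j x" for x j by (simp add: vec_eq_iff matrix_vector_axis D_def)
  have "D \<in> borel_measurable (leb l)"
  proof -
    have eq: "D = (\<lambda>x. \<Sum>j\<in>UNIV. (\<chi> i k. if k = j then gcol j x $ i else 0))"
      by (simp add: fun_eq_iff vec_eq_iff D_def)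
    have "(\<lambda>x. \<Sum>j\<in>UNIV. (\<chi> i k. if k = j then gcol j x $ i else 0) :: complex ^ 'm1 ^ 'm2) \<in> borel_measurable (leb l)"
    proof (rule borel_measurable_sum)
      fix j :: 'm1
      have "bounded_linear (\<lambda>y. (\<chi> i k. if k = j then y $ i else 0) :: complex ^ 'm1 ^ 'm2)"
        unfolding linear_conv_bounded_linear[symmetric] by (auto intro!: linearI simp: vec_eq_iff)
      then show "(\<lambda>x. (\<chi> i k. if k = j then gcol j x $ i else 0) :: complex ^ 'm1 ^ 'm2) \<in> borel_measurable (leb l)"
        by (rule borel_measurable_linear) (rule L2_on_measurable[OF gcol_L2])
    qed
    then show ?thesis unfolding eq .
  qed
  then obtain g where g: "g \<in> borel_measurable borel" "AE x in lebesgue. x \<in> {0..l} \<longrightarrow> D x = g x"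
    by (rule borel_representative) auto
  obtain B where B: "\<And>j. AE x in leb l. norm (gcol j x) \<le> B" using gcol_bounded by blast
  define b where "b = real CARD('m2) * (real CARD('m1) * B)"
  define d where "d x = (if norm (g x) \<le> \<bar>b\<bar> then g x else 0)" for x
  have "AE x in leb l. \<forall>j\<in>UNIV. norm (gcol j x) \<le> B" by (rule AE_finite_allI) (simp_all add: B)
  moreover have "AE x in leb l. D x = g x"
    using g(2) by (subst AE_restrict_space_iff) auto
  ultimately have "AE x in leb l. d x = D x"
  proof eventually_elim
    case (elim x)
    have "norm (D x) \<le> b" unfolding b_def
    proof (rule norm_matrix_le_entries)
      fix i j
      have "norm (gcol j x $ i) \<le> norm (gcol j x)" by (rule Finite_Cartesian_Product.norm_nth_le)
      then show "norm (D x $ i $ j) \<le> B" using elim(1) by (simp add: D_def) (meson order_trans)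
    qed
    then show ?case using elim(2) by (simp add: d_def)
  qed
  then have "AE x in leb l. d x *v axis j 1 = gcol j x" for j
    by eventually_elim (simp add: Dc)
  moreover have "d \<in> borel_measurable borel" unfolding d_def[abs_def] using g(1) by measurable
  moreover have "norm (d x) \<le> \<bar>b\<bar>" for x by (simp add: d_def)
  ultimately show ?thesis by blast
qed

lemma dfun_borel: "dfun \<in> borel_measurable borel"
  and dfun_bounded: "\<exists>B. \<forall>x. norm (dfun x) \<le> B"
  and dfun_gcol: "AE x in leb l. dfun x *v axis j 1 = gcol j x"
  using someI_ex[OF dfun_exists, folded dfun_def] by blast+

lemma dfun_measurable: "dfun \<in> borel_measurable (lebesgue_on S)"
  by (rule measurable_restrict_space1, rule measurable_completion) (use dfun_borel in simp)

lemma dfun_vec_L2: "L2_on {0..r} (\<lambda>t. dfun t *v c)"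
proof -
  obtain B where B: "\<forall>x. norm (dfun x) \<le> B" using dfun_bounded by blast
  have "L2_on {0..r} dfun"
    by (rule L2_on_bounded[where B = B]) (use B in \<open>auto intro: dfun_measurable\<close>)
  then show ?thesis by (rule L2_on_bounded_linear[OF bounded_linear_matrix_vector_left])
qed

lemma Er_dfun: "AE x in leb l. Er l (\<lambda>t. dfun t *v c) x = - adj (v x) *v c"
proof (rule Er_columns)
  show "L2_on {0..l} (\<lambda>t. dfun t *v axis j 1)" for j by (rule dfun_vec_L2)
  show "AE x in leb l. Er l (\<lambda>t. dfun t *v axis j 1) x = - adj (v x) *v axis j 1" for j
    using Er_AE_cong[OF order_refl dfun_vec_L2 gcol_L2 dfun_gcol[of j]] Er_gcol[of j]
    by eventually_elim simp
qed

text \<open>Defined as an integral, so that its derivative is known from the start;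
  \<open>Er_Phi\<close> and \<open>is_Phi1_imp\<close> identify it with \<Phi>1.\<close>

definition Phi :: "real \<Rightarrow> complex ^ 'm1 ^ 'm2" where
  "Phi x = (LINT t|leb x. dfun t)"

lemma dfun_integrable: "integrable (leb x) dfun"
proof -
  obtain B where B: "\<forall>x. norm (dfun x) \<le> B" using dfun_bounded by blast
  show ?thesis by (rule integrable_lebesgue_on_AE_bound[where B = B]) (use B in \<open>auto intro: dfun_measurable\<close>)
qed

lemma Phi_continuous: "continuous_on {0..r} Phi"
  unfolding Phi_def[abs_def] by (rule continuous_on_indefinite_lebesgue_integral[OF dfun_integrable])

lemma Phi_vec: "Phi x *v c = (LINT t|leb x. dfun t *v c)"
  unfolding Phi_def by (rule integral_bounded_linear[OF bounded_linear_matrix_vector_left dfun_integrable, symmetric])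

lemma Phi_vec_L2: "L2_on {0..r} (\<lambda>t. Phi t *v c)"
  by (rule L2_on_bounded_linear[OF bounded_linear_matrix_vector_left L2_on_continuous[OF Phi_continuous]])

text \<open>Apply \<open>L E = E J\<close> to \<open>dfun\<close> times \<open>c\<close>, whose
  image under \<open>E\<close> is \<open>- adj v c\<close>. Since
  \<open>\<beta>' = v \<gamma>\<close>, the inner integral is the value of
  \<open>adj \<beta> c\<close> at 0 minus that at x, and \<open>\<gamma>\<close> annihilates the
  latter; what remains is \<open>\<gamma>\<close> on the upper block.\<close>

lemma Er_Phi: "AE x in leb l. Er l (\<lambda>t. Phi t *v c) x = \<gamma> x *v vjoin c 0"
proof -
  define w where "w = (\<lambda>t. dfun t *v c)"
  have w: "L2_on {0..l} w" unfolding w_def by (rule dfun_vec_L2)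
  have "AE x in leb l. Lop l \<gamma> (Er l w) x = Er l (Jop l w) x"
    by (rule intertwining[OF less_imp_le[OF l_pos] order_refl w])
  moreover have "AE x in leb l. Lop l \<gamma> (Er l w) x = Lop l \<gamma> (\<lambda>x. - adj (v x) *v c) x"
    unfolding Lop_def
    by (rule adjp_AE_cong[OF adjp_vop[OF bker_lowk[OF bker_gamma[OF order_refl]]] Er_L2[OF order_refl w] adj_v_vec_L2])
       (use Er_dfun[of c] in \<open>simp add: w_def\<close>)
  ultimately show ?thesis using AE_in_interval
  proof eventually_elim
    case (elim x)
    have "lip_ad l (\<lambda>x. adj (\<beta> x) *v c) (\<lambda>x. adj (v x ** \<gamma> x) *v c)"
      by (rule lip_ad_linear[OF bounded_linear_matrix_vector_left lip_ad_linear[OF bounded_linear_adj lip_ad_beta]])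
    from lip_ad_lebesgue_integral[OF this, of x] elim(3)
    have 1: "(LINT t|leb x. adj (v t ** \<gamma> t) *v c) = adj (\<beta> x) *v c - adj I0 *v c"
      by (simp add: beta_0)
    have "Lop l \<gamma> (\<lambda>x. - adj (v x) *v c) x = \<gamma> x *v (LINT t|leb x. adj (\<gamma> t) *v (- adj (v t) *v c))"
      by (rule Lop_gamma[OF adj_v_vec_L2 order_refl elim(3)])
    also have "(\<lambda>t. adj (\<gamma> t) *v (- adj (v t) *v c)) = (\<lambda>t. - (adj (v t ** \<gamma> t) *v c))"
      by (simp add: fun_eq_iff adj_mult matrix_vector_mul_assoc[symmetric] matrix_vector_mult_minus_left matrix_vector_mult_minus_right)
    also have "\<gamma> x *v (LINT t|leb x. - (adj (v t ** \<gamma> t) *v c)) = \<gamma> x *v (adj I0 *v c) - \<gamma> x *v (adj (\<beta> x) *v c)"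
      by (simp add: 1 matrix_vector_mult_diff_distrib)
    also have "\<gamma> x *v (adj (\<beta> x) *v c) = 0"
      by (simp add: matrix_vector_mul_assoc gamma_adj_beta[OF elim(3)])
    finally have "Lop l \<gamma> (\<lambda>x. - adj (v x) *v c) x = \<gamma> x *v vjoin c 0" by (simp add: adj_I0_mult)
    moreover have "Er l (Jop l w) x = Er l (\<lambda>t. Phi t *v c) x"
      by (rule Er_cong[OF _ elim(3)]) (simp add: Jop_eq w_def Phi_vec)
    ultimately show ?case using elim by simp
  qed
qed

lemma Er_Pi: "AE x in leb l. Er l (\<lambda>t. Phi t *v vtop c + vbot c) x = \<gamma> x *v c"
  using Er_Phi[of "vtop c"] Er_const[of "vbot c"] AE_in_interval
proof eventually_elim
  case (elim x)
  have "vjoin (vtop c) 0 + vjoin 0 (vbot c) = c"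
    by (rule block_vec_eqI) (simp_all add: vtop_add vbot_add)
  then have "\<gamma> x *v vjoin (vtop c) 0 + \<gamma> x *v vjoin 0 (vbot c) = \<gamma> x *v c"
    by (simp flip: matrix_vector_right_distrib)
  then show ?case
    using Er_add[OF Phi_vec_L2 L2_on_const order_refl elim(3), of "vtop c" "vbot c"] elim by simp
qed

end

section \<open>Asymptotics of Weyl functions\<close>

definition Lap :: "real \<Rightarrow> (real \<Rightarrow> complex) \<Rightarrow> complex \<Rightarrow> complex" where
  "Lap l \<psi> z = (LINT t|leb l. exp (2 * \<i> * z * of_real t) * \<psi> t)"

lemma Lap_eq_integral:
  assumes "continuous_on {0..l} \<psi>"
  shows "Lap l \<psi> z = integral {0..l} (\<lambda>t. exp (2 * \<i> * z * of_real t) * \<psi> t)"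
proof -
  have "continuous_on {0..l} (\<lambda>t. exp (2 * \<i> * z * of_real t) * \<psi> t)" using assms by (intro continuous_intros)
  then have "integrable (leb l) (\<lambda>t. exp (2 * \<i> * z * of_real t) * \<psi> t)"
    by (rule L2_on_integrable[OF L2_on_continuous])
  then show ?thesis unfolding Lap_def by (rule lebesgue_integral_eq_integral) simp
qed

lemma Lap_holomorphic:
  assumes \<psi>: "continuous_on {0..l} \<psi>"
  shows "Lap l \<psi> holomorphic_on UNIV"
proof -
  have "(\<lambda>z. integral (cbox 0 l) (\<lambda>t. exp (2 * \<i> * z * of_real t) * \<psi> t)) holomorphic_on UNIV"
  proof (rule leibniz_rule_holomorphic)
    show "((\<lambda>z. exp (2 * \<i> * z * of_real t) * \<psi> t) has_field_derivative (2 * \<i> * of_real t) * exp (2 * \<i> * z * of_real t) * \<psi> t) (at z within UNIV)" for z t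
      by (auto intro!: derivative_eq_intros)
    show "(\<lambda>t. exp (2 * \<i> * z * of_real t) * \<psi> t) integrable_on cbox 0 l" for z
      using \<psi> by (intro integrable_continuous continuous_intros) simp
    have "continuous_on (UNIV \<times> {0..l}) (\<lambda>p. \<psi> (snd p))"
      by (rule continuous_on_compose2[OF \<psi>]) (auto intro: continuous_intros)
    then show "continuous_on (UNIV \<times> cbox 0 l) (\<lambda>(z, t). (2 * \<i> * of_real t) * exp (2 * \<i> * z * of_real t) * \<psi> t)"
      unfolding case_prod_beta' box_real by (intro continuous_intros)
  qed auto
  then show ?thesis by (simp add: Lap_eq_integral[OF \<psi>] fun_eq_iff[symmetric] cong: holomorphic_cong)
qed

lemma continuous_AE_le:
  fixes f :: "real \<Rightarrow> real"
  assumes f: "continuous_on {0..l} f" and "0 < l" and le: "AE x in leb l. f x \<le> B" and x: "x \<in> {0..l}"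
  shows "f x \<le> B"
proof -
  have "max (f x) B = B"
  proof (rule continuous_AE_eq[OF _ _ \<open>0 < l\<close> _ x])
    show "continuous_on {0..l} (\<lambda>x. max (f x) B)" using f by (intro continuous_intros)
    show "AE x in leb l. max (f x) B = B" using le by eventually_elim auto
  qed simp
  then show ?thesis by linarith
qed

section \<open>The explicit solution and its bound for Weyl functions\<close>

context dirac_similarity begin

text \<open>Variation of constants for \<open>m = q - Phi *v vtop c\<close>, which satisfies
  \<open>m' = - 2 \<i> z q\<close> and starts at \<open>vbot c\<close>; in this way no derivative of
  \<open>Phi\<close> enters. The bracket at x = l, for c = (h, W h), is the quantity estimated in
  \<open>weyl_estimate\<close>.\<close>

definition qsol :: "complex \<Rightarrow> complex ^ ('m1 + 'm2) \<Rightarrow> real \<Rightarrow> complex ^ 'm2" where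
  "qsol z c x = Phi x *v vtop c + exp ((- 2 * \<i> * z) * of_real x) *s
     (vbot c + (- 2 * \<i> * z) *s (LINT t|leb x. exp (2 * \<i> * z * of_real t) *s (Phi t *v vtop c)))"

lemma qsol_eq:
  shows "continuous_on {0..l} (qsol z c)"
    and "x \<in> {0..l} \<Longrightarrow> qsol z c x = Phi x *v vtop c + vbot c + (- 2 * \<i> * z) *s Jop l (qsol z c) x"
proof -
  define a where "a = - 2 * \<i> * z"
  define g where "g t = exp (2 * \<i> * z * of_real t) *s (Phi t *v vtop c)" for t
  define p where "p x = integral {0..x} g" for x
  have cPhi: "continuous_on {0..l} (\<lambda>t. Phi t *v vtop c)"
    by (rule bounded_linear.continuous_on[OF bounded_linear_matrix_vector_left Phi_continuous])
  have ce: "continuous_on {0..l} (\<lambda>t. exp (2 * \<i> * z * of_real t))" by (intro continuous_intros)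
  have cg: "continuous_on {0..l} g"
    unfolding g_def[abs_def] by (rule bounded_bilinear.continuous_on[OF bounded_bilinear_smult ce cPhi])
  have pL: "p x = (LINT t|leb x. g t)" if "x \<in> {0..l}" for x
  proof -
    have "continuous_on {0..x} g" by (rule continuous_on_subset[OF cg]) (use that in auto)
    from lebesgue_integral_eq_integral[OF L2_on_integrable[OF L2_on_continuous[OF this]]] show ?thesis
      by (simp add: p_def)
  qed
  have p: "lip_ad l p g"
  proof (rule lip_ad_C1[OF _ cg])
    show "(p has_vector_derivative g x) (at x within {0..l})" if "x \<in> {0..l}" for x
      unfolding p_def[abs_def] by (rule integral_has_vector_derivative[OF cg that])
  qed
  define m where "m x = exp (a * of_real x) *s (vbot c + a *s p x)" for x
  have 1: "lip_ad l (\<lambda>x. vbot c + a *s p x) (\<lambda>x. 0 + a *s g x)"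
    by (intro lip_ad_add lip_ad_const lip_ad_linear[OF bounded_bilinear.bounded_linear_right[OF bounded_bilinear_smult]] p)
  have 2: "lip_ad l m (\<lambda>x. exp (a * of_real x) *s (0 + a *s g x) + (a * exp (a * of_real x)) *s (vbot c + a *s p x))"
    unfolding m_def[abs_def] by (rule lip_ad_bilinear[OF bounded_bilinear_smult lip_ad_exp 1])
  have qm: "qsol z c x = Phi x *v vtop c + m x" if "x \<in> {0..l}" for x
    unfolding qsol_def m_def pL[OF that] g_def a_def ..
  have D: "exp (a * of_real x) *s (0 + a *s g x) + (a * exp (a * of_real x)) *s (vbot c + a *s p x) = a *s qsol z c x"
    if "x \<in> {0..l}" for x
  proof -
    have "exp (a * of_real x) *s g x = Phi x *v vtop c"
      by (simp add: g_def smult_smult a_def flip: exp_add)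
    then have "a *s (exp (a * of_real x) *s g x) = a *s (Phi x *v vtop c)" by simp
    then show ?thesis
      unfolding qm[OF that] m_def by (simp add: vec_eq_iff algebra_simps)
  qed
  have cm: "continuous_on {0..l} m" by (rule lip_ad_continuous_on[OF 2])
  have "continuous_on {0..l} (\<lambda>x. Phi x *v vtop c + m x)" by (intro continuous_on_add cPhi cm)
  then show cq: "continuous_on {0..l} (qsol z c)" by (rule continuous_on_eq) (simp add: qm)
  assume x: "x \<in> {0..l}"
  have cqx: "continuous_on {0..x} (qsol z c)" by (rule continuous_on_subset[OF cq]) (use x in auto)
  have "m x - m 0 = (LINT t|leb x. exp (a * of_real t) *s (0 + a *s g t) + (a * exp (a * of_real t)) *s (vbot c + a *s p t))"
    by (rule lip_ad_lebesgue_integral[OF 2, symmetric]) (use x in auto)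
  also have "\<dots> = (LINT t|leb x. a *s qsol z c t)"
    by (rule Bochner_Integration.integral_cong[OF refl], rule D) (use x in auto)
  also have "\<dots> = a *s (LINT t|leb x. qsol z c t)"
    by (rule integral_bounded_linear[OF bounded_bilinear.bounded_linear_right[OF bounded_bilinear_smult]
          L2_on_integrable[OF L2_on_continuous[OF cqx]]])
  finally have "m x = a *s (LINT t|leb x. qsol z c t) + m 0"
    by (simp only: diff_eq_eq)
  moreover have "m 0 = vbot c" by (simp add: m_def p_def)
  ultimately have "m x = vbot c + a *s (LINT t|leb x. qsol z c t)"
    by (simp only: add.commute)
  then show "qsol z c x = Phi x *v vtop c + vbot c + (- 2 * \<i> * z) *s Jop l (qsol z c) x"
    unfolding qm[OF x] Jop_eq[OF x] a_def by simp
qed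

lemma qsol_L2: "L2_on {0..l} (qsol z c)"
  by (rule L2_on_continuous[OF qsol_eq(1)])

lemma fsol_L2: "L2_on {0..l} (fsol z c)"
  by (rule L2_on_continuous[OF continuous_on_fsol])

text \<open>Both sides solve \<open>f = \<gamma> c - 2 \<i> z \<gamma> \<integral>\<^sub>0\<^sup>x \<gamma>\<^sup>* f\<close>.\<close>

lemma Er_qsol: "AE x in leb l. Er l (qsol z c) x = fsol z c x"
proof -
  define a where "a = - 2 * \<i> * z"
  define q where "q = qsol z c"
  have q: "L2_on {0..l} q" unfolding q_def by (rule qsol_L2)
  have Eq: "L2_on {0..l} (Er l q)" by (rule Er_L2[OF order_refl q])
  have Pi: "L2_on {0..l} (\<lambda>t. Phi t *v vtop c + vbot c)" by (intro L2_on_add Phi_vec_L2 L2_on_const)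
  have 1: "AE x in leb l. Er l q x = \<gamma> x *v c + a *s Lop l \<gamma> (Er l q) x"
    using Er_Pi[of c] intertwining[OF less_imp_le[OF l_pos] order_refl q] AE_in_interval
  proof eventually_elim
    case (elim x)
    have "Er l q x = Er l (\<lambda>t. (Phi t *v vtop c + vbot c) + a *s Jop l q t) x"
      by (rule Er_cong[OF _ elim(3)]) (simp only: q_def qsol_eq(2) a_def)
    also have "\<dots> = Er l (\<lambda>t. Phi t *v vtop c + vbot c) x + Er l (\<lambda>t. a *s Jop l q t) x"
      by (rule Er_add[OF Pi L2_on_smult[OF Jop_L2[OF q]] order_refl elim(3)])
    also have "Er l (\<lambda>t. a *s Jop l q t) x = a *s Er l (Jop l q) x"
      by (rule Er_smult[OF order_refl Jop_L2[OF q] elim(3)])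
    finally show ?case using elim by simp
  qed
  have 2: "fsol z c x = \<gamma> x *v c + a *s Lop l \<gamma> (fsol z c) x" if x: "x \<in> {0..l}" for x
    unfolding Lop_gamma[OF fsol_L2 order_refl x] fsol_eq[OF x] ysol_integral(1)[OF x] a_def
    by (simp add: matrix_vector_mult_diff_distrib matrix_vector_right_distrib matrix_vector_mult_smult fsol_eq[OF x])
  define \<delta> where "\<delta> x = Er l q x - fsol z c x" for x
  have \<delta>: "L2_on {0..l} \<delta>" unfolding \<delta>_def[abs_def] by (rule L2_on_diff[OF Eq fsol_L2])
  \<comment> \<open>The difference of the two solutions satisfies the homogeneous equation with this
    kernel, so \<open>volterra_bound\<close> with bound 0 applies.\<close>
  define \<kappa> where "\<kappa> = (\<lambda>x t. mat (- a) ** (\<gamma> x ** adj (\<gamma> t)))"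
  have b\<kappa>: "bker l \<kappa>" unfolding \<kappa>_def by (rule bker_scale[OF bker_gamma[OF order_refl]])
  obtain C where C: "C > 0"
    "\<And>q a. L2_on {0..l} q \<Longrightarrow> 0 \<le> a \<Longrightarrow> (AE x in leb l. norm (q x + vop l (lowk \<kappa>) q x) \<le> a) \<Longrightarrow>
       AE x in leb l. norm (q x) \<le> a * exp (C * x)"
    using volterra_bound[OF b\<kappa>] by blast
  have "AE x in leb l. norm (\<delta> x + vop l (lowk \<kappa>) \<delta> x) \<le> 0"
    using 1 AE_in_interval adjp_AE_diff[OF adjp_vop[OF bker_lowk[OF bker_gamma[OF order_refl]]] Eq fsol_L2[of z c], folded Lop_def \<delta>_def]
  proof eventually_elim
    case (elim x)
    have v: "vop l (lowk \<kappa>) \<delta> x = (- a) *s Lop l \<gamma> \<delta> x"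
      unfolding \<kappa>_def lowk_scale Lop_def
      by (rule vop_scale[OF bker_lowk[OF bker_gamma[OF order_refl]] L2_on_integrable[OF \<delta>] elim(2)])
    have d: "\<delta> x = a *s Lop l \<gamma> (Er l q) x - a *s Lop l \<gamma> (fsol z c) x"
      unfolding \<delta>_def using elim(1) 2[OF elim(2)] by (metis add_diff_cancel_left)
    have "\<delta> x + vop l (lowk \<kappa>) \<delta> x = 0"
      unfolding v elim(3) unfolding d by (simp add: vec_eq_iff algebra_simps)
    then show ?case by simp
  qed
  from C(2)[OF \<delta> order_refl this] show ?thesis
    by eventually_elim (simp add: \<delta>_def q_def)
qed

text \<open>With initial value (h, W h), \<open>qsol\<close> at l is bounded by a constant times the
  norm of h, uniformly in z, by \<open>weyl_solution_decay\<close> and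
  \<open>volterra_bound\<close>. Solving the formula for \<open>qsol\<close> at l for its bracket
  multiplies by a factor of modulus exp (- 2 l Im z).\<close>

lemma weyl_estimate:
  obtains C where "C \<ge> 0" "\<And>z W h. Im z > M \<Longrightarrow>
     (norm (vbot (u l z *v vjoin h (W *v h))) \<le> norm (vtop (u l z *v vjoin h (W *v h)))) \<Longrightarrow>
     norm (W *v h + (- 2 * \<i> * z) *s (LINT t|leb l. exp (2 * \<i> * z * of_real t) *s (Phi t *v h))) \<le> C * exp (- 2 * l * Im z) * norm h"
proof -
  obtain C where C: "C > 0"
    "\<And>q a. L2_on {0..l} q \<Longrightarrow> 0 \<le> a \<Longrightarrow> (AE x in leb l. norm (q x + vop l (lowk ker) q x) \<le> a) \<Longrightarrow>
       AE x in leb l. norm (q x) \<le> a * exp (C * x)"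
    using volterra_bound[OF bker_ker[OF order_refl]] by blast
  obtain K where K: "\<And>h. norm (Phi l *v h) \<le> norm h * K" "K > 0"
    using bounded_linear.pos_bounded[OF bounded_linear_matrix_vector_right[of "Phi l"]] by blast
  define B where "B = exp (M * l) * exp (C * l)"
  show thesis
  proof (rule that[of "B + K"])
    show "B + K \<ge> 0" using K(2) by (simp add: B_def add_nonneg_nonneg)
    fix z W h assume z: "Im z > M" and wl: "norm (vbot (u l z *v vjoin h (W *v h))) \<le> norm (vtop (u l z *v vjoin h (W *v h)))"
    define c where "c = vjoin h (W *v h)"
    define D where "D = W *v h + (- 2 * \<i> * z) *s (LINT t|leb l. exp (2 * \<i> * z * of_real t) *s (Phi t *v h))"
    have "AE x in leb l. norm (qsol z c x + vop l (lowk ker) (qsol z c) x) \<le> exp (M * l) * norm h"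
      using Er_qsol[of z c] AE_in_interval
    proof eventually_elim
      case (elim x)
      have "norm (fsol z c x) \<le> exp (M * x) * norm (vtop c)"
        by (rule weyl_solution_decay[OF z _ elim(2)]) (use wl in \<open>simp add: c_def\<close>)
      also have "\<dots> \<le> exp (M * l) * norm h"
        using elim M_pos by (intro mult_mono) (auto simp: c_def)
      finally show ?case using elim(1) by (simp add: Er_def)
    qed
    from C(2)[OF qsol_L2 _ this]
    have "AE x in leb l. norm (qsol z c x) \<le> exp (M * l) * norm h * exp (C * x)" by simp
    then have "AE x in leb l. norm (qsol z c x) \<le> B * norm h"
      using AE_in_interval
    proof eventually_elim
      case (elim x)
      have "exp (M * l) * norm h * exp (C * x) \<le> exp (M * l) * norm h * exp (C * l)"
        using elim C(1) by (intro mult_left_mono) auto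
      then show ?case using elim by (simp add: B_def mult_ac)
    qed
    \<comment> \<open>The bound holds almost everywhere; continuity makes it available at the single
      point l.\<close>
    then have ql: "norm (qsol z c l) \<le> B * norm h"
      using l_pos by (intro continuous_AE_le[OF continuous_on_norm[OF qsol_eq(1)] l_pos]) auto
    have "exp ((- 2 * \<i> * z) * of_real l) *s D = qsol z c l - Phi l *v h"
      by (simp add: qsol_def D_def c_def)
    then have "norm (exp ((- 2 * \<i> * z) * of_real l) *s D) \<le> B * norm h + norm h * K"
      using norm_triangle_ineq4[of "qsol z c l" "Phi l *v h"] ql K(1)[of h] by simp
    moreover have "norm (exp ((- 2 * \<i> * z) * of_real l)) = exp (2 * l * Im z)" by (simp add: norm_exp_eq_Re)
    ultimately have "exp (2 * l * Im z) * norm D \<le> B * norm h + norm h * K"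
      by (simp only: norm_smult)
    then have "exp (2 * l * Im z) * norm D \<le> (B + K) * norm h"
      by (simp add: distrib_right mult.commute[of "norm h"])
    then have "exp (- 2 * l * Im z) * (exp (2 * l * Im z) * norm D) \<le> exp (- 2 * l * Im z) * ((B + K) * norm h)"
      by (rule mult_left_mono) simp
    then have "norm D \<le> exp (- 2 * l * Im z) * ((B + K) * norm h)"
      unfolding mult.assoc[symmetric] exp_add[symmetric] by simp
    then show "norm (W *v h + (- 2 * \<i> * z) *s (LINT t|leb l. exp (2 * \<i> * z * of_real t) *s (Phi t *v h))) \<le> (B + K) * exp (- 2 * l * Im z) * norm h"
      by (simp only: D_def mult_ac)
  qed
qed

end

lemma matrix_left_inverse_imp_matrix_inv:
  fixes A B :: "complex ^ 'n::finite ^ 'n"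
  assumes "B ** A = mat 1"
  shows "A ** matrix_inv A = mat 1" "matrix_inv A ** A = mat 1"
proof -
  have "\<exists>B. A ** B = mat 1 \<and> B ** A = mat 1" using assms matrix_left_right_inverse by blast
  then have "A ** matrix_inv A = mat 1 \<and> matrix_inv A ** A = mat 1"
    unfolding matrix_inv_def by (rule someI_ex)
  then show "A ** matrix_inv A = mat 1" "matrix_inv A ** A = mat 1" by auto
qed

lemma injective_imp_matrix_inv:
  fixes A :: "complex ^ 'n::finite ^ 'n"
  assumes "\<And>x. A *v x = 0 \<Longrightarrow> x = 0"
  shows "A ** matrix_inv A = mat 1" "matrix_inv A ** A = mat 1"
proof -
  have "\<exists>B. B ** A = mat 1" using assms unfolding matrix_left_invertible_ker by blast
  then obtain B where "B ** A = mat 1" ..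
  then show "A ** matrix_inv A = mat 1" "matrix_inv A ** A = mat 1"
    by (rule matrix_left_inverse_imp_matrix_inv)+
qed

section \<open>Weyl functions and the Laplace transform of \<Phi>1\<close>

context dirac_system begin

text \<open>The vector (h, W h) is \<open>Ui *v (P *v k)\<close> with
  \<open>k = matrix_inv Q *v h\<close>, so its solution arrives at l in \<open>P *v k\<close>, where
  the form of j is nonnegative. \<open>Q\<close> is injective: if the upper half of
  \<open>Ui *v (P *v k)\<close> vanishes, the form is nonpositive at 0, yet it is at least its
  nonnegative value at l; so the lower half vanishes too.\<close>

lemma weyl_function_j_nonneg:
  fixes P :: "complex ^ 'm1 ^ ('m1 + 'm2)"
  assumes z: "Im z > M" and pd: "pos_def (adj P ** P)" and ps: "pos_semidef (adj P ** jmat ** P)"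
    and W: "W = OI ** matrix_inv (u l z) ** P ** matrix_inv (I0 ** matrix_inv (u l z) ** P)"
  shows "norm (vbot (u l z *v vjoin h (W *v h))) \<le> norm (vtop (u l z *v vjoin h (W *v h)))"
proof -
  define Ui where "Ui = matrix_inv (u l z)"
  define Q where "Q = I0 ** Ui ** P"
  have l: "l \<in> {0..l}" using l_pos by simp
  have U: "u l z ** Ui = mat 1" "Ui ** u l z = mat 1"
    unfolding Ui_def by (rule matrix_left_inverse_imp_matrix_inv[OF adj_u_mult_u(1)[OF l]])+
  have uU: "u l z *v (Ui *v y) = y" for y by (simp add: matrix_vector_mul_assoc U)
  have pos: "norm (vbot (P *v k)) \<le> norm (vtop (P *v k))" for k
  proof -
    have "herm_form (adj P ** jmat ** P) k = cip (P *v k) (jmat *v (P *v k))"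
      by (simp only: herm_form_cip matrix_vector_mul_assoc[symmetric] cip_adj adj_adj)
    also have "\<dots> = of_real ((norm (vtop (P *v k)))\<^sup>2 - (norm (vbot (P *v k)))\<^sup>2)"
      by (simp only: cip_blocks[of "P *v k"] vtop_jmat vbot_jmat cip_minus_right cip_self of_real_diff) simp
    finally have "Re (herm_form (adj P ** jmat ** P) k) = (norm (vtop (P *v k)))\<^sup>2 - (norm (vbot (P *v k)))\<^sup>2" by simp
    moreover have "0 \<le> Re (herm_form (adj P ** jmat ** P) k)" using ps by (simp add: pos_semidef_def)
    ultimately have "(norm (vbot (P *v k)))\<^sup>2 \<le> (norm (vtop (P *v k)))\<^sup>2" by simp
    then show ?thesis by (rule power2_le_imp_le) simp
  qed
  have Qv: "Q *v k = vtop (Ui *v (P *v k))" for k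
    by (simp only: Q_def matrix_vector_mul_assoc[symmetric] I0_mult_vec)
  have inj: "k = 0" if "Q *v k = 0" for k
  proof -
    define y where "y = Ui *v (P *v k)"
    have y0: "vtop y = 0" using that by (simp add: Qv y_def)
    have uy: "u l z *v y = P *v k" by (simp add: y_def uU)
    have "(norm (vtop (u l z *v y)))\<^sup>2 - (norm (vbot (u l z *v y)))\<^sup>2 \<le> (norm (vtop (u 0 z *v y)))\<^sup>2 - (norm (vbot (u 0 z *v y)))\<^sup>2"
      by (rule j_form_antimono) (use z l_pos in auto)
    moreover have "(norm (vbot (P *v k)))\<^sup>2 \<le> (norm (vtop (P *v k)))\<^sup>2" using pos by (intro power_mono) auto
    ultimately have "(norm (vbot y))\<^sup>2 \<le> 0" unfolding uy u_0 y0 matrix_vector_mul_lid norm_zero power_zero_numeral by linarith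
    then have "vbot y = 0" by simp
    with y0 have "y = 0" by (intro block_vec_eqI) (simp_all add: vtop_def vbot_def vec_eq_iff)
    then have Pk: "P *v k = 0" using uy by simp
    show ?thesis
    proof (rule ccontr)
      assume "k \<noteq> 0"
      then have "0 < Re (herm_form (adj P ** P) k)" using pd by (simp add: pos_def_def)
      then show False by (simp add: herm_form_cip matrix_vector_mul_assoc[symmetric] Pk)
    qed
  qed
  from injective_imp_matrix_inv(1)[of Q, OF inj] have Qi: "Q ** matrix_inv Q = mat 1" by blast
  define k where "k = matrix_inv Q *v h"
  have "vtop (Ui *v (P *v k)) = h"
    unfolding Qv[symmetric] k_def by (simp only: matrix_vector_mul_assoc Qi matrix_vector_mul_lid)
  moreover have "vbot (Ui *v (P *v k)) = W *v h"
    unfolding W Ui_def[symmetric] Q_def[symmetric] k_def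
    by (simp only: matrix_vector_mul_assoc[symmetric] OI_mult_vec)
  ultimately have "vjoin h (W *v h) = Ui *v (P *v k)" by (metis vjoin_eq)
  then have "u l z *v vjoin h (W *v h) = P *v k" by (simp add: uU)
  then show ?thesis using pos by simp
qed

end

lemma derivative_on_eq:
  fixes f :: "real \<Rightarrow> 'a::euclidean_space"
  assumes "0 < l" "x \<in> {0..l}" "(f has_vector_derivative D) (at x within {0..l})"
  shows "derivative_on l f x = D"
  unfolding derivative_on_def using vector_derivative_within_cbox[of 0 l x f D] assms by (simp add: box_real)

lemma boundedly_differentiable_imp_lip_ad:
  assumes l: "0 < l" and f: "boundedly_differentiable l f"
  shows "lip_ad l f (derivative_on l f)"
proof -
  obtain B where ac: "absolutely_continuous_on {0..l} f"
    and B: "AE x in leb l. \<exists>D. (f has_vector_derivative D) (at x within {0..l}) \<and> norm D \<le> B"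
    using f by (auto simp: boundedly_differentiable_def)
  have "AE x in leb l. (f has_vector_derivative derivative_on l f x) (at x within {0..l}) \<and> norm (derivative_on l f x) \<le> B"
    using B AE_space_lebesgue_on[of "{0..l}"]
  proof eventually_elim
    case (elim x)
    then obtain D where D: "(f has_vector_derivative D) (at x within {0..l})" "norm D \<le> B" by blast
    with derivative_on_eq[OF l elim(2) D(1)] show ?case by simp
  qed
  then have "AE x in leb l. (f has_vector_derivative derivative_on l f x) (at x within {0..l})"
    "AE x in leb l. norm (derivative_on l f x) \<le> B" by (eventually_elim, simp)+
  then show ?thesis by (rule lip_adI_absolutely_continuous[OF ac])
qed

lemma open_half_plane: "open (half_plane M)"
  unfolding half_plane_def by (simp add: open_halfspace_Im_gt)

context dirac_similarity begin

lemma Phi_entry_continuous: "continuous_on {0..l} (\<lambda>t. Phi t $ i $ j)"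
  by (intro continuous_on_component Phi_continuous)

lemma Phi_vec_zero: "Phi 0 = 0"
  unfolding Phi_def using integral_cong_AE[of dfun "lebesgue_on {0..0}" "\<lambda>_. 0"] AE_lebesgue_on_singleton
  by (simp add: dfun_measurable)

text \<open>The estimate is first obtained off the discrete exceptional set in the definition of a
  Weyl function and extends by continuity of both sides, since \<open>\<phi>\<close> is analytic and
  the Laplace transform entire.\<close>

lemma weyl_asymptotics:
  assumes weyl: "weyl_function l M u \<phi>"
  obtains C where "C \<ge> 0" "\<And>z i j. Im z > M \<Longrightarrow>
     norm (\<phi> z $ i $ j - 2 * \<i> * z * Lap l (\<lambda>t. Phi t $ i $ j) z) \<le> C * exp (- 2 * l * Im z)"
proof -
  obtain P where P: "P_ge M P" and ev: "\<forall>\<^sub>F z in cosparse (half_plane M).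
      \<phi> z = OI ** matrix_inv (u l z) ** P z ** matrix_inv (I0 ** matrix_inv (u l z) ** P z)"
    and an: "\<And>i k. (\<lambda>z. \<phi> z $ i $ k) analytic_on half_plane M"
    using weyl by (auto simp: weyl_function_def)
  obtain C where C: "C \<ge> 0" "\<And>z W h. Im z > M \<Longrightarrow>
     (norm (vbot (u l z *v vjoin h (W *v h))) \<le> norm (vtop (u l z *v vjoin h (W *v h)))) \<Longrightarrow>
     norm (W *v h + (- 2 * \<i> * z) *s (LINT t|leb l. exp (2 * \<i> * z * of_real t) *s (Phi t *v h))) \<le> C * exp (- 2 * l * Im z) * norm h"
    by (rule weyl_estimate) blast
  have ev2: "\<forall>\<^sub>F z in cosparse (half_plane M). pos_def (adj (P z) ** P z) \<and> pos_semidef (adj (P z) ** jmat ** P z)"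
    using P by (simp add: P_ge_def)
  define D where "D i j z = \<phi> z $ i $ j - 2 * \<i> * z * Lap l (\<lambda>t. Phi t $ i $ j) z" for i j z
  have good: "norm (D i j z) \<le> C * exp (- 2 * l * Im z)"
    if "Im z > M" "\<phi> z = OI ** matrix_inv (u l z) ** P z ** matrix_inv (I0 ** matrix_inv (u l z) ** P z)"
      "pos_def (adj (P z) ** P z) \<and> pos_semidef (adj (P z) ** jmat ** P z)" for z i j
  proof -
    define X where "X = \<phi> z *v axis j 1 + (- 2 * \<i> * z) *s (LINT t|leb l. exp (2 * \<i> * z * of_real t) *s (Phi t *v axis j 1))"
    have le: "norm X \<le> C * exp (- 2 * l * Im z) * norm (axis j 1 :: complex ^ 'm1)"
      unfolding X_def by (rule C(2)[OF that(1) weyl_function_j_nonneg[OF that(1) _ _ that(2)]]) (use that(3) in auto)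
    have int: "integrable (leb l) (\<lambda>t. exp (2 * \<i> * z * of_real t) *s (Phi t *v axis j 1))"
    proof (intro L2_on_integrable L2_on_continuous)
      have "continuous_on {0..l} (\<lambda>t. exp (2 * \<i> * z * of_real t))" by (intro continuous_intros)
      then show "continuous_on {0..l} (\<lambda>t. exp (2 * \<i> * z * of_real t) *s (Phi t *v axis j 1))"
        by (rule bounded_bilinear.continuous_on[OF bounded_bilinear_smult _
              bounded_linear.continuous_on[OF bounded_linear_matrix_vector_left Phi_continuous]])
    qed
    have "(LINT t|leb l. exp (2 * \<i> * z * of_real t) *s (Phi t *v axis j 1)) $ i
        = (LINT t|leb l. (exp (2 * \<i> * z * of_real t) *s (Phi t *v axis j 1)) $ i)"
      using integral_bounded_linear[OF bounded_linear_vec_nth int] by simp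
    also have "\<dots> = Lap l (\<lambda>t. Phi t $ i $ j) z"
      by (simp add: Lap_def matrix_vector_axis)
    finally have "X $ i = D i j z"
      by (simp add: X_def D_def matrix_vector_axis)
    then show ?thesis
      using order_trans[OF Finite_Cartesian_Product.norm_nth_le[of X i] le] by simp
  qed
  have cD: "isCont (D i j) z" if "Im z > M" for i j z
  proof -
    have "(\<lambda>z. \<phi> z $ i $ j) analytic_on {z}"
      by (rule analytic_on_subset[OF an]) (use that in \<open>simp add: half_plane_def\<close>)
    then have "isCont (\<lambda>z. \<phi> z $ i $ j) z" by (rule analytic_at_imp_isCont)
    moreover have "isCont (Lap l (\<lambda>t. Phi t $ i $ j)) z"
      using holomorphic_on_imp_continuous_on[OF Lap_holomorphic[OF Phi_entry_continuous]]
      by (simp add: continuous_on_eq_continuous_at)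
    ultimately show ?thesis unfolding D_def[abs_def]
      by (rule isCont_diff[OF _ isCont_mult[OF continuous_mult[OF continuous_const continuous_ident]]])
  qed
  have all: "norm (D i j z) \<le> C * exp (- 2 * l * Im z)" if z: "Im z > M" for i j z
  proof -
    have zh: "z \<in> half_plane M" using z by (simp add: half_plane_def)
    have "\<forall>\<^sub>F w in at z. norm (D i j w) \<le> C * exp (- 2 * l * Im w)"
    proof -
      have "\<forall>\<^sub>F w in at z. w \<in> half_plane M"
        using eventually_at_in_open'[OF open_half_plane zh] .
      then show ?thesis
        using eventually_cosparse_imp_eventually_at[OF ev zh, of UNIV] eventually_cosparse_imp_eventually_at[OF ev2 zh, of UNIV]
        by eventually_elim (rule good, auto simp: half_plane_def)
    qed
    moreover have "((\<lambda>w. norm (D i j w)) \<longlongrightarrow> norm (D i j z)) (at z)"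
      using cD[OF z] by (intro tendsto_norm) (simp add: isCont_def)
    moreover have "((\<lambda>w. C * exp (- 2 * l * Im w)) \<longlongrightarrow> C * exp (- 2 * l * Im z)) (at z)"
      by (intro tendsto_intros)
    ultimately show ?thesis by (intro tendsto_le[of "at z"]) auto
  qed
  show thesis by (rule that[OF C(1)]) (use all in \<open>simp add: D_def\<close>)
qed

text \<open>Both functions are continuous representatives of the same class, the image of
  \<open>\<gamma>\<^sub>1\<close> under \<open>Einv\<close>; their derivatives agree almost
  everywhere because the integrals over all [0,x] do.\<close>

lemma is_Phi1_imp:
  assumes "is_Phi1 l u Einv \<Phi>1"
  shows "\<And>x. x \<in> {0..l} \<Longrightarrow> \<Phi>1 x = Phi x" "AE x in leb l. derivative_on l \<Phi>1 x = dfun x"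
proof -
  have bd: "boundedly_differentiable l \<Phi>1"
    and ae: "AE x in leb l. \<Phi>1 x = apply_columnwise Einv (\<lambda>t. left_block (\<gamma> t)) x"
    using assms by (auto simp: is_Phi1_def)
  note lip = boundedly_differentiable_imp_lip_ad[OF l_pos bd]
  have col: "AE x in leb l. Einv (\<lambda>t. column j (left_block (\<gamma> t))) x = Phi x *v axis j 1" for j
  proof -
    define h where "h t = column j (left_block (\<gamma> t))" for t
    have h: "h t = \<gamma> t *v vjoin (axis j 1) 0" for t
      by (simp add: h_def left_block_mult[symmetric] vec_eq_iff matrix_vector_axis column_def)
    have hL2: "L2_on {0..l} h" unfolding h[abs_def] by (rule gamma_vec_L2)
    have p: "L2_on {0..l} (\<lambda>t. Phi t *v axis j 1)" by (rule Phi_vec_L2)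
    have "AE x in leb l. E (\<lambda>t. Phi t *v axis j 1) x = h x"
      using E_Er[OF p] Er_Phi[of "axis j 1"] by eventually_elim (simp add: h)
    then have "AE x in leb l. Einv (E (\<lambda>t. Phi t *v axis j 1)) x = Einv h x"
      by (rule bounded_L2_operator_AE_cong[OF Einv_bounded E_L2[OF p] hL2])
    with Einv_E[OF p] show ?thesis unfolding h_def[abs_def] by eventually_elim simp
  qed
  have "AE x in leb l. \<forall>j\<in>UNIV. Einv (\<lambda>t. column j (left_block (\<gamma> t))) x = Phi x *v axis j 1"
    by (rule AE_finite_allI) (simp_all add: col)
  with ae have "AE x in leb l. \<Phi>1 x = Phi x"
    by eventually_elim (simp add: vec_eq_iff apply_columnwise_def matrix_vector_axis)
  then show eq: "\<Phi>1 x = Phi x" if "x \<in> {0..l}" for x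
    by (rule continuous_AE_eq[OF lip_ad_continuous_on[OF lip] Phi_continuous l_pos _ that])
  have "AE x in leb l. derivative_on l \<Phi>1 x - dfun x = 0"
  proof (rule AE_zero_if_indefinite_integral_zero)
    show "integrable (leb l) (\<lambda>x. derivative_on l \<Phi>1 x - dfun x)"
      by (intro Bochner_Integration.integrable_diff lip_ad_integrable[OF lip] dfun_integrable)
    fix x assume x: "x \<in> {0..l}"
    have "(LINT t|leb x. derivative_on l \<Phi>1 t - dfun t) = (LINT t|leb x. derivative_on l \<Phi>1 t) - Phi x"
      unfolding Phi_def using x
      by (intro Bochner_Integration.integral_diff dfun_integrable lip_ad_integrable[OF lip_ad_restrict[OF lip]]) auto
    also have "\<dots> = \<Phi>1 x - \<Phi>1 0 - Phi x"
      using lip_ad_lebesgue_integral[OF lip, of x] x by simp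
    also have "\<Phi>1 0 = Phi 0" using eq[of 0] l_pos by simp
    also have "Phi 0 = 0" using Phi_vec_zero .
    finally show "(LINT t|leb x. derivative_on l \<Phi>1 t - dfun t) = 0" using eq[OF x] by simp
  qed
  then show "AE x in leb l. derivative_on l \<Phi>1 x = dfun x" by eventually_elim simp
qed

end

text \<open>The Weyl function determines the Laplace transform of \<open>Phi\<close> up to \<open>O(exp (- 2 l Im z))\<close>.\<close>

lemma Phi_unique:
  assumes "dirac_similarity l M v1 u1 E1 Einv1" "dirac_similarity l M v2 u2 E2 Einv2"
    and w1: "weyl_function l M u1 \<phi>" and w2: "weyl_function l M u2 \<phi>"
  shows "\<And>x. x \<in> {0..l} \<Longrightarrow> dirac_similarity.Phi l v1 Einv1 x = dirac_similarity.Phi l v2 Einv2 x"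
    "AE x in leb l. dirac_similarity.dfun l v1 Einv1 x = dirac_similarity.dfun l v2 Einv2 x"
proof -
  interpret A: dirac_similarity l M v1 u1 E1 Einv1 by fact
  interpret B: dirac_similarity l M v2 u2 E2 Einv2 by fact
  have ent: "AE t in leb l. A.Phi t $ i $ j - B.Phi t $ i $ j = 0" for i j
  proof -
    define \<delta> where "\<delta> t = A.Phi t $ i $ j - B.Phi t $ i $ j" for t
    obtain C1 where C1: "C1 \<ge> 0" "\<And>z i j. Im z > M \<Longrightarrow>
       norm (\<phi> z $ i $ j - 2 * \<i> * z * Lap l (\<lambda>t. A.Phi t $ i $ j) z) \<le> C1 * exp (- 2 * l * Im z)"
      by (rule A.weyl_asymptotics[OF w1]) blast
    obtain C2 where C2: "C2 \<ge> 0" "\<And>z i j. Im z > M \<Longrightarrow>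
       norm (\<phi> z $ i $ j - 2 * \<i> * z * Lap l (\<lambda>t. B.Phi t $ i $ j) z) \<le> C2 * exp (- 2 * l * Im z)"
      by (rule B.weyl_asymptotics[OF w2]) blast
    have c\<delta>: "continuous_on {0..l} \<delta>"
      unfolding \<delta>_def[abs_def] by (intro continuous_on_diff A.Phi_entry_continuous B.Phi_entry_continuous)
    have "AE t in leb l. \<delta> t = 0"
    proof (rule AE_zero_if_Laplace_bound)
      show "integrable (leb l) \<delta>" by (rule L2_on_integrable[OF L2_on_continuous[OF c\<delta>]])
      show "0 \<le> M" using A.M_pos by simp
      fix z assume z: "Im z > M"
      define a where "a = Lap l (\<lambda>t. A.Phi t $ i $ j) z"
      define b where "b = Lap l (\<lambda>t. B.Phi t $ i $ j) z"
      define e where "e = exp (- 2 * l * Im z)"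
      have ie: "integrable (leb l) (\<lambda>t. exp (2 * \<i> * z * of_real t) * g t)" if "continuous_on {0..l} g" for g
        using that by (intro L2_on_integrable L2_on_continuous continuous_intros)
      have eq: "(LINT t|leb l. exp (2 * \<i> * z * of_real t) * \<delta> t) = a - b"
        unfolding a_def b_def Lap_def \<delta>_def right_diff_distrib
        by (intro Bochner_Integration.integral_diff ie A.Phi_entry_continuous B.Phi_entry_continuous)
      have "2 * norm z * norm (a - b) = norm (2 * \<i> * z * (a - b))" by (simp add: norm_mult)
      also have "2 * \<i> * z * (a - b) = (\<phi> z $ i $ j - 2 * \<i> * z * b) - (\<phi> z $ i $ j - 2 * \<i> * z * a)"
        by (simp add: algebra_simps)
      also have "norm ((\<phi> z $ i $ j - 2 * \<i> * z * b) - (\<phi> z $ i $ j - 2 * \<i> * z * a)) \<le> C2 * e + C1 * e"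
        by (rule order_trans[OF norm_triangle_ineq4 add_mono])
           (use C1(2)[OF z, of i j] C2(2)[OF z, of i j] in \<open>simp_all add: a_def b_def e_def\<close>)
      finally have "2 * norm z * norm (a - b) \<le> (C1 + C2) * e" by (simp add: algebra_simps)
      \<comment> \<open>Dividing by \<open>2 * norm z\<close> costs at most the factor
        \<open>1 / (2 * M)\<close>, as \<open>norm z \<ge> Im z > M\<close>.\<close>
      moreover have "2 * M * norm (a - b) \<le> 2 * norm z * norm (a - b)"
        using z abs_Im_le_cmod[of z] by (intro mult_right_mono) auto
      ultimately have "2 * M * norm (a - b) \<le> (C1 + C2) * e" by linarith
      then have "norm (a - b) \<le> (C1 + C2) * e / (2 * M)" using A.M_pos by (simp add: field_simps)
      then show "norm (LINT t|leb l. exp (2 * \<i> * z * of_real t) * \<delta> t) \<le> (C1 + C2) / (2 * M) * exp (- 2 * l * Im z)"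
        by (simp add: eq e_def)
    qed
    then show ?thesis by (simp add: \<delta>_def)
  qed
  have "AE t in leb l. \<forall>p\<in>UNIV. A.Phi t $ fst p $ snd p - B.Phi t $ fst p $ snd p = 0"
  proof (rule AE_finite_allI)
    show "AE t in leb l. A.Phi t $ fst p $ snd p - B.Phi t $ fst p $ snd p = 0" for p
      by (rule ent)
  qed simp
  then have "AE t in leb l. A.Phi t = B.Phi t"
    by eventually_elim (auto simp: vec_eq_iff)
  then show eq: "A.Phi x = B.Phi x" if "x \<in> {0..l}" for x
    by (rule continuous_AE_eq[OF A.Phi_continuous B.Phi_continuous A.l_pos _ that])
  have "AE x in leb l. A.dfun x - B.dfun x = 0"
  proof (rule AE_zero_if_indefinite_integral_zero)
    show "integrable (leb l) (\<lambda>x. A.dfun x - B.dfun x)"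
      by (intro Bochner_Integration.integrable_diff A.dfun_integrable B.dfun_integrable)
    fix x assume x: "x \<in> {0..l}"
    have "(LINT t|leb x. A.dfun t - B.dfun t) = A.Phi x - B.Phi x"
      unfolding A.Phi_def B.Phi_def by (intro Bochner_Integration.integral_diff A.dfun_integrable B.dfun_integrable)
    then show "(LINT t|leb x. A.dfun t - B.dfun t) = 0" using eq[OF x] by simp
  qed
  then show "AE x in leb l. A.dfun x = B.dfun x" by eventually_elim simp
qed

section \<open>The inverse of the operator S\<close>

lemma bker_section_measurable:
  assumes "bker r \<kappa>"
  shows "x \<in> {0..r} \<Longrightarrow> (\<lambda>t. \<kappa> x t) \<in> borel_measurable (leb r)"
    "t \<in> {0..r} \<Longrightarrow> (\<lambda>x. \<kappa> x t) \<in> borel_measurable (leb r)"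
  using measurable_Pair2[OF assms[unfolded bker_def, THEN conjunct1], of x] measurable_Pair1[OF assms[unfolded bker_def, THEN conjunct1], of t]
  by simp_all

lemma vop_compose:
  fixes \<kappa>1 :: "real \<Rightarrow> real \<Rightarrow> complex ^ 'k::finite ^ 'p::finite" and \<kappa>2 :: "real \<Rightarrow> real \<Rightarrow> complex ^ 'q::finite ^ 'k"
  assumes \<kappa>1: "bker r \<kappa>1" and \<kappa>2: "bker r \<kappa>2" and f: "L2_on {0..r} f" and x: "x \<in> {0..r}"
  shows "vop r \<kappa>1 (vop r \<kappa>2 f) x = vop r (\<lambda>x t. LINT \<zeta>|leb r. \<kappa>1 x \<zeta> ** \<kappa>2 \<zeta> t) f x"
proof -
  obtain K where K: "K > 0" "\<And>A x. norm ((A::complex^'q^'p) *v x) \<le> norm A * norm x * K"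
    by (rule bounded_matrix_vector) blast
  obtain K' where K': "K' > 0" "\<And>A B. norm ((A::complex^'k^'p) ** (B::complex^'q^'k)) \<le> norm A * norm B * K'"
    using bounded_bilinear.pos_bounded[OF bounded_bilinear_matrix_matrix_mult] by blast
  obtain C1 where C1: "C1 \<ge> 0" "\<And>x t. x \<in> {0..r} \<Longrightarrow> t \<in> {0..r} \<Longrightarrow> norm (\<kappa>1 x t) \<le> C1"
    using bkerD_bound[OF \<kappa>1] by blast
  obtain C2 where C2: "C2 \<ge> 0" "\<And>x t. x \<in> {0..r} \<Longrightarrow> t \<in> {0..r} \<Longrightarrow> norm (\<kappa>2 x t) \<le> C2"
    using bkerD_bound[OF \<kappa>2] by blast
  interpret finite_measure "leb r" by (rule finite_measure_lebesgue_on_Icc)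
  note fi = L2_on_integrable[OF f]
  have le: "norm (\<kappa>1 x \<zeta> ** \<kappa>2 \<zeta> t) \<le> C1 * C2 * K'" if "\<zeta> \<in> {0..r}" "t \<in> {0..r}" for \<zeta> t
  proof -
    have "norm (\<kappa>1 x \<zeta> ** \<kappa>2 \<zeta> t) \<le> norm (\<kappa>1 x \<zeta>) * norm (\<kappa>2 \<zeta> t) * K'" by (rule K')
    also have "\<dots> \<le> C1 * C2 * K'" using that x C1 C2 K'(1) by (intro mult_right_mono mult_mono) auto
    finally show ?thesis .
  qed
  have int: "integrable (leb r) (\<lambda>\<zeta>. \<kappa>1 x \<zeta> ** \<kappa>2 \<zeta> t)" if t: "t \<in> {0..r}" for t
  proof (rule integrable_const_bound)
    show "AE \<zeta> in leb r. norm (\<kappa>1 x \<zeta> ** \<kappa>2 \<zeta> t) \<le> C1 * C2 * K'"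
      using AE_space_lebesgue_on[of "{0..r}"] by eventually_elim (rule le[OF _ t])
    show "(\<lambda>\<zeta>. \<kappa>1 x \<zeta> ** \<kappa>2 \<zeta> t) \<in> borel_measurable (leb r)"
      by (intro borel_measurable_mm bker_section_measurable[OF \<kappa>1] bker_section_measurable[OF \<kappa>2] t x)
  qed
  define H where "H \<zeta> t = (\<kappa>1 x \<zeta> ** \<kappa>2 \<zeta> t) *v f t" for \<zeta> t
  have "vop r \<kappa>1 (vop r \<kappa>2 f) x = (LINT \<zeta>|leb r. LINT t|leb r. H \<zeta> t)"
    unfolding vop_def[of r \<kappa>1]
  proof (rule Bochner_Integration.integral_cong)
    fix \<zeta> assume "\<zeta> \<in> space (leb r)"
    then have \<zeta>: "\<zeta> \<in> {0..r}" by simp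
    show "\<kappa>1 x \<zeta> *v vop r \<kappa>2 f \<zeta> = (LINT t|leb r. H \<zeta> t)"
      unfolding vop_def H_def
      using integral_bounded_linear[OF bounded_linear_matrix_vector_right bker_section_integrable[OF \<kappa>2 fi \<zeta>], of "\<kappa>1 x \<zeta>"]
      by (simp add: matrix_vector_mul_assoc)
  qed simp
  also have "\<dots> = (LINT t|leb r. LINT \<zeta>|leb r. H \<zeta> t)"
  proof (rule Fubini_lebesgue_on_bounded[symmetric, where f = "\<lambda>\<zeta>. 1" and g = "\<lambda>t. C1 * C2 * K' * K * norm (f t)"])
    have a: "(\<lambda>p. f (snd p)) \<in> borel_measurable (leb r \<Otimes>\<^sub>M leb r)"
      by (rule measurable_compose[OF measurable_snd L2_on_measurable[OF f]])
    have b: "(\<lambda>p. \<kappa>1 x (fst p)) \<in> borel_measurable (leb r \<Otimes>\<^sub>M leb r)"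
      by (rule measurable_compose[OF measurable_fst bker_section_measurable(1)[OF \<kappa>1 x]])
    show "(\<lambda>(\<zeta>, t). H \<zeta> t) \<in> borel_measurable (leb r \<Otimes>\<^sub>M leb r)"
      unfolding H_def case_prod_beta' using \<kappa>2
      by (intro borel_measurable_mv borel_measurable_mm a b) (simp add: bker_def case_prod_beta')
    fix \<zeta> t assume xt: "\<zeta> \<in> {0..r}" "t \<in> {0..r}"
    have "norm (H \<zeta> t) \<le> norm (\<kappa>1 x \<zeta> ** \<kappa>2 \<zeta> t) * norm (f t) * K" unfolding H_def by (rule K)
    also have "\<dots> \<le> (C1 * C2 * K') * norm (f t) * K" using le[OF xt] K(1) by (intro mult_right_mono) auto
    finally show "norm (H \<zeta> t) \<le> 1 * (C1 * C2 * K' * K * norm (f t))" by (simp add: mult_ac)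
  qed (use C1(1) C2(1) K(1) K'(1) fi in auto)
  also have "\<dots> = vop r (\<lambda>x t. LINT \<zeta>|leb r. \<kappa>1 x \<zeta> ** \<kappa>2 \<zeta> t) f x"
    unfolding vop_def
  proof (rule Bochner_Integration.integral_cong)
    fix t assume "t \<in> space (leb r)"
    then have t: "t \<in> {0..r}" by simp
    show "(LINT \<zeta>|leb r. H \<zeta> t) = (LINT \<zeta>|leb r. \<kappa>1 x \<zeta> ** \<kappa>2 \<zeta> t) *v f t"
      unfolding H_def using integral_bounded_linear[OF bounded_linear_matrix_vector_left int[OF t], of "f t"] by simp
  qed simp
  finally show ?thesis .
qed

text \<open>Boundedness in both the L^2 and the supremum norm. The first is what
  \<open>L2_inverse_operator\<close> demands of the truncated S and its inverse, the second gives
  the bound uniform in z of \<open>hdef_bound\<close>.\<close>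

definition bop :: "real \<Rightarrow> ('p::finite vfun \<Rightarrow> 'q::finite vfun) \<Rightarrow> bool" where
  "bop r T \<longleftrightarrow> (\<forall>f. L2_on {0..r} f \<longrightarrow> L2_on {0..r} (T f)) \<and>
     (\<exists>C\<ge>0. \<forall>f. L2_on {0..r} f \<longrightarrow> (LINT x|leb r. (norm (T f x))\<^sup>2) \<le> C * (LINT x|leb r. (norm (f x))\<^sup>2)) \<and>
     (\<exists>C\<ge>0. \<forall>f A. L2_on {0..r} f \<longrightarrow> A \<ge> 0 \<longrightarrow> (AE x in leb r. norm (f x) \<le> A) \<longrightarrow>
        (AE x in leb r. norm (T f x) \<le> C * A))"

lemma bopE:
  assumes "bop r T"
  obtains C D where "C \<ge> 0" "D \<ge> 0"
    "\<And>f. L2_on {0..r} f \<Longrightarrow> L2_on {0..r} (T f)"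
    "\<And>f. L2_on {0..r} f \<Longrightarrow> (LINT x|leb r. (norm (T f x))\<^sup>2) \<le> C * (LINT x|leb r. (norm (f x))\<^sup>2)"
    "\<And>f A. L2_on {0..r} f \<Longrightarrow> A \<ge> 0 \<Longrightarrow> (AE x in leb r. norm (f x) \<le> A) \<Longrightarrow>
        (AE x in leb r. norm (T f x) \<le> D * A)"
  using assms unfolding bop_def by blast

lemma bop_id: "bop r (\<lambda>f. f)"
  unfolding bop_def by (auto intro!: exI[of _ 1])

lemma bop_compose:
  assumes "bop r T" "bop r U"
  shows "bop r (\<lambda>f. T (U f))"
proof -
  obtain C D where T: "C \<ge> 0" "D \<ge> 0"
    "\<And>f. L2_on {0..r} f \<Longrightarrow> L2_on {0..r} (T f)"
    "\<And>f. L2_on {0..r} f \<Longrightarrow> (LINT x|leb r. (norm (T f x))\<^sup>2) \<le> C * (LINT x|leb r. (norm (f x))\<^sup>2)"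
    "\<And>f A. L2_on {0..r} f \<Longrightarrow> A \<ge> 0 \<Longrightarrow> (AE x in leb r. norm (f x) \<le> A) \<Longrightarrow>
        (AE x in leb r. norm (T f x) \<le> D * A)" by (rule bopE[OF assms(1)]) blast
  obtain C' D' where U: "C' \<ge> 0" "D' \<ge> 0"
    "\<And>f. L2_on {0..r} f \<Longrightarrow> L2_on {0..r} (U f)"
    "\<And>f. L2_on {0..r} f \<Longrightarrow> (LINT x|leb r. (norm (U f x))\<^sup>2) \<le> C' * (LINT x|leb r. (norm (f x))\<^sup>2)"
    "\<And>f A. L2_on {0..r} f \<Longrightarrow> A \<ge> 0 \<Longrightarrow> (AE x in leb r. norm (f x) \<le> A) \<Longrightarrow>
        (AE x in leb r. norm (U f x) \<le> D' * A)" by (rule bopE[OF assms(2)]) blast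
  have 1: "(LINT x|leb r. (norm (T (U f) x))\<^sup>2) \<le> (C * C') * (LINT x|leb r. (norm (f x))\<^sup>2)"
    if "L2_on {0..r} f" for f
    using T(4)[OF U(3)[OF that]] mult_left_mono[OF U(4)[OF that] T(1)] by (simp add: mult.assoc)
  have 2: "AE x in leb r. norm (T (U f) x) \<le> (D * D') * A"
    if "L2_on {0..r} f" "A \<ge> 0" "AE x in leb r. norm (f x) \<le> A" for f A
    using T(5)[OF U(3)[OF that(1)] _ U(5)[OF that]] U(2) that(2) by (simp add: mult.assoc)
  show ?thesis unfolding bop_def
    by (intro conjI allI impI exI[of _ "C * C'"] exI[of _ "D * D'"] T U mult_nonneg_nonneg 1 2)
qed

lemma bop_add:
  assumes "bop r T" "bop r U"
  shows "bop r (\<lambda>f x. T f x + U f x)"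
proof -
  obtain C D where T: "C \<ge> 0" "D \<ge> 0"
    "\<And>f. L2_on {0..r} f \<Longrightarrow> L2_on {0..r} (T f)"
    "\<And>f. L2_on {0..r} f \<Longrightarrow> (LINT x|leb r. (norm (T f x))\<^sup>2) \<le> C * (LINT x|leb r. (norm (f x))\<^sup>2)"
    "\<And>f A. L2_on {0..r} f \<Longrightarrow> A \<ge> 0 \<Longrightarrow> (AE x in leb r. norm (f x) \<le> A) \<Longrightarrow>
        (AE x in leb r. norm (T f x) \<le> D * A)" by (rule bopE[OF assms(1)]) blast
  obtain C' D' where U: "C' \<ge> 0" "D' \<ge> 0"
    "\<And>f. L2_on {0..r} f \<Longrightarrow> L2_on {0..r} (U f)"
    "\<And>f. L2_on {0..r} f \<Longrightarrow> (LINT x|leb r. (norm (U f x))\<^sup>2) \<le> C' * (LINT x|leb r. (norm (f x))\<^sup>2)"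
    "\<And>f A. L2_on {0..r} f \<Longrightarrow> A \<ge> 0 \<Longrightarrow> (AE x in leb r. norm (f x) \<le> A) \<Longrightarrow>
        (AE x in leb r. norm (U f x) \<le> D' * A)" by (rule bopE[OF assms(2)]) blast
  have 1: "(LINT x|leb r. (norm (T f x + U f x))\<^sup>2) \<le> (2 * C + 2 * C') * (LINT x|leb r. (norm (f x))\<^sup>2)"
    if f: "L2_on {0..r} f" for f
  proof -
    note iT = L2_on_square_integrable[OF T(3)[OF f]] and iU = L2_on_square_integrable[OF U(3)[OF f]]
    have "(LINT x|leb r. (norm (T f x + U f x))\<^sup>2) \<le> (LINT x|leb r. 2 * (norm (T f x))\<^sup>2 + 2 * (norm (U f x))\<^sup>2)"
      using iT iU by (intro integral_mono L2_on_square_integrable L2_on_add T U f Bochner_Integration.integrable_add integrable_mult_right square_norm_add_le)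
    also have "\<dots> = 2 * (LINT x|leb r. (norm (T f x))\<^sup>2) + 2 * (LINT x|leb r. (norm (U f x))\<^sup>2)"
      using iT iU by (subst Bochner_Integration.integral_add) auto
    finally show ?thesis using T(4)[OF f] U(4)[OF f] by (simp add: algebra_simps)
  qed
  have 2: "AE x in leb r. norm (T f x + U f x) \<le> (D + D') * A"
    if "L2_on {0..r} f" "A \<ge> 0" "AE x in leb r. norm (f x) \<le> A" for f A
    using T(5)[OF that] U(5)[OF that]
  proof eventually_elim
    case (elim x)
    then show ?case using norm_triangle_ineq[of "T f x" "U f x"] by (simp add: algebra_simps)
  qed
  show ?thesis unfolding bop_def
    by (intro conjI allI impI exI[of _ "2 * C + 2 * C'"] exI[of _ "D + D'"] L2_on_add T U 1 2) (use T U in auto)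
qed

text \<open>Cauchy-Schwarz against the constant 1, by expanding the integral of the square of
  \<open>r * norm (f x) - I\<close>, where \<open>I\<close> is the integral of
  \<open>norm (f x)\<close>.\<close>

lemma square_lebesgue_integral_le:
  fixes f :: "real \<Rightarrow> 'a::euclidean_space"
  assumes "L2_on {0..r} f" "0 \<le> r"
  shows "(LINT x|leb r. norm (f x))\<^sup>2 \<le> r * (LINT x|leb r. (norm (f x))\<^sup>2)"
proof (cases "r = 0")
  case True
  have m: "(\<lambda>x. norm (f x)) \<in> borel_measurable (leb r)"
    using L2_on_measurable[OF assms(1)] by measurable
  have "(LINT x|leb r. norm (f x)) = (LINT x|leb r. 0)"
  proof (rule integral_cong_AE[OF m])
    show "AE x in leb r. norm (f x) = 0" unfolding True by (rule AE_lebesgue_on_singleton)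
  qed simp
  then show ?thesis by (simp add: True)
next
  case False
  then have r: "r > 0" using assms by simp
  interpret finite_measure "leb r" by (rule finite_measure_lebesgue_on_Icc)
  define I where "I = (LINT x|leb r. norm (f x))"
  note i1 = integrable_norm[OF L2_on_integrable[OF assms(1)]] and i2 = L2_on_square_integrable[OF assms(1)]
  have "0 \<le> (LINT x|leb r. (r * norm (f x) - I)\<^sup>2)" by (intro Bochner_Integration.integral_nonneg) auto
  also have "(\<lambda>x. (r * norm (f x) - I)\<^sup>2) = (\<lambda>x. r\<^sup>2 * (norm (f x))\<^sup>2 - 2 * r * I * norm (f x) + I\<^sup>2)"
    by (auto simp: power2_eq_square algebra_simps)
  also have "(LINT x|leb r. r\<^sup>2 * (norm (f x))\<^sup>2 - 2 * r * I * norm (f x) + I\<^sup>2)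
     = r\<^sup>2 * (LINT x|leb r. (norm (f x))\<^sup>2) - 2 * r * I * I + r * I\<^sup>2"
  proof -
    have a: "integrable (leb r) (\<lambda>x. r\<^sup>2 * (norm (f x))\<^sup>2)" by (rule integrable_mult_right[OF i2])
    have b: "integrable (leb r) (\<lambda>x. 2 * r * I * norm (f x))" by (rule integrable_mult_right[OF i1])
    have c: "(LINT x|leb r. I\<^sup>2) = r * I\<^sup>2" using r by (simp add: measure_restrict_space)
    show ?thesis
      unfolding Bochner_Integration.integral_add[OF Bochner_Integration.integrable_diff[OF a b] integrable_const] Bochner_Integration.integral_diff[OF a b] integral_mult_right_zero I_def[symmetric] c ..
  qed
  finally have "0 \<le> r * (r * (LINT x|leb r. (norm (f x))\<^sup>2) - I\<^sup>2)" by (simp add: power2_eq_square algebra_simps)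
  then show ?thesis using r by (simp add: I_def zero_le_mult_iff)
qed

lemma bop_vop:
  fixes \<kappa> :: "real \<Rightarrow> real \<Rightarrow> complex ^ 'q::finite ^ 'p::finite"
  assumes \<kappa>: "bker r \<kappa>" and r: "0 \<le> r"
  shows "bop r (vop r \<kappa>)"
proof -
  interpret finite_measure "leb r" by (rule finite_measure_lebesgue_on_Icc)
  have mr: "measure lebesgue {0..r} = r" using r by simp
  obtain C where C: "C \<ge> 0" "\<And>f x. integrable (leb r) f \<Longrightarrow> x \<in> {0..r} \<Longrightarrow>
     norm (vop r \<kappa> f x) \<le> C * (LINT t|leb r. norm (f t))" by (rule vop_bound[OF \<kappa>]) blast
  have 1: "(LINT x|leb r. (norm (vop r \<kappa> f x))\<^sup>2) \<le> (C\<^sup>2 * r * r) * (LINT x|leb r. (norm (f x))\<^sup>2)"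
    if f: "L2_on {0..r} f" for f
  proof -
    define I where "I = (LINT x|leb r. norm (f x))"
    have "(LINT x|leb r. (norm (vop r \<kappa> f x))\<^sup>2) \<le> (LINT x|leb r. (C * I)\<^sup>2)"
    proof (rule integral_mono[OF L2_on_square_integrable[OF vop_L2[OF \<kappa> f]] integrable_const])
      fix x assume "x \<in> space (leb r)"
      then have "x \<in> {0..r}" by simp
      then show "(norm (vop r \<kappa> f x))\<^sup>2 \<le> (C * I)\<^sup>2"
        unfolding I_def by (rule power_mono[OF C(2)[OF L2_on_integrable[OF f]] norm_ge_zero])
    qed
    also have "\<dots> = r * C\<^sup>2 * I\<^sup>2" using r by (simp add: measure_restrict_space power_mult_distrib)
    also have "\<dots> \<le> r * C\<^sup>2 * (r * (LINT x|leb r. (norm (f x))\<^sup>2))"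
      unfolding I_def using r by (intro mult_left_mono square_lebesgue_integral_le f) auto
    finally show ?thesis by (simp add: mult_ac)
  qed
  have 2: "AE x in leb r. norm (vop r \<kappa> f x) \<le> (C * r) * A"
    if f: "L2_on {0..r} f" "A \<ge> 0" "AE x in leb r. norm (f x) \<le> A" for f A
    using AE_space_lebesgue_on[of "{0..r}"]
  proof eventually_elim
    case (elim x)
    have "norm (vop r \<kappa> f x) \<le> C * (LINT t|leb r. norm (f t))" by (rule C(2)[OF L2_on_integrable[OF f(1)] elim])
    also have "\<dots> \<le> C * (LINT t|leb r. A)"
      by (rule mult_left_mono[OF integral_mono_AE[OF integrable_norm[OF L2_on_integrable[OF f(1)]] integrable_const f(3)] C(1)])
    also have "\<dots> = C * r * A" using r by (simp add: measure_restrict_space)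
    finally show ?case .
  qed
  show ?thesis unfolding bop_def
    by (intro conjI allI impI exI[of _ "C\<^sup>2 * r * r"] exI[of _ "C * r"] vop_L2[OF \<kappa>] 1 2) (use C r in auto)
qed

text \<open>\<open>U\<close> has to agree with \<open>T\<close> only almost everywhere, which is how
  the truncated S is compared with \<open>Sr\<close>; linearity comes from the existence of an
  adjoint.\<close>

lemma bounded_L2_operatorI:
  fixes T :: "'p::finite vfun \<Rightarrow> 'p vfun"
  assumes adj: "adjp r T T'" and b: "bop r T"
    and eq: "\<And>f. L2_on {0..r} f \<Longrightarrow> AE x in leb r. U f x = T f x"
  shows "bounded_L2_operator {0..r} U"
proof -
  obtain C D :: real where C: "C \<ge> 0" "D \<ge> 0"
    "\<And>f. L2_on {0..r} f \<Longrightarrow> L2_on {0..r} (T f)"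
    "\<And>f. L2_on {0..r} f \<Longrightarrow> (LINT x|leb r. (norm (T f x))\<^sup>2) \<le> C * (LINT x|leb r. (norm (f x))\<^sup>2)"
    by (rule bopE[OF b]) blast
  have L2: "L2_on {0..r} (U f)" and I: "(LINT x|leb r. (norm (U f x))\<^sup>2) = (LINT x|leb r. (norm (T f x))\<^sup>2)"
    if f: "L2_on {0..r} f" for f
  proof -
    have m: "U f \<in> borel_measurable (leb r)"
      by (rule borel_measurable_lebesgue_on_AE_cong[OF L2_on_measurable[OF C(3)[OF f]] eq[OF f]]) simp
    show "L2_on {0..r} (U f)"
    proof (rule L2_onI_bound[OF m L2_on_square_integrable[OF C(3)[OF f]]])
      show "AE x in leb r. (norm (U f x))\<^sup>2 \<le> (norm (T f x))\<^sup>2" using eq[OF f] by eventually_elim simp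
    qed
    have mT: "T f \<in> borel_measurable (leb r)" by (rule L2_on_measurable[OF C(3)[OF f]])
    show "(LINT x|leb r. (norm (U f x))\<^sup>2) = (LINT x|leb r. (norm (T f x))\<^sup>2)"
      by (rule integral_cong_AE) (use m mT eq[OF f] in auto)
  qed
  show ?thesis unfolding bounded_L2_operator_def
  proof (intro conjI allI impI)
    show "L2_on {0..r} (U f)" if "L2_on {0..r} f" for f by (rule L2[OF that])
  next
    fix f g :: "'p vfun" assume "L2_on {0..r} f \<and> L2_on {0..r} g"
    then have f: "L2_on {0..r} f" and g: "L2_on {0..r} g" by auto
    show "AE x in leb r. U (\<lambda>t. f t + g t) x = U f x + U g x"
      using adjp_AE_add[OF adj f g] eq[OF f] eq[OF g] eq[OF L2_on_add[OF f g]] by eventually_elim simp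
  next
    fix f :: "'p vfun" and c :: complex assume f: "L2_on {0..r} f"
    show "AE x in leb r. U (\<lambda>t. c *s f t) x = c *s U f x"
      using adjp_AE_smult[OF adj f, of c] eq[OF f] eq[OF L2_on_smult[OF f, of c]] by eventually_elim simp
  next
    show "\<exists>C. \<forall>f. L2_on {0..r} f \<longrightarrow> L2_norm_on {0..r} (U f) \<le> C * L2_norm_on {0..r} f"
    proof (intro exI[of _ "sqrt C"] allI impI)
      fix f :: "'p vfun" assume f: "L2_on {0..r} f"
      show "L2_norm_on {0..r} (U f) \<le> sqrt C * L2_norm_on {0..r} f"
        unfolding L2_norm_on_def I[OF f] real_sqrt_mult[symmetric] using C(4)[OF f] by (rule real_sqrt_le_mono)
    qed
  qed
qed

lemma lebesgue_integral_reflect: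
  fixes g :: "real \<Rightarrow> 'a::euclidean_space"
  assumes "g \<in> borel_measurable borel"
  shows "(LINT t|lebesgue_on {a..b}. g (c - t)) = (LINT t|lebesgue_on {c-b..c-a}. g t)"
proof -
  have *: "(LINT t|lebesgue_on {a..b}. h t) = (LINT t|lborel. indicat_real {a..b} t *\<^sub>R h t)" if "h \<in> borel_measurable borel" for a b and h :: "real \<Rightarrow> 'a"
    using that by (subst integral_restrict_space) (auto intro!: integral_completion)
  have "(LINT t|lebesgue_on {c-b..c-a}. g t) = (LINT t|lborel. indicat_real {c-b..c-a} t *\<^sub>R g t)" by (rule *[OF assms])
  also have "\<dots> = (LINT t|lborel. indicat_real {c-b..c-a} (c + (-1) * t) *\<^sub>R g (c + (-1) * t))"
    by (subst lborel_integral_real_affine[of "-1" _ c]) auto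
  also have "\<dots> = (LINT t|lborel. indicat_real {a..b} t *\<^sub>R g (c - t))"
    by (intro Bochner_Integration.integral_cong) (auto simp: indicator_def)
  also have "\<dots> = (LINT t|lebesgue_on {a..b}. g (c - t))"
    by (rule *[symmetric]) (use assms in measurable)
  finally show ?thesis ..
qed

lemma lebesgue_integral_restrict_Icc:
  fixes h :: "real \<Rightarrow> 'a::euclidean_space"
  assumes "{a..b} \<subseteq> {0..r}"
  shows "(LINT t|leb r. (if a \<le> t \<and> t \<le> b then h t else 0)) = (LINT t|lebesgue_on {a..b}. h t)"
proof -
  have "(LINT t|leb r. (if a \<le> t \<and> t \<le> b then h t else 0)) = (LINT t|lebesgue. indicat_real {0..r} t *\<^sub>R (if a \<le> t \<and> t \<le> b then h t else 0))"
    by (subst integral_restrict_space) auto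
  also have "\<dots> = (LINT t|lebesgue. indicat_real {a..b} t *\<^sub>R h t)"
    using assms by (intro Bochner_Integration.integral_cong) (auto simp: indicator_def)
  also have "\<dots> = (LINT t|lebesgue_on {a..b}. h t)"
    by (subst integral_restrict_space) auto
  finally show ?thesis .
qed

lemma vop_cong: "(\<And>t. t \<in> {0..r} \<Longrightarrow> f t = g t) \<Longrightarrow> vop r \<kappa> f x = vop r \<kappa> g x"
  unfolding vop_def by (intro Bochner_Integration.integral_cong) auto

lemma integrable_lebesgue_on_Icc_if:
  fixes h :: "real \<Rightarrow> 'a::euclidean_space"
  assumes h: "integrable (leb r) h"
  shows "integrable (leb r) (\<lambda>t. if t \<le> x then h t else 0)"
proof -
  have [measurable]: "h \<in> borel_measurable (leb r)" "(\<lambda>x. x) \<in> borel_measurable (leb r)"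
    using h by (auto intro: measurable_id_lebesgue_on)
  show ?thesis by (rule Bochner_Integration.integrable_bound[OF h]) auto
qed

text \<open>The adjoint of a Volterra operator integrates over [x,r], up to the null set t = x. The
  form as a difference separates an integral over all of [0,r] from a causal one.\<close>

lemma vop_adjk_lowk:
  fixes \<kappa> :: "real \<Rightarrow> real \<Rightarrow> complex ^ 'q::finite ^ 'p::finite"
  assumes int: "integrable (leb r) (\<lambda>t. adjk \<kappa> x t *v f t)" and x: "x \<in> {0..r}"
  shows "vop r (adjk (lowk \<kappa>)) f x = (LINT t|leb r. adjk \<kappa> x t *v f t) - (LINT t|leb x. adjk \<kappa> x t *v f t)"
proof -
  define h where "h t = adjk \<kappa> x t *v f t" for t
  have h: "integrable (leb r) h" unfolding h_def[abs_def] by (rule int)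
  note h2 = integrable_lebesgue_on_Icc_if[OF h, of x]
  have [measurable]: "h \<in> borel_measurable (leb r)" "(\<lambda>x. x) \<in> borel_measurable (leb r)"
    using h by (auto intro: measurable_id_lebesgue_on)
  have ae: "AE t in leb r. t \<noteq> x"
    by (rule AE_lebesgue_on_iff_negligible[THEN iffD2]) (auto intro: negligible_subset[of "{x}"])
  have e: "adjk (lowk \<kappa>) x t *v f t = (if x \<le> t then h t else 0)" for t
    by (simp add: adjk_def lowk_def h_def)
  have "vop r (adjk (lowk \<kappa>)) f x = (LINT t|leb r. (if x \<le> t then h t else 0))"
    unfolding vop_def e ..
  also have "\<dots> = (LINT t|leb r. h t - (if t \<le> x then h t else 0))"
  proof (rule integral_cong_AE)
    show "AE t in leb r. (if x \<le> t then h t else 0) = h t - (if t \<le> x then h t else 0)"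
      using ae by eventually_elim auto
  qed measurable
  also have "\<dots> = (LINT t|leb r. h t) - (LINT t|leb r. (if t \<le> x then h t else 0))"
    by (rule Bochner_Integration.integral_diff[OF h h2])
  also have "(LINT t|leb r. (if t \<le> x then h t else 0)) = (LINT t|leb x. h t)"
    by (rule lebesgue_integral_Icc_extend[symmetric]) (use x in auto)
  finally show ?thesis by (simp add: h_def)
qed

definition Jadj :: "real \<Rightarrow> 'p::finite vfun \<Rightarrow> 'p vfun" where
  "Jadj r = vop r (adjk (lowk (\<lambda>x t. mat 1)))"

lemma adjp_J: "adjp r (Jop r) (Jadj r)"
  unfolding Jop_def Jadj_def by (rule adjp_vop[OF bker_J])

lemma Jadj_eq:
  assumes f: "integrable (leb r) f" and x: "x \<in> {0..r}"
  shows "Jadj r f x = (LINT t|leb r. f t) - Jop r f x"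
  unfolding Jop_eq[OF x] Jadj_def
  by (subst vop_adjk_lowk[OF _ x]) (simp_all add: adjk_def adj_mat f)

lemma cip_lebesgue_integral:
  assumes "integrable (lebesgue_on S) f"
  shows "cip h (LINT t|lebesgue_on S. f t) = (LINT t|lebesgue_on S. cip h (f t))"
    and "cip (LINT t|lebesgue_on S. f t) h = (LINT t|lebesgue_on S. cip (f t) h)"
  using integral_bounded_linear[OF bounded_bilinear.bounded_linear_right[OF bounded_bilinear_cip] assms, of h]
    integral_bounded_linear[OF bounded_bilinear.bounded_linear_left[OF bounded_bilinear_cip] assms, of h] by simp_all

lemma ipL_const_left:
  assumes "integrable (leb r) f"
  shows "ipL r (\<lambda>_. h) f = cip h (LINT t|leb r. f t)"
  using cip_lebesgue_integral[OF assms] by (simp add: ipL_def)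

lemma cip_left_eqI: "(\<And>h. cip h a = cip h b) \<Longrightarrow> a = b"
  by (simp add: vec_eq_iff cip_unit[symmetric])

section \<open>The factorisation of S and the defect equation\<close>

context dirac_similarity begin

text \<open>\<open>W f(x) = \<integral>\<^sub>0\<^sup>x \<Phi>\<^sub>1'(x - t) f(t) dt\<close> commutes with integration, and \<open>S\<^sub>r = I + W W\<^sup>*\<close> on \<open>[0,r]\<close>.\<close>

definition wker :: "real \<Rightarrow> real \<Rightarrow> complex ^ 'm1 ^ 'm2" where "wker = lowk (\<lambda>x t. dfun (x - t))"

definition W :: "real \<Rightarrow> 'm1 vfun \<Rightarrow> 'm2 vfun" where "W r = vop r wker"
definition Wadj :: "real \<Rightarrow> 'm2 vfun \<Rightarrow> 'm1 vfun" where "Wadj r = vop r (adjk wker)"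
definition Sr :: "real \<Rightarrow> 'm2 vfun \<Rightarrow> 'm2 vfun" where "Sr r f x = f x + W r (Wadj r f) x"
definition Eadj :: "real \<Rightarrow> 'm2 vfun \<Rightarrow> 'm2 vfun" where "Eadj r f x = f x + vop r (adjk (lowk ker)) f x"

lemma bker_wker: "bker r wker"
proof -
  obtain B where B: "\<And>x. norm (dfun x) \<le> B" using dfun_bounded by blast
  have "(\<lambda>(x, t). dfun (x - t)) \<in> borel_measurable borel"
    using measurable_compose[OF _ dfun_borel, of "\<lambda>(x, t). x - t" "borel"]
    by (simp add: case_prod_beta' borel_prod[symmetric])
  then have "bker r (\<lambda>x t. dfun (x - t))" by (rule bker_borel) (rule B)
  then show ?thesis unfolding wker_def by (rule bker_lowk)
qed

lemma adjp_W: "adjp r (W r) (Wadj r)"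
  unfolding W_def Wadj_def by (rule adjp_vop[OF bker_wker])

lemma adjp_Er: "r \<le> l \<Longrightarrow> adjp r (Er r) (Eadj r)"
  unfolding Er_def[abs_def] Eadj_def[abs_def] by (intro adjp_add adjp_id adjp_vop bker_lowk bker_ker)

lemma adjp_Sr: "adjp r (Sr r) (Sr r)"
  unfolding Sr_def[abs_def] by (intro adjp_add adjp_id adjp_compose[OF adjp_W adjp_sym[OF adjp_W]])

lemma bop_Sr: "0 \<le> r \<Longrightarrow> bop r (Sr r)"
  unfolding Sr_def[abs_def] W_def Wadj_def by (intro bop_add bop_id bop_compose[OF bop_vop bop_vop] bker_wker bker_adjk)

lemma bop_Er: "0 \<le> r \<Longrightarrow> r \<le> l \<Longrightarrow> bop r (Er r)" and bop_Eadj: "0 \<le> r \<Longrightarrow> r \<le> l \<Longrightarrow> bop r (Eadj r)"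
  unfolding Er_def[abs_def] Eadj_def[abs_def] by (intro bop_add bop_id bop_vop bker_lowk bker_ker bker_adjk; assumption)+

lemma W_const:
  assumes x: "x \<in> {0..r}"
  shows "W r (\<lambda>_. c) x = Phi x *v c"
proof -
  have "W r (\<lambda>_. c) x = (LINT t|leb x. dfun (x - t) *v c)"
    unfolding W_def wker_def by (rule vop_lowk[OF x])
  also have "\<dots> = (LINT t|lebesgue_on {x - x..x - 0}. dfun t *v c)"
    by (rule lebesgue_integral_reflect[of "\<lambda>t. dfun t *v c"]) (rule borel_measurable_mv[OF dfun_borel borel_measurable_const])
  finally show ?thesis by (simp add: Phi_vec)
qed

text \<open>Convolutions commute: both composed kernels integrate the derivative of \<Phi>1 over
  [0, x - t], once in terms of the distance to t and once in terms of the distance to x, and the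
  reflection of \<zeta> to x + t - \<zeta> exchanges the two.\<close>

lemma J_W:
  assumes f: "L2_on {0..r} f" and x: "x \<in> {0..r}"
  shows "Jop r (W r f) x = W r (Jop r f) x"
proof -
  have "Jop r (W r f) x = vop r (\<lambda>x t. LINT \<zeta>|leb r. lowk (\<lambda>x t. mat 1) x \<zeta> ** wker \<zeta> t) f x"
    unfolding Jop_def W_def by (rule vop_compose[OF bker_J bker_wker f x])
  also have "\<dots> = vop r (\<lambda>x t. LINT \<zeta>|leb r. wker x \<zeta> ** lowk (\<lambda>x t. mat 1) \<zeta> t) f x"
    unfolding vop_def
  proof (rule Bochner_Integration.integral_cong)
    fix t assume "t \<in> space (leb r)"
    then have t: "t \<in> {0..r}" by simp
    have sub: "{t..x} \<subseteq> {0..r}" using t x by auto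
    have "(LINT \<zeta>|leb r. lowk (\<lambda>x t. mat 1) x \<zeta> ** wker \<zeta> t) = (LINT \<zeta>|leb r. (if t \<le> \<zeta> \<and> \<zeta> \<le> x then dfun (\<zeta> - t) else 0))"
      by (intro Bochner_Integration.integral_cong) (auto simp: lowk_def wker_def)
    also have "\<dots> = (LINT \<zeta>|lebesgue_on {t..x}. dfun (\<zeta> - t))" by (rule lebesgue_integral_restrict_Icc[OF sub])
    also have "\<dots> = (LINT \<zeta>|lebesgue_on {x + t - x..x + t - t}. dfun (\<zeta> - t))" by simp
    also have "\<dots> = (LINT \<zeta>|lebesgue_on {t..x}. dfun (x + t - \<zeta> - t))"
      by (rule lebesgue_integral_reflect[symmetric, of "\<lambda>\<zeta>. dfun (\<zeta> - t)"])
         (rule measurable_compose[OF _ dfun_borel], simp)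
    also have "\<dots> = (LINT \<zeta>|lebesgue_on {t..x}. dfun (x - \<zeta>))" by simp
    also have "\<dots> = (LINT \<zeta>|leb r. (if t \<le> \<zeta> \<and> \<zeta> \<le> x then dfun (x - \<zeta>) else 0))"
      by (rule lebesgue_integral_restrict_Icc[OF sub, symmetric])
    also have "\<dots> = (LINT \<zeta>|leb r. wker x \<zeta> ** lowk (\<lambda>x t. mat 1) \<zeta> t)"
      by (intro Bochner_Integration.integral_cong) (auto simp: lowk_def wker_def)
    finally show "(LINT \<zeta>|leb r. lowk (\<lambda>x t. mat 1) x \<zeta> ** wker \<zeta> t) *v f t = (LINT \<zeta>|leb r. wker x \<zeta> ** lowk (\<lambda>x t. mat 1) \<zeta> t) *v f t"
      by simp
  qed simp
  also have "\<dots> = W r (Jop r f) x"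
    unfolding Jop_def W_def by (rule vop_compose[OF bker_wker bker_J f x, symmetric])
  finally show ?thesis .
qed

lemma Wadj_Jadj:
  assumes g: "L2_on {0..r} g"
  shows "AE x in leb r. Wadj r (Jadj r g) x = Jadj r (Wadj r g) x"
proof (rule adjp_unique[OF adjp_compose[OF adjp_J adjp_W] adjp_compose[OF adjp_W adjp_J] _ g])
  fix f :: "'m1 vfun" assume f: "L2_on {0..r} f"
  show "AE x in leb r. Jop r (W r f) x = W r (Jop r f) x"
    using AE_space_lebesgue_on[of "{0..r}"] by eventually_elim (rule J_W[OF f])
qed

text \<open>With Pi = [\<Phi>1, I] this is the operator identity J S + S J^* = Pi Pi^* applied to
  \<open>p\<close>; by \<open>W_const\<close> the moment of \<open>Wadj r p\<close> is the pairing
  of \<Phi>1 with \<open>p\<close>. It follows by commuting \<open>Jadj\<close> past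
  \<open>Wadj\<close> and \<open>Jop\<close> past \<open>W\<close>, with \<open>Jadj\<close> being
  the full moment minus \<open>Jop\<close>.\<close>

lemma Sr_Jadj:
  assumes p: "L2_on {0..r} p"
  shows "AE x in leb r. Sr r (Jadj r p) x =
     Phi x *v (LINT t|leb r. Wadj r p t) + (LINT t|leb r. p t) - Jop r (Sr r p) x"
proof -
  define w where "w = Wadj r p"
  define m where "m = (LINT t|leb r. w t)"
  have w: "L2_on {0..r} w" unfolding w_def by (rule adjpD(2)[OF adjp_W p])
  have Jp: "L2_on {0..r} (Jadj r p)" by (rule adjpD(2)[OF adjp_J p])
  have Jw: "L2_on {0..r} (Jadj r w)" by (rule adjpD(2)[OF adjp_J w])
  have Ww: "L2_on {0..r} (W r w)" by (rule adjpD(1)[OF adjp_W w])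
  have 1: "AE x in leb r. W r (Wadj r (Jadj r p)) x = W r (Jadj r w) x"
    unfolding w_def by (rule adjp_AE_cong[OF adjp_W adjpD(2)[OF adjp_W Jp] Jw[unfolded w_def] Wadj_Jadj[OF p]])
  have 2: "W r (Jadj r w) x = W r (\<lambda>t. m - Jop r w t) x" for x
    unfolding W_def m_def by (rule vop_cong) (rule Jadj_eq[OF L2_on_integrable[OF w]])
  have 3: "AE x in leb r. W r (\<lambda>t. m - Jop r w t) x = W r (\<lambda>_. m) x - W r (Jop r w) x"
    by (rule adjp_AE_diff[OF adjp_W L2_on_const Jop_L2[OF w]])
  have 4: "AE x in leb r. Jop r (Sr r p) x = Jop r p x + Jop r (W r w) x"
    unfolding Sr_def[abs_def] w_def[symmetric] by (rule adjp_AE_add[OF adjp_J p Ww])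
  show ?thesis
    using 1 3 4 AE_space_lebesgue_on[of "{0..r}"]
  proof eventually_elim
    case (elim x)
    have W: "W r (Wadj r (Jadj r p)) x = Phi x *v m - Jop r (W r w) x"
      by (simp only: elim(1) 2 elim(2) W_const[OF elim(4)] J_W[OF w elim(4)])
    show ?case
      unfolding Sr_def[of r "Jadj r p"] W elim(3) Jadj_eq[OF L2_on_integrable[OF p] elim(4)] m_def w_def
      by simp
  qed
qed

lemma Er_Pi_restrict:
  assumes "r \<le> l"
  shows "AE x in leb r. Er r (\<lambda>t. Phi t *v vtop c + vbot c) x = \<gamma> x *v c"
proof -
  have "AE x in leb r. Er l (\<lambda>t. Phi t *v vtop c + vbot c) x = \<gamma> x *v c"
    by (rule AE_lebesgue_on_subset[OF Er_Pi]) (use assms in auto)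
  with AE_space_lebesgue_on[of "{0..r}"] show ?thesis
    by eventually_elim (simp add: Er_restrict[OF _ assms])
qed

lemma gamma_vec_L2_restrict: "r \<le> l \<Longrightarrow> L2_on {0..r} (\<lambda>t. \<gamma> t *v c)"
  and fsol_L2_restrict: "r \<le> l \<Longrightarrow> L2_on {0..r} (fsol z c)"
  and qsol_L2_restrict: "r \<le> l \<Longrightarrow> L2_on {0..r} (qsol z c)"
  using L2_on_subset[OF gamma_vec_L2] L2_on_subset[OF fsol_L2] L2_on_subset[OF qsol_L2] by auto

lemma Pi_L2: "L2_on {0..r} (\<lambda>t. Phi t *v a + b)"
  by (intro L2_on_add Phi_vec_L2 L2_on_const)

text \<open>Since \<gamma> = E Pi, the left side is the adjoint of Pi applied to
  \<open>Eadj r f\<close>; its \<Phi>1 component becomes a moment through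
  \<open>W_const\<close>.\<close>

lemma moment_adj_gamma:
  assumes r: "r \<in> {0..l}" and f: "L2_on {0..r} f"
  shows "(LINT t|leb r. adj (\<gamma> t) *v f t) =
     vjoin (LINT t|leb r. Wadj r (Eadj r f) t) (LINT t|leb r. Eadj r f t)"
proof (rule cip_left_eqI)
  fix h :: "complex ^ ('m1 + 'm2)"
  have rl: "r \<le> l" using r by simp
  define p where "p = Eadj r f"
  have p: "L2_on {0..r} p" unfolding p_def by (rule adjpD(2)[OF adjp_Er[OF rl] f])
  have w: "L2_on {0..r} (Wadj r p)" by (rule adjpD(2)[OF adjp_W p])
  have "cip h (LINT t|leb r. adj (\<gamma> t) *v f t) = ipL r (\<lambda>x. \<gamma> x *v h) f"
    using cip_lebesgue_integral(1)[OF adj_gamma_mult_integrable[OF f rl], of r h] r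
    by (simp add: ipL_def cip_adj')
  also have "\<dots> = ipL r (Er r (\<lambda>t. Phi t *v vtop h + vbot h)) f"
    by (rule ipL_cong_left[OF gamma_vec_L2_restrict[OF rl] Er_L2[OF rl Pi_L2] f])
       (use Er_Pi_restrict[OF rl, of h] in \<open>eventually_elim, simp\<close>)
  also have "\<dots> = ipL r (\<lambda>t. Phi t *v vtop h + vbot h) p"
    unfolding p_def by (rule adjpD(3)[OF adjp_Er[OF rl] Pi_L2 f])
  also have "\<dots> = ipL r (\<lambda>t. Phi t *v vtop h) p + ipL r (\<lambda>_. vbot h) p"
    by (rule ipL_add_left[OF Phi_vec_L2 L2_on_const p])
  also have "ipL r (\<lambda>t. Phi t *v vtop h) p = ipL r (W r (\<lambda>_. vtop h)) p"
    unfolding ipL_def by (intro Bochner_Integration.integral_cong) (auto simp: W_const)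
  also have "\<dots> = ipL r (\<lambda>_. vtop h) (Wadj r p)" by (rule adjpD(3)[OF adjp_W L2_on_const p])
  finally show "cip h (LINT t|leb r. adj (\<gamma> t) *v f t) =
     cip h (vjoin (LINT t|leb r. Wadj r (Eadj r f) t) (LINT t|leb r. Eadj r f t))"
    unfolding p_def[symmetric] by (simp only: ipL_const_left[OF L2_on_integrable[OF w]] ipL_const_left[OF L2_on_integrable[OF p]] cip_blocks[of h "vjoin _ _"] vtop_vjoin vbot_vjoin)
qed

definition Ladj :: "real \<Rightarrow> 'm2 vfun \<Rightarrow> 'm2 vfun" where "Ladj r = vop r (adjk (lowk (\<lambda>x t. \<gamma> x ** adj (\<gamma> t))))"

text \<open>The adjoint form of \<open>intertwining\<close>.\<close>

lemma Eadj_Ladj: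
  assumes r: "r \<in> {0..l}" and g: "L2_on {0..r} g"
  shows "AE x in leb r. Eadj r (Ladj r g) x = Jadj r (Eadj r g) x"
proof -
  have rl: "0 \<le> r" "r \<le> l" using r by auto
  have L: "adjp r (Lop r \<gamma>) (Ladj r)"
    unfolding Lop_def Ladj_def by (rule adjp_vop[OF bker_lowk[OF bker_gamma[OF rl(2)]]])
  show ?thesis
    by (rule adjp_unique[OF adjp_compose[OF L adjp_Er[OF rl(2)]] adjp_compose[OF adjp_Er[OF rl(2)] adjp_J] intertwining[OF rl] g])
qed

text \<open>The integral over [0,x] is the one over [0,r] minus the one over [x,r]. This trades the
  initial value \<open>c\<close> for the value at \<open>r\<close>, and L for its adjoint with the
  opposite sign.\<close>

lemma fsol_Ladj:
  assumes r: "r \<in> {0..l}" and x: "x \<in> {0..r}"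
  shows "fsol z c x = \<gamma> x *v ysol z c r + (2 * \<i> * z) *s Ladj r (fsol z c) x"
proof -
  have rl: "r \<le> l" and xl: "x \<in> {0..l}" and rr: "r \<in> {0..r}" using r x by auto
  have e: "adjk (\<lambda>x t. \<gamma> x ** adj (\<gamma> t)) x t *v fsol z c t = \<gamma> x *v (adj (\<gamma> t) *v fsol z c t)" for t
    by (simp add: adjk_def adj_mult matrix_vector_mul_assoc)
  have ir: "integrable (leb y) (\<lambda>t. adj (\<gamma> t) *v fsol z c t)" if "y \<in> {0..l}" for y
    by (rule ysol_integral(2)[OF that])
  have I: "(LINT t|leb y. \<gamma> x *v (adj (\<gamma> t) *v fsol z c t)) = \<gamma> x *v (LINT t|leb y. adj (\<gamma> t) *v fsol z c t)"
    if "y \<in> {0..l}" for y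
    using integral_bounded_linear[OF bounded_linear_matrix_vector_right ir[OF that], of "\<gamma> x"] by simp
  define Ir Ix where "Ir = (LINT t|leb r. adj (\<gamma> t) *v fsol z c t)" and "Ix = (LINT t|leb x. adj (\<gamma> t) *v fsol z c t)"
  have L: "Ladj r (fsol z c) x = \<gamma> x *v Ir - \<gamma> x *v Ix"
    unfolding Ir_def Ix_def Ladj_def
    by (subst vop_adjk_lowk[OF _ x])
       (simp_all only: e I[OF r] I[OF xl] integrable_bounded_linear[OF bounded_linear_matrix_vector_right ir[OF r]])
  have F: "fsol z c x = \<gamma> x *v (c + (- 2 * \<i> * z) *s Ix)"
    unfolding fsol_eq[OF xl, of z c] ysol_integral(1)[OF xl, of z c] Ix_def ..
  show ?thesis
    unfolding ysol_integral(1)[OF r, of z c] L F Ir_def[symmetric]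
    by (simp add: matrix_vector_right_distrib matrix_vector_mult_diff_distrib matrix_vector_mult_smult vec_eq_iff algebra_simps)
qed

text \<open>The defect of \<open>S E\<^sup>* f = q\<close> (where \<open>f = E q\<close>) satisfies a Volterra equation whose right-hand side
  depends on \<open>a\<close> only, not on \<open>z\<close>.\<close>

definition gdef :: "real \<Rightarrow> complex ^ ('m1 + 'm2) \<Rightarrow> 'm2 vfun" where
  "gdef r a x = Sr r (Eadj r (\<lambda>t. \<gamma> t *v a)) x - (Phi x *v vtop a + vbot a)"

definition hdef :: "real \<Rightarrow> complex \<Rightarrow> complex ^ ('m1 + 'm2) \<Rightarrow> 'm2 vfun" where
  "hdef r z c x = Sr r (Eadj r (fsol z c)) x - qsol z c x"

lemma gdef_L2: "r \<le> l \<Longrightarrow> L2_on {0..r} (gdef r a)"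
  unfolding gdef_def[abs_def]
  by (intro L2_on_diff Pi_L2 adjpD(1)[OF adjp_Sr] adjpD(2)[OF adjp_Er] gamma_vec_L2_restrict)

lemma hdef_L2: "r \<le> l \<Longrightarrow> L2_on {0..r} (hdef r z c)"
  unfolding hdef_def[abs_def]
  by (intro L2_on_diff qsol_L2_restrict adjpD(1)[OF adjp_Sr] adjpD(2)[OF adjp_Er] fsol_L2_restrict)

text \<open>Let m be the pair of moments of \<open>p\<close>. Applying E^* to
  \<open>fsol_Ladj\<close> gives p = p0 + 2 i z J^* p, and \<open>Sr_Jadj\<close> turns this into S
  p = S p0 + 2 i z (Pi m - J S p). By \<open>moment_adj_gamma\<close>, c = a + 2 i z m, so the
  moments cancel against those in q = Pi c - 2 i z J q.\<close>

lemma hdef_eq: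
  assumes r: "r \<in> {0..l}"
  shows "AE x in leb r. hdef r z c x = gdef r (ysol z c r) x - (2 * \<i> * z) *s Jop r (hdef r z c) x"
proof -
  define f where "f = fsol z c"
  define a where "a = ysol z c r"
  define k where "k = 2 * \<i> * z"
  define p where "p = Eadj r f"
  define p0 where "p0 = Eadj r (\<lambda>t. \<gamma> t *v a)"
  define m1 where "m1 = (LINT t|leb r. Wadj r p t)"
  define m2 where "m2 = (LINT t|leb r. p t)"
  have rl: "r \<le> l" using r by simp
  note AE = adjp_Er[OF rl] and AS = adjp_Sr[of r]
  have f: "L2_on {0..r} f" unfolding f_def by (rule fsol_L2_restrict[OF rl])
  have g: "L2_on {0..r} (\<lambda>t. \<gamma> t *v a)" by (rule gamma_vec_L2_restrict[OF rl])
  have p: "L2_on {0..r} p" and p0: "L2_on {0..r} p0" unfolding p_def p0_def by (rule adjpD(2)[OF AE f] adjpD(2)[OF AE g])+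
  have Sp: "L2_on {0..r} (Sr r p)" by (rule adjpD(1)[OF AS p])
  have Jp: "L2_on {0..r} (Jadj r p)" by (rule adjpD(2)[OF adjp_J p])
  have L: "L2_on {0..r} (Ladj r f)" unfolding Ladj_def by (rule vop_L2[OF bker_adjk[OF bker_lowk[OF bker_gamma[OF rl]]] f])
  have m: "(LINT t|leb r. adj (\<gamma> t) *v f t) = vjoin m1 m2"
    unfolding m1_def m2_def p_def by (rule moment_adj_gamma[OF r f])
  have c: "c = a + k *s vjoin m1 m2"
    using ysol_integral(1)[OF r, of z c] unfolding m[unfolded f_def] a_def[symmetric] k_def by (simp add: vec_eq_iff)
  have 1: "AE x in leb r. p x = p0 x + k *s Jadj r p x"
  proof -
    have eq: "f t = \<gamma> t *v a + k *s Ladj r f t" if "t \<in> {0..r}" for t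
      unfolding f_def a_def k_def by (rule fsol_Ladj[OF r that])
    have e: "p x = Eadj r (\<lambda>t. \<gamma> t *v a + k *s Ladj r f t) x" if "x \<in> {0..r}" for x
      unfolding p_def Eadj_def by (rule arg_cong2[of _ _ _ _ "(+)", OF eq[OF that] vop_cong[OF eq]])
    show ?thesis
      using adjp_AE_add[OF adjp_sym[OF AE] g L2_on_smult[OF L, of k]] adjp_AE_smult[OF adjp_sym[OF AE] L, of k]
        Eadj_Ladj[OF r f] AE_space_lebesgue_on[of "{0..r}"]
    proof eventually_elim
      case (elim x)
      show ?case unfolding p0_def
        by (simp only: e[OF elim(4)] elim(1) elim(2) elim(3)) (simp only: p_def)
    qed
  qed
  have 2: "AE x in leb r. Sr r p x = Sr r p0 x + k *s Sr r (Jadj r p) x"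
    using adjp_AE_cong[OF AS p L2_on_add[OF p0 L2_on_smult[OF Jp]] 1] adjp_AE_add[OF AS p0 L2_on_smult[OF Jp, of k]] adjp_AE_smult[OF AS Jp, of k]
    by eventually_elim simp
  have 3: "AE x in leb r. Jop r (hdef r z c) x = Jop r (Sr r p) x - Jop r (qsol z c) x"
    unfolding hdef_def[abs_def] p_def f_def
    by (rule adjp_AE_diff[OF adjp_J Sp[unfolded p_def f_def] qsol_L2_restrict[OF rl]])
  show ?thesis
    using 2 3 Sr_Jadj[OF p] AE_space_lebesgue_on[of "{0..r}"]
  proof eventually_elim
    case (elim x)
    have xl: "x \<in> {0..l}" using elim(4) rl by auto
    have q: "qsol z c x = Phi x *v vtop c + vbot c + (- 2 * \<i> * z) *s Jop r (qsol z c) x"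
      using qsol_eq(2)[OF xl, of z c] by (simp only: Jop_eq[OF xl] Jop_eq[OF elim(4)])
    have P: "Phi x *v vtop c + vbot c = (Phi x *v vtop a + vbot a) + k *s (Phi x *v m1 + m2)"
      unfolding c by (simp add: vtop_add vbot_add vtop_smult vbot_smult matrix_vector_right_distrib matrix_vector_mult_smult vec_eq_iff algebra_simps)
    have "hdef r z c x = Sr r p x - qsol z c x" by (simp add: hdef_def p_def f_def)
    also have "\<dots> = gdef r a x - k *s (Jop r (Sr r p) x - Jop r (qsol z c) x)"
      unfolding q P elim(1) elim(3) gdef_def p0_def[symmetric] m1_def[symmetric] m2_def[symmetric]
      by (simp add: k_def vec_eq_iff algebra_simps)
    finally show ?case unfolding elim(2) k_def a_def .
  qed
qed

end

lemma cip_smult_left: "cip (k *s a) b = cnj k * cip a b" and cip_smult_right: "cip a (k *s b) = k * cip a b"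
  by (simp_all add: cip_def sum_distrib_left mult_ac)

text \<open>Formally, exp (k t) g(t) is the derivative of exp (k t) times the integral of h over
  [0,t]. As h is merely in L^2, the integration by parts is carried out with the adjoint of
  \<open>Jop\<close> acting on the exponential.\<close>

lemma Laplace_moment:
  fixes g h :: "'p::finite vfun"
  assumes r: "0 \<le> r" and g: "L2_on {0..r} g" and h: "L2_on {0..r} h"
    and eq: "AE x in leb r. h x = g x - k *s Jop r h x"
  shows "(LINT t|leb r. exp (k * of_real t) * cip b (g t)) = exp (k * of_real r) * cip b (LINT t|leb r. h t)"
proof -
  define e where "e t = exp (cnj k * of_real t) *s b" for t :: real
  have ce: "continuous_on {0..r} e"
    unfolding e_def[abs_def] by (intro bounded_bilinear.continuous_on[OF bounded_bilinear_smult] continuous_intros)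
  have e: "L2_on {0..r} e" by (rule L2_on_continuous[OF ce])
  note Jh = Jop_L2[OF h] and Je = adjpD(2)[OF adjp_J e]
  have lip: "lip_ad r e (\<lambda>t. (cnj k * exp (cnj k * of_real t)) *s b)"
    unfolding e_def[abs_def]
    by (rule lip_ad_linear[OF bounded_bilinear.bounded_linear_left[OF bounded_bilinear_smult] lip_ad_exp])
  have I: "cnj k *s (LINT t|leb x. e t) = e x - b" if "x \<in> {0..r}" for x
  proof -
    have ix: "integrable (leb x) e" by (rule L2_on_integrable[OF L2_on_subset[OF e]]) (use that in auto)
    have "cnj k *s (LINT t|leb x. e t) = (LINT t|leb x. cnj k *s e t)"
      using integral_bounded_linear[OF bounded_bilinear.bounded_linear_right[OF bounded_bilinear_smult] ix, of "cnj k"] by simp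
    also have "\<dots> = e x - e 0"
      using lip_ad_lebesgue_integral[OF lip, of x] that by (simp add: e_def smult_smult)
    finally show ?thesis by (simp add: e_def)
  qed
  have c: "cip (e t) y = exp (k * of_real t) * cip b y" for t y
    by (simp add: e_def cip_smult_left exp_cnj)
  have "(LINT t|leb r. exp (k * of_real t) * cip b (g t)) = ipL r e g"
    by (simp add: ipL_def c)
  also have "\<dots> = cnj (ipL r g e)" by (rule ipL_cnj[symmetric])
  also have "ipL r g e = ipL r (\<lambda>x. h x + k *s Jop r h x) e"
    by (rule ipL_cong_left[OF g L2_on_add[OF h L2_on_smult[OF Jh]] e]) (use eq in \<open>eventually_elim, simp\<close>)
  also have "cnj \<dots> = ipL r e (\<lambda>x. h x + k *s Jop r h x)" by (rule ipL_cnj)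
  also have "\<dots> = ipL r e h + k * ipL r e (Jop r h)"
    by (simp add: ipL_add_right[OF h L2_on_smult[OF Jh] e] ipL_scale_right)
  also have "ipL r e (Jop r h) = ipL r (Jadj r e) h"
    by (rule adjpD(3)[OF adjp_sym[OF adjp_J] e h, symmetric])
  also have "k * ipL r (Jadj r e) h = ipL r (\<lambda>x. cnj k *s Jadj r e x) h" by (simp add: ipL_scale_left)
  also have "\<dots> = ipL r (\<lambda>x. e r - e x) h"
    unfolding ipL_def
  proof (rule Bochner_Integration.integral_cong)
    fix x assume "x \<in> space (leb r)"
    then have x: "x \<in> {0..r}" by simp
    have "cnj k *s Jadj r e x = cnj k *s (LINT t|leb r. e t) - cnj k *s (LINT t|leb x. e t)"
      unfolding Jadj_eq[OF L2_on_integrable[OF e] x] Jop_eq[OF x] by (simp add: vec_eq_iff algebra_simps)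
    also have "\<dots> = e r - e x" using I[OF x] I[of r] r by simp
    finally show "cip (cnj k *s Jadj r e x) (h x) = cip (e r - e x) (h x)" by simp
  qed simp
  also have "\<dots> = ipL r (\<lambda>_. e r) h - ipL r e h" by (rule ipL_diff_left[OF L2_on_continuous[OF continuous_on_const] e h])
  also have "ipL r (\<lambda>_. e r) h = exp (k * of_real r) * cip b (LINT t|leb r. h t)"
    by (simp add: ipL_const_left[OF L2_on_integrable[OF h]] c)
  finally show ?thesis by simp
qed

lemma AE_zero_if_cip_zero:
  fixes g :: "'p::finite vfun"
  assumes "\<And>b. AE x in M. cip b (g x) = 0"
  shows "AE x in M. g x = 0"
proof -
  have "AE x in M. \<forall>i\<in>UNIV. g x $ i = 0"
    by (rule AE_finite_allI) (use assms[of "axis _ 1"] in \<open>simp_all add: cip_unit\<close>)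
  then show ?thesis by eventually_elim (simp add: vec_eq_iff)
qed

section \<open>Vanishing of the defect and the inverse of S\<close>

context dirac_similarity begin

text \<open>For \<open>Im z \<ge> 0\<close>, \<open>fsol\<close> is bounded by the value at
  \<open>r\<close>, \<open>volterra_bound\<close> passes this on to \<open>qsol\<close>, and S E^*
  is bounded in the supremum norm; none of the constants depends on z.\<close>

lemma hdef_bound:
  assumes r: "r \<in> {0..l}"
  obtains K where "K \<ge> 0" "\<And>z c. 0 \<le> Im z \<Longrightarrow> AE x in leb r. norm (hdef r z c x) \<le> K * norm (ysol z c r)"
proof -
  have rl: "0 \<le> r" "r \<le> l" using r by auto
  have b: "bop r (\<lambda>f. Sr r (Eadj r f))" by (rule bop_compose[OF bop_Sr[OF rl(1)] bop_Eadj[OF rl]])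
  obtain C' D where D: "C' \<ge> (0::real)" "D \<ge> 0"
    "\<And>f. L2_on {0..r} f \<Longrightarrow> L2_on {0..r} (Sr r (Eadj r f))"
    "\<And>f. L2_on {0..r} f \<Longrightarrow> (LINT x|leb r. (norm (Sr r (Eadj r f) x))\<^sup>2) \<le> C' * (LINT x|leb r. (norm (f x))\<^sup>2)"
    "\<And>f A. L2_on {0..r} f \<Longrightarrow> A \<ge> 0 \<Longrightarrow> (AE x in leb r. norm (f x) \<le> A) \<Longrightarrow>
        (AE x in leb r. norm (Sr r (Eadj r f) x) \<le> D * A)"
    by (rule bopE[OF b]) blast
  obtain C where C: "C > 0"
    "\<And>q a. L2_on {0..r} q \<Longrightarrow> 0 \<le> a \<Longrightarrow> (AE x in leb r. norm (q x + vop r (lowk ker) q x) \<le> a) \<Longrightarrow>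
       AE x in leb r. norm (q x) \<le> a * exp (C * x)"
    using volterra_bound[OF bker_ker[OF rl(2)]] by blast
  show thesis
  proof (rule that[of "D + exp (C * r)"])
    show "0 \<le> D + exp (C * r)" using D(2) by (simp add: add_nonneg_nonneg)
    fix z c assume z: "0 \<le> Im z"
    define A where "A = norm (ysol z c r)"
    have A: "A \<ge> 0" by (simp add: A_def)
    have f: "AE x in leb r. norm (fsol z c x) \<le> A"
      using AE_space_lebesgue_on[of "{0..r}"] by eventually_elim (auto simp: A_def intro!: fsol_norm_le z rl)
    have "AE x in leb r. Er l (qsol z c) x = fsol z c x"
      by (rule AE_lebesgue_on_subset[OF Er_qsol]) (use rl in auto)
    with f AE_space_lebesgue_on[of "{0..r}"]
    have "AE x in leb r. norm (qsol z c x + vop r (lowk ker) (qsol z c) x) \<le> A"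
    proof eventually_elim
      case (elim x)
      have "qsol z c x + vop r (lowk ker) (qsol z c) x = fsol z c x"
        using Er_restrict[OF elim(2) rl(2), of "qsol z c"] elim(3) unfolding Er_def by simp
      then show ?case using elim(1) by simp
    qed
    from C(2)[OF qsol_L2_restrict[OF rl(2)] A this] D(5)[OF fsol_L2_restrict[OF rl(2)] A f] AE_space_lebesgue_on[of "{0..r}"]
    show "AE x in leb r. norm (hdef r z c x) \<le> (D + exp (C * r)) * norm (ysol z c r)"
    proof eventually_elim
      case (elim x)
      have "A * exp (C * x) \<le> A * exp (C * r)" using elim(3) C(1) A by (intro mult_left_mono) auto
      moreover have "norm (hdef r z c x) \<le> norm (Sr r (Eadj r (fsol z c)) x) + norm (qsol z c x)"
        unfolding hdef_def by (rule norm_triangle_ineq4)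
      ultimately show ?case using elim unfolding A_def[symmetric] by (simp add: algebra_simps)
    qed
  qed
qed

text \<open>For each z the solution is chosen with the same value \<open>a\<close> at
  \<open>r\<close>. Then \<open>Laplace_moment\<close> writes the transform of \<open>gdef\<close>
  as exp (2 i z r) times a quantity bounded uniformly in z, and
  \<open>AE_zero_if_Laplace_bound\<close> leaves only the zero function.\<close>

lemma gdef_zero:
  assumes r: "r \<in> {0..l}"
  shows "AE x in leb r. gdef r a x = 0"
proof (rule AE_zero_if_cip_zero)
  fix b :: "complex ^ 'm2"
  have rl: "0 \<le> r" "r \<le> l" using r by auto
  interpret finite_measure "leb r" by (rule finite_measure_lebesgue_on_Icc)
  obtain K where K: "K \<ge> 0" "\<And>z c. 0 \<le> Im z \<Longrightarrow> AE x in leb r. norm (hdef r z c x) \<le> K * norm (ysol z c r)"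
    by (rule hdef_bound[OF r]) blast
  show "AE x in leb r. cip b (gdef r a x) = 0"
  proof (rule AE_zero_if_Laplace_bound)
    show "integrable (leb r) (\<lambda>x. cip b (gdef r a x))"
      by (rule L2_integrable_cip[OF L2_on_const gdef_L2[OF rl(2)]])
    show "0 \<le> M" using M_pos by simp
    fix z assume z: "M < Im z"
    then have z0: "0 \<le> Im z" using M_pos by simp
    obtain c where c: "ysol z c r = a" using ysol_terminal[OF r] by blast
    note h = hdef_L2[OF rl(2), of z c]
    have "norm (LINT t|leb r. hdef r z c t) \<le> (LINT t|leb r. norm (hdef r z c t))"
      by (rule integral_norm_bound)
    also have "\<dots> \<le> (LINT t|leb r. K * norm a)"
      by (rule integral_mono_AE[OF integrable_norm[OF L2_on_integrable[OF h]] integrable_const K(2)[OF z0, of c, unfolded c]])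
    also have "\<dots> = r * (K * norm a)" using rl by (simp add: measure_restrict_space)
    finally have I: "norm (LINT t|leb r. hdef r z c t) \<le> r * (K * norm a)" .
    have "norm (LINT t|leb r. exp (2 * \<i> * z * of_real t) * cip b (gdef r a t))
        = exp (- 2 * r * Im z) * norm (cip b (LINT t|leb r. hdef r z c t))"
      unfolding Laplace_moment[OF rl(1) gdef_L2[OF rl(2)] h hdef_eq[OF r, of z c], unfolded c] norm_mult
      by (simp add: mult_ac)
    also have "\<dots> \<le> exp (- 2 * r * Im z) * (norm b * (r * (K * norm a)))"
      by (intro mult_left_mono order_trans[OF norm_cip_le] I) auto
    finally show "norm (LINT t|leb r. exp (2 * \<i> * z * of_real t) * cip b (gdef r a t))
       \<le> (norm b * (r * (K * norm a))) * exp (- 2 * r * Im z)" by (simp add: mult_ac)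
  qed
qed

lemma hdef_zero:
  assumes r: "r \<in> {0..l}"
  shows "AE x in leb r. hdef r z c x = 0"
proof -
  define k where "k = 2 * \<i> * z"
  have rl: "0 \<le> r" "r \<le> l" using r by auto
  note h = hdef_L2[OF rl(2), of z c]
  define \<kappa> :: "real \<Rightarrow> real \<Rightarrow> complex ^ 'm2 ^ 'm2" where "\<kappa> = (\<lambda>x t. mat k ** mat 1)"
  have b: "bker r \<kappa>" unfolding \<kappa>_def by (rule bker_scale[OF bker_const])
  obtain C where C: "C > 0"
    "\<And>q a. L2_on {0..r} q \<Longrightarrow> 0 \<le> a \<Longrightarrow> (AE x in leb r. norm (q x + vop r (lowk \<kappa>) q x) \<le> a) \<Longrightarrow>
       AE x in leb r. norm (q x) \<le> a * exp (C * x)"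
    using volterra_bound[OF b] by blast
  have "AE x in leb r. norm (hdef r z c x + vop r (lowk \<kappa>) (hdef r z c) x) \<le> 0"
    using hdef_eq[OF r, of z c] gdef_zero[OF r, of "ysol z c r"] AE_space_lebesgue_on[of "{0..r}"]
  proof eventually_elim
    case (elim x)
    have "vop r (lowk \<kappa>) (hdef r z c) x = k *s Jop r (hdef r z c) x"
      unfolding \<kappa>_def lowk_scale Jop_def by (rule vop_scale[OF bker_J L2_on_integrable[OF h] elim(3)])
    then show ?case using elim(1,2) by (simp add: k_def)
  qed
  from C(2)[OF h order_refl this] show ?thesis by eventually_elim simp
qed

definition Sinv :: "real \<Rightarrow> 'm2 vfun \<Rightarrow> 'm2 vfun" where "Sinv r f = Eadj r (Er r f)"

lemma adjp_Sinv: "r \<le> l \<Longrightarrow> adjp r (Sinv r) (Sinv r)"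
  unfolding Sinv_def[abs_def] by (rule adjp_compose[OF adjp_sym[OF adjp_Er] adjp_Er])

lemma bop_Sinv: "0 \<le> r \<Longrightarrow> r \<le> l \<Longrightarrow> bop r (Sinv r)"
  unfolding Sinv_def[abs_def] by (rule bop_compose[OF bop_Eadj bop_Er])

lemma Sr_Sinv_exp:
  assumes r: "r \<in> {0..l}"
  shows "AE x in leb r. Sr r (Sinv r (\<lambda>t. exp (- 2 * \<i> * z * of_real t) *s b)) x = exp (- 2 * \<i> * z * of_real x) *s b"
proof -
  have rl: "0 \<le> r" "r \<le> l" using r by auto
  \<comment> \<open>With upper half 0 the function \<open>Phi\<close> drops out and
    \<open>qsol\<close> is a pure exponential.\<close>
  define c :: "complex ^ ('m1 + 'm2)" where "c = vjoin 0 b"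
  have q: "qsol z c = (\<lambda>t. exp (- 2 * \<i> * z * of_real t) *s b)"
    by (rule ext) (simp add: qsol_def c_def)
  note qL = qsol_L2_restrict[OF rl(2), of z c] and fL = fsol_L2_restrict[OF rl(2), of z c]
  have "AE x in leb r. Er l (qsol z c) x = fsol z c x"
    by (rule AE_lebesgue_on_subset[OF Er_qsol]) (use rl in auto)
  with AE_space_lebesgue_on[of "{0..r}"] have "AE x in leb r. Er r (qsol z c) x = fsol z c x"
    by eventually_elim (simp add: Er_restrict[OF _ rl(2)])
  then have "AE x in leb r. Sr r (Sinv r (qsol z c)) x = Sr r (Eadj r (fsol z c)) x"
    unfolding Sinv_def by (rule adjp_AE_cong[OF adjp_compose[OF adjp_Sr adjp_sym[OF adjp_Er[OF rl(2)]]] Er_L2[OF rl(2) qL] fL])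
  with hdef_zero[OF r, of z c] have "AE x in leb r. Sr r (Sinv r (qsol z c)) x = qsol z c x"
    by eventually_elim (simp add: hdef_def)
  then show ?thesis unfolding q .
qed

text \<open>Both operators are self-adjoint, so pairing the defect with an exponential moves them to
  the side where \<open>Sr_Sinv_exp\<close> applies; hence the Laplace transform of the defect is 0.
  The exponential is taken at \<open>cnj z\<close> because the pairing conjugates it.\<close>

lemma Sinv_Sr:
  assumes r: "r \<in> {0..l}" and g: "L2_on {0..r} g"
  shows "AE x in leb r. Sinv r (Sr r g) x = g x"
proof -
  have rl: "0 \<le> r" "r \<le> l" using r by auto
  define d where "d x = Sinv r (Sr r g) x - g x" for x
  note BS = adjp_compose[OF adjp_Sinv[OF rl(2)] adjp_Sr[of r]]
  have B: "L2_on {0..r} (Sinv r (Sr r g))" by (rule adjpD(1)[OF BS g])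
  have d: "L2_on {0..r} d" unfolding d_def[abs_def] by (rule L2_on_diff[OF B g])
  have "AE x in leb r. d x = 0"
  proof (rule AE_zero_if_cip_zero)
    fix b :: "complex ^ 'm2"
    show "AE x in leb r. cip b (d x) = 0"
    proof (rule AE_zero_if_Laplace_bound)
      show "integrable (leb r) (\<lambda>x. cip b (d x))" by (rule L2_integrable_cip[OF L2_on_const d])
      show "0 \<le> M" using M_pos by simp
      fix z assume "M < Im z"
      define q where "q t = exp (- 2 * \<i> * cnj z * of_real t) *s b" for t :: real
      have q: "L2_on {0..r} q" unfolding q_def[abs_def]
        by (intro L2_on_continuous bounded_bilinear.continuous_on[OF bounded_bilinear_smult] continuous_intros)
      have c: "exp (2 * \<i> * z * of_real t) * cip b y = cip (q t) y" for t y
        by (simp add: q_def cip_smult_left exp_cnj)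
      have "(LINT t|leb r. exp (2 * \<i> * z * of_real t) * cip b (d t)) = cnj (ipL r d q)"
        unfolding c ipL_cnj by (simp add: ipL_def)
      also have "ipL r d q = ipL r (Sinv r (Sr r g)) q - ipL r g q"
        unfolding d_def[abs_def] by (rule ipL_diff_left[OF B g q])
      also have "ipL r (Sinv r (Sr r g)) q = cnj (ipL r (Sr r (Sinv r q)) g)"
        unfolding ipL_cnj by (rule adjpD(3)[OF BS g q])
      also have "ipL r (Sr r (Sinv r q)) g = ipL r q g"
        by (rule ipL_cong_left[OF adjpD(2)[OF BS q] q g]) (use Sr_Sinv_exp[OF r, of "cnj z" b] in \<open>simp add: q_def[abs_def]\<close>)
      finally show "norm (LINT t|leb r. exp (2 * \<i> * z * of_real t) * cip b (d t)) \<le> 0 * exp (- 2 * r * Im z)"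
        by (simp add: ipL_cnj)
    qed
  qed
  then show ?thesis by (simp add: d_def)
qed

lemma Sr_Sinv:
  assumes r: "r \<in> {0..l}" and g: "L2_on {0..r} g"
  shows "AE x in leb r. Sr r (Sinv r g) x = g x"
proof -
  have rl: "r \<le> l" using r by auto
  show ?thesis
    by (rule adjp_unique[OF adjp_compose[OF adjp_Sinv[OF rl] adjp_Sr] adjp_id Sinv_Sr[OF r] g])
qed

end

lemma AE_lebesgue_on_reflect:
  assumes P: "AE x in leb l. P x" and sub: "0 \<le> c - b" "c - a \<le> l"
  shows "AE t in lebesgue_on {a..b::real}. P (c - t)"
proof -
  have "negligible {x \<in> {0..l}. \<not> P x}" using P by (simp add: AE_lebesgue_on_iff_negligible)
  then have "negligible ((\<lambda>x. c - x) ` {x \<in> {0..l}. \<not> P x})"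
    by (rule negligible_differentiable_image_negligible[OF order_refl]) (intro derivative_intros)
  moreover have "{t \<in> {a..b}. \<not> P (c - t)} \<subseteq> (\<lambda>x. c - x) ` {x \<in> {0..l}. \<not> P x}"
  proof
    fix t assume "t \<in> {t \<in> {a..b}. \<not> P (c - t)}"
    then have "c - t \<in> {x \<in> {0..l}. \<not> P x}" using sub by auto
    moreover have "t = c - (c - t)" by simp
    ultimately show "t \<in> (\<lambda>x. c - x) ` {x \<in> {0..l}. \<not> P x}" by blast
  qed
  ultimately show ?thesis by (auto simp: AE_lebesgue_on_iff_negligible intro: negligible_subset)
qed

lemma integral_cong_AE_lebesgue_on:
  fixes f g :: "'a::euclidean_space \<Rightarrow> 'b::euclidean_space"
  assumes eq: "AE x in lebesgue_on S. f x = g x" and g: "g \<in> borel_measurable (lebesgue_on S)" and S: "S \<in> sets lebesgue"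
  shows "(LINT x|lebesgue_on S. f x) = (LINT x|lebesgue_on S. g x)"
  by (rule integral_cong_AE[OF borel_measurable_lebesgue_on_AE_cong[OF g eq S] g eq])

lemma bounded_linear_entry: "bounded_linear (\<lambda>A :: complex^'q::finite^'p::finite. A $ i $ j)"
  using bounded_linear_compose[OF bounded_linear_vec_nth[of j] bounded_linear_vec_nth[of i]] .

lemma matrix_integrable_entrywise:
  fixes A :: "'a \<Rightarrow> complex ^ 'q::finite ^ 'p::finite"
  assumes "\<And>i j. integrable M (\<lambda>x. A x $ i $ j)"
  shows "integrable M A"
proof -
  have lin: "bounded_linear (\<lambda>z. axis i (axis j z) :: complex ^ 'q ^ 'p)" for i j
    unfolding linear_conv_bounded_linear[symmetric] by (rule linearI) (auto simp: vec_eq_iff axis_def)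
  have "(\<Sum>i\<in>UNIV. \<Sum>j\<in>UNIV. axis i (axis j (A x $ i $ j))) $ a $ b = A x $ a $ b" for x a b
  proof -
    have "(\<Sum>i\<in>UNIV. \<Sum>j\<in>UNIV. axis i (axis j (A x $ i $ j))) $ a $ b = (\<Sum>i\<in>UNIV. if i = a then (\<Sum>j\<in>UNIV. if j = b then A x $ i $ j else 0) else 0)"
      unfolding sum_component by (intro sum.cong refl) (auto simp: axis_def intro!: sum.cong)
    also have "\<dots> = A x $ a $ b" by simp
    finally show ?thesis .
  qed
  then have "A x = (\<Sum>i\<in>UNIV. \<Sum>j\<in>UNIV. axis i (axis j (A x $ i $ j)))" for x
    by (simp add: vec_eq_iff)
  then have "A = (\<lambda>x. \<Sum>i\<in>UNIV. \<Sum>j\<in>UNIV. axis i (axis j (A x $ i $ j)))" by blast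
  moreover have "integrable M (\<lambda>x. \<Sum>i\<in>UNIV. \<Sum>j\<in>UNIV. axis i (axis j (A x $ i $ j)) :: complex ^ 'q ^ 'p)"
    by (intro Bochner_Integration.integrable_sum integrable_bounded_linear[OF lin] assms)
  ultimately show ?thesis by simp
qed

section \<open>The truncated S and the formula for \<beta>\<close>

context dirac_similarity begin

text \<open>The limit \<open>min x t\<close> comes from composing the triangular kernel of
  \<open>W\<close> with that of its adjoint. Only values of the derivative on [0, max x t] occur, so
  \<open>r\<close> may replace \<open>l\<close>.\<close>

lemma s_kernel_eq:
  assumes D: "AE x in leb l. derivative_on l \<Phi>1 x = dfun x"
    and r: "r \<le> l" and x: "x \<in> {0..r}" and t: "t \<in> {0..r}"
  shows "s_kernel l \<Phi>1 x t = (LINT \<zeta>|leb r. wker x \<zeta> ** adjk wker \<zeta> t)"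
proof -
  have m: "(\<lambda>\<zeta>. dfun (x - \<zeta>) ** adj (dfun (t - \<zeta>))) \<in> borel_measurable (lebesgue_on {0..min x t})"
    by (intro borel_measurable_mm borel_measurable_adj measurable_compose[OF _ dfun_borel] borel_measurable_diff
        borel_measurable_const measurable_id_lebesgue_on)
  have 1: "AE \<zeta> in lebesgue_on {0..min x t}. derivative_on l \<Phi>1 (x - \<zeta>) = dfun (x - \<zeta>)"
    by (rule AE_lebesgue_on_reflect[OF D]) (use x r in auto)
  have 2: "AE \<zeta> in lebesgue_on {0..min x t}. derivative_on l \<Phi>1 (t - \<zeta>) = dfun (t - \<zeta>)"
    by (rule AE_lebesgue_on_reflect[OF D]) (use t r in auto)
  have "s_kernel l \<Phi>1 x t = (LINT \<zeta>|lebesgue_on {0..min x t}. dfun (x - \<zeta>) ** adj (dfun (t - \<zeta>)))"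
    unfolding s_kernel_def by (rule integral_cong_AE_lebesgue_on[OF _ m]) (use 1 2 in \<open>eventually_elim, simp\<close>, simp)
  also have "\<dots> = (LINT \<zeta>|leb r. (if 0 \<le> \<zeta> \<and> \<zeta> \<le> min x t then dfun (x - \<zeta>) ** adj (dfun (t - \<zeta>)) else 0))"
    by (rule lebesgue_integral_restrict_Icc[symmetric]) (use x in auto)
  also have "\<dots> = (LINT \<zeta>|leb r. wker x \<zeta> ** adjk wker \<zeta> t)"
    by (intro Bochner_Integration.integral_cong) (auto simp: wker_def lowk_def adjk_def)
  finally show ?thesis .
qed

lemma S_trunc_eq:
  assumes D: "AE x in leb l. derivative_on l \<Phi>1 x = dfun x"
    and r: "r \<le> l" and f: "L2_on {0..r} f" and x: "x \<in> {0..r}"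
  shows "S_trunc l \<Phi>1 r f x = Sr r f x"
proof -
  have "S_trunc l \<Phi>1 r f x = f x + (LINT t|leb l. s_kernel l \<Phi>1 x t *v cutoff r f t)"
    using x by (simp add: S_trunc_def cutoff_def S_op_def)
  also have "(LINT t|leb l. s_kernel l \<Phi>1 x t *v cutoff r f t) =
      (LINT t|leb l. (if 0 \<le> t \<and> t \<le> r then s_kernel l \<Phi>1 x t *v f t else 0))"
    by (intro Bochner_Integration.integral_cong) (auto simp: cutoff_def)
  also have "\<dots> = (LINT t|leb r. s_kernel l \<Phi>1 x t *v f t)"
    by (rule lebesgue_integral_restrict_Icc) (use r in auto)
  also have "\<dots> = vop r (\<lambda>x t. LINT \<zeta>|leb r. wker x \<zeta> ** adjk wker \<zeta> t) f x"
    unfolding vop_def by (intro Bochner_Integration.integral_cong) (simp_all add: s_kernel_eq[OF D r x])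
  also have "\<dots> = W r (Wadj r f) x"
    unfolding W_def Wadj_def by (rule vop_compose[OF bker_wker bker_adjk[OF bker_wker] f x, symmetric])
  finally show ?thesis by (simp add: Sr_def)
qed

text \<open>Inverses are unique only up to null sets; the second claim makes the formula for \<beta>
  independent of the one chosen.\<close>

lemma S_trunc_inverse:
  assumes D: "AE x in leb l. derivative_on l \<Phi>1 x = dfun x" and r: "r \<in> {0..l}"
  shows "L2_inverse_operator {0..r} (S_trunc l \<Phi>1 r) (Sinv r)"
    and "\<And>R f. L2_inverse_operator {0..r} (S_trunc l \<Phi>1 r) R \<Longrightarrow> L2_on {0..r} f \<Longrightarrow> AE x in leb r. R f x = Sinv r f x"
proof -
  have rl: "0 \<le> r" "r \<le> l" using r by auto
  have S: "AE x in leb r. S_trunc l \<Phi>1 r f x = Sr r f x" if "L2_on {0..r} f" for f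
    using AE_space_lebesgue_on[of "{0..r}"] by eventually_elim (rule S_trunc_eq[OF D rl(2) that])
  have bS: "bounded_L2_operator {0..r} (S_trunc l \<Phi>1 r)"
    by (rule bounded_L2_operatorI[OF adjp_Sr bop_Sr[OF rl(1)] S])
  have bI: "bounded_L2_operator {0..r} (Sinv r)"
    by (rule bounded_L2_operatorI[OF adjp_Sinv[OF rl(2)] bop_Sinv[OF rl]]) simp
  have "(AE x in leb r. S_trunc l \<Phi>1 r (Sinv r f) x = f x) \<and> (AE x in leb r. Sinv r (S_trunc l \<Phi>1 r f) x = f x)"
    if f: "L2_on {0..r} f" for f
  proof
    have B: "L2_on {0..r} (Sinv r f)" by (rule adjpD(1)[OF adjp_Sinv[OF rl(2)] f])
    show "AE x in leb r. S_trunc l \<Phi>1 r (Sinv r f) x = f x"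
      using S[OF B] Sr_Sinv[OF r f] by eventually_elim simp
    have "AE x in leb r. Sinv r (S_trunc l \<Phi>1 r f) x = Sinv r (Sr r f) x"
      by (rule adjp_AE_cong[OF adjp_Sinv[OF rl(2)] _ adjpD(1)[OF adjp_Sr f] S[OF f]])
         (use bS f in \<open>simp add: bounded_L2_operator_def\<close>)
    with Sinv_Sr[OF r f] show "AE x in leb r. Sinv r (S_trunc l \<Phi>1 r f) x = f x"
      by eventually_elim simp
  qed
  with bS bI show "L2_inverse_operator {0..r} (S_trunc l \<Phi>1 r) (Sinv r)"
    unfolding L2_inverse_operator_def by blast
  fix R and f :: "'m2 vfun" assume R: "L2_inverse_operator {0..r} (S_trunc l \<Phi>1 r) R" and f: "L2_on {0..r} f"
  have Rf: "L2_on {0..r} (R f)" using R f by (auto simp: L2_inverse_operator_def bounded_L2_operator_def)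
  have "AE x in leb r. S_trunc l \<Phi>1 r (R f) x = f x" using R f by (auto simp: L2_inverse_operator_def)
  with S[OF Rf] have "AE x in leb r. Sr r (R f) x = f x" by eventually_elim simp
  from adjp_AE_cong[OF adjp_Sinv[OF rl(2)] adjpD(1)[OF adjp_Sr Rf] f this] Sinv_Sr[OF r Rf]
  show "AE x in leb r. R f x = Sinv r f x" by eventually_elim simp
qed

lemma beta_formula:
  assumes \<Phi>: "\<And>x. x \<in> {0..l} \<Longrightarrow> \<Phi>1 x = Phi x"
    and D: "AE x in leb l. derivative_on l \<Phi>1 x = dfun x" and r: "r \<in> {0..l}"
    and R: "L2_inverse_operator {0..r} (S_trunc l \<Phi>1 r) R"
  shows "\<beta> r = I0 - (LINT t|leb r. adj (apply_columnwise R (derivative_on l \<Phi>1) t) ** hcat (\<Phi>1 t) (mat 1))"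
proof -
  have rl: "0 \<le> r" "r \<le> l" using r by auto
  define AC where "AC = apply_columnwise R (derivative_on l \<Phi>1)"
  define H where "H t = (hcat (\<Phi>1 t) (mat 1) :: complex ^ ('m1 + 'm2) ^ 'm2)" for t
  define d where "d k t = dfun t *v axis k 1" for k t
  have dL: "L2_on {0..r} (d k)" for k unfolding d_def[abs_def] by (rule dfun_vec_L2)
  have AC: "AE t in leb r. AC t *v axis k 1 = Sinv r (d k) t" for k
  proof -
    define h where "h t = column k (derivative_on l \<Phi>1 t)" for t
    have "AE t in leb r. derivative_on l \<Phi>1 t = dfun t"
      by (rule AE_lebesgue_on_subset[OF D]) (use rl in auto)
    then have h: "AE t in leb r. h t = d k t"
      by eventually_elim (simp add: h_def d_def vec_eq_iff matrix_vector_axis column_def)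
    have hm: "h \<in> borel_measurable (leb r)"
      by (rule borel_measurable_lebesgue_on_AE_cong[OF L2_on_measurable[OF dL] h]) simp
    have hL: "L2_on {0..r} h"
      by (rule L2_onI_bound[OF hm L2_on_square_integrable[OF dL[of k]]]) (use h in \<open>eventually_elim, simp\<close>)
    have "AE t in leb r. Sinv r h t = Sinv r (d k) t"
      by (rule adjp_AE_cong[OF adjp_Sinv[OF rl(2)] hL dL h])
    with S_trunc_inverse(2)[OF D r R hL] show ?thesis
      by eventually_elim (simp add: AC_def apply_columnwise_def vec_eq_iff matrix_vector_axis h_def[abs_def])
  qed
  have H: "H t *v axis j 1 = Phi t *v vtop (axis j 1) + vbot (axis j 1)" if "t \<in> {0..r}" for t j
    using that rl by (simp add: H_def hcat_mult_vec \<Phi>)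
  \<comment> \<open>The operators act on columns, so the matrix integral is read entry by entry as
    an inner product in L^2.\<close>
  have ent: "(adj A ** B) $ k $ j = cip (A *v axis k 1) (B *v axis j 1)" for A :: "complex ^ 'm1 ^ 'm2" and B :: "complex ^ ('m1 + 'm2) ^ 'm2" and k j
    by (simp add: cip_adj' cip_unit matrix_vector_mul_assoc matrix_vector_axis)
  have BL: "L2_on {0..r} (Sinv r (d k))" for k by (rule adjpD(1)[OF adjp_Sinv[OF rl(2)] dL])
  have e: "AE t in leb r. (adj (AC t) ** H t) $ k $ j = cip (Sinv r (d k) t) (Phi t *v vtop (axis j 1) + vbot (axis j 1))" for k j
    using AC[of k] AE_space_lebesgue_on[of "{0..r}"] by eventually_elim (simp add: ent H)
  have int: "integrable (leb r) (\<lambda>t. cip (Sinv r (d k) t) (Phi t *v vtop c + vbot c))" for k c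
    by (rule L2_integrable_cip[OF BL Pi_L2])
  have iG: "integrable (leb r) (\<lambda>t. adj (AC t) ** H t)"
  proof (rule matrix_integrable_entrywise)
    fix k j
    have m: "(\<lambda>t. (adj (AC t) ** H t) $ k $ j) \<in> borel_measurable (leb r)"
      by (rule borel_measurable_lebesgue_on_AE_cong[OF borel_measurable_integrable[OF int] e]) simp
    show "integrable (leb r) (\<lambda>t. (adj (AC t) ** H t) $ k $ j)"
      by (rule integrable_cong_AE_imp[OF int m]) (use e[of k j] in \<open>eventually_elim, simp\<close>)
  qed
  have "\<beta> r $ k $ j = (I0 - (LINT t|leb r. adj (AC t) ** H t)) $ k $ j" for k j
  proof -
    have vL: "L2_on {0..r} (\<lambda>t. - adj (v t) *v axis k 1)" by (rule L2_on_subset[OF adj_v_vec_L2]) (use rl in auto)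
    have Ed: "AE t in leb r. Er r (d k) t = - adj (v t) *v axis k 1"
    proof -
      have "AE t in leb r. Er l (d k) t = - adj (v t) *v axis k 1"
        unfolding d_def by (rule AE_lebesgue_on_subset[OF Er_dfun]) (use rl in auto)
      with AE_space_lebesgue_on[of "{0..r}"] show ?thesis by eventually_elim (simp add: Er_restrict[OF _ rl(2)])
    qed
    have EL: "L2_on {0..r} (Er r (d k))" by (rule Er_L2[OF rl(2) dL])
    define P where "P t = Phi t *v vtop (axis j 1) + vbot (axis j 1)" for t
    have PL: "L2_on {0..r} P" unfolding P_def[abs_def] by (rule Pi_L2)
    have "(LINT t|leb r. adj (AC t) ** H t) $ k $ j = (LINT t|leb r. (adj (AC t) ** H t) $ k $ j)"
      using integral_bounded_linear[OF bounded_linear_entry iG, of k j] by simp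
    also have "\<dots> = ipL r (Sinv r (d k)) P"
      unfolding ipL_def P_def by (rule integral_cong_AE_lebesgue_on[OF e borel_measurable_integrable[OF int]]) simp
    also have "\<dots> = ipL r (Er r (d k)) (Er r P)"
      unfolding Sinv_def by (rule adjpD(3)[OF adjp_sym[OF adjp_Er[OF rl(2)]] EL PL])
    also have "\<dots> = ipL r (\<lambda>t. - adj (v t) *v axis k 1) (Er r P)"
      by (rule ipL_cong_left[OF EL vL Er_L2[OF rl(2) PL] Ed])
    also have "\<dots> = cnj (ipL r (Er r P) (\<lambda>t. - adj (v t) *v axis k 1))" by (simp add: ipL_cnj)
    also have "ipL r (Er r P) (\<lambda>t. - adj (v t) *v axis k 1) = ipL r (\<lambda>t. \<gamma> t *v axis j 1) (\<lambda>t. - adj (v t) *v axis k 1)"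
      by (rule ipL_cong_left[OF Er_L2[OF rl(2) PL] gamma_vec_L2_restrict[OF rl(2)] vL])
         (use Er_Pi_restrict[OF rl(2), of "axis j 1"] in \<open>simp add: P_def[abs_def]\<close>)
    also have "cnj \<dots> = (LINT t|leb r. - ((v t ** \<gamma> t) $ k $ j))"
      unfolding ipL_cnj unfolding ipL_def
      by (intro Bochner_Integration.integral_cong refl)
         (simp add: adj_minus[symmetric] cip_adj' cip_unit matrix_matrix_mult_def[of "- v _"] matrix_matrix_mult_def[of "v _" "\<gamma> _"] sum_negf matrix_vector_mul_assoc matrix_vector_axis)
    also have "\<dots> = - (\<beta> r $ k $ j - \<beta> 0 $ k $ j)"
      using lip_ad_lebesgue_integral[OF lip_ad_linear[OF bounded_linear_entry lip_ad_beta] rl, of k j] by simp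
    finally show ?thesis by (simp add: beta_0)
  qed
  then show ?thesis unfolding AC_def[symmetric] H_def[symmetric] by (simp add: vec_eq_iff)
qed

end

section \<open>The Fourier formula\<close>

text \<open>\<open>sinc\<close> abbreviates a case distinction at 0; as a constant it stays in one
  piece under integrals.\<close>

definition sine_cardinal :: "real \<Rightarrow> real" where "sine_cardinal = sinc"

lemma continuous_on_sine_cardinal: "continuous_on S f \<Longrightarrow> continuous_on S (\<lambda>x. sine_cardinal (f x))"
  unfolding sine_cardinal_def by (rule continuous_on_sinc)

lemma DERIV_Si': "(Si has_real_derivative sine_cardinal x) (at x)"
  unfolding sine_cardinal_def by (rule DERIV_Si)

lemma integral_exp_Dirichlet:
  fixes a s :: real
  assumes "0 \<le> a"
  shows "((\<lambda>\<xi>. exp (\<i> * of_real s * of_real \<xi>)) has_integral of_real (2 * a * sine_cardinal (a * s))) {-a..a}"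
proof (cases "s = 0")
  case True
  have "((\<lambda>\<xi>. 1 :: complex) has_integral (2 * a) *\<^sub>R 1) {-a..a}"
    using has_integral_const_real[of "1::complex" "-a" a] assms by simp
  then show ?thesis by (simp add: True scaleR_conv_of_real sine_cardinal_def)
next
  case False
  have D: "((\<lambda>\<xi>. exp (\<i> * of_real s * of_real \<xi>) / (\<i> * of_real s)) has_vector_derivative exp (\<i> * of_real s * of_real \<xi>)) (at \<xi> within {-a..a})" for \<xi>
    by (rule has_vector_derivative_real_field) (use False in \<open>auto intro!: derivative_eq_intros\<close>)
  have 1: "((\<lambda>\<xi>. exp (\<i> * of_real s * of_real \<xi>)) has_integral
      (exp (\<i> * of_real s * of_real a) / (\<i> * of_real s) - exp (\<i> * of_real s * of_real (-a)) / (\<i> * of_real s))) {-a..a}"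
    by (rule fundamental_theorem_of_calculus) (use assms D in auto)
  have 2: "exp (\<i> * of_real s * of_real a) / (\<i> * of_real s) - exp (\<i> * of_real s * of_real (-a)) / (\<i> * of_real s) = of_real (2 * sin (a * s) / s)"
  proof -
    have "exp (\<i> * of_real s * of_real a) = cis (a * s)" "exp (\<i> * of_real s * of_real (-a)) = cis (- (a * s))"
      by (simp_all add: cis_conv_exp mult_ac)
    moreover have "cis (a * s) - cis (- (a * s)) = 2 * \<i> * of_real (sin (a * s))" by (simp add: complex_eq_iff)
    ultimately have "exp (\<i> * of_real s * of_real a) / (\<i> * of_real s) - exp (\<i> * of_real s * of_real (-a)) / (\<i> * of_real s) = (2 * \<i> * of_real (sin (a * s))) / (\<i> * of_real s)"
      by (metis diff_divide_distrib)
    then show ?thesis using False by simp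
  qed
  have 3: "2 * a * sine_cardinal (a * s) = 2 * sin (a * s) / s" using False by (auto simp: sine_cardinal_def)
  show ?thesis using 1 unfolding 2 3 .
qed

text \<open>Up to sign the factor of \<open>f'\<close> is the primitive of the Dirichlet kernel,
  normalised to vanish at t = l; the boundary term at 0 is killed by \<open>f 0 = 0\<close>. The
  gain is that \<open>Si\<close> is bounded whereas the kernel grows with \<open>a\<close>.\<close>

lemma Dirichlet_integral_by_parts:
  fixes f f' :: "real \<Rightarrow> complex"
  assumes lip: "lip_ad l f f'" and f0: "f 0 = 0" and l: "0 \<le> l"
  shows "integral {0..l} (\<lambda>t. f t * of_real (2 * a * sine_cardinal (a * (2 * t - x)))) =
     (LINT t|leb l. of_real (Si (a * (2 * l - x)) - Si (a * (2 * t - x))) * f' t)"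
proof -
  define k where "k t = complex_of_real (Si (a * (2 * l - x)) - Si (a * (2 * t - x)))" for t
  define k' where "k' t = - complex_of_real (2 * a * sine_cardinal (a * (2 * t - x)))" for t
  have ck: "continuous_on {0..l} k'" unfolding k'_def[abs_def]
    by (intro continuous_on_minus continuous_on_of_real continuous_on_mult continuous_on_sine_cardinal continuous_intros)
  have lk: "lip_ad l k k'"
  proof (rule lip_ad_C1)
    fix t
    have "((\<lambda>t. Si (a * (2 * l - x)) - Si (a * (2 * t - x))) has_real_derivative - (2 * a * sine_cardinal (a * (2 * t - x)))) (at t within {0..l})"
      by (rule derivative_eq_intros DERIV_chain2[OF DERIV_Si'] refl)+ simp
    then show "(k has_vector_derivative k' t) (at t within {0..l})"
      unfolding k_def[abs_def] k'_def
      by (subst of_real_minus[symmetric]) (rule has_vector_derivative_of_real)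
    show "continuous_on {0..l} k'" by (rule ck)
  qed
  have "(LINT t|leb l. k t * f' t + k' t * f t) = k l * f l - k 0 * f 0"
    using lip_ad_lebesgue_integral[OF lip_ad_bilinear[OF bounded_bilinear_mult lk lip] l order_refl] by simp
  also have "\<dots> = 0" by (simp add: k_def f0)
  also have "(LINT t|leb l. k t * f' t + k' t * f t) = (LINT t|leb l. k t * f' t) + (LINT t|leb l. k' t * f t)"
    by (intro Bochner_Integration.integral_add integrable_continuous_on_mult[OF lip_ad_continuous_on[OF lk] lip_ad_integrable[OF lip]]
         integrable_continuous_on_mult[OF ck L2_on_integrable[OF L2_on_continuous[OF lip_ad_continuous_on[OF lip]]]])
  also have "(LINT t|leb l. k' t * f t) = - (LINT t|leb l. f t * of_real (2 * a * sine_cardinal (a * (2 * t - x))))"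
    unfolding Bochner_Integration.integral_minus[symmetric] by (simp add: k'_def mult.commute)
  also have "(LINT t|leb l. f t * of_real (2 * a * sine_cardinal (a * (2 * t - x)))) = integral {0..l} (\<lambda>t. f t * of_real (2 * a * sine_cardinal (a * (2 * t - x))))"
    by (intro lebesgue_integral_eq_integral L2_on_integrable L2_on_continuous continuous_on_mult lip_ad_continuous_on[OF lip])
       (intro continuous_intros continuous_on_sine_cardinal, simp)
  finally show ?thesis by (simp add: k_def)
qed

text \<open>The limits \<plusminus> pi / 2 of \<open>Si\<close> make the factor of \<open>f'\<close>
  tend to pi for t < x / 2 and to 0 for t > x / 2, so the limit is pi times the integral of
  \<open>f'\<close> over [0, x / 2].\<close>

lemma Dirichlet_integral_tendsto:
  fixes f f' :: "real \<Rightarrow> complex"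
  assumes lip: "lip_ad l f f'" and f0: "f 0 = 0" and x: "0 < x" "x < 2 * l"
  shows "((\<lambda>a. LINT t|leb l. of_real (Si (a * (2 * l - x)) - Si (a * (2 * t - x))) * f' t) \<longlongrightarrow> of_real pi * f (x / 2)) at_top"
proof -
  have l: "0 < l" using x by simp
  obtain B where B: "\<And>T. \<bar>Si T\<bar> \<le> B" using bounded_Si by blast
  have fi: "integrable (leb l) f'" by (rule lip_ad_integrable[OF lip])
  have lim: "((\<lambda>a. Si (a * y)) \<longlongrightarrow> (if y > 0 then pi / 2 else - (pi / 2))) at_top" if "y \<noteq> 0" for y
  proof (cases "y > 0")
    case True
    then have "filterlim (\<lambda>a. a * y) at_top at_top" by real_asymp
    from filterlim_compose[OF Si_at_top this] show ?thesis using True by simp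
  next
    case False
    then have y: "y < 0" using that by simp
    then have "filterlim (\<lambda>a. a * (-y)) at_top at_top" by real_asymp
    from filterlim_compose[OF Si_at_top this] have "((\<lambda>a. - Si (a * (-y))) \<longlongrightarrow> - (pi / 2)) at_top" by (intro tendsto_minus)
    moreover have "\<forall>\<^sub>F a in at_top. - Si (a * (-y)) = Si (a * y)"
      using eventually_ge_at_top[of 0]
    proof eventually_elim
      case (elim a)
      then have "a * (-y) \<ge> 0" using y by (intro mult_nonneg_nonneg) auto
      from Si_neg[OF this] show ?case by simp
    qed
    ultimately have "((\<lambda>a. Si (a * y)) \<longlongrightarrow> - (pi / 2)) at_top" by (rule tendsto_cong[THEN iffD1, rotated])
    then show ?thesis using False by simp
  qed
  have "((\<lambda>a. LINT t|leb l. of_real (Si (a * (2 * l - x)) - Si (a * (2 * t - x))) * f' t)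
     \<longlongrightarrow> (LINT t|leb l. of_real pi * (if t \<le> x / 2 then f' t else 0))) at_top"
  proof (rule integral_dominated_convergence_at_top[where w = "\<lambda>t. 2 * B * norm (f' t)"])
    have m: "f' \<in> borel_measurable (leb l)" using fi by simp
    have idm[measurable]: "(\<lambda>x. x) \<in> borel_measurable (leb l)" by (rule measurable_id_lebesgue_on)
    note [measurable] = m
    show "(\<lambda>t. of_real pi * (if t \<le> x / 2 then f' t else 0)) \<in> borel_measurable (leb l)" by measurable
    show "(\<lambda>t. of_real (Si (a * (2 * l - x)) - Si (a * (2 * t - x))) * f' t) \<in> borel_measurable (leb l)" for a
      by measurable
    show "integrable (leb l) (\<lambda>t. 2 * B * norm (f' t))" using fi by auto
    show "\<forall>\<^sub>F a in at_top. AE t in leb l. norm (of_real (Si (a * (2 * l - x)) - Si (a * (2 * t - x))) * f' t) \<le> 2 * B * norm (f' t)"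
    proof (intro always_eventually allI AE_I2)
      fix a t
      have "\<bar>Si (a * (2 * l - x)) - Si (a * (2 * t - x))\<bar> \<le> 2 * B"
        using B[of "a * (2 * l - x)"] B[of "a * (2 * t - x)"] by linarith
      then show "norm (of_real (Si (a * (2 * l - x)) - Si (a * (2 * t - x))) * f' t) \<le> 2 * B * norm (f' t)"
        unfolding norm_mult norm_of_real by (rule mult_right_mono) simp
    qed
    have ae: "AE t in leb l. t \<noteq> x / 2"
      by (rule AE_lebesgue_on_iff_negligible[THEN iffD2]) (auto intro: negligible_subset[of "{x / 2}"])
    show "AE t in leb l. ((\<lambda>a. of_real (Si (a * (2 * l - x)) - Si (a * (2 * t - x))) * f' t) \<longlongrightarrow> of_real pi * (if t \<le> x / 2 then f' t else 0)) at_top"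
      using ae
    proof eventually_elim
      case (elim t)
      have "((\<lambda>a. Si (a * (2 * l - x)) - Si (a * (2 * t - x))) \<longlongrightarrow> pi / 2 - (if 2 * t - x > 0 then pi / 2 else - (pi / 2))) at_top"
        using lim[of "2 * l - x"] lim[of "2 * t - x"] x elim by (intro tendsto_diff) auto
      then have "((\<lambda>a. of_real (Si (a * (2 * l - x)) - Si (a * (2 * t - x))) * f' t) \<longlongrightarrow> of_real (pi / 2 - (if 2 * t - x > 0 then pi / 2 else - (pi / 2))) * f' t) at_top"
        by (intro tendsto_mult_right tendsto_of_real)
      moreover have "of_real (pi / 2 - (if 2 * t - x > 0 then pi / 2 else - (pi / 2))) * f' t = of_real pi * (if t \<le> x / 2 then f' t else 0)"
        using elim by auto
      ultimately show ?case by simp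
    qed
  qed
  also have "(LINT t|leb l. of_real pi * (if t \<le> x / 2 then f' t else 0)) = of_real pi * (LINT t|lebesgue_on {0..x/2}. f' t)"
    using lebesgue_integral_Icc_extend[of 0 "x / 2" l f'] x by simp
  also have "(LINT t|lebesgue_on {0..x/2}. f' t) = f (x / 2)"
    using lip_ad_lebesgue_integral[OF lip, of "x / 2"] x f0 by simp
  finally show ?thesis .
qed

text \<open>Uniform in \<open>a\<close> and \<open>x\<close>, so it yields a majorant when the
  pointwise limit is turned into a limit in L^2.\<close>

lemma Dirichlet_integral_bounded:
  fixes f' :: "real \<Rightarrow> complex"
  assumes fi: "integrable (leb l) f'"
  shows "\<exists>K. \<forall>a x. norm (LINT t|leb l. of_real (Si (a * (2 * l - x)) - Si (a * (2 * t - x))) * f' t) \<le> K"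
proof -
  obtain B where B: "\<And>T. \<bar>Si T\<bar> \<le> B" using bounded_Si by blast
  have cSi: "continuous_on UNIV Si" by (intro continuous_at_imp_continuous_on ballI isCont_Si)
  have "norm (LINT t|leb l. of_real (Si (a * (2 * l - x)) - Si (a * (2 * t - x))) * f' t) \<le> (LINT t|leb l. 2 * B * norm (f' t))" for a x
  proof (rule Bochner_Integration.integral_norm_bound_integral)
    have le: "norm (of_real (Si (a * (2 * l - x)) - Si (a * (2 * t - x))) * f' t) \<le> 2 * B * norm (f' t)" for t
    proof -
      have "\<bar>Si (a * (2 * l - x)) - Si (a * (2 * t - x))\<bar> \<le> 2 * B"
        using B[of "a * (2 * l - x)"] B[of "a * (2 * t - x)"] by linarith
      then show ?thesis unfolding norm_mult norm_of_real by (rule mult_right_mono) simp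
    qed
    then show "norm (of_real (Si (a * (2 * l - x)) - Si (a * (2 * t - x))) * f' t) \<le> 2 * B * norm (f' t)" for t .
    show i: "integrable (leb l) (\<lambda>t. 2 * B * norm (f' t))" using fi by auto
    have c: "continuous_on {0..l} (\<lambda>t. complex_of_real (Si (a * (2 * l - x)) - Si (a * (2 * t - x))))"
      by (rule continuous_on_of_real[OF continuous_on_diff[OF continuous_on_const continuous_on_compose2[OF cSi _ subset_UNIV]]])
         (intro continuous_intros)
    show "integrable (leb l) (\<lambda>t. of_real (Si (a * (2 * l - x)) - Si (a * (2 * t - x))) * f' t)"
      by (rule integrable_continuous_on_mult[OF c fi])
  qed
  then show ?thesis by blast
qed

section \<open>Shifting the line of integration\<close>

lemma exp_minus_le_powr:
  fixes y :: real
  assumes y: "0 < y"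
  shows "exp (- y) \<le> y powr (- (1 / 4))"
proof -
  have "y powr (1 / 4) \<le> exp y"
  proof (cases "y \<le> 1")
    case True
    have "y powr (1 / 4) \<le> 1 powr (1 / 4)" using True y by (intro powr_mono2) auto
    moreover have "1 powr (1 / 4) \<le> exp y" using y by simp
    ultimately show ?thesis by (rule order_trans)
  next
    case False
    then have "y powr (1 / 4) \<le> y powr 1" by (intro powr_mono) auto
    moreover have "y powr 1 = y" using y by simp
    moreover have "y \<le> exp y" using exp_ge_add_one_self[of y] by linarith
    ultimately show ?thesis by linarith
  qed
  then have "inverse (exp y) \<le> inverse (y powr (1 / 4))" using y by (intro le_imp_inverse_le) auto
  then show ?thesis by (simp add: exp_minus powr_minus)
qed

text \<open>Both coordinates are at most the modulus, hence so is their weighted geometric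
  mean.\<close>

lemma powr_le_norm_Complex:
  fixes a t x :: real
  assumes "0 < a" "0 < t" and x: "\<bar>x\<bar> = a"
  shows "a powr (1 / 8) * t powr (7 / 8) \<le> norm (Complex x t)"
proof -
  define m where "m = norm (Complex x t)"
  have m: "a \<le> m" "t \<le> m" using abs_Re_le_cmod[of "Complex x t"] abs_Im_le_cmod[of "Complex x t"] x by (auto simp: m_def)
  have "a powr (1 / 8) * t powr (7 / 8) \<le> m powr (1 / 8) * m powr (7 / 8)"
    using m assms by (intro mult_mono powr_mono2) auto
  also have "\<dots> = m" using m assms by (simp add: powr_add[symmetric])
  finally show ?thesis by (simp add: m_def)
qed

text \<open>Shifting the line of integration upwards to infinity; the vertical sides are estimated with
  \<open>e\<^sup>-\<^sup>y \<le> y\<^sup>-\<^sup>1\<^sup>/\<^sup>4\<close> and \<open>|\<plusminus>a + \<i>t| \<ge> a\<^sup>1\<^sup>/\<^sup>8 t\<^sup>7\<^sup>/\<^sup>8\<close>, which makes them integrable in \<open>t\<close>, square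
  integrable in \<open>s\<close> and small in \<open>a\<close>.\<close>

lemma horizontal_integral_bound:
  fixes G :: "complex \<Rightarrow> complex"
  assumes hol: "G holomorphic_on half_plane M" and M: "0 \<le> M" and C: "0 \<le> C"
    and bd: "\<And>z. Im z > M \<Longrightarrow> norm (G z) \<le> C / norm z"
    and \<eta>: "\<eta> > M" and a: "0 < a" and s: "0 < s"
  shows "norm (integral {-a..a} (\<lambda>\<xi>. exp (\<i> * of_real s * Complex \<xi> \<eta>) * G (Complex \<xi> \<eta>))) \<le> 16 * C * \<eta> powr (- (1/8)) * s powr (- (1/4)) * a powr (- (1/8))"
proof -
  define H where "H z = exp (\<i> * of_real s * z) * G z" for z
  have holH: "H holomorphic_on half_plane M" unfolding H_def by (intro holomorphic_intros hol)
  have conv: "convex (half_plane M)" unfolding half_plane_def by (rule convex_halfspace_Im_gt)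
  \<comment> \<open>A primitive on the convex half-plane replaces contour integration: each side of
    the rectangle contributes a difference of values of \<open>P\<close>.\<close>
  obtain P where P: "\<And>z. z \<in> half_plane M \<Longrightarrow> (P has_field_derivative H z) (at z within half_plane M)"
    using holomorphic_convex_primitive'[OF conv open_half_plane holH] by blast
  have P': "(P has_field_derivative H z) (at z)" if "Im z > M" for z
    using P[of z] that at_within_open[OF _ open_half_plane, of z M] by (simp add: half_plane_def)
  have nH: "norm (H z) \<le> exp (- s * Im z) * (C / norm z)" if "Im z > M" for z
    unfolding H_def norm_mult using bd[OF that] by (intro mult_mono) auto
  have hor: "((\<lambda>\<xi>. P (Complex \<xi> t)) has_vector_derivative H (Complex \<xi> t)) (at \<xi> within X)" if "t > M" for \<xi> t X
  proof -
    have "((\<lambda>\<xi>. Complex \<xi> t) has_vector_derivative 1) (at \<xi> within X)"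
      unfolding Complex_eq by (auto intro!: derivative_eq_intros)
    from field_vector_diff_chain_within[OF this, of P "H (Complex \<xi> t)"] P'[of "Complex \<xi> t"] that
    show ?thesis by (auto simp: o_def intro: has_field_derivative_at_within)
  qed
  have ver: "((\<lambda>t. P (Complex x t)) has_vector_derivative \<i> * H (Complex x t)) (at t)" if "t > M" for x t
  proof -
    have "((\<lambda>t. Complex x t) has_vector_derivative \<i>) (at t)"
      unfolding Complex_eq by (auto intro!: derivative_eq_intros)
    from field_vector_diff_chain_at[OF this, of P "H (Complex x t)"] P'[of "Complex x t"] that
    show ?thesis by (auto simp: o_def)
  qed
  have "((\<lambda>\<xi>. H (Complex \<xi> \<eta>)) has_integral P (Complex a \<eta>) - P (Complex (-a) \<eta>)) {-a..a}"
    by (rule fundamental_theorem_of_calculus) (use a hor[OF \<eta>] in auto)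
  then have I: "integral {-a..a} (\<lambda>\<xi>. H (Complex \<xi> \<eta>)) = P (Complex a \<eta>) - P (Complex (-a) \<eta>)"
    by (rule integral_unique)
  define K where "K = C * s powr (- (1/4)) * a powr (- (1/8))"
  have K: "K \<ge> 0" using C by (simp add: K_def)
  have side: "norm (P (Complex x T) - P (Complex x \<eta>)) \<le> 8 * K * \<eta> powr (- (1/8))" if x: "\<bar>x\<bar> = a" and T: "T > \<eta>" for x T
  proof -
    \<comment> \<open>The integrand on a vertical side has exponent 1/4 + 7/8 = 9/8 > 1, so its
      primitive, which brings in the factor 8, stays bounded however long the side is.\<close>
    have "norm (P (Complex x T) - P (Complex x \<eta>)) \<le> (- 8 * K * T powr (- (1/8))) - (- 8 * K * \<eta> powr (- (1/8)))"
    proof (rule differentiable_bound_general[OF T])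
      show "continuous_on {\<eta>..T} (\<lambda>t. P (Complex x t))"
        by (intro continuous_at_imp_continuous_on ballI has_vector_derivative_continuous[OF ver]) (use \<eta> in auto)
      show "continuous_on {\<eta>..T} (\<lambda>t. - 8 * K * t powr (- (1/8)))"
        using \<eta> M by (intro continuous_intros) auto
      fix t assume t: "\<eta> < t" "t < T"
      then have t0: "t > 0" and tM: "t > M" using \<eta> M by auto
      show "((\<lambda>t. P (Complex x t)) has_vector_derivative \<i> * H (Complex x t)) (at t)" by (rule ver[OF tM])
      show "((\<lambda>t. - 8 * K * t powr (- (1/8))) has_vector_derivative K * t powr (- (9/8))) (at t)"
        using t0 by (auto intro!: derivative_eq_intros simp: has_real_derivative_iff_has_vector_derivative[symmetric])
      have "norm (\<i> * H (Complex x t)) \<le> exp (- (s * t)) * (C / norm (Complex x t))"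
        using nH[of "Complex x t"] tM by (simp add: norm_mult)
      also have "\<dots> \<le> (s * t) powr (- (1/4)) * (C / (a powr (1 / 8) * t powr (7 / 8)))"
      proof (rule mult_mono)
        have p: "0 < a powr (1 / 8) * t powr (7 / 8)" using a t0 by simp
        note q = powr_le_norm_Complex[OF a t0 x]
        show "C / norm (Complex x t) \<le> C / (a powr (1 / 8) * t powr (7 / 8))"
          by (rule divide_left_mono[OF q C mult_pos_pos[OF less_le_trans[OF p q] p]])
        show "exp (- (s * t)) \<le> (s * t) powr (- (1/4))" by (rule exp_minus_le_powr) (use s t0 in simp)
      qed (use C in auto)
      also have "\<dots> = K * (t powr (- (1/4)) * t powr (- (7/8)))"
        using s t0 a by (simp add: K_def powr_mult powr_minus field_simps)
      also have "t powr (- (1/4)) * t powr (- (7/8)) = t powr (- (9/8))" by (simp add: powr_add[symmetric])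
      finally show "norm (\<i> * H (Complex x t)) \<le> K * t powr (- (9/8))" .
    qed
    also have "\<dots> \<le> 8 * K * \<eta> powr (- (1/8))" using K by simp
    finally show ?thesis .
  qed
  \<comment> \<open>At fixed width the upper side shrinks like 1 / T, so only the two vertical
    sides, each with the constant 8, survive.\<close>
  have top: "norm (P (Complex a T) - P (Complex (-a) T)) \<le> 2 * a * C / T" if T: "T > \<eta>" for T
  proof -
    have T0: "T > 0" "T > M" using T \<eta> M by auto
    have "norm (P (Complex a T) - P (Complex (-a) T)) \<le> C / T * a - C / T * (- a)"
    proof (rule differentiable_bound_general)
      show "- a < a" using a by simp
      show "((\<lambda>\<xi>. P (Complex \<xi> T)) has_vector_derivative H (Complex \<xi> T)) (at \<xi>)" for \<xi>
        by (rule hor[OF T0(2)])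
      show "continuous_on {- a..a} (\<lambda>\<xi>. P (Complex \<xi> T))"
        using hor[OF T0(2), of _ UNIV] by (intro continuous_at_imp_continuous_on ballI has_vector_derivative_continuous)
      show "continuous_on {- a..a} (\<lambda>\<xi>. C / T * \<xi>)" by (intro continuous_intros)
      show "((\<lambda>\<xi>. C / T * \<xi>) has_vector_derivative C / T) (at \<xi>)" for \<xi>
        using T0(1) by (auto intro!: derivative_eq_intros simp: has_real_derivative_iff_has_vector_derivative[symmetric])
      fix \<xi>
      have "norm (H (Complex \<xi> T)) \<le> exp (- s * T) * (C / norm (Complex \<xi> T))" using nH[of "Complex \<xi> T"] T0 by simp
      also have "\<dots> \<le> 1 * (C / T)"
      proof (rule mult_mono)
        have q: "T \<le> norm (Complex \<xi> T)" using abs_Im_le_cmod[of "Complex \<xi> T"] T0 by simp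
        show "C / norm (Complex \<xi> T) \<le> C / T"
          by (rule divide_left_mono[OF q C mult_pos_pos[OF less_le_trans[OF T0(1) q] T0(1)]])
        have "0 \<le> s * T" using s T0(1) by (intro mult_nonneg_nonneg) linarith+
        then show "exp (- s * T) \<le> 1" by simp
      qed (use C in auto)
      finally show "norm (H (Complex \<xi> T)) \<le> C / T" by simp
    qed
    then show ?thesis using a by (simp add: field_simps)
  qed
  have fin: "norm (P (Complex a \<eta>) - P (Complex (-a) \<eta>)) \<le> 16 * K * \<eta> powr (- (1/8)) + 2 * a * C / T" if T: "T > \<eta>" for T
  proof -
    define X Y X' Y' where XY: "X = P (Complex a \<eta>)" "Y = P (Complex (-a) \<eta>)" "X' = P (Complex a T)" "Y' = P (Complex (-a) T)"
    have "norm (X - Y) = norm ((X' - Y') - (X' - X) + (Y' - Y))" by simp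
    then have "norm (X - Y) \<le> norm (X' - Y') + norm (X' - X) + norm (Y' - Y)"
      using norm_triangle_ineq[of "(X' - Y') - (X' - X)" "Y' - Y"] norm_triangle_ineq4[of "X' - Y'" "X' - X"] by linarith
    moreover have "norm (X' - X) \<le> 8 * K * \<eta> powr (- (1/8))" "norm (Y' - Y) \<le> 8 * K * \<eta> powr (- (1/8))"
      unfolding XY using side[OF _ T, of a] side[OF _ T, of "-a"] a by auto
    ultimately show ?thesis using top[OF T] unfolding XY by linarith
  qed
  have "((\<lambda>T. 16 * K * \<eta> powr (- (1/8)) + 2 * a * C / T) \<longlongrightarrow> 16 * K * \<eta> powr (- (1/8)) + 0) at_top"
    by (intro tendsto_add tendsto_const) real_asymp
  then have "norm (P (Complex a \<eta>) - P (Complex (-a) \<eta>)) \<le> 16 * K * \<eta> powr (- (1/8)) + 0"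
  proof (rule tendsto_lowerbound)
    show "\<forall>\<^sub>F T in at_top. norm (P (Complex a \<eta>) - P (Complex (-a) \<eta>)) \<le> 16 * K * \<eta> powr (- (1/8)) + 2 * a * C / T"
      using eventually_gt_at_top[of \<eta>] by eventually_elim (rule fin)
  qed simp
  then show ?thesis using I by (simp add: H_def K_def mult_ac)
qed

text \<open>The bound for the remainder behaves like the power -1/4 of the distance to the end point
  x = 2 l; this is the integrability of its square.\<close>

lemma integrable_rpowr_endpoint:
  fixes b :: real
  assumes "0 \<le> b"
  shows "integrable (leb b) (\<lambda>x. (b - x) powr (- (1/2)))"
proof -
  have "((\<lambda>x. (b - x) powr (- (1/2))) has_integral (- 2 * sqrt (b - b) - (- 2 * sqrt (b - 0)))) {0..b}"
  proof (rule fundamental_theorem_of_calculus_interior[OF assms])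
    show "continuous_on {0..b} (\<lambda>x. - 2 * sqrt (b - x))" by (intro continuous_intros)
    fix x assume "x \<in> {0<..<b}"
    then have p: "b - x > 0" by simp
    have "((\<lambda>x. - 2 * sqrt (b - x)) has_real_derivative inverse (sqrt (b - x))) (at x)"
      using p by (auto intro!: derivative_eq_intros simp: field_simps)
    moreover have "inverse (sqrt (b - x)) = (b - x) powr (- (1/2))"
      using p by (simp add: powr_minus powr_half_sqrt)
    ultimately show "((\<lambda>x. - 2 * sqrt (b - x)) has_vector_derivative (b - x) powr (- (1/2))) (at x)"
      by (simp add: has_real_derivative_iff_has_vector_derivative)
  qed
  then have "(\<lambda>x. (b - x) powr (- (1/2))) integrable_on {0..b}" by blast
  then have "(\<lambda>x. (b - x) powr (- (1/2))) absolutely_integrable_on {0..b}"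
    by (rule nonnegative_absolutely_integrable_1) simp
  then show ?thesis by (subst integrable_restrict_space) (auto simp: set_integrable_def)
qed

text \<open>After exchanging the integrals the exponent is - 2 \<eta> t + i (2 t - x) \<xi>: the
  inner integral is a Dirichlet kernel centred at t = x / 2, and the damping stays with
  \<open>\<Psi>\<close>.\<close>

lemma has_integral_mult_exp_Lap:
  fixes \<Psi> :: "real \<Rightarrow> complex"
  assumes c\<Psi>: "continuous_on {0..l} \<Psi>" and a: "0 \<le> a"
  shows "integral {-a..a} (\<lambda>\<xi>. exp (- \<i> * of_real x * of_real \<xi>) * Lap l \<Psi> (Complex \<xi> \<eta>)) =
     integral {0..l} (\<lambda>t. (exp (of_real (- 2 * \<eta>) * of_real t) * \<Psi> t) * of_real (2 * a * sine_cardinal (a * (2 * t - x))))"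
proof -
  define f where "f t = exp (of_real (- 2 * \<eta>) * of_real t) * \<Psi> t" for t
  define H where "H \<xi> t = f t * exp (\<i> * of_real (2 * t - x) * of_real \<xi>)" for \<xi> t
  have cf: "continuous_on {0..l} f" unfolding f_def[abs_def] by (intro continuous_intros c\<Psi>)
  have e: "exp (- \<i> * of_real x * of_real \<xi>) * (exp (2 * \<i> * Complex \<xi> \<eta> * of_real t) * \<Psi> t) = H \<xi> t" for \<xi> t
  proof -
    have "- \<i> * of_real x * of_real \<xi> + 2 * \<i> * Complex \<xi> \<eta> * of_real t = of_real (- 2 * \<eta>) * of_real t + \<i> * of_real (2 * t - x) * of_real \<xi>"
      by (simp add: complex_eq_iff algebra_simps)
    then show ?thesis unfolding H_def f_def by (simp only: mult.assoc[symmetric] exp_add[symmetric]) (simp only: mult_ac exp_add)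
  qed
  have "exp (- \<i> * of_real x * of_real \<xi>) * Lap l \<Psi> (Complex \<xi> \<eta>) = integral {0..l} (H \<xi>)" for \<xi>
    unfolding Lap_eq_integral[OF c\<Psi>] integral_mult_right[symmetric] e by simp
  then have "integral {-a..a} (\<lambda>\<xi>. exp (- \<i> * of_real x * of_real \<xi>) * Lap l \<Psi> (Complex \<xi> \<eta>)) = integral (cbox (-a) a) (\<lambda>\<xi>. integral (cbox 0 l) (H \<xi>))"
    by (simp add: box_real)
  also have "\<dots> = integral (cbox 0 l) (\<lambda>t. integral (cbox (-a) a) (\<lambda>\<xi>. H \<xi> t))"
  proof (rule integral_swap_continuous)
    have "continuous_on (cbox (-a, 0) (a, l)) (\<lambda>p. f (snd p))"
      by (rule continuous_on_compose2[OF cf continuous_on_snd[OF continuous_on_id]]) (auto simp: cbox_Pair_eq box_real)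
    then show "continuous_on (cbox (-a, 0) (a, l)) (\<lambda>(\<xi>, t). H \<xi> t)"
      unfolding H_def case_prod_beta' by (intro continuous_intros)
  qed
  also have "\<dots> = integral {0..l} (\<lambda>t. f t * of_real (2 * a * sine_cardinal (a * (2 * t - x))))"
    unfolding H_def integral_mult_right box_real integral_unique[OF integral_exp_Dirichlet[OF a]] ..
  finally show ?thesis by (simp only: f_def)
qed

text \<open>\<open>F\<close> differs from the main term \<open>A\<close> by a remainder.
  \<open>A\<close> converges to \<open>Gl\<close> pointwise, except possibly at the end points, and
  boundedly. The remainder is at most a constant times the powers -1/4 of 2 l - x and -1/8 of a, so
  its L^2 norm tends to 0.\<close>

lemma Fourier_recovery:
  fixes \<Psi> \<Psi>' :: "real \<Rightarrow> complex"
  assumes lip: "lip_ad l \<Psi> \<Psi>'" and \<Psi>0: "\<Psi> 0 = 0" and l: "0 < l" and M: "0 < M"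
    and an: "\<phi> analytic_on half_plane M" and C: "0 \<le> C"
    and bd: "\<And>z. Im z > M \<Longrightarrow> norm (\<phi> z - 2 * \<i> * z * Lap l \<Psi> z) \<le> C * exp (- 2 * l * Im z)"
    and \<eta>: "\<eta> > M"
  shows "lim_in_mean {0..2 * l}
     (\<lambda>a x. LINT \<xi>|lebesgue_on {-a..a}. exp (- \<i> * of_real x * of_real \<xi>) * (\<phi> (Complex \<xi> \<eta>) / (2 * \<i> * Complex \<xi> \<eta>)))
     (\<lambda>x. of_real (pi * exp (- (x * \<eta>))) * \<Psi> (x / 2))"
proof -
  have c\<Psi>: "continuous_on {0..l} \<Psi>" by (rule lip_ad_continuous_on[OF lip])
  define f where "f t = exp (of_real (- 2 * \<eta>) * of_real t) * \<Psi> t" for t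
  obtain f' where f': "lip_ad l f f'"
    using lip_ad_bilinear[OF bounded_bilinear_mult lip_ad_exp lip, of "of_real (- 2 * \<eta>)"] unfolding f_def[abs_def] by blast
  have f0: "f 0 = 0" by (simp add: f_def \<Psi>0)
  \<comment> \<open>The factor cancels the decay exp (- 2 l Im z) of the error and leaves the order
    1 / norm z. In the integral it is compensated by the frequency s = 2 l - x, which is positive
    inside the interval.\<close>
  define GG where "GG z = exp (- 2 * \<i> * of_real l * z) * (\<phi> z / (2 * \<i> * z) - Lap l \<Psi> z)" for z
  define Gl where "Gl x = of_real (pi * exp (- (x * \<eta>))) * \<Psi> (x / 2)" for x
  define \<psi> where "\<psi> \<xi> = \<phi> (Complex \<xi> \<eta>) / (2 * \<i> * Complex \<xi> \<eta>)" for \<xi>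
  define F where "F a x = (LINT \<xi>|lebesgue_on {-a..a}. exp (- \<i> * of_real x * of_real \<xi>) * \<psi> \<xi>)" for a x
  define A where "A a x = integral {-a..a} (\<lambda>\<xi>. exp (- \<i> * of_real x * of_real \<xi>) * Lap l \<Psi> (Complex \<xi> \<eta>))" for a x
  have nz: "z \<noteq> 0" if "z \<in> half_plane M" for z using that M by (auto simp: half_plane_def)
  have hol: "GG holomorphic_on half_plane M"
    unfolding GG_def[abs_def]
    by (intro holomorphic_intros analytic_imp_holomorphic[OF an] holomorphic_on_subset[OF Lap_holomorphic[OF c\<Psi>]]) (use nz in auto)
  have GGb: "norm (GG z) \<le> (C / 2) / norm z" if z: "Im z > M" for z
  proof -
    have z0: "z \<noteq> 0" using nz[of z] z by (simp add: half_plane_def)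
    have "\<phi> z / (2 * \<i> * z) - Lap l \<Psi> z = (\<phi> z - 2 * \<i> * z * Lap l \<Psi> z) / (2 * \<i> * z)" using z0 by (simp add: field_simps)
    then have "norm (GG z) = exp (2 * l * Im z) * (norm (\<phi> z - 2 * \<i> * z * Lap l \<Psi> z) / (2 * norm z))"
      by (simp add: GG_def norm_mult norm_divide)
    also have "\<dots> \<le> exp (2 * l * Im z) * ((C * exp (- 2 * l * Im z)) / (2 * norm z))"
      using bd[OF z] by (intro mult_left_mono divide_right_mono) auto
    also have "\<dots> = (C / 2) / norm z" by (simp add: field_simps exp_minus)
    finally show ?thesis .
  qed
  have line: "continuous_on X (\<lambda>\<xi>. Complex \<xi> \<eta>)" for X unfolding Complex_eq by (intro continuous_intros)
  have sub: "(\<lambda>\<xi>. Complex \<xi> \<eta>) ` X \<subseteq> half_plane M" for X using \<eta> by (auto simp: half_plane_def)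
  have cL: "continuous_on X (\<lambda>\<xi>. Lap l \<Psi> (Complex \<xi> \<eta>))" for X
    by (rule continuous_on_compose2[OF holomorphic_on_imp_continuous_on[OF Lap_holomorphic[OF c\<Psi>]] line]) simp
  have cG: "continuous_on X (\<lambda>\<xi>. GG (Complex \<xi> \<eta>))" for X
    by (rule continuous_on_compose2[OF holomorphic_on_imp_continuous_on[OF hol] line sub])
  have c\<psi>: "continuous_on X \<psi>" for X
    unfolding \<psi>_def[abs_def]
    by (intro continuous_on_divide continuous_on_compose2[OF holomorphic_on_imp_continuous_on[OF analytic_imp_holomorphic[OF an]] line sub]
         continuous_on_mult continuous_on_const line) (use nz[of "Complex _ \<eta>"] \<eta> in \<open>auto simp: half_plane_def\<close>)
  have Fi: "F a x = integral {-a..a} (\<lambda>\<xi>. exp (- \<i> * of_real x * of_real \<xi>) * \<psi> \<xi>)" for a x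
    unfolding F_def by (intro lebesgue_integral_eq_integral L2_on_integrable L2_on_continuous continuous_intros c\<psi>) simp
  have param: "continuous_on {0..2*l} (\<lambda>x. integral {-a..a} (\<lambda>\<xi>. exp (- \<i> * of_real x * of_real \<xi>) * h \<xi>))"
    if h: "continuous_on UNIV h" for h :: "real \<Rightarrow> complex" and a
  proof -
    have "continuous_on {0..2*l} (\<lambda>x. integral (cbox (-a) a) (\<lambda>\<xi>. exp (- \<i> * of_real x * of_real \<xi>) * h \<xi>))"
    proof (rule integral_continuous_on_param)
      have "continuous_on ({0..2*l} \<times> cbox (-a) a) (\<lambda>p. h (snd p))"
        by (rule continuous_on_compose2[OF h continuous_on_snd[OF continuous_on_id]]) simp
      then show "continuous_on ({0..2*l} \<times> cbox (-a) a) (\<lambda>(x, \<xi>). exp (- \<i> * of_real x * of_real \<xi>) * h \<xi>)"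
        unfolding case_prod_beta' by (intro continuous_intros)
    qed
    then show ?thesis by (simp add: box_real)
  qed
  have FL2: "L2_on {0..2*l} (F a)" for a
    unfolding Fi[abs_def] by (rule L2_on_continuous[OF param[OF c\<psi>]])
  have AL2: "L2_on {0..2*l} (A a)" for a
    unfolding A_def[abs_def] by (rule L2_on_continuous[OF param[OF cL]])
  have GL2: "L2_on {0..2*l} Gl"
  proof (rule L2_on_continuous)
    have "continuous_on {0..2*l} (\<lambda>x. \<Psi> (x / 2))"
      by (rule continuous_on_compose2[OF c\<Psi>]) (auto intro!: continuous_intros)
    then show "continuous_on {0..2*l} Gl" unfolding Gl_def[abs_def] by (intro continuous_intros)
  qed
  define K1 where "K1 = 16 * (C / 2) * \<eta> powr (- (1/8))"
  have K1: "K1 \<ge> 0" using C by (simp add: K1_def)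
  have R: "norm (F a x - A a x) \<le> K1 * (2 * l - x) powr (- (1/4)) * a powr (- (1/8))" if a: "0 < a" and x: "0 \<le> x" "x < 2 * l" for a x
  proof -
    define s where "s = 2 * l - x"
    have s: "s > 0" using x by (simp add: s_def)
    define I where "I = integral {-a..a} (\<lambda>\<xi>. exp (\<i> * of_real s * Complex \<xi> \<eta>) * GG (Complex \<xi> \<eta>))"
    have e: "exp (- \<i> * of_real x * of_real \<xi>) * \<psi> \<xi> - exp (- \<i> * of_real x * of_real \<xi>) * Lap l \<Psi> (Complex \<xi> \<eta>)
       = of_real (exp (- (x * \<eta>))) * (exp (\<i> * of_real s * Complex \<xi> \<eta>) * GG (Complex \<xi> \<eta>))" for \<xi>
    proof -
      define D where "D = \<psi> \<xi> - Lap l \<Psi> (Complex \<xi> \<eta>)"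
      have "of_real (- (x * \<eta>)) + \<i> * of_real s * Complex \<xi> \<eta> + - 2 * \<i> * of_real l * Complex \<xi> \<eta> = - \<i> * of_real x * of_real \<xi>"
        by (simp add: complex_eq_iff s_def algebra_simps)
      then have "exp (- \<i> * of_real x * of_real \<xi>) = exp (of_real (- (x * \<eta>))) * exp (\<i> * of_real s * Complex \<xi> \<eta>) * exp (- 2 * \<i> * of_real l * Complex \<xi> \<eta>)"
        by (simp only: exp_add[symmetric])
      then have "exp (- \<i> * of_real x * of_real \<xi>) * D = of_real (exp (- (x * \<eta>))) * (exp (\<i> * of_real s * Complex \<xi> \<eta>) * (exp (- 2 * \<i> * of_real l * Complex \<xi> \<eta>) * D))"
        by (simp only: exp_of_real mult.assoc)
      then show ?thesis unfolding GG_def \<psi>_def[symmetric] D_def right_diff_distrib by simp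
    qed
    have "F a x - A a x = integral {-a..a} (\<lambda>\<xi>. exp (- \<i> * of_real x * of_real \<xi>) * \<psi> \<xi> - exp (- \<i> * of_real x * of_real \<xi>) * Lap l \<Psi> (Complex \<xi> \<eta>))"
      unfolding Fi A_def
      by (rule Henstock_Kurzweil_Integration.integral_diff[symmetric]; rule integrable_continuous_real; intro continuous_intros c\<psi> cL)
    also have "\<dots> = of_real (exp (- (x * \<eta>))) * I" unfolding e integral_mult_right I_def ..
    finally have "norm (F a x - A a x) = exp (- (x * \<eta>)) * norm I" by (simp add: norm_mult)
    also have "\<dots> \<le> 1 * norm I" using x \<eta> M by (intro mult_right_mono) auto
    also have "norm I \<le> 16 * (C / 2) * \<eta> powr (- (1/8)) * s powr (- (1/4)) * a powr (- (1/8))"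
      unfolding I_def by (rule horizontal_integral_bound[OF hol _ _ GGb \<eta> a s]) (use M C in auto)
    finally show ?thesis by (simp add: K1_def s_def)
  qed
  have Aeq: "A a x = (LINT t|leb l. of_real (Si (a * (2 * l - x)) - Si (a * (2 * t - x))) * f' t)" if "0 \<le> a" for a x
    unfolding A_def has_integral_mult_exp_Lap[OF c\<Psi> that]
    using Dirichlet_integral_by_parts[OF f' f0 less_imp_le[OF l], of a x] by (simp only: f_def)
  obtain K where K: "\<And>a x. norm (LINT t|leb l. of_real (Si (a * (2 * l - x)) - Si (a * (2 * t - x))) * f' t) \<le> K"
    using Dirichlet_integral_bounded[OF lip_ad_integrable[OF f']] by blast
  have fG: "of_real pi * f (x / 2) = Gl x" for x
    unfolding Gl_def f_def by (simp add: exp_of_real[symmetric] mult_ac)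
  have AG0: "((\<lambda>a. LINT x|lebesgue_on {0..2*l}. (norm (A a x - Gl x))\<^sup>2) \<longlongrightarrow> (LINT x|lebesgue_on {0..2*l}. 0)) at_top"
  proof (rule integral_dominated_convergence_at_top[where w = "\<lambda>x. 2 * K\<^sup>2 + 2 * (norm (Gl x))\<^sup>2"])
    interpret finite_measure "lebesgue_on {0..2*l}" by (rule finite_measure_lebesgue_on_Icc)
    show "(\<lambda>x. (norm (A a x - Gl x))\<^sup>2) \<in> borel_measurable (lebesgue_on {0..2*l})" for a
      by (rule borel_measurable_integrable[OF L2_on_square_integrable[OF L2_on_diff[OF AL2 GL2]]])
    show "integrable (lebesgue_on {0..2*l}) (\<lambda>x. 2 * K\<^sup>2 + 2 * (norm (Gl x))\<^sup>2)"
      using L2_on_square_integrable[OF GL2] by auto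
    show "\<forall>\<^sub>F a in at_top. AE x in lebesgue_on {0..2*l}. norm ((norm (A a x - Gl x))\<^sup>2) \<le> 2 * K\<^sup>2 + 2 * (norm (Gl x))\<^sup>2"
      using eventually_ge_at_top[of 0]
    proof eventually_elim
      case (elim a)
      show ?case
      proof (rule AE_I2)
        fix x
        have "norm (A a x) \<le> K" unfolding Aeq[OF elim] by (rule K)
        then have "(norm (A a x))\<^sup>2 \<le> K\<^sup>2" by (intro power_mono) auto
        then show "norm ((norm (A a x - Gl x))\<^sup>2) \<le> 2 * K\<^sup>2 + 2 * (norm (Gl x))\<^sup>2"
          using square_norm_add_le[of "A a x" "- Gl x"] by simp
      qed
    qed
    have "AE x in lebesgue_on {0..2*l}. x \<noteq> 0 \<and> x \<noteq> 2 * l"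
      by (rule AE_lebesgue_on_iff_negligible[THEN iffD2]) (auto intro: negligible_subset[of "{0, 2*l}"])
    with AE_space_lebesgue_on[of "{0..2*l}"]
    show "AE x in lebesgue_on {0..2*l}. ((\<lambda>a. (norm (A a x - Gl x))\<^sup>2) \<longlongrightarrow> 0) at_top"
    proof eventually_elim
      case (elim x)
      have "((\<lambda>a. LINT t|leb l. of_real (Si (a * (2 * l - x)) - Si (a * (2 * t - x))) * f' t) \<longlongrightarrow> Gl x) at_top"
        using Dirichlet_integral_tendsto[OF f' f0, of x] elim unfolding fG by auto
      moreover have "\<forall>\<^sub>F a in at_top. (LINT t|leb l. of_real (Si (a * (2 * l - x)) - Si (a * (2 * t - x))) * f' t) = A a x"
        using eventually_ge_at_top[of 0] by eventually_elim (simp only: Aeq)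
      ultimately have "((\<lambda>a. A a x) \<longlongrightarrow> Gl x) at_top" by (rule tendsto_cong[THEN iffD1, rotated])
      then have "((\<lambda>a. (norm (A a x - Gl x))\<^sup>2) \<longlongrightarrow> (norm (Gl x - Gl x))\<^sup>2) at_top" by (intro tendsto_intros)
      then show ?case by simp
    qed
  qed simp
  define J where "J = (LINT x|lebesgue_on {0..2*l}. (2 * l - x) powr (- (1/2)))"
  have FG: "(LINT x|lebesgue_on {0..2*l}. (norm (F a x - Gl x))\<^sup>2) \<le>
     2 * (LINT x|lebesgue_on {0..2*l}. (norm (A a x - Gl x))\<^sup>2) + 2 * K1\<^sup>2 * J * a powr (- (1/4))" if a: "0 < a" for a
  proof -
    note iA = L2_on_square_integrable[OF L2_on_diff[OF AL2[of a] GL2]] and iF = L2_on_square_integrable[OF L2_on_diff[OF FL2[of a] GL2]]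
    note iJ = integrable_rpowr_endpoint[of "2 * l"]
    have i2: "integrable (lebesgue_on {0..2*l}) (\<lambda>x. 2 * K1\<^sup>2 * a powr (- (1/4)) * (2 * l - x) powr (- (1/2)))"
      using iJ l by auto
    have i1: "integrable (lebesgue_on {0..2*l}) (\<lambda>x. 2 * (norm (A a x - Gl x))\<^sup>2)" using iA by auto
    have ae: "AE x in lebesgue_on {0..2*l}. x \<noteq> 2 * l"
      by (rule AE_lebesgue_on_iff_negligible[THEN iffD2]) (auto intro: negligible_subset[of "{2*l}"])
    have "(LINT x|lebesgue_on {0..2*l}. (norm (F a x - Gl x))\<^sup>2) \<le> (LINT x|lebesgue_on {0..2*l}. 2 * (norm (A a x - Gl x))\<^sup>2 + 2 * K1\<^sup>2 * a powr (- (1/4)) * (2 * l - x) powr (- (1/2)))"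
    proof (rule integral_mono_AE[OF iF Bochner_Integration.integrable_add[OF i1 i2]])
      show "AE x in lebesgue_on {0..2*l}. (norm (F a x - Gl x))\<^sup>2 \<le> 2 * (norm (A a x - Gl x))\<^sup>2 + 2 * K1\<^sup>2 * a powr (- (1/4)) * (2 * l - x) powr (- (1/2))"
        using ae AE_space_lebesgue_on[of "{0..2*l}"]
      proof eventually_elim
        case (elim x)
        then have x: "0 \<le> x" "x < 2 * l" by auto
        have "(norm (F a x - A a x))\<^sup>2 \<le> (K1 * (2 * l - x) powr (- (1/4)) * a powr (- (1/8)))\<^sup>2"
          by (rule power_mono[OF R[OF a x] norm_ge_zero])
        also have "\<dots> = K1\<^sup>2 * ((2 * l - x) powr (- (1/4)) * (2 * l - x) powr (- (1/4))) * (a powr (- (1/8)) * a powr (- (1/8)))"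
          by (simp add: power2_eq_square mult_ac)
        also have "\<dots> = K1\<^sup>2 * (2 * l - x) powr (- (1/2)) * a powr (- (1/4))"
          by (simp add: powr_add[symmetric])
        finally have "2 * (norm (F a x - A a x))\<^sup>2 \<le> 2 * K1\<^sup>2 * a powr (- (1/4)) * (2 * l - x) powr (- (1/2))" by (simp add: mult_ac)
        moreover have "(norm (F a x - Gl x))\<^sup>2 \<le> 2 * (norm (A a x - Gl x))\<^sup>2 + 2 * (norm (F a x - A a x))\<^sup>2"
          using square_norm_add_le[of "A a x - Gl x" "F a x - A a x"] by simp
        ultimately show ?case by linarith
      qed
    qed
    also have "\<dots> = 2 * (LINT x|lebesgue_on {0..2*l}. (norm (A a x - Gl x))\<^sup>2) + 2 * K1\<^sup>2 * a powr (- (1/4)) * J"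
      unfolding Bochner_Integration.integral_add[OF i1 i2] integral_mult_right_zero J_def ..
    finally show ?thesis by (simp add: mult_ac)
  qed
  have lim0: "((\<lambda>a. LINT x|lebesgue_on {0..2*l}. (norm (F a x - Gl x))\<^sup>2) \<longlongrightarrow> 0) at_top"
  proof (rule tendsto_sandwich)
    show "\<forall>\<^sub>F a in at_top. 0 \<le> (LINT x|lebesgue_on {0..2*l}. (norm (F a x - Gl x))\<^sup>2)"
      by (intro always_eventually allI Bochner_Integration.integral_nonneg) simp
    show "\<forall>\<^sub>F a in at_top. (LINT x|lebesgue_on {0..2*l}. (norm (F a x - Gl x))\<^sup>2) \<le>
       2 * (LINT x|lebesgue_on {0..2*l}. (norm (A a x - Gl x))\<^sup>2) + 2 * K1\<^sup>2 * J * a powr (- (1/4))"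
      using eventually_gt_at_top[of 0] by eventually_elim (rule FG)
    have p: "((\<lambda>a::real. a powr (- (1/4))) \<longlongrightarrow> 0) at_top" by real_asymp
    have "((\<lambda>a. 2 * (LINT x|lebesgue_on {0..2*l}. (norm (A a x - Gl x))\<^sup>2) + 2 * K1\<^sup>2 * J * a powr (- (1/4))) \<longlongrightarrow> 2 * (LINT x|lebesgue_on {0..2*l}. 0) + 2 * K1\<^sup>2 * J * 0) at_top"
      by (intro tendsto_add tendsto_mult tendsto_const AG0 p)
    then show "((\<lambda>a. 2 * (LINT x|lebesgue_on {0..2*l}. (norm (A a x - Gl x))\<^sup>2) + 2 * K1\<^sup>2 * J * a powr (- (1/4))) \<longlongrightarrow> 0) at_top"
      by simp
  qed simp
  show ?thesis
    unfolding lim_in_mean_def L2_norm_on_def \<psi>_def[symmetric] F_def[symmetric] Gl_def[symmetric]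
    using tendsto_real_sqrt[OF lim0] FL2 GL2 by simp
qed

section \<open>Recovery of the potential\<close>

lemma has_vector_derivative_iff_quotient:
  fixes f :: "real \<Rightarrow> 'a::real_normed_vector"
  shows "(f has_vector_derivative D) (at x within S) \<longleftrightarrow> ((\<lambda>y. (f y - f x) /\<^sub>R (y - x)) \<longlongrightarrow> D) (at x within S)"
proof -
  have "norm (f y - f x - (y - x) *\<^sub>R D) / norm (y - x) = norm ((f y - f x) /\<^sub>R (y - x) - D)" if "y \<noteq> x" for y
  proof -
    have "(f y - f x) /\<^sub>R (y - x) - D = (f y - f x - (y - x) *\<^sub>R D) /\<^sub>R (y - x)"
      using that by (simp add: scaleR_diff_right)
    then show ?thesis using that by (simp add: divide_inverse mult.commute abs_inverse)
  qed
  then have ev: "\<forall>\<^sub>F y in at x within S. norm (f y - f x - (y - x) *\<^sub>R D) / norm (y - x) = norm ((f y - f x) /\<^sub>R (y - x) - D)"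
    by (simp add: eventually_at_filter)
  have "(f has_vector_derivative D) (at x within S) \<longleftrightarrow> ((\<lambda>y. norm (f y - f x - (y - x) *\<^sub>R D) / norm (y - x)) \<longlongrightarrow> 0) (at x within S)"
    unfolding has_vector_derivative_def has_derivative_iff_norm by (simp add: bounded_linear_scaleR_left)
  also have "\<dots> \<longleftrightarrow> ((\<lambda>y. norm ((f y - f x) /\<^sub>R (y - x) - D)) \<longlongrightarrow> 0) (at x within S)"
    by (rule tendsto_cong[OF ev])
  also have "\<dots> \<longleftrightarrow> ((\<lambda>y. (f y - f x) /\<^sub>R (y - x)) \<longlongrightarrow> D) (at x within S)"
    by (simp add: tendsto_norm_zero_iff LIM_zero_iff)
  finally show ?thesis .
qed

lemma lip_ad_imp_boundedly_differentiable:
  assumes f: "lip_ad l f f'"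
  shows "boundedly_differentiable l f"
proof -
  obtain B where "AE x in leb l. norm (f' x) \<le> B" using lip_ad_AE_bound[OF f] by blast
  with lip_adD_AE[OF f] have "AE x in leb l. \<exists>D. (f has_vector_derivative D) (at x within {0..l}) \<and> norm D \<le> B"
    by eventually_elim blast
  then show ?thesis unfolding boundedly_differentiable_def using lip_ad_absolutely_continuous_on[OF f] by blast
qed

lemma norm_matrix_mult_le:
  obtains K where "K > 0" "\<And>A B. norm ((A::complex^'q::finite^'p::finite) ** (B::complex^'r::finite^'q)) \<le> norm A * norm B * K"
  using bounded_bilinear.pos_bounded[OF bounded_bilinear_matrix_matrix_mult] by blast

lemma AE_bounded_matrix_mult:
  fixes f :: "real \<Rightarrow> complex^'q::finite^'p::finite" and g :: "real \<Rightarrow> complex^'r::finite^'q"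
  assumes "\<exists>B. AE x in M. norm (f x) \<le> B" "\<exists>B. AE x in M. norm (g x) \<le> B"
  shows "\<exists>B. AE x in M. norm (f x ** g x) \<le> B"
proof -
  obtain K where K: "K > 0" "\<And>A B. norm ((A::complex^'q^'p) ** (B::complex^'r^'q)) \<le> norm A * norm B * K"
    by (rule norm_matrix_mult_le) blast
  obtain B1 B2 where B: "AE x in M. norm (f x) \<le> B1" "AE x in M. norm (g x) \<le> B2" using assms by blast
  have "AE x in M. norm (f x ** g x) \<le> B1 * B2 * K"
    using B
  proof eventually_elim
    case (elim x)
    have "norm (f x ** g x) \<le> norm (f x) * norm (g x) * K" by (rule K)
    also have "\<dots> \<le> B1 * B2 * K"
      using elim K(1) order_trans[OF norm_ge_zero elim(1)] by (intro mult_right_mono mult_mono) auto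
    finally show ?case .
  qed
  then show ?thesis by blast
qed

lemma continuous_on_Icc_bound:
  fixes f :: "real \<Rightarrow> 'a::real_normed_vector"
  assumes "continuous_on {0..l} f"
  obtains B where "\<And>x. x \<in> {0..l} \<Longrightarrow> norm (f x) \<le> B"
proof -
  obtain B where "\<forall>x\<in>f ` {0..l}. norm x \<le> B"
    using compact_imp_bounded[OF compact_continuous_image[OF assms compact_Icc]] unfolding bounded_iff by blast
  then show thesis by (intro that[of B]) blast
qed

lemma AE_bounded_continuous_on:
  fixes f :: "real \<Rightarrow> 'a::euclidean_space"
  assumes "continuous_on {0..l} f"
  shows "\<exists>B. AE x in leb l. norm (f x) \<le> B"
proof -
  obtain B where B: "\<And>x. x \<in> {0..l} \<Longrightarrow> norm (f x) \<le> B" by (rule continuous_on_Icc_bound[OF assms]) blast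
  have "AE x in leb l. norm (f x) \<le> B" using AE_space_lebesgue_on[of "{0..l}"] by eventually_elim (rule B)
  then show ?thesis by blast
qed

lemma matrix_minus_mult_left: "(- A) ** B = - (A ** (B::complex^'r::finite^'q::finite))"
  and matrix_minus_mult_right: "A ** (- B) = - (A ** (B::complex^'r::finite^'q::finite))"
  by (simp_all add: matrix_matrix_mult_def vec_eq_iff sum_negf)

lemma matrix_inv_unique_left:
  fixes A B :: "complex^'n::finite^'n"
  assumes "B ** A = mat 1"
  shows "matrix_inv A = B"
proof -
  have "B ** (A ** matrix_inv A) = matrix_inv A" by (simp add: matrix_mul_assoc assms)
  then show ?thesis by (simp add: matrix_left_inverse_imp_matrix_inv(1)[OF assms])
qed

section \<open>Differentiability of \<gamma> and existence of an admissible completion of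
  \<beta>\<close>

context dirac_system begin

text \<open>In the derivative of \<open>\<gamma> t ** adj (\<gamma> x)\<close> the factor
  \<open>\<beta> t ** adj (\<gamma> x)\<close> vanishes at t = x and is Lipschitz, so integrating
  from x to y gains a second power.\<close>

lemma gamma_increment_bound:
  obtains K where "K \<ge> 0" "\<And>x y. x \<in> {0..l} \<Longrightarrow> y \<in> {0..l} \<Longrightarrow> norm (\<gamma> y ** adj (\<gamma> x) - mat 1) \<le> K * (y - x)\<^sup>2"
proof -
  obtain L where L: "L-lipschitz_on {0..l} \<beta>" using lip_adD_lipschitz[OF lip_ad_beta] by blast
  have L0: "L \<ge> 0" using L by (rule lipschitz_on_nonneg)
  obtain Bg where Bg: "\<And>x. x \<in> {0..l} \<Longrightarrow> norm (adj (\<gamma> x)) \<le> Bg"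
    by (rule continuous_on_Icc_bound[OF bounded_linear.continuous_on[OF bounded_linear_adj lip_ad_continuous_on[OF lip_ad_gamma]]]) blast
  obtain Bv where Bv: "\<And>x. x \<in> {0<..<l} \<Longrightarrow> norm (v x) \<le> Bv" using norm_v_bound by blast
  obtain Ka where Ka: "\<And>A. norm (adj (A :: complex^'m2^'m1)) \<le> norm A * Ka" "Ka > 0"
    using bounded_linear.pos_bounded[OF bounded_linear_adj] by blast
  obtain K1 where K1: "K1 > 0" "\<And>A B. norm ((A::complex^('m1+'m2)^'m1) ** (B::complex^'m2^('m1+'m2))) \<le> norm A * norm B * K1"
    by (rule norm_matrix_mult_le) blast
  obtain K2 where K2: "K2 > 0" "\<And>A B. norm ((A::complex^'m1^'m2) ** (B::complex^'m2^'m1)) \<le> norm A * norm B * K2"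
    by (rule norm_matrix_mult_le) blast
  have Bg0: "Bg \<ge> 0" using order_trans[OF norm_ge_zero Bg[of 0]] l_pos by simp
  have Bv0: "Bv \<ge> 0" using order_trans[OF norm_ge_zero Bv[of "l/2"]] l_pos by simp
  define K where "K = Bv * Ka * (L * Bg * K1) * K2"
  have K0: "K \<ge> 0" using Bv0 Ka(2) L0 Bg0 K1(1) K2(1) by (simp add: K_def)
  \<comment> \<open>\<open>x\<close> may be either end point, which covers both orders of
    \<open>x\<close> and \<open>y\<close>.\<close>
  have main: "norm (\<gamma> q ** adj (\<gamma> x) - \<gamma> p ** adj (\<gamma> x)) \<le> K * (q - p)\<^sup>2"
    if x: "x = p \<or> x = q" and pq: "0 \<le> p" "p \<le> q" "q \<le> l" for x p q
  proof -
    have xl: "x \<in> {0..l}" using x pq by auto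
    define g' where "g' t = - (adj (v t) ** \<beta> t) ** adj (\<gamma> x)" for t
    have lip: "lip_ad l (\<lambda>t. \<gamma> t ** adj (\<gamma> x)) g'"
      unfolding g'_def by (rule lip_ad_linear[OF bounded_bilinear.bounded_linear_left[OF bounded_bilinear_matrix_matrix_mult] lip_ad_gamma])
    have "norm (g' t) \<le> K * (q - p)" if t: "t \<in> {p..q}" "t \<in> {0<..<l}" for t
    proof -
      have tl: "t \<in> {0..l}" using t(2) by simp
      have "g' t = - (adj (v t) ** ((\<beta> t - \<beta> x) ** adj (\<gamma> x)))"
        unfolding g'_def matrix_minus_mult_left bounded_bilinear.diff_left[OF bounded_bilinear_matrix_matrix_mult] beta_adj_gamma[OF xl]
        by (simp add: matrix_mul_assoc)
      then have "norm (g' t) \<le> norm (adj (v t)) * norm ((\<beta> t - \<beta> x) ** adj (\<gamma> x)) * K2" using K2(2) by simp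
      also have "\<dots> \<le> (Bv * Ka) * ((L * (q - p)) * Bg * K1) * K2"
      proof (intro mult_right_mono mult_mono)
        have "norm (adj (v t)) \<le> norm (v t) * Ka" by (rule Ka)
        also have "\<dots> \<le> Bv * Ka" using Bv[OF t(2)] Ka(2) by (intro mult_right_mono) auto
        finally show "norm (adj (v t)) \<le> Bv * Ka" .
        have "norm (\<beta> t - \<beta> x) \<le> L * dist t x" using lipschitz_onD[OF L tl xl] by (simp add: dist_norm)
        also have "\<dots> \<le> L * (q - p)" using t(1) x pq L0 by (intro mult_left_mono) (auto simp: dist_real_def)
        finally have b: "norm (\<beta> t - \<beta> x) \<le> L * (q - p)" .
        have "norm ((\<beta> t - \<beta> x) ** adj (\<gamma> x)) \<le> norm (\<beta> t - \<beta> x) * norm (adj (\<gamma> x)) * K1" by (rule K1)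
        also have "\<dots> \<le> (L * (q - p)) * Bg * K1"
          using b Bg[OF xl] K1(1) L0 pq by (intro mult_right_mono mult_mono) auto
        finally show "norm ((\<beta> t - \<beta> x) ** adj (\<gamma> x)) \<le> (L * (q - p)) * Bg * K1" .
      qed (use Bv0 Ka(2) K2(1) in auto)
      also have "\<dots> = K * (q - p)" by (simp add: K_def mult_ac)
      finally show ?thesis .
    qed
    then have "AE t in lebesgue_on {p..q}. norm (g' t) \<le> K * (q - p)"
      using AE_space_lebesgue_on[of "{p..q}"] AE_lebesgue_on_subset[OF AE_interior, of "{p..q}"] pq
      by (auto elim: AE_mp)
    from has_integral_AE_bound[OF lip_ad_has_integral[OF lip pq] this] K0 pq
    show ?thesis by (simp add: power2_eq_square mult.assoc)
  qed
  show thesis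
  proof (rule that[OF K0])
    fix x y assume xy: "x \<in> {0..l}" "y \<in> {0..l}"
    show "norm (\<gamma> y ** adj (\<gamma> x) - mat 1) \<le> K * (y - x)\<^sup>2"
    proof (cases "x \<le> y")
      case True
      then show ?thesis using main[of x x y] xy gamma_adj_gamma[OF xy(1)] by simp
    next
      case False
      then show ?thesis using main[of x y x] xy gamma_adj_gamma[OF xy(1)]
        by (simp add: norm_minus_commute power2_commute)
    qed
  qed
qed

text \<open>In \<open>\<gamma>(y) - \<gamma>(x) = \<gamma>(y) \<beta>(x)\<^sup>* \<beta>(x) + (\<gamma>(y) \<gamma>(x)\<^sup>* - 1) \<gamma>(x)\<close> the last term is \<open>O((y - x)\<^sup>2)\<close>, and
  \<open>\<gamma>(y) \<beta>(x)\<^sup>* = - \<gamma>(y) (\<beta>(y) - \<beta>(x))\<^sup>*\<close>.\<close>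

lemma gamma_has_vector_derivative:
  assumes \<beta>: "(\<beta> has_vector_derivative D) (at x within S)" and S: "S \<subseteq> {0..l}" and x: "x \<in> {0..l}"
  shows "(\<gamma> has_vector_derivative - (\<gamma> x ** adj D ** \<beta> x)) (at x within S)"
  unfolding has_vector_derivative_iff_quotient
proof -
  obtain K where K: "K \<ge> 0" "\<And>x y. x \<in> {0..l} \<Longrightarrow> y \<in> {0..l} \<Longrightarrow> norm (\<gamma> y ** adj (\<gamma> x) - mat 1) \<le> K * (y - x)\<^sup>2"
    by (rule gamma_increment_bound) blast
  note mm = bounded_bilinear_matrix_matrix_mult
  have tb: "((\<lambda>y. (\<beta> y - \<beta> x) /\<^sub>R (y - x)) \<longlongrightarrow> D) (at x within S)"
    using \<beta> by (simp only: has_vector_derivative_iff_quotient)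
  have tg: "(\<gamma> \<longlongrightarrow> \<gamma> x) (at x within S)"
    using continuous_on_subset[OF lip_ad_continuous_on[OF lip_ad_gamma] insert_subset[THEN iffD2, OF conjI[OF x S]]]
    unfolding continuous_on_def by (auto intro: tendsto_within_subset)
  have evS: "\<forall>\<^sub>F y in at x within S. y \<in> S \<and> y \<noteq> x" by (simp add: eventually_at_filter)
  define R where "R y = (\<gamma> y ** adj (\<gamma> x) - mat 1) /\<^sub>R (y - x)" for y
  have tR: "(R \<longlongrightarrow> 0) (at x within S)"
  proof (rule Lim_null_comparison)
    show "\<forall>\<^sub>F y in at x within S. norm (R y) \<le> K * \<bar>y - x\<bar>"
      using evS
    proof eventually_elim
      case (elim y)
      then have yl: "y \<in> {0..l}" using S by auto
      have "norm (R y) = norm (\<gamma> y ** adj (\<gamma> x) - mat 1) / \<bar>y - x\<bar>" by (simp add: R_def divide_inverse mult.commute abs_inverse)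
      also have "\<dots> \<le> K * (y - x)\<^sup>2 / \<bar>y - x\<bar>" by (rule divide_right_mono[OF K(2)[OF x yl]]) simp
      also have "(y - x)\<^sup>2 = \<bar>y - x\<bar> * \<bar>y - x\<bar>" by (simp add: power2_eq_square)
      also have "K * (\<bar>y - x\<bar> * \<bar>y - x\<bar>) / \<bar>y - x\<bar> = K * \<bar>y - x\<bar>"
      proof -
        have "K * (a * a) / a = K * a" if "a \<noteq> 0" for a :: real using that by simp
        from this[of "\<bar>y - x\<bar>"] elim show ?thesis by linarith
      qed
      finally show ?case .
    qed
    have "((\<lambda>y. K * \<bar>y - x\<bar>) \<longlongrightarrow> K * \<bar>x - x\<bar>) (at x within S)" by (intro tendsto_intros)
    then show "((\<lambda>y. K * \<bar>y - x\<bar>) \<longlongrightarrow> 0) (at x within S)" by simp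
  qed
  have "((\<lambda>y. - (\<gamma> y ** adj ((\<beta> y - \<beta> x) /\<^sub>R (y - x)) ** \<beta> x) + R y ** \<gamma> x) \<longlongrightarrow> - (\<gamma> x ** adj D ** \<beta> x) + 0 ** \<gamma> x) (at x within S)"
    by (intro tendsto_add tendsto_minus bounded_bilinear.tendsto[OF mm] tg tR tendsto_const bounded_linear.tendsto[OF bounded_linear_adj] tb)
  moreover have "\<forall>\<^sub>F y in at x within S. - (\<gamma> y ** adj ((\<beta> y - \<beta> x) /\<^sub>R (y - x)) ** \<beta> x) + R y ** \<gamma> x = (\<gamma> y - \<gamma> x) /\<^sub>R (y - x)"
    using evS
  proof eventually_elim
    case (elim y)
    then have yl: "y \<in> {0..l}" using S by auto
    have "\<gamma> y ** adj ((\<beta> y - \<beta> x) /\<^sub>R (y - x)) = (\<gamma> y ** adj (\<beta> y) - \<gamma> y ** adj (\<beta> x)) /\<^sub>R (y - x)"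
      by (simp add: linear_scale[OF bounded_linear.linear[OF bounded_linear_adj]] adj_diff bounded_bilinear.scaleR_right[OF mm] bounded_bilinear.diff_right[OF mm])
    also have "\<dots> = - ((\<gamma> y ** adj (\<beta> x)) /\<^sub>R (y - x))" by (simp add: gamma_adj_beta[OF yl])
    finally have 1: "- (\<gamma> y ** adj ((\<beta> y - \<beta> x) /\<^sub>R (y - x)) ** \<beta> x) = (\<gamma> y ** (adj (\<beta> x) ** \<beta> x)) /\<^sub>R (y - x)"
      by (simp add: matrix_minus_mult_left bounded_bilinear.scaleR_left[OF mm] matrix_mul_assoc)
    have 2: "R y ** \<gamma> x = (\<gamma> y ** (adj (\<gamma> x) ** \<gamma> x) - \<gamma> x) /\<^sub>R (y - x)"
      by (simp add: R_def bounded_bilinear.scaleR_left[OF mm] bounded_bilinear.diff_left[OF mm] matrix_mul_assoc)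
    have "\<gamma> y ** (adj (\<beta> x) ** \<beta> x) + \<gamma> y ** (adj (\<gamma> x) ** \<gamma> x) = \<gamma> y"
      unfolding bounded_bilinear.add_right[OF mm, symmetric] adj_beta_beta[OF x] by simp
    then show ?case unfolding 1 2 scaleR_add_right[symmetric] by (simp add: algebra_simps)
  qed
  ultimately show "((\<lambda>y. (\<gamma> y - \<gamma> x) /\<^sub>R (y - x)) \<longlongrightarrow> - (\<gamma> x ** adj D ** \<beta> x)) (at x within S)"
    by (simp add: tendsto_cong bounded_bilinear.zero_left[OF mm])
qed

text \<open>\<open>\<gamma>\<close> itself qualifies, with empty exceptional set:
  \<open>gamma_has_vector_derivative\<close> gives it a two-sided or one-sided derivative wherever
  \<open>\<beta>\<close> has one, and its Lipschitz constant bounds them all.\<close>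

lemma gamma_tilde_gamma: "gamma_tilde l \<beta> \<gamma>"
  unfolding gamma_tilde_def
proof (intro conjI)
  show "continuous_on {0..l} \<gamma>" by (rule lip_ad_continuous_on[OF lip_ad_gamma])
  show "boundedly_differentiable l \<gamma>" by (rule lip_ad_imp_boundedly_differentiable[OF lip_ad_gamma])
  have "\<gamma> differentiable (at x within {0..l})" if x: "x \<in> {0..l}" and b: "\<beta> differentiable (at x within {0..l})" for x
    using gamma_has_vector_derivative[OF vector_derivative_works[THEN iffD1, OF b] order_refl x] by (rule differentiableI_vector)
  then show "\<exists>N. finite N \<and> (\<forall>x\<in>{0..l} - N. \<beta> differentiable (at x within {0..l}) \<longrightarrow> \<gamma> differentiable (at x within {0..l}))"
    by (intro exI[of _ "{}"]) auto
  obtain L where L: "L-lipschitz_on {0..l} \<gamma>" using lip_adD_lipschitz[OF lip_ad_gamma] by blast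
  have right: "\<exists>D. (\<gamma> has_vector_derivative D) (at_right x) \<and> norm D \<le> L"
    if x: "x \<in> {0..<l}" and b: "\<beta> differentiable (at_right x)" for x
  proof -
    have e: "at_right x = at x within {x..l}" using x by (intro at_within_Icc_at_right[symmetric]) auto
    have sub: "{x..l} \<subseteq> {0..l}" and xl: "x \<in> {0..l}" "x < l" "x \<in> {x..l}" using x by auto
    note D = gamma_has_vector_derivative[OF vector_derivative_works[THEN iffD1, OF b[unfolded e]] sub xl(1)]
    show ?thesis unfolding e
      using D has_vector_derivative_norm_le_lipschitz[OF lipschitz_on_subset[OF L sub] D xl(2,3)] by blast
  qed
  have left: "\<exists>D. (\<gamma> has_vector_derivative D) (at_left x) \<and> norm D \<le> L"
    if x: "x \<in> {0<..l}" and b: "\<beta> differentiable (at_left x)" for x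
  proof -
    have e: "at_left x = at x within {0..x}" using x by (intro at_within_Icc_at_left[symmetric]) auto
    have sub: "{0..x} \<subseteq> {0..l}" and xl: "x \<in> {0..l}" "0 < x" "x \<in> {0..x}" using x by auto
    note D = gamma_has_vector_derivative[OF vector_derivative_works[THEN iffD1, OF b[unfolded e]] sub xl(1)]
    show ?thesis unfolding e
      using D has_vector_derivative_norm_le_lipschitz[OF lipschitz_on_subset[OF L sub] D xl(2,3)] by blast
  qed
  show "\<exists>B. (\<forall>x\<in>{0..<l}. \<beta> differentiable (at_right x) \<longrightarrow> (\<exists>D. (\<gamma> has_vector_derivative D) (at_right x) \<and> norm D \<le> B)) \<and>
         (\<forall>x\<in>{0<..l}. \<beta> differentiable (at_left x) \<longrightarrow> (\<exists>D. (\<gamma> has_vector_derivative D) (at_left x) \<and> norm D \<le> B))"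
    using right left by blast
  have "pos_def (mat 1 :: complex^'m2^'m2)"
    by (auto simp: pos_def_def adj_mat herm_form_cip cip_self)
  then show "\<forall>x\<in>{0..l}. \<beta> x ** adj (\<gamma> x) = 0 \<and> pos_def (\<gamma> x ** adj (\<gamma> x))"
    by (simp add: beta_adj_gamma gamma_adj_gamma)
  show "\<gamma> 0 = OI" by (rule gamma_0)
qed

text \<open>The rows of \<open>G\<close> are orthogonal to those of \<open>\<beta>\<close>, so only
  the \<open>\<gamma>\<close> part of the resolution of the identity in \<open>adj_beta_beta\<close>
  acts on them.\<close>

lemma gamma_tilde_factor:
  assumes b: "\<beta> x ** adj G = 0" and x: "x \<in> {0..l}"
  shows "G = (G ** adj (\<gamma> x)) ** \<gamma> x"
proof -
  note mm = bounded_bilinear_matrix_matrix_mult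
  have "adj (\<beta> x ** adj G) = 0" by (simp add: b)
  then have Gb: "G ** adj (\<beta> x) = 0" by (simp add: adj_mult)
  have "G = G ** (adj (\<beta> x) ** \<beta> x + adj (\<gamma> x) ** \<gamma> x)" by (simp add: adj_beta_beta[OF x])
  also have "\<dots> = G ** adj (\<beta> x) ** \<beta> x + G ** adj (\<gamma> x) ** \<gamma> x"
    by (simp add: bounded_bilinear.add_right[OF mm] matrix_mul_assoc)
  also have "G ** adj (\<beta> x) ** \<beta> x = 0" by (simp add: Gb bounded_bilinear.zero_left[OF mm])
  finally show ?thesis by simp
qed

end

section \<open>Comparing an arbitrary completion with \<gamma>\<close>

context dirac_system begin

context
  fixes g :: "real \<Rightarrow> complex ^ ('m1 + 'm2) ^ 'm2"
  assumes g: "gamma_tilde l \<beta> g"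
begin

text \<open>\<open>g = theta \<gamma>\<close>, so the inverse of \<open>theta\<close> is the required \<open>\<kappa>\<close>.\<close>

definition theta :: "real \<Rightarrow> complex ^ 'm2 ^ 'm2" where "theta x = g x ** adj (\<gamma> x)"

lemma gamma_tilde_props:
  shows lip_ad_gamma_tilde: "lip_ad l g (derivative_on l g)"
    and beta_adj_gamma_tilde: "x \<in> {0..l} \<Longrightarrow> \<beta> x ** adj (g x) = 0"
    and pos_def_gamma_tilde: "x \<in> {0..l} \<Longrightarrow> pos_def (g x ** adj (g x))"
    and gamma_tilde_0: "g 0 = OI"
  using g boundedly_differentiable_imp_lip_ad[OF l_pos, of g] by (auto simp: gamma_tilde_def)

lemma gamma_tilde_theta: "x \<in> {0..l} \<Longrightarrow> g x = theta x ** \<gamma> x"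
  unfolding theta_def by (rule gamma_tilde_factor[OF beta_adj_gamma_tilde])

lemma gamma_tilde_adj_gamma_tilde: "x \<in> {0..l} \<Longrightarrow> g x ** adj (g x) = theta x ** adj (theta x)"
proof -
  assume x: "x \<in> {0..l}"
  have "g x ** adj (g x) = theta x ** (\<gamma> x ** adj (\<gamma> x)) ** adj (theta x)"
    unfolding gamma_tilde_theta[OF x] by (simp add: adj_mult matrix_mul_assoc)
  then show ?thesis by (simp add: gamma_adj_gamma[OF x])
qed

lemma adj_theta_injective: "x \<in> {0..l} \<Longrightarrow> adj (theta x) *v h = 0 \<Longrightarrow> h = 0"
proof (rule ccontr)
  assume x: "x \<in> {0..l}" and h: "adj (theta x) *v h = 0" "h \<noteq> 0"
  then have "0 < Re (herm_form (g x ** adj (g x)) h)" using pos_def_gamma_tilde[OF x] by (simp add: pos_def_def)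
  then show False by (simp add: gamma_tilde_adj_gamma_tilde[OF x] herm_form_cip matrix_vector_mul_assoc[symmetric] h)
qed

lemma theta_inverse:
  assumes x: "x \<in> {0..l}"
  shows "theta x ** matrix_inv (theta x) = mat 1" "matrix_inv (theta x) ** theta x = mat 1"
proof -
  have "adj (theta x) ** matrix_inv (adj (theta x)) = mat 1"
    by (rule injective_imp_matrix_inv(1)[OF adj_theta_injective[OF x]])
  then have "adj (adj (theta x) ** matrix_inv (adj (theta x))) = mat 1" by (simp add: adj_mat)
  then have "adj (matrix_inv (adj (theta x))) ** theta x = mat 1" by (simp add: adj_mult)
  then show "theta x ** matrix_inv (theta x) = mat 1" "matrix_inv (theta x) ** theta x = mat 1"
    by (rule matrix_left_inverse_imp_matrix_inv)+
qed

text \<open>The term of the product rule with the derivative of \<open>\<gamma>\<close> drops out,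
  because the adjoint of that derivative is \<open>- adj \<beta> v\<close> and \<open>g\<close> is
  orthogonal to \<open>\<beta>\<close>.\<close>

lemma lip_ad_theta: "lip_ad l theta (\<lambda>x. derivative_on l g x ** adj (\<gamma> x))"
proof -
  note mm = bounded_bilinear_matrix_matrix_mult
  have "lip_ad l (\<lambda>x. adj (\<gamma> x)) (\<lambda>x. adj (- (adj (v x) ** \<beta> x)))"
    by (rule lip_ad_linear[OF bounded_linear_adj lip_ad_gamma])
  from lip_ad_bilinear[OF mm lip_ad_gamma_tilde this]
  have "lip_ad l (\<lambda>x. g x ** adj (\<gamma> x)) (\<lambda>x. g x ** adj (- (adj (v x) ** \<beta> x)) + derivative_on l g x ** adj (\<gamma> x))" .
  then show ?thesis
  proof (rule lip_ad_cong)
    show "AE x in leb l. g x ** adj (- (adj (v x) ** \<beta> x)) + derivative_on l g x ** adj (\<gamma> x) = derivative_on l g x ** adj (\<gamma> x)"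
      using AE_in_interval
    proof eventually_elim
      case (elim x)
      have "adj (\<beta> x ** adj (g x)) = 0" by (simp add: beta_adj_gamma_tilde[OF elim])
      then have "g x ** adj (\<beta> x) = 0" by (simp add: adj_mult)
      then have "g x ** adj (- (adj (v x) ** \<beta> x)) = 0"
        by (simp add: adj_minus adj_mult matrix_minus_mult_right matrix_mul_assoc bounded_bilinear.zero_left[OF mm])
      then show ?case by simp
    qed
  qed (simp add: theta_def)
qed

text \<open>\<open>adj (theta x)\<close> is injective for every \<open>x\<close>, so by compactness
  of [0,l] times the unit sphere it is bounded below by one constant; its reciprocal bounds the
  inverse, up to the factor from the matrix norm.\<close>

lemma matrix_inv_theta_bound: "\<exists>B. \<forall>x\<in>{0..l}. norm (matrix_inv (theta x)) \<le> B"
proof -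
  define F where "F p = norm (adj (theta (fst p)) *v snd p)" for p :: "real \<times> (complex ^ 'm2)"
  have ct: "continuous_on ({0..l} \<times> sphere 0 1) (\<lambda>p :: real \<times> (complex ^ 'm2). adj (theta (fst p)))"
    by (rule bounded_linear.continuous_on[OF bounded_linear_adj continuous_on_compose2[OF lip_ad_continuous_on[OF lip_ad_theta] continuous_on_fst[OF continuous_on_id]]])
       auto
  have "continuous_on ({0..l} \<times> sphere 0 1) F"
    unfolding F_def[abs_def]
    by (intro continuous_on_norm bounded_bilinear.continuous_on[OF bounded_bilinear_matrix_vector_mult ct] continuous_on_snd continuous_on_id)
  moreover have "compact ({0..l} \<times> sphere (0 :: complex ^ 'm2) 1)" by (intro compact_Times compact_Icc compact_sphere)
  moreover have "(0, axis undefined 1 :: complex ^ 'm2) \<in> {0..l} \<times> sphere 0 1" using l_pos by (simp add: norm_axis_1)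
  ultimately obtain p where p: "p \<in> {0..l} \<times> sphere 0 1" "\<And>q. q \<in> {0..l} \<times> sphere 0 1 \<Longrightarrow> F p \<le> F q"
    using continuous_attains_inf[of "{0..l} \<times> sphere 0 1" F] by blast
  define c where "c = F p"
  have c: "c > 0"
  proof -
    have "snd p \<noteq> 0" using p(1) by auto
    then have "adj (theta (fst p)) *v snd p \<noteq> 0" using adj_theta_injective[of "fst p" "snd p"] p(1) by auto
    then show ?thesis by (simp add: c_def F_def)
  qed
  have low: "c * norm h \<le> norm (adj (theta x) *v h)" if x: "x \<in> {0..l}" for x h
  proof (cases "h = 0")
    case False
    define k where "k = (1 / of_real (norm h) :: complex) *s h"
    have "norm k = 1" using False by (simp add: k_def norm_smult norm_divide)
    then have "c \<le> norm (adj (theta x) *v k)" using p(2)[of "(x, k)"] x by (simp add: c_def F_def)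
    also have "\<dots> = norm (adj (theta x) *v h) / norm h"
      by (simp add: k_def matrix_vector_mult_smult norm_smult norm_divide)
    finally show ?thesis using False by (simp add: field_simps)
  qed simp
  have "norm (matrix_inv (theta x)) \<le> real CARD('m2) * (real CARD('m2) * (1 / c))" if x: "x \<in> {0..l}" for x
  proof (rule norm_matrix_le_entries)
    fix i j
    define I where "I = adj (matrix_inv (theta x))"
    have "adj (matrix_inv (theta x) ** theta x) = mat 1" by (simp add: theta_inverse[OF x] adj_mat)
    then have I: "adj (theta x) ** I = mat 1" by (simp add: adj_mult I_def)
    have "c * norm (I *v axis i 1) \<le> norm (adj (theta x) *v (I *v axis i 1))" by (rule low[OF x])
    also have "\<dots> = 1" by (simp add: matrix_vector_mul_assoc I norm_axis_1)
    finally have "norm (I *v axis i 1) \<le> 1 / c" using c by (simp add: field_simps)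
    moreover have "norm (matrix_inv (theta x) $ i $ j) = norm ((I *v axis i 1) $ j)" by (simp add: matrix_vector_axis I_def adj_def)
    ultimately show "norm (matrix_inv (theta x) $ i $ j) \<le> 1 / c"
      using Finite_Cartesian_Product.norm_nth_le[of "I *v axis i 1" j] by linarith
  qed
  then show ?thesis by blast
qed

text \<open>The resolvent identity for the difference of two inverses gives both the Lipschitz bound
  and, divided by y - x, the derivative.\<close>

lemma lip_ad_matrix_inv_theta:
  "lip_ad l (\<lambda>x. matrix_inv (theta x)) (\<lambda>x. - (matrix_inv (theta x) ** (derivative_on l g x ** adj (\<gamma> x)) ** matrix_inv (theta x)))"
proof -
  note mm = bounded_bilinear_matrix_matrix_mult
  define \<kappa> where "\<kappa> x = matrix_inv (theta x)" for x
  obtain B where B: "\<And>x. x \<in> {0..l} \<Longrightarrow> norm (\<kappa> x) \<le> B" using matrix_inv_theta_bound unfolding \<kappa>_def by blast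
  have B0: "B \<ge> 0" using order_trans[OF norm_ge_zero B[of 0]] l_pos by simp
  obtain L where L: "L-lipschitz_on {0..l} theta" using lip_adD_lipschitz[OF lip_ad_theta] by blast
  have L0: "L \<ge> 0" using L by (rule lipschitz_on_nonneg)
  obtain K where K: "K > 0" "\<And>A B. norm ((A::complex^'m2^'m2) ** (B::complex^'m2^'m2)) \<le> norm A * norm B * K"
    by (rule norm_matrix_mult_le) blast
  have diff: "\<kappa> y - \<kappa> x = - (\<kappa> y ** (theta y - theta x) ** \<kappa> x)" if "x \<in> {0..l}" "y \<in> {0..l}" for x y
  proof -
    have "\<kappa> y ** (theta y - theta x) ** \<kappa> x = (\<kappa> y ** theta y) ** \<kappa> x - \<kappa> y ** (theta x ** \<kappa> x)"
      by (simp add: bounded_bilinear.diff_right[OF mm] bounded_bilinear.diff_left[OF mm] matrix_mul_assoc)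
    then show ?thesis using theta_inverse(1)[OF that(1)] theta_inverse(2)[OF that(2)] by (simp add: \<kappa>_def)
  qed
  have Lip: "(B * L * K * B * K)-lipschitz_on {0..l} \<kappa>"
  proof (rule lipschitz_onI)
    fix y x assume xy: "y \<in> {0..l}" "x \<in> {0..l}"
    have "dist (\<kappa> y) (\<kappa> x) = norm (\<kappa> y ** (theta y - theta x) ** \<kappa> x)" unfolding dist_norm diff[OF xy(2,1)] by simp
    also have "\<dots> \<le> norm (\<kappa> y ** (theta y - theta x)) * norm (\<kappa> x) * K" by (rule K)
    also have "\<dots> \<le> (B * (L * dist y x) * K) * B * K"
    proof (intro mult_right_mono mult_mono B xy)
      have "norm (\<kappa> y ** (theta y - theta x)) \<le> norm (\<kappa> y) * norm (theta y - theta x) * K" by (rule K)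
      also have "\<dots> \<le> B * (L * dist y x) * K"
        using lipschitz_onD[OF L xy] B[OF xy(1)] K(1) B0 by (intro mult_right_mono mult_mono) (auto simp: dist_norm)
      finally show "norm (\<kappa> y ** (theta y - theta x)) \<le> B * (L * dist y x) * K" .
    qed (use B0 K(1) L0 in auto)
    finally show "dist (\<kappa> y) (\<kappa> x) \<le> B * L * K * B * K * dist y x" by (simp add: mult_ac)
  qed (use B0 L0 K(1) in auto)
  have "AE x in leb l. (\<kappa> has_vector_derivative - (\<kappa> x ** (derivative_on l g x ** adj (\<gamma> x)) ** \<kappa> x)) (at x within {0..l})"
    using lip_adD_AE[OF lip_ad_theta] AE_in_interval
  proof eventually_elim
    case (elim x)
    have tk: "(\<kappa> \<longlongrightarrow> \<kappa> x) (at x within {0..l})"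
      using lipschitz_on_continuous_on[OF Lip] elim(2) by (simp add: continuous_on_def)
    have "((\<lambda>y. - (\<kappa> y ** ((theta y - theta x) /\<^sub>R (y - x)) ** \<kappa> x)) \<longlongrightarrow> - (\<kappa> x ** (derivative_on l g x ** adj (\<gamma> x)) ** \<kappa> x)) (at x within {0..l})"
      by (intro tendsto_minus bounded_bilinear.tendsto[OF mm] tk tendsto_const elim(1)[unfolded has_vector_derivative_iff_quotient])
    moreover have "\<forall>\<^sub>F y in at x within {0..l}. - (\<kappa> y ** ((theta y - theta x) /\<^sub>R (y - x)) ** \<kappa> x) = (\<kappa> y - \<kappa> x) /\<^sub>R (y - x)"
    proof -
      have "\<forall>\<^sub>F y in at x within {0..l}. y \<in> {0..l}" by (simp add: eventually_at_filter)
      then show ?thesis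
        by eventually_elim (simp add: diff[OF elim(2)] bounded_bilinear.scaleR_left[OF mm] bounded_bilinear.scaleR_right[OF mm])
    qed
    ultimately show ?case unfolding has_vector_derivative_iff_quotient by (rule tendsto_cong[THEN iffD1, rotated])
  qed
  with Lip show ?thesis unfolding lip_ad_def \<kappa>_def by blast
qed

text \<open>Inserting \<open>g = theta \<gamma>\<close> cancels \<open>adj theta\<close>: the right
  inverse of \<open>g\<close> becomes \<open>adj \<gamma>\<close> times the inverse of
  \<open>theta\<close>. The equation for \<kappa> is then the one that this inverse
  satisfies.\<close>

lemma kappa_coefficient:
  assumes x: "x \<in> {0..l}"
  shows "A ** adj (g x) ** matrix_inv (g x ** adj (g x)) = (A ** adj (\<gamma> x)) ** matrix_inv (theta x)"
proof -
  define I where "I = matrix_inv (theta x)"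
  have "adj (I ** theta x) = mat 1" by (simp add: I_def theta_inverse[OF x] adj_mat)
  then have aI: "adj (theta x) ** adj I = mat 1" by (simp add: adj_mult)
  have "adj (theta x ** I) = mat 1" by (simp add: I_def theta_inverse[OF x] adj_mat)
  then have aI': "adj I ** adj (theta x) = mat 1" by (simp add: adj_mult)
  have "(adj I ** I) ** (theta x ** adj (theta x)) = adj I ** ((I ** theta x) ** adj (theta x))" by (simp add: matrix_mul_assoc)
  also have "\<dots> = mat 1" by (simp add: I_def[symmetric] theta_inverse(2)[OF x, folded I_def] aI')
  finally have inv: "matrix_inv (g x ** adj (g x)) = adj I ** I"
    unfolding gamma_tilde_adj_gamma_tilde[OF x] by (rule matrix_inv_unique_left)
  have "A ** adj (g x) ** (adj I ** I) = A ** adj (\<gamma> x) ** (adj (theta x) ** adj I) ** I"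
    unfolding gamma_tilde_theta[OF x] adj_mult by (simp add: matrix_mul_assoc)
  then show ?thesis unfolding inv aI by (simp add: I_def)
qed

lemma theta_0: "theta 0 = mat 1"
  by (simp add: theta_def gamma_tilde_0 gamma_0 OI_adj_OI)

lemma kappa_tilde_matrix_inv_theta: "kappa_tilde l g (\<lambda>x. matrix_inv (theta x))"
  unfolding kappa_tilde_def
proof (intro conjI)
  show "matrix_inv (theta 0) = mat 1" by (rule matrix_inv_unique_left) (simp add: theta_0)
  show "absolutely_continuous_on {0..l} (\<lambda>x. matrix_inv (theta x))"
    by (rule lip_ad_absolutely_continuous_on[OF lip_ad_matrix_inv_theta])
  show "AE x in leb l. ((\<lambda>x. matrix_inv (theta x)) has_vector_derivative
      - (matrix_inv (theta x) ** derivative_on l g x ** adj (g x) ** matrix_inv (g x ** adj (g x)))) (at x within {0..l})"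
    using lip_adD_AE[OF lip_ad_matrix_inv_theta] AE_in_interval
    by eventually_elim (simp add: kappa_coefficient matrix_mul_assoc)
qed

text \<open>The product of \<open>\<kappa>\<close> and \<open>theta\<close> has derivative 0.
  Bounding the right-hand side of the equation first places \<open>\<kappa>\<close>, a priori only
  absolutely continuous, among the Lipschitz functions.\<close>

lemma kappa_tilde_unique:
  assumes k: "kappa_tilde l g \<kappa>" and x: "x \<in> {0..l}"
  shows "\<kappa> x = matrix_inv (theta x)"
proof -
  note mm = bounded_bilinear_matrix_matrix_mult
  define \<kappa>' where "\<kappa>' x = - (\<kappa> x ** (derivative_on l g x ** adj (\<gamma> x)) ** matrix_inv (theta x))" for x
  have k0: "\<kappa> 0 = mat 1" and ac: "absolutely_continuous_on {0..l} \<kappa>"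
    and d: "AE x in leb l. (\<kappa> has_vector_derivative
      - (\<kappa> x ** derivative_on l g x ** adj (g x) ** matrix_inv (g x ** adj (g x)))) (at x within {0..l})"
    using k by (auto simp: kappa_tilde_def)
  have d': "AE x in leb l. (\<kappa> has_vector_derivative \<kappa>' x) (at x within {0..l})"
    using d AE_in_interval by eventually_elim (simp add: kappa_coefficient matrix_mul_assoc \<kappa>'_def)
  have "\<exists>B. AE x in leb l. norm (\<kappa> x ** (derivative_on l g x ** adj (\<gamma> x)) ** matrix_inv (theta x)) \<le> B"
  proof (intro AE_bounded_matrix_mult[OF AE_bounded_matrix_mult[OF _ AE_bounded_matrix_mult]])
    show "\<exists>B. AE x in leb l. norm (derivative_on l g x) \<le> B" using lip_ad_AE_bound[OF lip_ad_gamma_tilde] by blast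
  qed (intro AE_bounded_continuous_on absolutely_continuous_on_imp_continuous_on[OF ac]
        lip_ad_continuous_on[OF lip_ad_matrix_inv_theta] bounded_linear.continuous_on[OF bounded_linear_adj lip_ad_continuous_on[OF lip_ad_gamma]])+
  then obtain B where "AE x in leb l. norm (\<kappa>' x) \<le> B" by (auto simp: \<kappa>'_def)
  from lip_adI_absolutely_continuous[OF ac d' this] have lk: "lip_ad l \<kappa> \<kappa>'" .
  have "\<kappa> x ** theta x = \<kappa> 0 ** theta 0"
  proof (rule lip_ad_const_deriv_0[OF lip_ad_bilinear[OF mm lk lip_ad_theta] _ x])
    show "AE x in leb l. \<kappa> x ** (derivative_on l g x ** adj (\<gamma> x)) + \<kappa>' x ** theta x = 0"
      using AE_in_interval
    proof eventually_elim
      case (elim x)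
      have "\<kappa>' x ** theta x = - (\<kappa> x ** (derivative_on l g x ** adj (\<gamma> x)) ** (matrix_inv (theta x) ** theta x))"
        by (simp add: \<kappa>'_def matrix_minus_mult_left matrix_mul_assoc)
      then show ?case by (simp add: theta_inverse[OF elim])
    qed
  qed
  then have "\<kappa> x ** theta x = mat 1" by (simp add: k0 theta_0)
  then show ?thesis by (rule matrix_inv_unique_left[symmetric])
qed

lemma gamma_eq_kappa_tilde:
  assumes k: "kappa_tilde l g \<kappa>" and x: "x \<in> {0..l}"
  shows "\<gamma> x = \<kappa> x ** g x"
proof -
  have "\<kappa> x ** g x = (matrix_inv (theta x) ** theta x) ** \<gamma> x"
    unfolding kappa_tilde_unique[OF assms] by (subst gamma_tilde_theta[OF x]) (simp add: matrix_mul_assoc)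
  then show ?thesis by (simp add: theta_inverse[OF x])
qed

end

end

text \<open>\<open>beta\<close> determines \<open>gamma\<close>: the derivative of
  \<open>gamma u2 x ** adj (gamma u1 x)\<close> contains only products of one system's
  \<open>gamma\<close> with the other's \<open>beta\<close>, which vanish as the two
  \<open>beta\<close> coincide. The product thus remains the identity, and
  \<open>gamma_tilde_factor\<close> gives equality.\<close>

lemma potential_unique_beta:
  assumes "dirac_system l M v1 u1" "dirac_system l M v2 u2" and eq: "\<And>x. x \<in> {0..l} \<Longrightarrow> beta u1 x = beta u2 x"
  shows "AE x in leb l. v2 x = v1 x"
proof -
  interpret A: dirac_system l M v1 u1 by fact
  interpret B: dirac_system l M v2 u2 by fact
  note mm = bounded_bilinear_matrix_matrix_mult
  have lip: "lip_ad l (\<lambda>x. gamma u2 x ** adj (gamma u1 x))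
     (\<lambda>x. gamma u2 x ** adj (- (adj (v1 x) ** beta u1 x)) + (- (adj (v2 x) ** beta u2 x)) ** adj (gamma u1 x))"
    by (rule lip_ad_bilinear[OF mm B.lip_ad_gamma lip_ad_linear[OF bounded_linear_adj A.lip_ad_gamma]])
  have g: "gamma u2 x = gamma u1 x" if x: "x \<in> {0..l}" for x
  proof -
    have "gamma u2 x ** adj (gamma u1 x) = gamma u2 0 ** adj (gamma u1 0)"
    proof (rule lip_ad_const_deriv_0[OF lip _ x])
      show "AE x in leb l. gamma u2 x ** adj (- (adj (v1 x) ** beta u1 x)) + (- (adj (v2 x) ** beta u2 x)) ** adj (gamma u1 x) = 0"
        using A.AE_in_interval
      proof eventually_elim
        case (elim x)
        have 1: "gamma u2 x ** adj (beta u1 x) = 0" using B.gamma_adj_beta[OF elim] eq[OF elim] by simp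
        have 2: "beta u2 x ** adj (gamma u1 x) = 0" using A.beta_adj_gamma[OF elim] eq[OF elim] by simp
        have "gamma u2 x ** adj (- (adj (v1 x) ** beta u1 x)) = - ((gamma u2 x ** adj (beta u1 x)) ** v1 x)"
          by (simp add: adj_minus adj_mult matrix_minus_mult_right matrix_mul_assoc)
        moreover have "(- (adj (v2 x) ** beta u2 x)) ** adj (gamma u1 x) = - (adj (v2 x) ** (beta u2 x ** adj (gamma u1 x)))"
          by (simp add: matrix_minus_mult_left matrix_mul_assoc)
        ultimately show ?case by (simp add: 1 2 bounded_bilinear.zero_left[OF mm] bounded_bilinear.zero_right[OF mm])
      qed
    qed
    then have one: "gamma u2 x ** adj (gamma u1 x) = mat 1" by (simp add: A.gamma_0 B.gamma_0 OI_adj_OI)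
    have "beta u1 x ** adj (gamma u2 x) = 0" using B.beta_adj_gamma[OF x] eq[OF x] by simp
    from A.gamma_tilde_factor[OF this x] show ?thesis by (simp add: one)
  qed
  show ?thesis
    using A.potential_from_beta_gamma B.potential_from_beta_gamma A.AE_in_interval
  proof eventually_elim
    case (elim x)
    obtain D1 D2 where D: "(beta u1 has_vector_derivative D1) (at x within {0..l})" "v1 x = D1 ** adj (gamma u1 x)"
      "(beta u2 has_vector_derivative D2) (at x within {0..l})" "v2 x = D2 ** adj (gamma u2 x)" using elim by blast
    have "(beta u2 has_vector_derivative D1) (at x within {0..l})"
      by (rule has_vector_derivative_transform[OF elim(3) _ D(1)]) (simp add: eq)
    then have "D1 = D2"
      using derivative_on_eq[OF A.l_pos elim(3)] D(3) by metis
    then show ?case using D g[OF elim(3)] by simp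
  qed
qed

text \<open>A common Weyl function gives both systems the same \<Phi>1 with the same derivative,
  hence the same truncated S, and one inverse serves in \<open>beta_formula\<close> for
  both.\<close>

lemma potential_unique:
  assumes A: "dirac_similarity l M v1 u1 E1 Einv1" and B: "dirac_similarity l M v2 u2 E2 Einv2"
    and w1: "weyl_function l M u1 \<phi>" and w2: "weyl_function l M u2 \<phi>" and \<Phi>: "is_Phi1 l u1 Einv1 \<Phi>1"
  shows "AE x in leb l. v2 x = v1 x"
proof (rule potential_unique_beta)
  interpret A: dirac_similarity l M v1 u1 E1 Einv1 by fact
  interpret B: dirac_similarity l M v2 u2 E2 Einv2 by fact
  show "dirac_system l M v1 u1" "dirac_system l M v2 u2" by unfold_locales
  note P1 = A.is_Phi1_imp[OF \<Phi>] and U = Phi_unique[OF A B w1 w2]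
  have P2: "\<Phi>1 x = B.Phi x" if "x \<in> {0..l}" for x using P1(1)[OF that] U(1)[OF that] by simp
  have D2: "AE x in leb l. derivative_on l \<Phi>1 x = B.dfun x" using P1(2) U(2) by eventually_elim simp
  fix x assume x: "x \<in> {0..l}"
  show "beta u1 x = beta u2 x"
    using A.beta_formula[OF P1 x A.S_trunc_inverse(1)[OF P1(2) x]] B.beta_formula[OF P2 D2 x A.S_trunc_inverse(1)[OF P1(2) x]] by simp
qed

theorem theorem3p14:
  fixes l M :: real
    and v :: "real \<Rightarrow> complex ^ 'm2::finite ^ 'm1::finite"
    and u :: "real \<Rightarrow> complex \<Rightarrow> complex ^ ('m1 + 'm2) ^ ('m1 + 'm2)"
    and \<phi> :: "complex \<Rightarrow> complex ^ 'm1 ^ 'm2"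
    and E Einv :: "'m2 vfun \<Rightarrow> 'm2 vfun"
    and \<Phi>1 :: "real \<Rightarrow> complex ^ 'm1 ^ 'm2"
  assumes "0 < l" and "0 < M"
    and "admissible_potential l M v"
    and "fundamental_solution l v u"
    and "weyl_function l M u \<phi>"
    and "similarity_operator l u E Einv"
    and "is_Phi1 l u Einv \<Phi>1"
  shows
    "\<comment> \<open>uniqueness of the potential with the given Weyl function\<close>
     (\<forall>(v2 :: real \<Rightarrow> complex ^ 'm2 ^ 'm1) u2 E2 Einv2.
        admissible_potential l M v2 \<and> fundamental_solution l v2 u2 \<and> weyl_function l M u2 \<phi> \<and>
        similarity_operator l u2 E2 Einv2 \<longrightarrow> (AE x in lebesgue_on {0..l}. v2 x = v x)) \<and>
     \<comment> \<open>recovery of \<open>\<Phi>1\<close> from \<open>\<phi>\<close>\<close>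
     (\<forall>\<eta>>M. \<forall>i k. \<exists>G.
        lim_in_mean {0..2 * l}
          (\<lambda>a x. LINT \<xi>|lebesgue_on {-a..a}. exp (- \<i> * of_real x * of_real \<xi>) *
             (\<phi> (Complex \<xi> \<eta>) $ i $ k / (2 * \<i> * Complex \<xi> \<eta>))) G \<and>
        (AE x in lebesgue_on {0..2 * l}.
           \<Phi>1 (x / 2) $ i $ k = of_real (1 / pi * exp (x * \<eta>)) * G x)) \<and>
     \<comment> \<open>recovery of \<open>\<beta>\<close> from \<open>\<Phi>1\<close>\<close>
     (\<forall>x\<in>{0..l}.
        (\<exists>R. L2_inverse_operator {0..x} (S_trunc l \<Phi>1 x) R) \<and>
        (\<forall>R. L2_inverse_operator {0..x} (S_trunc l \<Phi>1 x) R \<longrightarrow>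
           beta u x = I0 - (LINT t|lebesgue_on {0..x}.
             adj (apply_columnwise R (derivative_on l \<Phi>1) t) ** hcat (\<Phi>1 t) (mat 1)))) \<and>
     \<comment> \<open>recovery of \<open>\<gamma>\<close> from \<open>\<beta>\<close>\<close>
     gamma u 0 = OI \<and>
     (\<exists>g. gamma_tilde l (beta u) g) \<and>
     (\<forall>g. gamma_tilde l (beta u) g \<longrightarrow>
        (\<exists>\<kappa>. kappa_tilde l g \<kappa>) \<and>
        (\<forall>\<kappa>1 \<kappa>2. kappa_tilde l g \<kappa>1 \<and> kappa_tilde l g \<kappa>2 \<longrightarrow> (\<forall>x\<in>{0..l}. \<kappa>1 x = \<kappa>2 x)) \<and>
        (\<forall>\<kappa>. kappa_tilde l g \<kappa> \<longrightarrow> (\<forall>x\<in>{0..l}. gamma u x = \<kappa> x ** g x))) \<and>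
     \<comment> \<open>recovery of \<open>v\<close> from \<open>\<beta>\<close> and \<open>\<gamma>\<close>\<close>
     (AE x in lebesgue_on {0..l}. \<exists>D.
        (beta u has_vector_derivative D) (at x within {0..l}) \<and> v x = D ** adj (gamma u x))"
proof -
  interpret dirac_similarity l M v u E Einv by unfold_locales (use assms in auto)
  have DS: "dirac_similarity l M v u E Einv" by unfold_locales
  note P = is_Phi1_imp[OF assms(7)]
  have unique: "\<forall>(v2 :: real \<Rightarrow> complex ^ 'm2 ^ 'm1) u2 E2 Einv2.
        admissible_potential l M v2 \<and> fundamental_solution l v2 u2 \<and> weyl_function l M u2 \<phi> \<and>
        similarity_operator l u2 E2 Einv2 \<longrightarrow> (AE x in leb l. v2 x = v x)"
  proof (intro allI impI)
    fix v2 :: "real \<Rightarrow> complex ^ 'm2 ^ 'm1" and u2 E2 Einv2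
    assume a: "admissible_potential l M v2 \<and> fundamental_solution l v2 u2 \<and> weyl_function l M u2 \<phi> \<and> similarity_operator l u2 E2 Einv2"
    then have "dirac_similarity l M v2 u2 E2 Einv2" by unfold_locales (use assms(1,2) in auto)
    then show "AE x in leb l. v2 x = v x"
      using potential_unique[OF DS _ assms(5) _ assms(7)] a by blast
  qed
  have fourier: "\<exists>G. lim_in_mean {0..2 * l}
          (\<lambda>a x. LINT \<xi>|lebesgue_on {-a..a}. exp (- \<i> * of_real x * of_real \<xi>) *
             (\<phi> (Complex \<xi> \<eta>) $ i $ k / (2 * \<i> * Complex \<xi> \<eta>))) G \<and>
        (AE x in lebesgue_on {0..2 * l}.
           \<Phi>1 (x / 2) $ i $ k = of_real (1 / pi * exp (x * \<eta>)) * G x)" if \<eta>: "\<eta> > M" for \<eta> i k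
  proof (intro exI conjI)
    obtain C where C: "C \<ge> 0" "\<And>z i j. Im z > M \<Longrightarrow>
       norm (\<phi> z $ i $ j - 2 * \<i> * z * Lap l (\<lambda>t. Phi t $ i $ j) z) \<le> C * exp (- 2 * l * Im z)"
      by (rule weyl_asymptotics[OF assms(5)]) blast
    have bd: "boundedly_differentiable l \<Phi>1" using assms(7) by (simp add: is_Phi1_def)
    \<comment> \<open>\<open>Phi\<close> equals \<Phi>1 everywhere on [0,l] and so inherits its
      derivative.\<close>
    have "lip_ad l Phi (derivative_on l \<Phi>1)"
      by (rule lip_ad_cong[OF boundedly_differentiable_imp_lip_ad[OF assms(1) bd]]) (simp_all add: P(1))
    from lip_ad_linear[OF bounded_linear_entry this]
    have lip: "lip_ad l (\<lambda>t. Phi t $ i $ k) (\<lambda>t. derivative_on l \<Phi>1 t $ i $ k)" .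
    have an: "(\<lambda>z. \<phi> z $ i $ k) analytic_on half_plane M" using assms(5) by (simp add: weyl_function_def)
    show "lim_in_mean {0..2 * l}
          (\<lambda>a x. LINT \<xi>|lebesgue_on {-a..a}. exp (- \<i> * of_real x * of_real \<xi>) *
             (\<phi> (Complex \<xi> \<eta>) $ i $ k / (2 * \<i> * Complex \<xi> \<eta>)))
          (\<lambda>x. of_real (pi * exp (- (x * \<eta>))) * Phi (x / 2) $ i $ k)"
      by (rule Fourier_recovery[OF lip _ assms(1,2) an C(1) C(2) \<eta>]) (simp add: Phi_vec_zero)
    show "AE x in lebesgue_on {0..2 * l}.
           \<Phi>1 (x / 2) $ i $ k = of_real (1 / pi * exp (x * \<eta>)) * (of_real (pi * exp (- (x * \<eta>))) * Phi (x / 2) $ i $ k)"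
      using AE_space_lebesgue_on[of "{0..2*l}"]
    proof eventually_elim
      case (elim x)
      have "of_real (1 / pi * exp (x * \<eta>)) * (of_real (pi * exp (- (x * \<eta>))) * Phi (x / 2) $ i $ k)
         = of_real ((1 / pi * exp (x * \<eta>)) * (pi * exp (- (x * \<eta>)))) * Phi (x / 2) $ i $ k"
        by (simp only: of_real_mult mult.assoc)
      also have "(1 / pi * exp (x * \<eta>)) * (pi * exp (- (x * \<eta>))) = 1" by (simp add: exp_minus)
      finally show ?case using P(1)[of "x / 2"] elim by simp
    qed
  qed
  have operator: "(\<exists>R. L2_inverse_operator {0..x} (S_trunc l \<Phi>1 x) R) \<and>
        (\<forall>R. L2_inverse_operator {0..x} (S_trunc l \<Phi>1 x) R \<longrightarrow>
           beta u x = I0 - (LINT t|leb x.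
             adj (apply_columnwise R (derivative_on l \<Phi>1) t) ** hcat (\<Phi>1 t) (mat 1)))" if x: "x \<in> {0..l}" for x
    using S_trunc_inverse(1)[OF P(2) x] beta_formula[OF P x] by blast
  have kappa: "(\<exists>\<kappa>. kappa_tilde l g \<kappa>) \<and>
        (\<forall>\<kappa>1 \<kappa>2. kappa_tilde l g \<kappa>1 \<and> kappa_tilde l g \<kappa>2 \<longrightarrow> (\<forall>x\<in>{0..l}. \<kappa>1 x = \<kappa>2 x)) \<and>
        (\<forall>\<kappa>. kappa_tilde l g \<kappa> \<longrightarrow> (\<forall>x\<in>{0..l}. gamma u x = \<kappa> x ** g x))" if g: "gamma_tilde l (beta u) g" for g
    using kappa_tilde_matrix_inv_theta[OF g] kappa_tilde_unique[OF g] gamma_eq_kappa_tilde[OF g] by metis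
  show ?thesis
    by (intro conjI unique allI impI ballI fourier gamma_0 potential_from_beta_gamma exI[of _ "gamma u"] gamma_tilde_gamma)
       (use operator kappa in blast)+
qed

end
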